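(* Consider the $d$-dimensional additive monotone regression model on the fixed lattice design described in the context, with $\sigma>0$, and let $j\in\{1,\dots,d\}$ with $\beta_j>1/3$. Let $\widehat N_j$ be the number of observations in the fitted constant block at $x_{0,j}$ and let $\mathbb L_j$ be the random variable defined in the context. Let $\delta\in(0,1)$, let $c_\delta$ be a continuity point of the distribution function of $|\mathbb L_j|$ with $\mathbb P(|\mathbb L_j|>c_\delta)=\delta$, let $\widehat\sigma^2$ be a consistent estimator of $\sigma^2$ (i.e. $\widehat\sigma^2\to\sigma^2$ in probability), and let $$\mathcal I_n(x_{0,j};c_\delta,j)=\left[\widehat f_j(x_{0,j})-\frac{c_\delta\widehat\sigma}{\sqrt{\widehat N_j}},\ \widehat f_j(x_{0,j})+\frac{c_\delta\widehat\sigma}{\sqrt{\widehat N_j}}\right].$$ Then $$\lim_{n\to\infty}\mathbb P\bigl(f_j^*(x_{0,j})\in\mathcal I_n(x_{0,j};c_\delta,j)\bigr)=1-\delta .$$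
   Context: Design. The design points are the full lattice $\mathcal X=\{X_1,\dots,X_n\}=\prod_{l=1}^d\mathcal X_l\subset\mathbb R^d$ with $\mathcal X_l=\{k/n_l:k=1,\dots,n_l\}$, so $n=\prod_{l=1}^d n_l$; write $X_i=(x_{i,1},\dots,x_{i,d})^T$. Asymptotics are along a sequence of such designs in which $n_l\to\infty$ for every $l$ and $n_l=n^{\beta_l}$ exactly, with fixed exponents $\beta_l\in(0,1)$, $\sum_{l=1}^d\beta_l=1$. The fixed point $x_0=(x_{0,1},\dots,x_{0,d})^T\in(0,1)^d$ belongs to $\mathcal X$ for every design in the sequence. Model. $Y_i=\mu^*+f_1^*(x_{i,1})+\cdots+f_d^*(x_{i,d})+\varepsilon_i$, $i=1,\dots,n$, where $\mu^*\in\mathbb R$ and the $\varepsilon_i$ are i.i.d. with a fixed distribution of mean zero and finite variance $\sigma^2$. Each $f_j^*:[0,1]\to\mathbb R$ is nondecreasing and satisfies the identifiability constraint $\sum_{i=1}^n f_j^*(x_{i,j})=0$; it depends on $n$ only through the centering constant, i.e. $f_j^*(x)=g_j(x)-n_j^{-1}\sum_{k=1}^{n_j}g_j(k/n_j)$ for a fixed nondecreasing $g_j:[0,1]\to\mathbb R$. Local smoothness. For each $j$, $g_j$ (equivalently $f_j^*$) is differentiable at $x_{0,j}$ with derivative $f_j^{*\prime}(x_{0,j})=g_j'(x_{0,j})>0$, in the sense that for all $L_0>0$, $\lim_{\delta\searrow0}\delta^{-1}\sup_{x\in[0,1],|x-x_{0,j}|\le L_0\delta}|f_j^*(x)-f_j^*(x_{0,j})-f_j^{*\prime}(x_{0,j})(x-x_{0,j})|=0$.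 Estimator. $(\widehat\mu,\widehat f_1,\dots,\widehat f_d)$ is a minimizer of $\sum_{i=1}^n(Y_i-\mu-f_1(x_{i,1})-\cdots-f_d(x_{i,d}))^2$ over $\mu\in\mathbb R$ and nondecreasing $f_1,\dots,f_d:[0,1]\to\mathbb R$, normalized so that $\sum_{i=1}^n\widehat f_j(x_{i,j})=0$ for every $j$ (values at design points are then uniquely determined). Block size. $\widehat v_j\le\widehat u_j$ are the lower and upper endpoints of the largest interval of consecutive points of $\mathcal X_j$ containing $x_{0,j}$ on which $\widehat f_j$ is constant, and $\widehat N_j=\sum_{i=1}^n\mathbf 1\{x_{i,j}\in[\widehat v_j,\widehat u_j]\}$. Also $\widehat\sigma\ge0$ is the square root of $\widehat\sigma^2$. Limit variable. Let $W$ be a two-sided standard Brownian motion with $W(0)=0$. Let $g_j^*$ and $h_j^*$ be the almost surely unique minimizer and maximizer in $\min_{g\ge0}\max_{h>0}\left\{\frac{W(g)-W(-h)}{g+h}+g-h\right\}$, i.e. the min-max value equals $\frac{W(g_j^* )-W(-h_j^* )}{g_j^*+h_j^*}+g_j^*-h_j^*$. Then $$\mathbb L_j=\sqrt{g_j^*+h_j^*}\ \min_{g\ge0}\max_{h>0}\left\{\frac{W(g)-W(-h)}{g+h}+g-h\right\}.$$ *)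

theory Defs
  imports "HOL-Probability.Probability"
begin

definition grid :: "nat \<Rightarrow> real set" where
  "grid N = (\<lambda>k. real k / real N) ` {1..N}"

definition lattice :: "('d::finite \<Rightarrow> nat) \<Rightarrow> (real ^ 'd) set" where
  "lattice nl = {x. \<forall>l. x $ l \<in> grid (nl l)}"

definition lattice_size :: "('d::finite \<Rightarrow> nat) \<Rightarrow> nat" where
  "lattice_size nl = (\<Prod>l\<in>UNIV. nl l)"

text \<open>
  On the lattice every value \<open>k / N\<close> of a coordinate occurs equally often, so subtracting the
  grid average is exactly the constraint that the component sums to zero over the design.
\<close>

definition centered :: "nat \<Rightarrow> (real \<Rightarrow> real) \<Rightarrow> real \<Rightarrow> real" where
  "centered N g x = g x - (\<Sum>k=1..N. g (real k / real N)) / real N"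

text \<open>
  \<open>D\<close> is the derivative of \<open>g\<close> at \<open>x0\<close>.  The real supremum is meaningful because \<open>g\<close> is monotone,
  hence bounded, on the unit interval and the index set contains \<open>x0\<close>.
\<close>

definition locally_linear_at :: "(real \<Rightarrow> real) \<Rightarrow> real \<Rightarrow> real \<Rightarrow> bool" where
  "locally_linear_at g x0 D \<longleftrightarrow>
     (\<forall>L0>0. ((\<lambda>\<delta>. (SUP x\<in>{x\<in>{0..1}. \<bar>x - x0\<bar> \<le> L0 * \<delta>}. \<bar>g x - g x0 - D * (x - x0)\<bar>) / \<delta>)
                \<longlongrightarrow> 0) (at_right 0))"

definition residual_ss ::
  "nat \<Rightarrow> (nat \<Rightarrow> real ^ 'd::finite) \<Rightarrow> (nat \<Rightarrow> real) \<Rightarrow> real \<Rightarrow> ('d \<Rightarrow> real \<Rightarrow> real) \<Rightarrow> real" where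
  "residual_ss n X Y \<mu> f = (\<Sum>i=1..n. (Y i - \<mu> - (\<Sum>l\<in>UNIV. f l (X i $ l)))\<^sup>2)"

definition additive_isotonic_lse ::
  "nat \<Rightarrow> (nat \<Rightarrow> real ^ 'd::finite) \<Rightarrow> (nat \<Rightarrow> real) \<Rightarrow> real \<Rightarrow> ('d \<Rightarrow> real \<Rightarrow> real) \<Rightarrow> bool" where
  "additive_isotonic_lse n X Y \<mu> f \<longleftrightarrow>
     (\<forall>l. mono_on {0..1} (f l)) \<and>
     (\<forall>\<mu>' f'. (\<forall>l. mono_on {0..1} (f' l)) \<longrightarrow>
        residual_ss n X Y \<mu> f \<le> residual_ss n X Y \<mu>' f') \<and>
     (\<forall>l. (\<Sum>i=1..n. f l (X i $ l)) = 0)"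

text \<open>
  Constancy is only required at the points of the grid \<open>A\<close>, since a least squares fit is not
  determined elsewhere.  Constant intervals containing \<open>x0\<close> are closed under union, so the
  extreme endpoints below belong to one and the same interval, the largest one.
\<close>

definition const_interval :: "real set \<Rightarrow> (real \<Rightarrow> real) \<Rightarrow> real \<Rightarrow> real \<Rightarrow> real \<Rightarrow> bool" where
  "const_interval A f x0 v u \<longleftrightarrow>
     v \<in> A \<and> u \<in> A \<and> v \<le> x0 \<and> x0 \<le> u \<and> f constant_on (A \<inter> {v..u})"

definition block_lower :: "real set \<Rightarrow> (real \<Rightarrow> real) \<Rightarrow> real \<Rightarrow> real" where
  "block_lower A f x0 = Min {v. \<exists>u. const_interval A f x0 v u}"

definition block_upper :: "real set \<Rightarrow> (real \<Rightarrow> real) \<Rightarrow> real \<Rightarrow> real" where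
  "block_upper A f x0 = Max {u. \<exists>v. const_interval A f x0 v u}"

definition block_size ::
  "nat \<Rightarrow> (nat \<Rightarrow> real ^ 'd::finite) \<Rightarrow> 'd \<Rightarrow> real set \<Rightarrow> (real \<Rightarrow> real) \<Rightarrow> real \<Rightarrow> nat" where
  "block_size n X l A f x0 = card {i\<in>{1..n}. X i $ l \<in> {block_lower A f x0..block_upper A f x0}}"

definition two_sided_brownian_motion :: "'b measure \<Rightarrow> (real \<Rightarrow> 'b \<Rightarrow> real) \<Rightarrow> bool" where
  "two_sided_brownian_motion P W \<longleftrightarrow>
     prob_space P \<and>
     (\<forall>t. W t \<in> borel_measurable P) \<and>
     (AE \<omega> in P. W 0 \<omega> = 0) \<and>
     (AE \<omega> in P. continuous_on UNIV (\<lambda>t. W t \<omega>)) \<and>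
     (\<forall>s t. s < t \<longrightarrow>
        distributed P lborel (\<lambda>\<omega>. W t \<omega> - W s \<omega>) (normal_density 0 (sqrt (t - s)))) \<and>
     (\<forall>k (\<tau> :: nat \<Rightarrow> real). strict_mono_on {..k} \<tau> \<longrightarrow>
        prob_space.indep_vars P (\<lambda>_. borel) (\<lambda>i \<omega>. W (\<tau> (Suc i)) \<omega> - W (\<tau> i) \<omega>) {..<k})"

definition drifted_slope :: "(real \<Rightarrow> real) \<Rightarrow> real \<Rightarrow> real \<Rightarrow> real" where
  "drifted_slope w g h = (w g - w (- h)) / (g + h) + g - h"

text \<open>
  The inner maximum is \<open>\<infinity>\<close> at \<open>g = 0\<close> for almost every Brownian path, hence the values in
  \<^typ>\<open>ereal\<close>.
\<close>

definition inner_max :: "(real \<Rightarrow> real) \<Rightarrow> real \<Rightarrow> ereal" where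
  "inner_max w g = (SUP h\<in>{0<..}. ereal (drifted_slope w g h))"

definition minmax_value :: "(real \<Rightarrow> real) \<Rightarrow> ereal" where
  "minmax_value w = (INF g\<in>{0..}. inner_max w g)"

definition minmax_attained_at :: "(real \<Rightarrow> real) \<Rightarrow> real \<Rightarrow> real \<Rightarrow> bool" where
  "minmax_attained_at w g h \<longleftrightarrow>
     0 \<le> g \<and> inner_max w g = minmax_value w \<and>
     0 < h \<and> ereal (drifted_slope w g h) = inner_max w g"

text \<open>
  The minimizer and maximizer exist and are unique only almost surely, so the limit variable is
  pinned down only up to a null set.
\<close>

definition is_limit_variable ::
  "'b measure \<Rightarrow> (real \<Rightarrow> 'b \<Rightarrow> real) \<Rightarrow> ('b \<Rightarrow> real) \<Rightarrow> bool" where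
  "is_limit_variable P W L \<longleftrightarrow>
     L \<in> borel_measurable P \<and>
     (AE \<omega> in P. \<exists>g h. minmax_attained_at (\<lambda>t. W t \<omega>) g h \<and>
        L \<omega> = sqrt (g + h) * real_of_ereal (minmax_value (\<lambda>t. W t \<omega>)))"

definition converges_in_prob :: "(nat \<Rightarrow> 'a measure) \<Rightarrow> (nat \<Rightarrow> 'a \<Rightarrow> real) \<Rightarrow> real \<Rightarrow> bool" where
  "converges_in_prob M T c \<longleftrightarrow>
     (\<forall>m. T m \<in> borel_measurable (M m)) \<and>
     (\<forall>\<eta>>0. (\<lambda>m. measure (M m) {\<omega> \<in> space (M m). \<bar>T m \<omega> - c\<bar> > \<eta>}) \<longlonglongrightarrow> 0)"

end

theory Submission
  imports Defs
begin

text \<open>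
  On a full lattice the additive components decouple.  Within a slice of the design on which the
  \<open>j\<close>-th coordinate is constant, every other component, of the regression function and of the fit,
  sums to zero.  Hence the \<open>j\<close>-th component of the least squares fit is the ordinary isotonic
  regression of the slice means of the data, centred by the fitted constant: the constant block at
  \<open>x0\<close> is the segment over the index of \<open>x0\<close> of a line supporting the diagram of cumulative slice
  means, and the fitted value is the slope of that line (\<open>lse_block_chord\<close>).

  Measure the distance to \<open>x0\<close> in units \<open>\<rho>\<close> with \<open>\<rho> ^ 3 = 4 * \<sigma>\<^sup>2 / (D\<^sup>2 * n)\<close> and the cumulative sums in
  the matching unit.  The errors then have variance one per unit of time and the drift tends to
  \<open>t\<^sup>2\<close>, so the diagram tends to \<open>W t + t\<^sup>2\<close>.  A unit of time contains \<open>N * \<rho>\<close> slices, where \<open>N\<close> is the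
  number of values of the \<open>j\<close>-th coordinate, and this tends to infinity because \<open>\<beta> j > 1 / 3\<close>.  A
  block over the time interval from \<open>a\<close> to \<open>b\<close> contains \<open>n * \<rho> * (b - a)\<close> observations; therefore the
  estimation error times the square root of the block size is \<open>\<sigma> * sqrt (b - a) * s\<close>, where \<open>s\<close> is the
  rescaled slope, up to the error of the fitted constant, which is negligible.  The derivative \<open>D\<close> has
  cancelled.  On the limiting side, where the min-max is attained at \<open>(g, h)\<close>, the line through the
  graph of \<open>W t + t\<^sup>2\<close> at \<open>- h\<close> and \<open>g\<close> supports that graph and the min-max value is its slope
  (\<open>chord_of_minmax\<close>), so \<open>L\<close> is the same functional of \<open>W t + t\<^sup>2\<close>.

  It remains to see that the functional is stable and that the diagrams converge.  A supporting chord
  moves little under a small perturbation of the diagram if its slope is bounded, its ends are away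
  from time zero, no third point comes close to its line, and the diagram grows away from zero
  (\<open>chord_stable\<close>).  Almost all of the mass of Brownian motion with parabolic drift has these
  properties (\<open>chord_slope_bounded\<close>, \<open>not_vertex_right\<close>, \<open>no_ties_on_grid\<close>), which gives
  \<open>limit_chord_stable\<close>.  The third one is the core: given the other increments, a near tie between
  three separated pieces of the path confines one Brownian increment to a short interval.

  Convergence is used in a one-sided form, between events of two unrelated spaces
  (\<open>array_tracks_bm\<close>): for every event \<open>G\<close> of the Brownian space and all late sample sizes, some event
  of the sample space has probability almost that of \<open>G\<close>, and each of its points has a diagram close to
  \<open>W t + t\<^sup>2\<close> for some path in \<open>G\<close>.  Applied to the events that \<open>\<bar>L\<bar>\<close> is below, or above, the critical
  value by a margin, this bounds the coverage probability from both sides, and continuity of the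
  distribution function of \<open>\<bar>L\<bar>\<close> at the critical value closes the gap.
\<close>

section \<open>Supporting chords and their stability\<close>

lemma affine_interpolation:
  fixes x y z a b :: real
  assumes "x \<le> y" "y \<le> z"
  shows "(a + b * y) * (z - x) = (a + b * x) * (z - y) + (a + b * z) * (y - x)"
  by (simp add: algebra_simps)

text \<open>
  The difference of the two lines is affine.  It is at most \<open>e\<close> near both ends of the
  first chord and at least \<open>- e\<close> at both ends of the second, because the diagram lies
  above the second line, and above the first up to \<open>e\<close>.  If \<open>t p\<close> were far
  from \<open>p1\<close> the difference would be large there, and interpolating between \<open>t
  p\<close> and points where it is small would contradict affinity.  The margin \<open>\<kappa> * max
  1 (\<bar>t i\<bar> / T)\<close> grows linearly so that it beats the leverage of a remote \<open>t
  p\<close>.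
\<close>

lemma chord_left_end_stable:
  fixes t v :: "'i \<Rightarrow> real"
  assumes i: "p \<in> I" "q \<in> I" "ip \<in> I" "iq \<in> I"
    and pq: "t p \<le> 0" "0 \<le> t q"
    and supp: "\<And>i. i \<in> I \<Longrightarrow> v i \<ge> a2 + s2 * t i" "v p = a2 + s2 * t p" "v q = a2 + s2 * t q"
    and near: "\<And>i. i \<in> I \<Longrightarrow> v i \<ge> a1 + s1 * t i - e"
    and far: "\<And>i. i \<in> I \<Longrightarrow> \<bar>t i - p1\<bar> > \<eta> \<Longrightarrow> \<bar>t i - q1\<bar> > \<eta> \<Longrightarrow>
        v i \<ge> a1 + s1 * t i + \<kappa> * max 1 (\<bar>t i\<bar> / T)"
    and ip: "\<bar>t ip - p1\<bar> \<le> \<eta>" "v ip \<le> a1 + s1 * t ip + e"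
    and iq: "\<bar>t iq - q1\<bar> \<le> \<eta>" "v iq \<le> a1 + s1 * t iq + e"
    and sep: "p1 \<le> - 3 * \<eta>" "q1 \<ge> 3 * \<eta>"
    and c: "\<eta> > 0" "T \<ge> 1" "\<kappa> > 0" "0 < e" "8 * T * e < \<kappa> * \<eta>" "\<eta> \<le> 1"
  shows "\<bar>t p - p1\<bar> \<le> \<eta>"
proof (rule ccontr)
  assume np: "\<not> \<bar>t p - p1\<bar> \<le> \<eta>"
  define E where "E = \<kappa> * max 1 (\<bar>t p\<bar> / T)"
  define d where "d x = (a2 - a1) + (s2 - s1) * x" for x
  have "\<bar>t p - q1\<bar> > \<eta>" using pq sep c by linarith
  from far[OF i(1) _ this] np have "v p \<ge> a1 + s1 * t p + E" by (simp add: E_def)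
  then have dp: "d (t p) \<ge> E" using supp(2) by (simp add: d_def algebra_simps)
  have dq: "d (t q) \<ge> - e" using near[OF i(2)] supp(3) by (simp add: d_def algebra_simps)
  have dip: "d (t ip) \<le> e" using ip(2) supp(1)[OF i(3)] by (simp add: d_def algebra_simps)
  have diq: "d (t iq) \<le> e" using iq(2) supp(1)[OF i(4)] by (simp add: d_def algebra_simps)
  have tip: "t ip \<le> - 2 * \<eta>" and tiq: "t iq \<ge> 2 * \<eta>" using ip iq sep c by linarith+
  have E1: "E \<ge> \<kappa>" unfolding E_def using c by (simp add: mult_le_cancel_left1)
  have ek: "8 * e \<le> \<kappa>"
  proof -
    have "8 * e * 1 \<le> 8 * e * T" using c by (intro mult_left_mono) auto
    also have "\<dots> < \<kappa> * \<eta>" using c by (simp add: algebra_simps)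
    also have "\<dots> \<le> \<kappa> * 1" using c by (intro mult_left_mono) auto
    finally show ?thesis by simp
  qed
  show False
  proof (cases "t p \<ge> t ip")
    case True
    have "d (t p) * (t iq - t ip) = d (t ip) * (t iq - t p) + d (t iq) * (t p - t ip)"
      unfolding d_def by (rule affine_interpolation) (use True pq tiq c in auto)
    also have "\<dots> \<le> e * (t iq - t p) + e * (t p - t ip)"
      using True pq tiq c dip diq by (intro add_mono mult_right_mono) auto
    also have "\<dots> = e * (t iq - t ip)" by (simp add: algebra_simps)
    finally have "d (t p) \<le> e" using tip tiq c by (simp add: mult_le_cancel_right)
    then show False using dp E1 ek c by linarith
  next
    case False
    have "d (t ip) * (t q - t p) = d (t p) * (t q - t ip) + d (t q) * (t ip - t p)"
      unfolding d_def by (rule affine_interpolation) (use False pq tip c in auto)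
    moreover have "d (t p) * (t q - t ip) \<ge> E * (t q - t ip)"
      using dp tip pq c by (intro mult_right_mono) auto
    moreover have "d (t q) * (t ip - t p) \<ge> - e * (t ip - t p)"
      using dq False by (intro mult_right_mono) auto
    moreover have "d (t ip) * (t q - t p) \<le> e * (t q - t p)"
      using dip pq by (intro mult_right_mono) auto
    ultimately have "E * (t q - t ip) - e * (t ip - t p) \<le> e * (t q - t p)" by linarith
    then have "(E - e) * (t q - t ip) \<le> 2 * e * (t ip - t p)" by (simp add: algebra_simps)
    moreover have "(E - e) * (t q - t ip) \<ge> (E/2) * (2 * \<eta>)"
      using E1 ek c tip pq by (intro mult_mono) auto
    moreover have "2 * e * (t ip - t p) \<le> 2 * e * \<bar>t p\<bar>"
      using c tip by (intro mult_left_mono) auto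
    ultimately have *: "E * \<eta> \<le> 2 * e * \<bar>t p\<bar>" by simp
    have "E \<ge> \<kappa> * (\<bar>t p\<bar> / T)" unfolding E_def using c by (intro mult_left_mono) auto
    then have "E * \<eta> \<ge> \<kappa> * (\<bar>t p\<bar> / T) * \<eta>" using c by (intro mult_right_mono) auto
    with * have "\<kappa> * (\<bar>t p\<bar> / T) * \<eta> \<le> 2 * e * \<bar>t p\<bar>" by linarith
    then have "(\<kappa> * \<eta>) * \<bar>t p\<bar> \<le> (2 * e * T) * \<bar>t p\<bar>" using c by (simp add: field_simps)
    moreover have "\<bar>t p\<bar> > 0" using False tip c by linarith
    ultimately have "\<kappa> * \<eta> \<le> 2 * (T * e)" by (simp add: mult_le_cancel_right ac_simps)
    moreover have "T * e > 0" using c by simp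
    ultimately show False using c(5) by linarith
  qed
qed

text \<open>
  The first line \<open>a1 + s1 * t\<close> need only support the diagram up to \<open>e\<close>, so
  it may come from a nearby limiting diagram; the second supports it exactly.  The right end follows
  from the left one by reflecting time, and the slopes are then compared over two points at distance
  at least \<open>2 * \<eta>\<close>.
\<close>

lemma chord_stable:
  fixes t v :: "'i \<Rightarrow> real"
  assumes i: "p \<in> I" "q \<in> I" "ip \<in> I" "iq \<in> I"
    and pq: "t p \<le> 0" "0 \<le> t q"
    and supp: "\<And>i. i \<in> I \<Longrightarrow> v i \<ge> a2 + s2 * t i" "v p = a2 + s2 * t p" "v q = a2 + s2 * t q"
    and near: "\<And>i. i \<in> I \<Longrightarrow> v i \<ge> a1 + s1 * t i - e"
    and far: "\<And>i. i \<in> I \<Longrightarrow> \<bar>t i - p1\<bar> > \<eta> \<Longrightarrow> \<bar>t i - q1\<bar> > \<eta> \<Longrightarrow>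
        v i \<ge> a1 + s1 * t i + \<kappa> * max 1 (\<bar>t i\<bar> / T)"
    and ip: "\<bar>t ip - p1\<bar> \<le> \<eta>" "v ip \<le> a1 + s1 * t ip + e"
    and iq: "\<bar>t iq - q1\<bar> \<le> \<eta>" "v iq \<le> a1 + s1 * t iq + e"
    and sep: "p1 \<le> - 3 * \<eta>" "q1 \<ge> 3 * \<eta>"
    and c: "\<eta> > 0" "T \<ge> 1" "\<kappa> > 0" "0 < e" "8 * T * e < \<kappa> * \<eta>" "\<eta> \<le> 1"
  shows "\<bar>t p - p1\<bar> \<le> \<eta>" "\<bar>t q - q1\<bar> \<le> \<eta>" "\<bar>s2 - s1\<bar> \<le> e / \<eta>"
proof -
  show P: "\<bar>t p - p1\<bar> \<le> \<eta>"
    by (rule chord_left_end_stable[where t=t and v=v and T=T and \<kappa>=\<kappa> and e=e, OF i pq supp near far ip iq sep c])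
  have "\<bar>- t q - - q1\<bar> \<le> \<eta>"
  proof (rule chord_left_end_stable[where I=I and p=q and q=p and ip=iq and iq=ip and t="\<lambda>i. - t i" and v=v
        and ?a1.0=a1 and ?s1.0="-s1" and ?a2.0=a2 and ?s2.0="-s2" and ?q1.0="-p1" and T=T and \<kappa>=\<kappa> and e=e])
    show "v i \<ge> a1 + - s1 * - t i + \<kappa> * max 1 (\<bar>- t i\<bar> / T)"
      if "i \<in> I" "\<bar>- t i - - q1\<bar> > \<eta>" "\<bar>- t i - - p1\<bar> > \<eta>" for i
      using far[of i] that by (simp add: abs_minus_commute)
    show "\<bar>- t iq - - q1\<bar> \<le> \<eta>" "\<bar>- t ip - - p1\<bar> \<le> \<eta>" using ip iq by (simp_all add: abs_minus_commute)
  qed (use i pq supp near ip iq sep c in simp_all)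
  then show Q: "\<bar>t q - q1\<bar> \<le> \<eta>" by linarith
  define d where "d x = (a2 - a1) + (s2 - s1) * x" for x
  have dp: "d (t p) \<ge> - e" using near[OF i(1)] supp(2) by (simp add: d_def algebra_simps)
  have dq: "d (t q) \<ge> - e" using near[OF i(2)] supp(3) by (simp add: d_def algebra_simps)
  have dip: "d (t ip) \<le> e" using ip(2) supp(1)[OF i(3)] by (simp add: d_def algebra_simps)
  have diq: "d (t iq) \<le> e" using iq(2) supp(1)[OF i(4)] by (simp add: d_def algebra_simps)
  have "d (t q) - d (t ip) \<ge> - 2 * e" using dq dip by linarith
  then have 1: "(s2 - s1) * (t q - t ip) \<ge> - 2 * e" by (simp add: d_def algebra_simps)
  have "d (t iq) - d (t p) \<le> 2 * e" using diq dp by linarith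
  then have 2: "(s2 - s1) * (t iq - t p) \<le> 2 * e" by (simp add: d_def algebra_simps)
  have g1: "t q - t ip \<ge> 2 * \<eta>" and g2: "t iq - t p \<ge> 2 * \<eta>" using Q P ip iq sep c by linarith+
  have "s2 - s1 \<ge> - (e / \<eta>)"
  proof (rule ccontr)
    assume "\<not> ?thesis"
    then have neg: "s1 - s2 > e / \<eta>" by linarith
    then have "s1 - s2 > 0" using c by (smt (verit) divide_pos_pos)
    then have "(s1 - s2) * (t q - t ip) \<ge> (s1 - s2) * (2 * \<eta>)" using g1 by (intro mult_left_mono) auto
    moreover have "(s1 - s2) * (2 * \<eta>) > e / \<eta> * (2 * \<eta>)" using neg c by (intro mult_strict_right_mono) auto
    moreover have "e / \<eta> * (2 * \<eta>) = 2 * e" using c by simp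
    ultimately show False using 1 by (simp add: algebra_simps)
  qed
  moreover have "s2 - s1 \<le> e / \<eta>"
  proof (rule ccontr)
    assume "\<not> ?thesis"
    then have neg: "s2 - s1 > e / \<eta>" by linarith
    then have "s2 - s1 > 0" using c by (smt (verit) divide_pos_pos)
    then have "(s2 - s1) * (t iq - t p) \<ge> (s2 - s1) * (2 * \<eta>)" using g2 by (intro mult_left_mono) auto
    moreover have "(s2 - s1) * (2 * \<eta>) > e / \<eta> * (2 * \<eta>)" using neg c by (intro mult_strict_right_mono) auto
    moreover have "e / \<eta> * (2 * \<eta>) = 2 * e" using c by simp
    ultimately show False using 2 by (simp add: algebra_simps)
  qed
  ultimately show "\<bar>s2 - s1\<bar> \<le> e / \<eta>" by linarith
qed

text \<open>
  With \<open>V t = w t + t\<^sup>2\<close>, \<open>drifted_slope w g h\<close> is the slope of the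
  secant of \<open>V\<close> over \<open>[- h, g]\<close>. Maximality in \<open>h\<close> puts the
  graph above the line to the left of zero, and minimality in \<open>g\<close> puts it above the line
  to the right.  The growth condition makes the supremum over \<open>h\<close> effectively one over a
  bounded range, so a point strictly below the line would lower the inner maximum by a definite
  amount.
\<close>

lemma chord_of_minmax:
  fixes w :: "real \<Rightarrow> real"
  assumes cont: "continuous_on UNIV w" and tail: "\<And>t. t \<le> - T \<Longrightarrow> \<bar>w t\<bar> \<le> c * \<bar>t\<bar>"
    and at: "minmax_attained_at w g h"
  defines "s \<equiv> real_of_ereal (minmax_value w)"
  shows "w t + t\<^sup>2 \<ge> (w (- h) + h\<^sup>2) + s * (t + h)"
    and "w g + g\<^sup>2 = (w (- h) + h\<^sup>2) + s * (g + h)"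
proof -
  define V where "V t = w t + t\<^sup>2" for t
  have V': "V (- x) = w (- x) + x\<^sup>2" for x by (simp add: V_def)
  have slope: "drifted_slope w g h * (g + h) = V g - V (- h)" if "g + h > 0" for g h
    using that by (simp add: drifted_slope_def V_def field_simps power2_eq_square)
  from at have g: "g \<ge> 0" and h: "h > 0" and in_g: "inner_max w g = minmax_value w"
    and sl: "ereal (drifted_slope w g h) = inner_max w g" by (auto simp: minmax_attained_at_def)
  have s: "s = drifted_slope w g h" unfolding s_def by (metis in_g sl real_of_ereal.simps(1))
  have mv: "minmax_value w = ereal s" using s in_g sl by simp
  have eq: "V g = V (- h) + s * (g + h)" using slope[of g h] g h s by (simp add: algebra_simps)
  then show "w g + g\<^sup>2 = (w (- h) + h\<^sup>2) + s * (g + h)" by (simp add: V_def)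
  define l where "l t = V (- h) + s * (t + h)" for t
  have neg: "V (- h') \<ge> l (- h')" if "h' > 0" for h'
  proof -
    have "ereal (drifted_slope w g h') \<le> inner_max w g" unfolding inner_max_def
      using that by (intro SUP_upper) auto
    then have "drifted_slope w g h' \<le> s" using in_g mv by simp
    then have "drifted_slope w g h' * (g + h') \<le> s * (g + h')" using g that by (intro mult_right_mono) auto
    then show ?thesis using slope[of g h'] g that eq by (simp add: l_def algebra_simps)
  qed
  have contV: "continuous_on UNIV V" unfolding V_def by (intro continuous_intros cont)
  have zero: "V 0 \<ge> l 0"
  proof -
    have "((\<lambda>x. V x - l x) \<longlongrightarrow> V 0 - l 0) (at_left 0)"
      using contV unfolding l_def
      by (intro tendsto_intros) (simp add: continuous_on_eq_continuous_at continuous_at filterlim_at_split)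
    moreover have "eventually (\<lambda>x. V x - l x \<ge> 0) (at_left 0)"
      unfolding eventually_at_left_field using neg[of "- x" for x] by (intro exI[of _ "-1"]) (auto simp: field_simps)
    ultimately have "V 0 - l 0 \<ge> 0" by (rule tendsto_lowerbound) simp
    then show ?thesis by simp
  qed
  have pos: "V g' \<ge> l g'" if g': "g' > 0" for g'
  proof (rule ccontr)
    assume "\<not> ?thesis"
    define d where "d = l g' - V g'"
    have d: "d > 0" using \<open>\<not> V g' \<ge> l g'\<close> by (simp add: d_def)
    \<comment> \<open>For \<open>h'\<close> beyond \<open>H\<close> the quadratic term at \<open>- h'\<close> pulls the secant slope down to \<open>s - 1\<close>; up to
      \<open>H\<close> a violation of size \<open>d\<close> at \<open>g'\<close> costs at least \<open>d / (g' + H)\<close> of slope.\<close>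
    define H where "H = \<bar>T\<bar> + \<bar>c\<bar> + \<bar>s - 1\<bar> + 1 + \<bar>V g' - (s - 1) * g'\<bar>"
    have big: "drifted_slope w g' h' \<le> s - 1" if h': "h' \<ge> H" for h'
    proof -
      have hp: "h' \<ge> 1" "- h' \<le> - T" using h' by (auto simp: H_def)
      have "\<bar>w (- h')\<bar> \<le> c * h'" using tail[of "- h'"] hp by simp
      then have "V (- h') \<ge> h'\<^sup>2 - c * h'" by (simp add: V')
      moreover have "h'\<^sup>2 - c * h' + (s - 1) * h' = h' * (h' - c + (s - 1))" by (simp add: power2_eq_square algebra_simps)
      moreover have "h' * (h' - c + (s - 1)) \<ge> 1 * \<bar>V g' - (s - 1) * g'\<bar>"
        using hp h' by (intro mult_mono) (auto simp: H_def)
      moreover have "V g' - (s - 1) * g' \<le> 1 * \<bar>V g' - (s - 1) * g'\<bar>" by simp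
      ultimately have "V g' - (s - 1) * g' \<le> V (- h') + (s - 1) * h'"
        by (metis (no_types, lifting) add_right_mono order_trans)
      then have "drifted_slope w g' h' * (g' + h') \<le> (s - 1) * (g' + h')"
        using slope[of g' h'] g' hp by (simp add: algebra_simps)
      then show ?thesis using g' hp by (simp add: mult_le_cancel_right)
    qed
    have small: "drifted_slope w g' h' \<le> s - d / (g' + H)" if h': "0 < h'" "h' \<le> H" for h'
    proof -
      have "drifted_slope w g' h' * (g' + h') = V g' - V (- h')" using slope g' h' by simp
      also have "\<dots> \<le> (l g' - d) - l (- h')" using neg[OF h'(1)] by (simp add: d_def)
      also have "\<dots> = s * (g' + h') - d" by (simp add: l_def algebra_simps)
      also have "\<dots> \<le> s * (g' + h') - d / (g' + H) * (g' + h')"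
        using g' h' d by (simp add: field_simps)
      finally have "drifted_slope w g' h' * (g' + h') \<le> (s - d / (g' + H)) * (g' + h')"
        by (simp add: algebra_simps)
      then show ?thesis using g' h' by (simp add: mult_le_cancel_right)
    qed
    have "inner_max w g' \<le> ereal (s - min 1 (d / (g' + H)))"
      unfolding inner_max_def
    proof (rule SUP_least)
      fix x :: real assume "x \<in> {0<..}"
      then show "ereal (drifted_slope w g' x) \<le> ereal (s - min 1 (d / (g' + H)))"
        using big[of x] small[of x] by (cases "x \<le> H") auto
    qed
    moreover have "minmax_value w \<le> inner_max w g'" unfolding minmax_value_def
      using g' by (intro INF_lower) auto
    ultimately have "s \<le> s - min 1 (d / (g' + H))" using mv by (metis ereal_less_eq(3) order_trans)
    moreover have "d / (g' + H) > 0" using d g' by (intro divide_pos_pos) (auto simp: H_def)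
    ultimately show False by simp
  qed
  have "V t \<ge> l t" using neg[of "- t"] zero pos[of t] by (cases "t < 0"; cases "t = 0") auto
  then show "w t + t\<^sup>2 \<ge> (w (- h) + h\<^sup>2) + s * (t + h)" by (simp add: V_def l_def)
qed

section \<open>Least squares on a lattice\<close>

text \<open>
  Replacing the \<open>j\<close>-th coordinate maps one slice of the lattice bijectively onto another.
\<close>

lemma lattice_slice_sum:
  fixes \<phi> :: "real \<Rightarrow> real" and nl :: "'d::finite \<Rightarrow> nat"
  assumes "j \<noteq> l" "a \<in> grid (nl j)" "b \<in> grid (nl j)"
  shows "(\<Sum>x | x \<in> lattice nl \<and> x $ j = a. \<phi> (x $ l)) = (\<Sum>x | x \<in> lattice nl \<and> x $ j = b. \<phi> (x $ l))"
proof -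
  define r where "r c = (\<lambda>x::real^'d. \<chi> i. if i = j then c else x $ i)" for c
  show ?thesis
    by (rule sum.reindex_bij_witness[of _ "r a" "r b"])
      (use assms in \<open>auto simp: r_def lattice_def vec_eq_iff\<close>)
qed

lemma lattice_slice_card:
  fixes nl :: "'d::finite \<Rightarrow> nat"
  assumes "a \<in> grid (nl j)" "b \<in> grid (nl j)"
  shows "card {x. x \<in> lattice nl \<and> x $ j = a} = card {x. x \<in> lattice nl \<and> x $ j = b}"
proof -
  define r where "r c = (\<lambda>x::real^'d. \<chi> i. if i = j then c else x $ i)" for c
  have "bij_betw (r b) {x. x \<in> lattice nl \<and> x $ j = a} {x. x \<in> lattice nl \<and> x $ j = b}"
    by (rule bij_betw_byWitness[of _ "r a"])
      (use assms in \<open>auto simp: r_def lattice_def vec_eq_iff\<close>)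
  then show ?thesis by (rule bij_betw_same_card)
qed

definition slice :: "nat \<Rightarrow> (nat \<Rightarrow> real ^ 'd::finite) \<Rightarrow> 'd \<Rightarrow> nat \<Rightarrow> nat \<Rightarrow> nat set" where
  "slice n X j N k = {i \<in> {1..n}. X i $ j = real k / real N}"

lemma image_Collect_simp: "X ` {i \<in> A. Q (X i)} = {x. x \<in> X ` A \<and> Q x}"
  by blast

lemma slice_sum_lattice:
  fixes \<phi> :: "real ^ 'd::finite \<Rightarrow> real"
  assumes "bij_betw X {1..n} (lattice nl)"
  shows "(\<Sum>i\<in>slice n X j N k. \<phi> (X i)) = (\<Sum>x | x \<in> lattice nl \<and> x $ j = real k / real N. \<phi> x)"
proof (rule sum.reindex_bij_betw)
  have X: "X ` {1..n} = lattice nl" "inj_on X {1..n}" using assms by (simp_all add: bij_betw_def)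
  have "X ` slice n X j N k = {x. x \<in> X ` {1..n} \<and> x $ j = real k / real N}"
    unfolding slice_def by (rule image_Collect_simp)
  then show "bij_betw X (slice n X j N k) {x. x \<in> lattice nl \<and> x $ j = real k / real N}"
    unfolding X(1) bij_betw_def using inj_on_subset[OF X(2), of "slice n X j N k"]
    by (simp add: slice_def subset_iff)
qed

lemma slice_disjoint: "N > 0 \<Longrightarrow> k \<noteq> k' \<Longrightarrow> slice n X j N k \<inter> slice n X j N k' = {}"
  by (auto simp: slice_def field_simps)

lemma finite_slice [simp]: "finite (slice n X j N k)"
  by (auto simp: slice_def)

lemma UN_slice:
  fixes nl :: "'d::finite \<Rightarrow> nat"
  assumes "bij_betw X {1..n} (lattice nl)" "nl j > 0"
  shows "(\<Union>k\<in>{1..nl j}. slice n X j (nl j) k) = {1..n}"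
proof -
  have "X i \<in> lattice nl" if "i \<in> {1..n}" for i using assms that by (auto simp: bij_betw_def)
  then have "X i $ j \<in> grid (nl j)" if "i \<in> {1..n}" for i using that by (auto simp: lattice_def)
  then show ?thesis by (fastforce simp: slice_def grid_def)
qed

lemma sum_slices:
  fixes nl :: "'d::finite \<Rightarrow> nat" and \<phi> :: "nat \<Rightarrow> real"
  assumes "bij_betw X {1..n} (lattice nl)" "nl j > 0"
  shows "(\<Sum>i=1..n. \<phi> i) = (\<Sum>k=1..nl j. \<Sum>i\<in>slice n X j (nl j) k. \<phi> i)"
proof -
  have "(\<Sum>i=1..n. \<phi> i) = sum \<phi> (\<Union>k\<in>{1..nl j}. slice n X j (nl j) k)" using UN_slice[OF assms] by simp
  also have "\<dots> = (\<Sum>k=1..nl j. \<Sum>i\<in>slice n X j (nl j) k. \<phi> i)"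
    by (rule sum.UNION_disjoint) (use assms in \<open>simp_all add: slice_disjoint\<close>)
  finally show ?thesis .
qed

text \<open>
  All slices give the same sum, and these sums add up to zero.  This is where the lattice design
  decouples the components.
\<close>

lemma slice_sum_other_zero:
  fixes nl :: "'d::finite \<Rightarrow> nat"
  assumes "bij_betw X {1..n} (lattice nl)" "nl j > 0" "l \<noteq> j"
    and zero: "(\<Sum>i=1..n. \<phi> (X i $ l)) = 0" and k: "k \<in> {1..nl j}"
  shows "(\<Sum>i\<in>slice n X j (nl j) k. \<phi> (X i $ l)) = (0::real)"
proof -
  have "(\<Sum>i\<in>slice n X j (nl j) k'. \<phi> (X i $ l)) = (\<Sum>i\<in>slice n X j (nl j) k. \<phi> (X i $ l))"
    if "k' \<in> {1..nl j}" for k'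
    unfolding slice_sum_lattice[OF assms(1), of "\<lambda>x. \<phi> (x $ l)"]
    by (rule lattice_slice_sum) (use assms that in \<open>auto simp: grid_def\<close>)
  then have "(\<Sum>i=1..n. \<phi> (X i $ l)) = (\<Sum>k'=1..nl j. \<Sum>i\<in>slice n X j (nl j) k. \<phi> (X i $ l))"
    unfolding sum_slices[OF assms(1,2)] by simp
  then show ?thesis using zero assms(2) by simp
qed

lemma card_slice:
  fixes nl :: "'d::finite \<Rightarrow> nat"
  assumes "bij_betw X {1..n} (lattice nl)" "nl j > 0" and k: "k \<in> {1..nl j}"
  shows "nl j * card (slice n X j (nl j) k) = n"
proof -
  have c: "card (slice n X j (nl j) k) = card {x. x \<in> lattice nl \<and> x $ j = real k / real (nl j)}" for k
    using slice_sum_lattice[OF assms(1), of "\<lambda>x. 1" j "nl j" k] by simp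
  have eq: "card (slice n X j (nl j) k') = card (slice n X j (nl j) k)" if "k' \<in> {1..nl j}" for k'
    unfolding c by (rule lattice_slice_card) (use k that in \<open>auto simp: grid_def\<close>)
  have "real n = (\<Sum>k'=1..nl j. real (card (slice n X j (nl j) k')))"
    using sum_slices[OF assms(1,2), of "\<lambda>_. 1"] by simp
  also have "\<dots> = (\<Sum>k'=1..nl j. real (card (slice n X j (nl j) k)))"
    by (intro sum.cong) (use eq in auto)
  finally have "real n = real (nl j * card (slice n X j (nl j) k))" by simp
  then show ?thesis by linarith
qed

text \<open>
  The derivative at zero of the right-hand side along the direction \<open>d\<close> must be
  nonnegative.
\<close>

lemma first_order_condition:
  fixes R d :: "nat \<Rightarrow> real"
  assumes "\<And>\<theta>. 0 < \<theta> \<Longrightarrow> \<theta> \<le> \<theta>0 \<Longrightarrow> (\<Sum>i=1..n. (R i)\<^sup>2) \<le> (\<Sum>i=1..n. (R i - \<theta> * d i)\<^sup>2)" and "\<theta>0 > 0"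
  shows "(\<Sum>i=1..n. R i * d i) \<le> 0"
proof (rule ccontr)
  assume "\<not> ?thesis"
  define a where "a = (\<Sum>i=1..n. R i * d i)"
  define b where "b = (\<Sum>i=1..n. (d i)\<^sup>2)"
  have a: "a > 0" using \<open>\<not> _\<close> by (simp add: a_def)
  have b: "b \<ge> 0" unfolding b_def by (intro sum_nonneg) auto
  \<comment> \<open>So short a step that the linear term outweighs the quadratic one.\<close>
  define \<theta> where "\<theta> = min \<theta>0 (a / (b + 1))"
  have \<theta>: "\<theta> > 0" "\<theta> \<le> \<theta>0" using a b assms by (auto simp: \<theta>_def)
  have "(\<Sum>i=1..n. (R i - \<theta> * d i)\<^sup>2) = (\<Sum>i=1..n. (R i)\<^sup>2) - 2 * \<theta> * a + \<theta>\<^sup>2 * b"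
    unfolding a_def b_def sum_distrib_left sum_subtractf[symmetric] sum.distrib[symmetric]
    by (intro sum.cong) (auto simp: power2_eq_square algebra_simps)
  with assms(1)[OF \<theta>] have "2 * a * \<theta> \<le> \<theta> * b * \<theta>" by (simp add: power2_eq_square algebra_simps)
  then have "2 * a \<le> \<theta> * b" using \<theta> by (simp add: mult_le_cancel_right)
  also have "\<theta> * b \<le> a / (b + 1) * b" using b by (intro mult_right_mono) (auto simp: \<theta>_def)
  also have "\<dots> \<le> a" using a b by (simp add: field_simps)
  finally show False using a by simp
qed

text \<open>
  The characterisation of isotonic regression by cumulative residuals.  Shifting the fit on all slices
  beyond \<open>a\<close> upwards preserves monotonicity; shifting it downwards does so for small
  shifts if the fit jumps after \<open>a\<close>; shifting the constant is always allowed.  The other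
  components contribute nothing because they sum to zero over each slice.
\<close>

lemma lse_residual_sums:
  fixes nl :: "'d::finite \<Rightarrow> nat"
  assumes bij: "bij_betw X {1..n} (lattice nl)" and N: "nl j > 0"
    and lse: "additive_isotonic_lse n X Y \<mu> f"
  defines "F \<equiv> \<lambda>k. f j (real k / real (nl j))"
  defines "r \<equiv> \<lambda>k. \<Sum>i\<in>slice n X j (nl j) k. Y i - \<mu> - F k"
  shows "(\<Sum>k=1..nl j. r k) = 0"
    and "a \<le> nl j \<Longrightarrow> (\<Sum>k=1..a. r k) \<ge> 0"
    and "a < nl j \<Longrightarrow> F a < F (Suc a) \<Longrightarrow> (\<Sum>k=1..a. r k) = 0"
proof -
  define N where "N = nl j"
  have N0: "N > 0" using assms by (simp add: N_def)
  define R where "R i = Y i - \<mu> - (\<Sum>l\<in>UNIV. f l (X i $ l))" for i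
  have mono: "mono_on {0..1} (f l)" for l using lse by (simp add: additive_isotonic_lse_def)
  have opt: "residual_ss n X Y \<mu> f \<le> residual_ss n X Y \<mu>' f'" if "\<And>l. mono_on {0..1} (f' l)" for \<mu>' f'
    using lse that by (simp add: additive_isotonic_lse_def)
  have rowR: "(\<Sum>i\<in>slice n X j N k. R i) = r k" if k: "k \<in> {1..N}" for k
  proof -
    have "(\<Sum>i\<in>slice n X j N k. R i) = (\<Sum>i\<in>slice n X j N k. (Y i - \<mu> - F k) - (\<Sum>l\<in>UNIV-{j}. f l (X i $ l)))"
    proof (intro sum.cong refl)
      fix i assume "i \<in> slice n X j N k"
      then have "f j (X i $ j) = F k" by (simp add: slice_def F_def N_def)
      then show "R i = (Y i - \<mu> - F k) - (\<Sum>l\<in>UNIV-{j}. f l (X i $ l))"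
        unfolding R_def by (subst sum.remove[of _ j]) auto
    qed
    also have "\<dots> = r k - (\<Sum>l\<in>UNIV-{j}. \<Sum>i\<in>slice n X j N k. f l (X i $ l))"
      by (simp add: sum_subtractf r_def N_def sum.swap[of _ "slice n X j (nl j) k"])
    also have "(\<Sum>l\<in>UNIV-{j}. \<Sum>i\<in>slice n X j N k. f l (X i $ l)) = 0"
    proof (rule sum.neutral, rule ballI)
      fix l assume l: "l \<in> UNIV - {j}"
      show "(\<Sum>i\<in>slice n X j N k. f l (X i $ l)) = 0"
        unfolding N_def by (rule slice_sum_other_zero[OF bij N, of l])
          (use l k lse in \<open>auto simp: N_def additive_isotonic_lse_def\<close>)
    qed
    finally show ?thesis by simp
  qed
  have Xgrid: "\<exists>k\<in>{1..N}. X i $ j = real k / real N" if "i \<in> {1..n}" for i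
    using UN_slice[OF bij N] that by (auto simp: slice_def N_def)
  have pert: "c * (\<Sum>k=Suc a..N. r k) \<le> 0" if a: "a < N" and c: "c > 0 \<or> F a < F (Suc a)" for a and c :: real
  proof -
    define d where "d i = (if real (Suc a) / real N \<le> X i $ j then c else 0)" for i
    define \<theta>0 where "\<theta>0 = (if c > 0 then 1 else (F (Suc a) - F a) / (\<bar>c\<bar> + 1))"
    have \<theta>0: "\<theta>0 > 0" using c by (auto simp: \<theta>0_def)
    have "(\<Sum>i=1..n. R i * d i) \<le> 0"
    proof (rule first_order_condition[OF _ \<theta>0])
      fix \<theta> :: real assume \<theta>: "0 < \<theta>" "\<theta> \<le> \<theta>0"
      \<comment> \<open>The competitor must be monotone on all of \<open>[0, 1]\<close>.  Rounding down to the grid makes it a step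
        function, so that only its values at grid points matter.\<close>
      define g where "g x = f j (real_of_int \<lfloor>N * x\<rfloor> / N) + (if int (Suc a) \<le> \<lfloor>N * x\<rfloor> then \<theta> * c else 0)" for x :: real
      have jump: "F a \<le> F (Suc a) + \<theta> * c"
      proof (cases "c > 0")
        case True
        have "F a \<le> F (Suc a)" unfolding F_def
          by (rule mono_onD[OF mono]) (use a N_def N0 in \<open>auto simp: field_simps\<close>)
        then show ?thesis using True \<theta> by (smt (verit) mult_pos_pos)
      next
        case False
        have "\<theta> * \<bar>c\<bar> \<le> \<theta>0 * \<bar>c\<bar>" using \<theta> by (intro mult_right_mono) auto
        also have "\<dots> \<le> F (Suc a) - F a" using False c
          by (auto simp: \<theta>0_def field_simps)
        finally show ?thesis using False by simp
      qed
      have gm: "mono_on {0..1} g"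
      proof (rule mono_onI)
        fix x y :: real assume xy: "x \<in> {0..1}" "y \<in> {0..1}" "x \<le> y"
        have fl: "\<lfloor>N * x\<rfloor> \<le> \<lfloor>N * y\<rfloor>" using xy by (intro floor_mono mult_left_mono) auto
        have fl01: "real_of_int \<lfloor>N * z\<rfloor> / N \<in> {0..1}" if "z \<in> {0..1}" for z :: real
        proof -
          have "0 \<le> real N * z" "real N * z \<le> real N" using that N0 mult_left_le[of z "real N"] by auto
          then have "0 \<le> \<lfloor>N * z\<rfloor>" "real_of_int \<lfloor>N * z\<rfloor> \<le> N" by linarith+
          then show ?thesis using N0 by simp
        qed
        have le: "f j (real_of_int \<lfloor>N * x\<rfloor> / N) \<le> f j (real_of_int \<lfloor>N * y\<rfloor> / N)"
          by (rule mono_onD[OF mono]) (use fl01 xy fl N0 in \<open>auto simp: divide_right_mono\<close>)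
        show "g x \<le> g y"
        proof (cases "\<lfloor>N * x\<rfloor> \<le> int a \<and> int (Suc a) \<le> \<lfloor>N * y\<rfloor>")
          case True
          have "f j (real_of_int \<lfloor>N * x\<rfloor> / N) \<le> F a" unfolding F_def N_def[symmetric]
          proof (rule mono_onD[OF mono])
            have "real_of_int \<lfloor>N * x\<rfloor> \<le> real a" using True by linarith
            then show "real_of_int \<lfloor>N * x\<rfloor> / N \<le> real a / N" by (rule divide_right_mono) simp
          qed (use fl01 xy a N0 in auto)
          moreover have "F (Suc a) \<le> f j (real_of_int \<lfloor>N * y\<rfloor> / N)" unfolding F_def N_def[symmetric]
          proof (rule mono_onD[OF mono])
            have "real (Suc a) \<le> real_of_int \<lfloor>N * y\<rfloor>" using True by linarith
            then show "real (Suc a) / N \<le> real_of_int \<lfloor>N * y\<rfloor> / N" by (rule divide_right_mono) simp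
          qed (use fl01 xy a N0 in auto)
          ultimately show ?thesis using True jump by (auto simp: g_def)
        next
          case False
          then show ?thesis using le fl by (auto simp: g_def)
        qed
      qed
      have gX: "g (X i $ j) = f j (X i $ j) + \<theta> * d i" if i: "i \<in> {1..n}" for i
      proof -
        obtain k where k: "k \<in> {1..N}" "X i $ j = real k / real N" using Xgrid[OF i] by auto
        have "N * (X i $ j) = real k" using k N0 by simp
        moreover have "real (Suc a) / N \<le> X i $ j \<longleftrightarrow> Suc a \<le> k"
          using k N0 by (simp add: divide_le_cancel del: of_nat_Suc)
        ultimately show ?thesis using k by (simp add: g_def d_def)
      qed
      have "residual_ss n X Y \<mu> f \<le> residual_ss n X Y \<mu> (f(j := g))"
        by (rule opt) (use gm mono in auto)
      also have "\<dots> = (\<Sum>i=1..n. (R i - \<theta> * d i)\<^sup>2)"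
        unfolding residual_ss_def
      proof (intro sum.cong refl)
        fix i assume i: "i \<in> {1..n}"
        have "(\<Sum>l\<in>UNIV. (f(j := g)) l (X i $ l)) = g (X i $ j) + (\<Sum>l\<in>UNIV-{j}. f l (X i $ l))"
          by (subst sum.remove[of _ j]) auto
        moreover have "(\<Sum>l\<in>UNIV. f l (X i $ l)) = f j (X i $ j) + (\<Sum>l\<in>UNIV-{j}. f l (X i $ l))"
          by (subst sum.remove[of _ j]) auto
        ultimately have "Y i - \<mu> - (\<Sum>l\<in>UNIV. (f(j := g)) l (X i $ l)) = R i - \<theta> * d i"
          using gX[OF i] by (simp add: R_def)
        then show "(Y i - \<mu> - (\<Sum>l\<in>UNIV. (f(j := g)) l (X i $ l)))\<^sup>2 = (R i - \<theta> * d i)\<^sup>2" by simp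
      qed
      finally show "(\<Sum>i=1..n. (R i)\<^sup>2) \<le> (\<Sum>i=1..n. (R i - \<theta> * d i)\<^sup>2)"
        by (simp add: residual_ss_def R_def)
    qed
    also have "(\<Sum>i=1..n. R i * d i) = (\<Sum>k=1..N. \<Sum>i\<in>slice n X j N k. R i * d i)"
      unfolding N_def by (rule sum_slices[OF bij N])
    also have "\<dots> = (\<Sum>k=1..N. if k \<in> {Suc a..N} then c * r k else 0)"
    proof (intro sum.cong refl)
      fix k assume k: "k \<in> {1..N}"
      have "d i = (if k \<in> {Suc a..N} then c else 0)" if "i \<in> slice n X j N k" for i
        using that k N0 by (auto simp: d_def slice_def divide_le_cancel simp del: of_nat_Suc)
      then have "(\<Sum>i\<in>slice n X j N k. R i * d i) = (\<Sum>i\<in>slice n X j N k. (if k \<in> {Suc a..N} then c else 0) * R i)"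
        by (intro sum.cong) auto
      then show "(\<Sum>i\<in>slice n X j N k. R i * d i) = (if k \<in> {Suc a..N} then c * r k else 0)"
        using rowR[OF k] by (auto simp flip: sum_distrib_left)
    qed
    also have "\<dots> = (\<Sum>k=Suc a..N. c * r k)"
      by (subst sum.inter_restrict[symmetric]) (auto intro!: sum.cong)
    finally show ?thesis by (simp add: sum_distrib_left)
  qed
  have tot: "(\<Sum>k=1..N. r k) = (\<Sum>i=1..n. R i)"
    using sum_slices[where X=X and j=j and nl=nl and \<phi>=R, OF bij N] rowR by (auto simp: N_def intro!: sum.cong)
  have mu: "c * (\<Sum>i=1..n. R i) \<le> 0" for c :: real
  proof -
    have "(\<Sum>i=1..n. R i * c) \<le> 0"
    proof (rule first_order_condition[of 1])
      fix \<theta> :: real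
      have "residual_ss n X Y \<mu> f \<le> residual_ss n X Y (\<mu> + \<theta> * c) f" by (rule opt) (use mono in auto)
      also have "\<dots> = (\<Sum>i=1..n. (R i - \<theta> * c)\<^sup>2)"
        unfolding residual_ss_def by (intro sum.cong) (auto simp: R_def algebra_simps)
      finally show "(\<Sum>i=1..n. (R i)\<^sup>2) \<le> (\<Sum>i=1..n. (R i - \<theta> * c)\<^sup>2)"
        by (simp add: residual_ss_def R_def)
    qed simp
    then show ?thesis by (simp add: sum_distrib_left mult.commute)
  qed
  show total: "(\<Sum>k=1..nl j. r k) = 0" using mu[of 1] mu[of "-1"] tot by (simp add: N_def)
  have split: "(\<Sum>k=1..a. r k) = - (\<Sum>k=Suc a..N. r k)" if "a \<le> N" for a
  proof -
    have "(\<Sum>k=1..N. r k) = (\<Sum>k=1..a. r k) + (\<Sum>k=Suc a..N. r k)"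
      using sum.ub_add_nat[of 1 a r "N - a"] that by simp
    then show ?thesis using total by (simp add: N_def)
  qed
  show nn: "(\<Sum>k=1..a. r k) \<ge> 0" if "a \<le> nl j"
  proof (cases "a = nl j")
    case False
    then show ?thesis using pert[of a 1] split[of a] that by (simp add: N_def)
  qed (use total in simp)
  show "(\<Sum>k=1..a. r k) = 0" if "a < nl j" "F a < F (Suc a)"
    using pert[of a "-1"] split[of a] that nn by (simp add: N_def)
qed

text \<open>
  The diagram \<open>C\<close> is the cumulative sum of the fit, which is convex, plus the cumulative
  residual, which is nonnegative and vanishes at both ends of the level set of the fit that contains
  \<open>k0\<close>.  So the segment over that level set lies on the graph of \<open>C\<close> and
  supports it.  The cardinality of the level set is recorded since it shows that the block size is a
  measurable function of the data.
\<close>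

lemma lse_block_chord:
  fixes nl :: "'d::finite \<Rightarrow> nat"
  assumes bij: "bij_betw X {1..n} (lattice nl)" and N: "nl j > 0" and k0: "k0 \<in> {1..nl j}"
    and lse: "additive_isotonic_lse n X Y \<mu> f" and K: "nl j * K = n" "K > 0"
  defines "F \<equiv> \<lambda>k. f j (real k / real (nl j))"
  defines "C \<equiv> \<lambda>a. \<Sum>k=1..a. (\<Sum>i\<in>slice n X j (nl j) k. Y i) / real K - \<mu>"
  shows "\<exists>a b. a < k0 \<and> k0 \<le> b \<and> b \<le> nl j \<and>
    block_size n X j (grid (nl j)) (f j) (real k0 / real (nl j)) = K * (b - a) \<and>
    b - a = card {k\<in>{1..nl j}. F k = F k0} \<and>
    (\<forall>k\<le>nl j. C k \<ge> C a + F k0 * (real k - real a)) \<and>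
    C b = C a + F k0 * (real b - real a)"
proof -
  define N where "N = nl j"
  have N0: "N > 0" using assms by (simp add: N_def)
  have mono: "mono_on {0..1} (f j)" using lse by (simp add: additive_isotonic_lse_def)
  have Fm: "F k \<le> F k'" if "k \<le> k'" "k' \<le> N" for k k'
    unfolding F_def by (rule mono_onD[OF mono]) (use that N0 in \<open>auto simp: N_def divide_right_mono\<close>)
  have cr: "card (slice n X j N k) = K" if "k \<in> {1..N}" for k
    using card_slice[OF bij N, of k] that K N0 unfolding N_def by (metis nat_mult_eq_cancel1)

  \<comment> \<open>By monotonicity the level set is an interval of indices; as \<open>a\<close> may be \<open>0\<close>, it is described by
    \<open>Suc a \<le> k \<and> k \<le> b\<close>.\<close>
  define S where "S = {k\<in>{1..N}. F k = F k0}"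
  have S: "finite S" "k0 \<in> S" using k0 by (auto simp: S_def N_def)
  define a where "a = Min S - 1"
  define b where "b = Max S"
  have MinS: "Min S \<in> S" "Max S \<in> S" using S by (auto intro!: Min_in Max_in)
  have Sa: "Min S = Suc a" using MinS by (auto simp: a_def S_def)
  have ak: "a < k0" using S Sa by (metis Min_le Suc_le_eq)
  have kb: "k0 \<le> b" using S by (simp add: b_def)
  have bN: "b \<le> N" using MinS by (simp add: b_def S_def)
  have inS: "k \<in> S \<longleftrightarrow> Suc a \<le> k \<and> k \<le> b" for k
  proof
    assume "Suc a \<le> k \<and> k \<le> b"
    then have k: "Min S \<le> k" "k \<le> Max S" using Sa by (auto simp: b_def)
    have "F (Min S) \<le> F k" "F k \<le> F (Max S)" using k MinS bN by (auto intro!: Fm simp: b_def)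
    then show "k \<in> S" using MinS k by (auto simp: S_def)
  qed (use S Sa in \<open>auto simp: b_def Suc_le_eq simp flip: Sa\<close>)
  have grid: "grid N = (\<lambda>k. real k / real N) ` {1..N}" by (simp add: grid_def)
  have ci: "const_interval (grid N) (f j) (real k0 / real N) (real v / real N) (real u / real N) \<longleftrightarrow>
      v \<in> S \<and> u \<in> S \<and> v \<le> k0 \<and> k0 \<le> u" if "v \<in> {1..N}" "u \<in> {1..N}" for u v
  proof -
    have "f j constant_on (grid N \<inter> {real v / real N..real u / real N}) \<longleftrightarrow> F v = F k0 \<and> F u = F k0"
      if vu: "v \<le> k0" "k0 \<le> u"
    proof
      assume "f j constant_on (grid N \<inter> {real v / real N..real u / real N})"
      then obtain y where y: "\<And>x. x \<in> grid N \<inter> {real v / real N..real u / real N} \<Longrightarrow> f j x = y"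
        by (auto simp: constant_on_def)
      have "F k = y" if "k \<in> {v..u}" for k
        unfolding F_def N_def[symmetric] by (rule y)
          (use that \<open>v \<in> _\<close> \<open>u \<in> _\<close> in \<open>auto simp: grid divide_right_mono\<close>)
      then show "F v = F k0 \<and> F u = F k0" using vu by simp
    next
      assume F: "F v = F k0 \<and> F u = F k0"
      have "f j x = F k0" if x: "x \<in> grid N \<inter> {real v / real N..real u / real N}" for x
      proof -
        obtain k where k: "k \<in> {1..N}" "x = real k / real N" using x by (auto simp: grid)
        then have "v \<le> k" "k \<le> u" using x N0 by (auto simp: divide_le_cancel)
        then have "F v \<le> F k" "F k \<le> F u" using \<open>u \<in> _\<close> by (auto intro!: Fm)
        then show ?thesis using F k by (simp add: F_def N_def)
      qed
      then show "f j constant_on (grid N \<inter> {real v / real N..real u / real N})"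
        by (auto simp: constant_on_def)
    qed
    then show ?thesis using that N0 by (auto simp: const_interval_def grid S_def divide_le_cancel)
  qed
  have ci': "\<exists>v'\<in>{1..N}. \<exists>u'\<in>{1..N}. v = real v' / real N \<and> u = real u' / real N"
    if "const_interval (grid N) (f j) (real k0 / real N) v u" for v u
    using that by (auto simp: const_interval_def grid)
  have sub: "S \<subseteq> {1..N}" by (auto simp: S_def)
  have low: "block_lower (grid N) (f j) (real k0 / real N) = real (Suc a) / real N"
    unfolding block_lower_def
  proof (rule Min_eqI)
    have "{v. \<exists>u. const_interval (grid N) (f j) (real k0 / real N) v u} \<subseteq> grid N"
      by (auto simp: const_interval_def)
    then show "finite {v. \<exists>u. const_interval (grid N) (f j) (real k0 / real N) v u}"
      by (rule finite_subset) (simp add: grid)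
    have "const_interval (grid N) (f j) (real k0 / real N) (real (Suc a) / real N) (real k0 / real N)"
      using ci[of "Suc a" k0] ak kb bN inS S(2) k0 by (simp add: N_def)
    then show "real (Suc a) / real N \<in> {v. \<exists>u. const_interval (grid N) (f j) (real k0 / real N) v u}" by blast
    fix v assume "v \<in> {v. \<exists>u. const_interval (grid N) (f j) (real k0 / real N) v u}"
    then obtain u where u: "const_interval (grid N) (f j) (real k0 / real N) v u" by blast
    with ci' obtain v' u' where vu: "v' \<in> {1..N}" "u' \<in> {1..N}" "v = real v' / real N" "u = real u' / real N" by metis
    then have "v' \<in> S" using ci[OF vu(1,2)] u by simp
    then have "Suc a \<le> v'" using inS by simp
    then show "real (Suc a) / real N \<le> v" unfolding vu by (intro divide_right_mono) auto
  qed
  have upp: "block_upper (grid N) (f j) (real k0 / real N) = real b / real N"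
    unfolding block_upper_def
  proof (rule Max_eqI)
    have "{u. \<exists>v. const_interval (grid N) (f j) (real k0 / real N) v u} \<subseteq> grid N"
      by (auto simp: const_interval_def)
    then show "finite {u. \<exists>v. const_interval (grid N) (f j) (real k0 / real N) v u}"
      by (rule finite_subset) (simp add: grid)
    have "const_interval (grid N) (f j) (real k0 / real N) (real k0 / real N) (real b / real N)"
      using ci[of k0 b] ak kb bN inS S(2) k0 by (simp add: N_def)
    then show "real b / real N \<in> {u. \<exists>v. const_interval (grid N) (f j) (real k0 / real N) v u}" by blast
    fix u assume "u \<in> {u. \<exists>v. const_interval (grid N) (f j) (real k0 / real N) v u}"
    then obtain v where u: "const_interval (grid N) (f j) (real k0 / real N) v u" by blast
    with ci' obtain v' u' where vu: "v' \<in> {1..N}" "u' \<in> {1..N}" "v = real v' / real N" "u = real u' / real N" by metis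
    then have "u' \<in> S" using ci[OF vu(1,2)] u by simp
    then have "u' \<le> b" using inS by simp
    then show "u \<le> real b / real N" unfolding vu by (intro divide_right_mono) auto
  qed
  have size: "block_size n X j (grid N) (f j) (real k0 / real N) = K * (b - a)"
  proof -
    have "{i\<in>{1..n}. X i $ j \<in> {real (Suc a) / real N..real b / real N}} = (\<Union>k\<in>{Suc a..b}. slice n X j N k)"
    proof -
      have "X i $ j \<in> {real (Suc a) / real N..real b / real N} \<longleftrightarrow> i \<in> (\<Union>k\<in>{Suc a..b}. slice n X j N k)"
        if "i \<in> {1..n}" for i
      proof -
        have "i \<in> (\<Union>k\<in>{1..N}. slice n X j N k)" using UN_slice[OF bij N] that unfolding N_def by blast
        then obtain k where "k \<in> {1..N}" "i \<in> slice n X j N k" by blast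
        then have k: "X i $ j = real k / real N" by (simp add: slice_def)
        then show ?thesis using that N0 by (auto simp: slice_def divide_le_cancel simp del: of_nat_Suc)
      qed
      moreover have "slice n X j N k \<subseteq> {1..n}" for k by (auto simp: slice_def)
      ultimately show ?thesis by blast
    qed
    then have "block_size n X j (grid N) (f j) (real k0 / real N) = card (\<Union>k\<in>{Suc a..b}. slice n X j N k)"
      unfolding block_size_def low upp by simp
    also have "\<dots> = (\<Sum>k=Suc a..b. card (slice n X j N k))"
      by (rule card_UN_disjoint) (simp_all add: slice_disjoint N0)
    also have "\<dots> = (\<Sum>k=Suc a..b. K)" using bN by (intro sum.cong) (auto simp: cr)
    finally show ?thesis by simp
  qed
  define r where "r k = (\<Sum>i\<in>slice n X j N k. Y i - \<mu> - F k)" for k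
  \<comment> \<open>Cumulative residuals: the vertical distance between the diagram and the cumulative fit, times
    \<open>K\<close>.\<close>
  define G where "G a = (\<Sum>k=1..a. r k)" for a
  have GN: "G N = 0" "\<And>a. a \<le> N \<Longrightarrow> G a \<ge> 0" "\<And>a. a < N \<Longrightarrow> F a < F (Suc a) \<Longrightarrow> G a = 0"
    using lse_residual_sums[OF bij N lse] unfolding G_def r_def F_def N_def by auto
  have C: "C a = (\<Sum>k=1..a. F k) + G a / K" if "a \<le> N" for a
  proof -
    have "C a = (\<Sum>k=1..a. F k + r k / K)" unfolding C_def N_def[symmetric]
    proof (intro sum.cong refl)
      fix k assume "k \<in> {1..a}"
      then have "card (slice n X j N k) = K" using that by (intro cr) auto
      then have "r k = (\<Sum>i\<in>slice n X j N k. Y i) - K * \<mu> - K * F k"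
        by (simp add: r_def sum_subtractf)
      then show "(\<Sum>i\<in>slice n X j N k. Y i) / K - \<mu> = F k + r k / K" using K by (simp add: field_simps)
    qed
    then show ?thesis by (simp add: sum.distrib G_def sum_divide_distrib)
  qed
  have Ga: "G a = 0"
  proof (cases "a = 0")
    case False
    have "a \<notin> S" using inS by simp
    then have "F a \<noteq> F k0" using False ak k0 by (auto simp: S_def N_def)
    moreover have "F (Suc a) = F k0" using inS[of "Suc a"] ak kb by (auto simp: S_def)
    moreover have "F a \<le> F (Suc a)" using ak kb bN by (intro Fm) auto
    ultimately show ?thesis using ak kb bN by (intro GN(3)) auto
  qed (simp add: G_def)
  have Gb: "G b = 0"
  proof (cases "b = N")
    case False
    have "Suc b \<notin> S" using inS by simp
    then have "F (Suc b) \<noteq> F k0" using False bN by (auto simp: S_def N_def)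
    moreover have "F b = F k0" using inS[of "b"] ak kb by (auto simp: S_def)
    moreover have "F b \<le> F (Suc b)" using False bN by (intro Fm) auto
    ultimately show ?thesis using False bN by (intro GN(3)) auto
  qed (simp add: GN)
  have conv: "(\<Sum>k=1..k. F k) - (\<Sum>k=1..a. F k) \<ge> F k0 * (real k - real a)" if k: "k \<le> N" for k
  proof (cases "a \<le> k")
    case True
    have "(\<Sum>k=1..k. F k) = (\<Sum>k=1..a. F k) + (\<Sum>i=Suc a..k. F i)"
      using True sum.ub_add_nat[of 1 a F "k - a"] by simp
    moreover have "(\<Sum>i=Suc a..k. F i) \<ge> (\<Sum>i=Suc a..k. F k0)"
    proof (rule sum_mono)
      fix i assume i: "i \<in> {Suc a..k}"
      have "F (Suc a) = F k0" using inS[of "Suc a"] ak kb by (auto simp: S_def)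
      moreover have "F (Suc a) \<le> F i" using i k by (intro Fm) auto
      ultimately show "F k0 \<le> F i" by simp
    qed
    ultimately show ?thesis using True by (simp add: of_nat_diff mult.commute)
  next
    case False
    have "(\<Sum>k=1..a. F k) = (\<Sum>k=1..k. F k) + (\<Sum>i=Suc k..a. F i)"
      using False sum.ub_add_nat[of 1 k F "a - k"] by simp
    moreover have "(\<Sum>i=Suc k..a. F i) \<le> (\<Sum>i=Suc k..a. F k0)"
    proof (rule sum_mono)
      fix i assume i: "i \<in> {Suc k..a}"
      show "F i \<le> F k0" using i ak k0 by (intro Fm) (auto simp: N_def)
    qed
    ultimately show ?thesis using False by (simp add: of_nat_diff algebra_simps)
  qed
  have eqb: "(\<Sum>k=1..b. F k) - (\<Sum>k=1..a. F k) = F k0 * (real b - real a)"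
  proof -
    have "(\<Sum>k=1..b. F k) = (\<Sum>k=1..a. F k) + (\<Sum>i=Suc a..b. F i)"
      using ak kb sum.ub_add_nat[of 1 a F "b - a"] by simp
    moreover have "(\<Sum>i=Suc a..b. F i) = (\<Sum>i=Suc a..b. F k0)"
      by (intro sum.cong) (use inS in \<open>auto simp: S_def\<close>)
    ultimately show ?thesis using ak kb by (simp add: of_nat_diff mult.commute)
  qed
  show ?thesis
  proof (rule exI[of _ a], rule exI[of _ b], intro conjI allI impI ak kb)
    show "b \<le> nl j" using bN by (simp add: N_def)
    show "block_size n X j (grid (nl j)) (f j) (real k0 / real (nl j)) = K * (b - a)"
      using size by (simp add: N_def)
    have "{k\<in>{1..nl j}. F k = F k0} = S" by (simp add: S_def N_def)
    also have "S = {Suc a..b}" using inS by (intro set_eqI) (simp only: atLeastAtMost_iff)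
    finally have "{k\<in>{1..nl j}. F k = F k0} = {Suc a..b}" .
    then show "b - a = card {k\<in>{1..nl j}. F k = F k0}" by simp
    show "C k \<ge> C a + F k0 * (real k - real a)" if "k \<le> nl j" for k
    proof -
      have "a \<le> N" using ak kb bN by simp
      moreover have "G k / K \<ge> 0" using GN(2) that by (simp add: N_def)
      ultimately show ?thesis using conv[of k] that C[of k] C[of a] Ga by (simp add: N_def)
    qed
    show "C b = C a + F k0 * (real b - real a)"
      using eqb C[of a] C[of b] Ga Gb ak kb bN by simp
  qed
qed

text \<open>
  The max-min formula for the slope of the supporting chord exhibits the fit as a measurable function
  of the data, although the estimator is only given as some minimiser at every sample point.
\<close>

lemma lse_maxmin:
  fixes nl :: "'d::finite \<Rightarrow> nat"
  assumes bij: "bij_betw X {1..n} (lattice nl)" and N: "nl j > 0" and k: "k \<in> {1..nl j}"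
    and lse: "additive_isotonic_lse n X Y \<mu> f" and K: "nl j * K = n" "K > 0"
  defines "C \<equiv> \<lambda>a. \<Sum>k=1..a. (\<Sum>i\<in>slice n X j (nl j) k. Y i) / real K - \<mu>"
  shows "f j (real k / real (nl j)) = Max ((\<lambda>a. Min ((\<lambda>b. (C b - C a) / (real b - real a)) ` {k..nl j})) ` {..<k})"
proof -
  define F where "F = f j (real k / real (nl j))"
  obtain a b where ab: "a < k" "k \<le> b" "b \<le> nl j"
    "\<And>i. i \<le> nl j \<Longrightarrow> C i \<ge> C a + F * (real i - real a)" "C b = C a + F * (real b - real a)"
    using lse_block_chord[OF bij N k lse K] unfolding C_def F_def by blast
  define h where "h a = Min ((\<lambda>b. (C b - C a) / (real b - real a)) ` {k..nl j})" for a
  have "Max (h ` {..<k}) = F"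
  proof (rule Max_eqI)
    show "finite (h ` {..<k})" by simp
    show "y \<le> F" if y: "y \<in> h ` {..<k}" for y
    proof -
      obtain a' where a': "a' < k" "y = h a'" using y by auto
      have "h a' \<le> (C b - C a') / (real b - real a')" unfolding h_def using ab(2,3) by (intro Min_le) auto
      also have "\<dots> \<le> F"
      proof -
        have "C a' \<ge> C a + F * (real a' - real a)" using ab k a' by simp
        then have "C b - C a' \<le> F * (real b - real a')" using ab(5) by (simp add: algebra_simps)
        then show ?thesis using a' ab by (simp add: pos_divide_le_eq)
      qed
      finally show ?thesis using a' by simp
    qed
    have "h a = F" unfolding h_def
    proof (rule Min_eqI)
      show "F \<le> y" if y: "y \<in> (\<lambda>b. (C b - C a) / (real b - real a)) ` {k..nl j}" for y
      proof -
        obtain b' where b': "k \<le> b'" "b' \<le> nl j" "y = (C b' - C a) / (real b' - real a)" using y by auto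
        have "C b' - C a \<ge> F * (real b' - real a)" using ab(4)[OF b'(2)] by simp
        then show ?thesis using b' ab by (simp add: pos_le_divide_eq)
      qed
      have "F = (C b - C a) / (real b - real a)" using ab(1,2,5) by simp
      then show "F \<in> (\<lambda>b. (C b - C a) / (real b - real a)) ` {k..nl j}"
        by (rule image_eqI) (use ab(2,3) in simp)
    qed simp
    then show "F \<in> h ` {..<k}" using ab(1) by (metis imageI lessThan_iff)
  qed
  then show ?thesis by (simp add: F_def h_def)
qed

lemma lse_mean:
  fixes nl :: "'d::finite \<Rightarrow> nat"
  assumes bij: "bij_betw X {1..n} (lattice nl)" and N: "nl j > 0"
    and lse: "additive_isotonic_lse n X Y \<mu> f"
  shows "(\<Sum>i=1..n. Y i) = real n * \<mu>"
proof -
  have "0 = (\<Sum>k=1..nl j. \<Sum>i\<in>slice n X j (nl j) k. Y i - \<mu> - f j (real k / real (nl j)))"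
    using lse_residual_sums(1)[OF bij N lse] by simp
  also have "\<dots> = (\<Sum>k=1..nl j. \<Sum>i\<in>slice n X j (nl j) k. Y i - \<mu> - f j (X i $ j))"
    by (intro sum.cong refl) (simp add: slice_def)
  also have "\<dots> = (\<Sum>i=1..n. Y i - \<mu> - f j (X i $ j))" by (rule sum_slices[OF bij N, symmetric])
  also have "\<dots> = (\<Sum>i=1..n. Y i) - real n * \<mu> - (\<Sum>i=1..n. f j (X i $ j))" by (simp add: sum_subtractf)
  also have "(\<Sum>i=1..n. f j (X i $ j)) = 0" using lse by (simp add: additive_isotonic_lse_def)
  finally show ?thesis by simp
qed

lemma centered_sum_zero:
  fixes nl :: "'d::finite \<Rightarrow> nat" and n :: nat
  assumes bij: "bij_betw X {1..n} (lattice nl)" and N: "nl l > 0"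
  shows "(\<Sum>i=1..n. centered (nl l) g (X i $ l)) = 0"
proof -
  define N where "N = nl l"
  have N0: "N > 0" using assms by (simp add: N_def)
  have one: "1 \<in> {1..nl l}" using assms by simp
  define K where "K = card (slice n X l (nl l) 1)"
  have cK: "card (slice n X l N k) = K" if "k \<in> {1..N}" for k
    using card_slice[OF bij N, of k] card_slice[OF bij N one] that N0 unfolding K_def N_def by (metis nat_mult_eq_cancel1)
  have "(\<Sum>i=1..n. centered N g (X i $ l)) = (\<Sum>k=1..N. \<Sum>i\<in>slice n X l N k. centered N g (X i $ l))"
    unfolding N_def by (rule sum_slices[OF bij N])
  also have "\<dots> = (\<Sum>k=1..N. real K * centered N g (real k / real N))"
  proof (intro sum.cong refl)
    fix k assume k: "k \<in> {1..N}"
    have "(\<Sum>i\<in>slice n X l N k. centered N g (X i $ l)) = (\<Sum>i\<in>slice n X l N k. centered N g (real k / real N))"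
      by (intro sum.cong) (auto simp: slice_def)
    then show "(\<Sum>i\<in>slice n X l N k. centered N g (X i $ l)) = real K * centered N g (real k / real N)" using cK[OF k] by simp
  qed
  also have "\<dots> = real K * ((\<Sum>k=1..N. g (real k / real N)) - real N * ((\<Sum>k=1..N. g (real k / real N)) / real N))"
    by (simp add: sum_distrib_left[symmetric] centered_def sum_subtractf)
  also have "\<dots> = 0" using N0 by simp
  finally show ?thesis by (simp add: N_def)
qed

section \<open>Properties that hold off a small set\<close>

text \<open>
  The property \<open>Q\<close> itself need not be measurable; it only has to hold off a small
  measurable set. This suits properties that quantify over all times, slopes or finite diagrams.
\<close>

definition holds_except :: "'a measure \<Rightarrow> real \<Rightarrow> ('a \<Rightarrow> bool) \<Rightarrow> bool" where
  "holds_except M p Q \<longleftrightarrow> (\<exists>B\<in>sets M. measure M B \<le> p \<and> (\<forall>\<omega>\<in>space M - B. Q \<omega>))"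

lemma holds_exceptI:
  "B \<in> sets M \<Longrightarrow> measure M B \<le> p \<Longrightarrow> (\<And>\<omega>. \<omega> \<in> space M \<Longrightarrow> \<omega> \<notin> B \<Longrightarrow> Q \<omega>) \<Longrightarrow> holds_except M p Q"
  by (auto simp: holds_except_def)

lemma holds_exceptE:
  assumes "holds_except M p Q"
  obtains B where "B \<in> sets M" "measure M B \<le> p" "\<And>\<omega>. \<omega> \<in> space M \<Longrightarrow> \<omega> \<notin> B \<Longrightarrow> Q \<omega>"
  using assms by (auto simp: holds_except_def)

lemma holds_except_mono:
  assumes "holds_except M p Q" "p \<le> p'" "\<And>\<omega>. \<omega> \<in> space M \<Longrightarrow> Q \<omega> \<Longrightarrow> Q' \<omega>"
  shows "holds_except M p' Q'"
proof -
  from assms(1) obtain B where "B \<in> sets M" "measure M B \<le> p" "\<And>\<omega>. \<omega> \<in> space M \<Longrightarrow> \<omega> \<notin> B \<Longrightarrow> Q \<omega>"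
    by (metis holds_exceptE)
  with assms(2,3) show ?thesis by (intro holds_exceptI[of B]) auto
qed

lemma (in finite_measure) holds_except_conj:
  assumes "holds_except M p Q" "holds_except M p' Q'"
  shows "holds_except M (p + p') (\<lambda>\<omega>. Q \<omega> \<and> Q' \<omega>)"
proof -
  from assms obtain A B where "A \<in> sets M" "measure M A \<le> p" "\<And>\<omega>. \<omega> \<in> space M \<Longrightarrow> \<omega> \<notin> A \<Longrightarrow> Q \<omega>"
    "B \<in> sets M" "measure M B \<le> p'" "\<And>\<omega>. \<omega> \<in> space M \<Longrightarrow> \<omega> \<notin> B \<Longrightarrow> Q' \<omega>"
    by (metis holds_exceptE)
  then show ?thesis
    using measure_Un_le[of A M B] by (intro holds_exceptI[of "A \<union> B"]) auto
qed

lemma (in finite_measure) holds_except_ball: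
  assumes "finite I" "\<And>i. i \<in> I \<Longrightarrow> holds_except M (p i) (Q i)"
  shows "holds_except M (\<Sum>i\<in>I. p i) (\<lambda>\<omega>. \<forall>i\<in>I. Q i \<omega>)"
  using assms
proof (induction I)
  case empty
  then show ?case by (intro holds_exceptI[of "{}"]) auto
next
  case (insert i I)
  then have "holds_except M (p i + (\<Sum>i\<in>I. p i)) (\<lambda>\<omega>. Q i \<omega> \<and> (\<forall>i\<in>I. Q i \<omega>))"
    by (intro holds_except_conj) auto
  then show ?case using insert by simp
qed

lemma (in finite_measure) holds_except_all:
  fixes p :: "nat \<Rightarrow> real"
  assumes "summable p" "\<And>i. holds_except M (p i) (Q i)"
  shows "holds_except M (\<Sum>i. p i) (\<lambda>\<omega>. \<forall>i. Q i \<omega>)"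
proof -
  from assms(2) obtain B where B: "\<And>i. B i \<in> sets M" "\<And>i. measure M (B i) \<le> p i"
    "\<And>i \<omega>. \<omega> \<in> space M \<Longrightarrow> \<omega> \<notin> B i \<Longrightarrow> Q i \<omega>"
    unfolding holds_except_def by (metis DiffI)
  have s: "summable (\<lambda>i. measure M (B i))"
    by (rule summable_comparison_test'[OF assms(1), of 0]) (use B(2) in auto)
  have "measure M (\<Union>i. B i) \<le> (\<Sum>i. measure M (B i))"
    by (rule finite_measure_subadditive_countably) (use B s in auto)
  also have "\<dots> \<le> (\<Sum>i. p i)" by (intro suminf_le B s assms)
  finally show ?thesis using B by (intro holds_exceptI[of "\<Union>i. B i"]) auto
qed

lemma holds_except_AE:
  assumes "AE \<omega> in M. Q \<omega>" shows "holds_except M 0 Q"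
proof -
  from AE_E[OF assms] obtain N where "{\<omega>\<in>space M. \<not> Q \<omega>} \<subseteq> N" "emeasure M N = 0" "N \<in> sets M" by metis
  then show ?thesis by (intro holds_exceptI[of N]) (auto simp: measure_def)
qed

text \<open>
  Used to pass from finite dyadic grids to all dyadic times at no cost in probability.
\<close>

lemma (in finite_measure) holds_except_incseq:
  assumes meas: "\<And>q::nat. {\<omega>\<in>space M. Q q \<omega>} \<in> sets M"
    and dec: "\<And>q \<omega>. \<omega> \<in> space M \<Longrightarrow> Q (Suc q) \<omega> \<Longrightarrow> Q q \<omega>"
    and p: "\<And>q. measure M {\<omega>\<in>space M. \<not> Q q \<omega>} \<le> p"
  shows "holds_except M p (\<lambda>\<omega>. \<forall>q. Q q \<omega>)"
proof (rule holds_exceptI)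
  define B where "B q = {\<omega>\<in>space M. \<not> Q q \<omega>}" for q
  have B: "B q \<in> sets M" for q
  proof -
    have "B q = space M - {\<omega>\<in>space M. Q q \<omega>}" by (auto simp: B_def)
    then show ?thesis using meas by auto
  qed
  show "(\<Union>q. B q) \<in> sets M" using B by auto
  have "incseq B" by (rule incseq_SucI) (use dec in \<open>auto simp: B_def\<close>)
  then have "(\<lambda>q. measure M (B q)) \<longlonglongrightarrow> measure M (\<Union>q. B q)"
    by (intro finite_Lim_measure_incseq) (use B in auto)
  then show "measure M (\<Union>q. B q) \<le> p"
    by (rule LIMSEQ_le_const2) (use p in \<open>auto simp: B_def\<close>)
qed auto

lemma (in finite_measure) holds_except_eventually:
  assumes meas: "\<And>r::nat. {\<omega>\<in>space M. Q r \<omega>} \<in> sets M"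
    and inc: "\<And>r \<omega>. \<omega> \<in> space M \<Longrightarrow> Q r \<omega> \<Longrightarrow> Q (Suc r) \<omega>"
    and ae: "AE \<omega> in M. \<exists>r. Q r \<omega>" and p: "p > 0"
  shows "\<exists>r0. \<forall>r\<ge>r0. holds_except M p (Q r)"
proof -
  define B where "B q = {\<omega>\<in>space M. \<not> Q q \<omega>}" for q
  have B: "B q \<in> sets M" for q
  proof -
    have "B q = space M - {\<omega>\<in>space M. Q q \<omega>}" by (auto simp: B_def)
    then show ?thesis using meas by auto
  qed
  have "decseq B" by (rule decseq_SucI) (use inc in \<open>auto simp: B_def\<close>)
  then have "(\<lambda>q. measure M (B q)) \<longlonglongrightarrow> measure M (\<Inter>q. B q)"
    by (intro finite_Lim_measure_decseq) (use B in auto)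
  also have "measure M (\<Inter>q. B q) = 0"
  proof -
    have "AE \<omega> in M. \<omega> \<notin> (\<Inter>q. B q)" using ae by eventually_elim (auto simp: B_def)
    then have "(\<Inter>q. B q) \<in> null_sets M" using B by (subst AE_iff_null_sets) auto
    then show ?thesis by (simp add: measure_def null_setsD1)
  qed
  finally have "eventually (\<lambda>q. measure M (B q) < p) sequentially" using p by (rule order_tendstoD)
  then obtain r0 where "\<And>r. r \<ge> r0 \<Longrightarrow> measure M (B r) < p" by (auto simp: eventually_sequentially)
  then show ?thesis
    by (intro exI[of _ r0] allI impI holds_exceptI[of "B _"]) (use B in \<open>auto simp: B_def less_imp_le\<close>)
qed

section \<open>Maximal inequalities\<close>

lemma (in prob_space) indep_vars_prob_split:
  assumes "indep_vars (\<lambda>_. borel) X I" "J \<inter> K = {}" "J \<subseteq> I" "K \<subseteq> I"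
    and [measurable]: "Measurable.pred (PiM J (\<lambda>_. borel)) P" "Measurable.pred (PiM K (\<lambda>_. borel)) Q"
  shows "prob {\<omega>\<in>space M. P (restrict (\<lambda>i. X i \<omega>) J) \<and> Q (restrict (\<lambda>i. X i \<omega>) K)} =
    prob {\<omega>\<in>space M. P (restrict (\<lambda>i. X i \<omega>) J)} * prob {\<omega>\<in>space M. Q (restrict (\<lambda>i. X i \<omega>) K)}"
proof -
  have X: "random_variable borel (X i)" if "i \<in> I" for i
    using assms(1) that by (auto simp: indep_vars_def)
  have sp: "restrict (\<lambda>i. X i \<omega>) L \<in> space (PiM L (\<lambda>_. borel))" for L :: "'b set" and \<omega>
    by (auto simp: space_PiM)
  note iv = indep_varD[OF indep_var_restrict[OF assms(1-4)],
      of "{x\<in>space (PiM J (\<lambda>_. borel)). P x}" "{x\<in>space (PiM K (\<lambda>_. borel)). Q x}"]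
  have "prob ((\<lambda>x. (\<lambda>i\<in>J. X i x, \<lambda>i\<in>K. X i x)) -` ({x \<in> space (Pi\<^sub>M J (\<lambda>_. borel)). P x} \<times> {x \<in> space (Pi\<^sub>M K (\<lambda>_. borel)). Q x}) \<inter> space M) =
    prob ((\<lambda>\<omega>. \<lambda>i\<in>J. X i \<omega>) -` {x \<in> space (Pi\<^sub>M J (\<lambda>_. borel)). P x} \<inter> space M) *
    prob ((\<lambda>\<omega>. \<lambda>i\<in>K. X i \<omega>) -` {x \<in> space (Pi\<^sub>M K (\<lambda>_. borel)). Q x} \<inter> space M)"
    by (rule iv) measurable
  then show ?thesis using sp[of _ J] sp[of _ K]
    by (simp add: vimage_def Int_def conj_commute conj_left_commute)
qed

text \<open>
  Stop at the first index at which the partial sum exceeds \<open>2 * a\<close>.  The later increments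
  are independent of this event and with probability at least one half move the sum by at most
  \<open>a\<close>, so that the total sum still exceeds \<open>a\<close>.
\<close>

lemma (in prob_space) ottaviani:
  fixes X :: "nat \<Rightarrow> 'a \<Rightarrow> real"
  assumes indep: "indep_vars (\<lambda>_. borel) X {..<n}" and a: "a > 0"
    and tail: "\<And>j. j \<le> n \<Longrightarrow> prob {\<omega>\<in>space M. \<bar>\<Sum>i\<in>{j..<n}. X i \<omega>\<bar> > a} \<le> 1/2"
  shows "prob {\<omega>\<in>space M. \<exists>j\<le>n. \<bar>\<Sum>i<j. X i \<omega>\<bar> > 2 * a} \<le> 2 * prob {\<omega>\<in>space M. \<bar>\<Sum>i<n. X i \<omega>\<bar> > a}"
proof -
  have [measurable]: "random_variable borel (X i)" if "i < n" for i
    using indep that by (auto simp: indep_vars_def)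
  define S where "S j \<omega> = (\<Sum>i<j. X i \<omega>)" for j \<omega>
  have Sm: "random_variable borel (S j)" if "j \<le> n" for j
    unfolding S_def using that by (intro borel_measurable_sum) auto
  define A where "A j = {\<omega>\<in>space M. \<bar>S j \<omega>\<bar> > 2 * a \<and> (\<forall>i\<in>{..<j}. \<bar>S i \<omega>\<bar> \<le> 2 * a)}" for j
  define B where "B j = {\<omega>\<in>space M. \<bar>\<Sum>i\<in>{j..<n}. X i \<omega>\<bar> \<le> a}" for j
  define E where "E = {\<omega>\<in>space M. \<bar>S n \<omega>\<bar> > a}"
  have Am: "A j \<in> events" if "j \<le> n" for j
  proof -
    have E: "{\<omega>\<in>space M. \<bar>S i \<omega>\<bar> > 2 * a} \<in> events" if "i \<le> n" for i
    proof -
      have [measurable]: "random_variable borel (S i)" using Sm that .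
      show ?thesis by measurable
    qed
    have "A j = {\<omega>\<in>space M. \<bar>S j \<omega>\<bar> > 2 * a} - (\<Union>i<j. {\<omega>\<in>space M. \<bar>S i \<omega>\<bar> > 2 * a})"
      by (force simp: A_def)
    also have "\<dots> \<in> events" using that E by (intro sets.Diff sets.finite_UN) auto
    finally show ?thesis .
  qed
  have Bm: "B j \<in> events" for j
    unfolding B_def by measurable
  have Em: "E \<in> events"
  proof -
    have [measurable]: "random_variable borel (S n)" by (rule Sm) simp
    show ?thesis unfolding E_def by measurable
  qed
  have AB: "prob (A j \<inter> B j) = prob (A j) * prob (B j)" if j: "j \<le> n" for j
  proof -
    define P where "P x \<longleftrightarrow> \<bar>\<Sum>i<j. x i\<bar> > 2 * a \<and> (\<forall>i\<in>{..<j}. \<bar>\<Sum>l<i. x l\<bar> \<le> 2 * a)" for x :: "nat \<Rightarrow> real"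
    define Q where "Q x \<longleftrightarrow> \<bar>\<Sum>i\<in>{j..<n}. x i\<bar> \<le> a" for x :: "nat \<Rightarrow> real"
    have m1: "(\<lambda>x. \<Sum>l<i. x l) \<in> borel_measurable (PiM {..<j} (\<lambda>_. borel :: real measure))" if "i \<le> j" for i
      using that by (intro borel_measurable_sum measurable_component_singleton) auto
    have [measurable]: "Measurable.pred (PiM {..<j} (\<lambda>_. borel)) P"
    proof -
      have "Measurable.pred (PiM {..<j} (\<lambda>_. borel)) (\<lambda>x. \<bar>\<Sum>l<i. x l\<bar> \<le> 2 * a)"
        "Measurable.pred (PiM {..<j} (\<lambda>_. borel)) (\<lambda>x. \<bar>\<Sum>l<i. x l\<bar> > 2 * a)" if "i \<le> j" for i
      proof -
        note [measurable] = m1[OF that]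
        show "Measurable.pred (PiM {..<j} (\<lambda>_. borel)) (\<lambda>x. \<bar>\<Sum>l<i. x l\<bar> \<le> 2 * a)"
          "Measurable.pred (PiM {..<j} (\<lambda>_. borel)) (\<lambda>x. \<bar>\<Sum>l<i. x l\<bar> > 2 * a)" by measurable
      qed
      then show ?thesis unfolding P_def
        by (intro pred_intros_logic pred_intros_finite) auto
    qed
    have [measurable]: "Measurable.pred (PiM {j..<n} (\<lambda>_. borel)) Q"
      unfolding Q_def by measurable
    have "prob {\<omega>\<in>space M. P (restrict (\<lambda>i. X i \<omega>) {..<j}) \<and> Q (restrict (\<lambda>i. X i \<omega>) {j..<n})} =
      prob {\<omega>\<in>space M. P (restrict (\<lambda>i. X i \<omega>) {..<j})} * prob {\<omega>\<in>space M. Q (restrict (\<lambda>i. X i \<omega>) {j..<n})}"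
      by (rule indep_vars_prob_split[OF indep]) (use j in auto)
    moreover have "P (restrict (\<lambda>i. X i \<omega>) {..<j}) \<longleftrightarrow> \<bar>S j \<omega>\<bar> > 2 * a \<and> (\<forall>i\<in>{..<j}. \<bar>S i \<omega>\<bar> \<le> 2 * a)" for \<omega>
      by (simp add: P_def S_def)
    moreover have "Q (restrict (\<lambda>i. X i \<omega>) {j..<n}) \<longleftrightarrow> \<bar>\<Sum>i\<in>{j..<n}. X i \<omega>\<bar> \<le> a" for \<omega>
      by (simp add: Q_def)
    ultimately show ?thesis by (simp add: A_def B_def Int_def conj_ac)
  qed
  have B2: "prob (B j) \<ge> 1/2" if "j \<le> n" for j
  proof -
    have "B j = space M - {\<omega>\<in>space M. \<bar>\<Sum>i\<in>{j..<n}. X i \<omega>\<bar> > a}" by (auto simp: B_def)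
    moreover have "{\<omega>\<in>space M. \<bar>\<Sum>i\<in>{j..<n}. X i \<omega>\<bar> > a} \<in> events" by measurable
    ultimately show ?thesis using tail[OF that] by (simp add: prob_compl)
  qed
  have disj: "disjoint_family_on A {..n}"
    unfolding disjoint_family_on_def
  proof (intro ballI impI)
    fix i j assume "i \<in> {..n}" "j \<in> {..n}" "i \<noteq> j"
    then show "A i \<inter> A j = {}"
      by (cases "i < j") (force simp: A_def not_less le_less)+
  qed
  have first: "{\<omega>\<in>space M. \<exists>j\<le>n. \<bar>S j \<omega>\<bar> > 2 * a} \<subseteq> (\<Union>j\<in>{..n}. A j)"
  proof
    fix \<omega> assume "\<omega> \<in> {\<omega>\<in>space M. \<exists>j\<le>n. \<bar>S j \<omega>\<bar> > 2 * a}"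
    then have \<omega>: "\<omega> \<in> space M" and ex: "\<exists>j. j \<le> n \<and> \<bar>S j \<omega>\<bar> > 2 * a" by auto
    define j where "j = (LEAST j. j \<le> n \<and> \<bar>S j \<omega>\<bar> > 2 * a)"
    have "j \<le> n \<and> \<bar>S j \<omega>\<bar> > 2 * a" unfolding j_def by (rule LeastI_ex[OF ex])
    moreover have "\<bar>S i \<omega>\<bar> \<le> 2 * a" if "i < j" for i
      using not_less_Least[of i "\<lambda>j. j \<le> n \<and> \<bar>S j \<omega>\<bar> > 2 * a"] that calculation
      by (auto simp: j_def)
    ultimately show "\<omega> \<in> (\<Union>j\<in>{..n}. A j)" using \<omega> by (auto simp: A_def)
  qed
  have ABE: "A j \<inter> B j \<subseteq> E" if "j \<le> n" for j
  proof
    fix \<omega> assume \<omega>: "\<omega> \<in> A j \<inter> B j"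
    have "S n \<omega> = S j \<omega> + (\<Sum>i\<in>{j..<n}. X i \<omega>)"
      unfolding S_def using that by (metis atLeast0LessThan bot_nat_0.extremum sum.atLeastLessThan_concat)
    then show "\<omega> \<in> E" using \<omega> by (auto simp: A_def B_def E_def)
  qed
  have "(\<Sum>j\<le>n. prob (A j)) \<le> (\<Sum>j\<le>n. 2 * prob (A j \<inter> B j))"
  proof (rule sum_mono)
    fix j assume "j \<in> {..n}"
    then have "prob (A j) * (1/2) \<le> prob (A j) * prob (B j)" by (intro mult_left_mono B2) auto
    then show "prob (A j) \<le> 2 * prob (A j \<inter> B j)" using AB[of j] \<open>j \<in> _\<close> by simp
  qed
  also have "\<dots> = 2 * (\<Sum>j\<le>n. prob (A j \<inter> B j))" by (simp add: sum_distrib_left)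
  also have "(\<Sum>j\<le>n. prob (A j \<inter> B j)) = prob (\<Union>j\<in>{..n}. A j \<inter> B j)"
  proof (rule finite_measure_finite_Union[symmetric])
    show "(\<lambda>j. A j \<inter> B j) ` {..n} \<subseteq> events" using Am Bm by auto
    show "disjoint_family_on (\<lambda>j. A j \<inter> B j) {..n}"
      using disj unfolding disjoint_family_on_def by blast
  qed simp
  also have "\<dots> \<le> prob E"
    by (rule finite_measure_mono) (use ABE Em in auto)
  finally have "(\<Sum>j\<le>n. prob (A j)) \<le> 2 * prob E" by simp
  moreover have "prob {\<omega>\<in>space M. \<exists>j\<le>n. \<bar>S j \<omega>\<bar> > 2 * a} \<le> prob (\<Union>j\<in>{..n}. A j)"
    by (rule finite_measure_mono[OF first]) (use Am in auto)
  moreover have "prob (\<Union>j\<in>{..n}. A j) = (\<Sum>j\<le>n. prob (A j))"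
    by (rule finite_measure_finite_Union) (use Am disj in auto)
  ultimately show ?thesis by (simp add: S_def E_def)
qed

text \<open>
  Unless the bound is trivial, \<open>v / a\<^sup>2 \<le> 1 / 2\<close> for \<open>a = l / 2\<close>
  and Ottaviani's inequality applies.  The tail hypothesis is what Chebyshev's inequality gives for
  Brownian increments and for the rescaled errors alike.
\<close>

lemma (in prob_space) maximal_inequality:
  fixes X :: "nat \<Rightarrow> 'a \<Rightarrow> real"
  assumes indep: "indep_vars (\<lambda>_. borel) X {..<n}" and l: "l > 0"
    and tail: "\<And>j a. j \<le> n \<Longrightarrow> a > 0 \<Longrightarrow> prob {\<omega>\<in>space M. \<bar>\<Sum>i\<in>{j..<n}. X i \<omega>\<bar> > a} \<le> v / a\<^sup>2"
  shows "prob {\<omega>\<in>space M. \<exists>j\<le>n. \<bar>\<Sum>i<j. X i \<omega>\<bar> > l} \<le> 8 * v / l\<^sup>2"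
proof (cases "8 * v / l\<^sup>2 \<ge> 1")
  case False
  define a where "a = l / 2"
  have a: "a > 0" "l = 2 * a" using l by (auto simp: a_def)
  have v: "v / a\<^sup>2 \<le> 1 / 2" using False a by (simp add: field_simps power2_eq_square)
  have "prob {\<omega>\<in>space M. \<exists>j\<le>n. \<bar>\<Sum>i<j. X i \<omega>\<bar> > 2 * a} \<le> 2 * prob {\<omega>\<in>space M. \<bar>\<Sum>i<n. X i \<omega>\<bar> > a}"
    by (rule ottaviani[OF indep a(1)]) (use tail a v order_trans in blast)
  also have "\<dots> \<le> 2 * (v / a\<^sup>2)" using tail[of 0 a] a by (simp add: atLeast0LessThan)
  also have "\<dots> = 8 * v / l\<^sup>2" using a by (simp add: power2_eq_square)
  finally show ?thesis using a by simp
qed (use prob_le_1 order_trans in blast)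

text \<open>
  Dyadic peeling: on the shell from \<open>2 ^ l * T\<close> to \<open>2 ^ Suc l * T\<close> the bound
  \<open>\<theta> * t\<close> is at least \<open>\<theta> * 2 ^ l * T\<close>, and the failure
  probabilities of the shells form a geometric series.
\<close>

lemma (in finite_measure) linear_growth_bound:
  fixes S :: "'i \<Rightarrow> 'a \<Rightarrow> real"
  assumes max: "\<And>R l. R > 0 \<Longrightarrow> l > 0 \<Longrightarrow>
      holds_except M (8 * R / l\<^sup>2) (\<lambda>\<omega>. \<forall>i\<in>I. t i \<le> R \<longrightarrow> \<bar>S i \<omega>\<bar> \<le> l)"
    and T: "T > 0" and th: "\<theta> > 0"
  shows "holds_except M (32 / (\<theta>\<^sup>2 * T)) (\<lambda>\<omega>. \<forall>i\<in>I. t i \<ge> T \<longrightarrow> \<bar>S i \<omega>\<bar> \<le> \<theta> * t i)"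
proof -
  define p where "p l = 16 / (\<theta>\<^sup>2 * T) * (1/2)^l" for l :: nat
  have "holds_except M (\<Sum>l. p l) (\<lambda>\<omega>. \<forall>l. \<forall>i\<in>I. t i \<le> 2^Suc l * T \<longrightarrow> \<bar>S i \<omega>\<bar> \<le> \<theta> * (2^l * T))"
  proof (rule holds_except_all)
    show "summable p" unfolding p_def by (intro summable_mult summable_geometric) auto
    fix l :: nat
    have "8 * (2^Suc l * T) / (\<theta> * (2^l * T))\<^sup>2 = p l"
      using T th by (simp add: p_def power2_eq_square field_simps power_divide)
    then show "holds_except M (p l) (\<lambda>\<omega>. \<forall>i\<in>I. t i \<le> 2^Suc l * T \<longrightarrow> \<bar>S i \<omega>\<bar> \<le> \<theta> * (2^l * T))"
      using max[of "2^Suc l * T" "\<theta> * (2^l * T)"] T th by simp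
  qed
  moreover have "(\<Sum>l. p l) = 32 / (\<theta>\<^sup>2 * T)"
    unfolding p_def by (subst suminf_mult) (auto simp: suminf_geometric)
  moreover have "\<bar>S i \<omega>\<bar> \<le> \<theta> * t i"
    if all: "\<forall>l. \<forall>i\<in>I. t i \<le> 2^Suc l * T \<longrightarrow> \<bar>S i \<omega>\<bar> \<le> \<theta> * (2^l * T)" and i: "i \<in> I" "t i \<ge> T" for i \<omega>
  proof -
    obtain m where "t i / T < 2 ^ m" using real_arch_pow[of 2 "t i / T"] by auto
    then have ex: "\<exists>m. t i \<le> 2^m * T" using T by (auto simp: field_simps intro: less_imp_le)
    define m where "m = (LEAST m. t i \<le> 2^m * T)"
    have m: "t i \<le> 2^m * T" unfolding m_def by (rule LeastI_ex[OF ex])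
    show ?thesis
    proof (cases m)
      case 0
      then have "t i \<le> 2^Suc 0 * T" using m T by simp
      then have "\<bar>S i \<omega>\<bar> \<le> \<theta> * (2^0 * T)" using all i by blast
      also have "\<dots> \<le> \<theta> * t i" using i th by simp
      finally show ?thesis .
    next
      case (Suc l)
      then have "\<not> t i \<le> 2^l * T" using not_less_Least[of l "\<lambda>m. t i \<le> 2^m * T"] by (simp add: m_def)
      then have "\<theta> * (2^l * T) \<le> \<theta> * t i" using th by (intro mult_left_mono) auto
      moreover have "\<bar>S i \<omega>\<bar> \<le> \<theta> * (2^l * T)" using all i m Suc by blast
      ultimately show ?thesis by simp
    qed
  qed
  ultimately show ?thesis
    by (elim holds_except_mono) (simp, blast)
qed

section \<open>Sums of independent identically distributed variables\<close>

lemma (in prob_space) second_moment_iid_sum: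
  fixes X :: "'i \<Rightarrow> 'a \<Rightarrow> real"
  assumes "finite A" "indep_vars (\<lambda>_. borel) X A"
    and "\<And>i. i \<in> A \<Longrightarrow> integrable M (X i)" "\<And>i. i \<in> A \<Longrightarrow> expectation (X i) = 0"
    and "\<And>i. i \<in> A \<Longrightarrow> integrable M (\<lambda>\<omega>. (X i \<omega>)\<^sup>2)" "\<And>i. i \<in> A \<Longrightarrow> expectation (\<lambda>\<omega>. (X i \<omega>)\<^sup>2) = s"
  shows "integrable M (\<lambda>\<omega>. (\<Sum>i\<in>A. X i \<omega>)\<^sup>2) \<and> expectation (\<lambda>\<omega>. (\<Sum>i\<in>A. X i \<omega>)\<^sup>2) = real (card A) * s"
  using assms
proof (induction A)
  case (insert i A)
  let ?Y = "\<lambda>\<omega>. \<Sum>i\<in>A. X i \<omega>"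
  have IH: "integrable M (\<lambda>\<omega>. (?Y \<omega>)\<^sup>2)" "expectation (\<lambda>\<omega>. (?Y \<omega>)\<^sup>2) = real (card A) * s"
    using insert indep_vars_subset[of "\<lambda>_. borel" X "insert i A" A] by auto
  have Y: "integrable M ?Y" "expectation ?Y = 0" using insert.prems by auto
  have iv: "indep_var borel (X i) borel ?Y"
    using insert by (intro indep_vars_sum) auto
  have XY: "integrable M (\<lambda>\<omega>. X i \<omega> * ?Y \<omega>)" "expectation (\<lambda>\<omega>. X i \<omega> * ?Y \<omega>) = 0"
    using indep_var_integrable[OF iv] indep_var_lebesgue_integral[OF iv] insert.prems Y by auto
  have eq: "(\<Sum>i\<in>insert i A. X i \<omega>)\<^sup>2 = (X i \<omega>)\<^sup>2 + 2 * (X i \<omega> * ?Y \<omega>) + (?Y \<omega>)\<^sup>2" for \<omega>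
    using insert by (simp add: power2_eq_square algebra_simps)
  show ?case unfolding eq using insert IH XY by (auto simp: algebra_simps)
qed (auto)

lemma (in prob_space) chebyshev_iid_sum:
  fixes X :: "'i \<Rightarrow> 'a \<Rightarrow> real"
  assumes "finite A" "indep_vars (\<lambda>_. borel) X A"
    and "\<And>i. i \<in> A \<Longrightarrow> integrable M (X i)" "\<And>i. i \<in> A \<Longrightarrow> expectation (X i) = 0"
    and "\<And>i. i \<in> A \<Longrightarrow> integrable M (\<lambda>\<omega>. (X i \<omega>)\<^sup>2)" "\<And>i. i \<in> A \<Longrightarrow> expectation (\<lambda>\<omega>. (X i \<omega>)\<^sup>2) = s"
    and a: "a > 0"
  shows "prob {\<omega>\<in>space M. \<bar>\<Sum>i\<in>A. X i \<omega>\<bar> > a} \<le> real (card A) * s / a\<^sup>2"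
proof -
  note sm = second_moment_iid_sum[OF assms(1-6)]
  have [measurable]: "X i \<in> borel_measurable M" if "i \<in> A" for i using assms(3) that by auto
  have "prob {\<omega>\<in>space M. \<bar>\<Sum>i\<in>A. X i \<omega>\<bar> > a} \<le> prob {\<omega>\<in>space M. (\<Sum>i\<in>A. X i \<omega>)\<^sup>2 \<ge> a\<^sup>2}"
  proof (rule finite_measure_mono)
    show "{\<omega>\<in>space M. (\<Sum>i\<in>A. X i \<omega>)\<^sup>2 \<ge> a\<^sup>2} \<in> events" by measurable
  qed (use a in \<open>auto simp: abs_le_square_iff[symmetric]\<close>)
  also have "\<dots> \<le> expectation (\<lambda>\<omega>. (\<Sum>i\<in>A. X i \<omega>)\<^sup>2) / a\<^sup>2"
    by (rule integral_Markov_inequality_measure[where A="{}"]) (use sm a in auto)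
  finally show ?thesis using sm by simp
qed

text \<open>
  A single probability space that carries an infinite independent sequence with the given law; the
  central limit theorem is applied there.
\<close>

lemma PiM_coordinates_indep:
  assumes \<nu>: "prob_space \<nu>" "sets \<nu> = sets borel"
  defines "\<Omega> \<equiv> PiM (UNIV :: nat set) (\<lambda>_. \<nu>)"
  shows "prob_space \<Omega>" "prob_space.indep_vars \<Omega> (\<lambda>_. borel) (\<lambda>i \<omega>. \<omega> i) UNIV"
    "distr \<Omega> borel (\<lambda>\<omega>. \<omega> i) = \<nu>"
proof -
  show ps: "prob_space \<Omega>" unfolding \<Omega>_def by (intro prob_space_PiM \<nu>)
  interpret prob_space \<Omega> by fact
  have s: "sets \<Omega> = sets (PiM UNIV (\<lambda>_. borel))" unfolding \<Omega>_def by (intro sets_PiM_cong refl \<nu>)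
  have d: "distr \<Omega> borel (\<lambda>\<omega>. \<omega> i) = \<nu>" for i
  proof -
    have "distr \<Omega> \<nu> (\<lambda>\<omega>. \<omega> i) = \<nu>" unfolding \<Omega>_def by (intro distr_PiM_component \<nu>) auto
    then show ?thesis using \<nu>(2) distr_cong[of \<Omega> \<Omega> borel \<nu> "\<lambda>\<omega>. \<omega> i" "\<lambda>\<omega>. \<omega> i"] by simp
  qed
  then show "distr \<Omega> borel (\<lambda>\<omega>. \<omega> i) = \<nu>" .
  have "random_variable borel (\<lambda>\<omega>. \<omega> i)" for i
    by (subst measurable_cong_sets[OF s refl]) simp
  then show "indep_vars (\<lambda>_. borel) (\<lambda>i \<omega>. \<omega> i) UNIV"
    by (subst indep_vars_iff_distr_eq_PiM)
       (auto simp: d distr_id2 s restrict_UNIV \<Omega>_def[symmetric])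
qed

text \<open>
  The standardised sum depends on the number of its summands only, whatever probability space and
  index set they live on.  So one weakly convergent sequence of laws serves all designs at once.
\<close>

lemma iid_sum_clt:
  fixes \<nu> :: "real measure"
  assumes \<nu>: "real_distribution \<nu>" "integrable \<nu> (\<lambda>x. x)" "(\<integral>x. x \<partial>\<nu>) = 0"
      "integrable \<nu> (\<lambda>x. x\<^sup>2)" "(\<integral>x. x\<^sup>2 \<partial>\<nu>) = \<sigma>\<^sup>2" and s: "\<sigma> > 0"
  obtains \<F> :: "nat \<Rightarrow> real measure" where "\<And>r. real_distribution (\<F> r)"
    "weak_conv_m \<F> std_normal_distribution"
    "\<And>(M :: 'a measure) (\<epsilon> :: 'i \<Rightarrow> 'a \<Rightarrow> real) A. prob_space M \<Longrightarrow> prob_space.indep_vars M (\<lambda>_. borel) \<epsilon> A \<Longrightarrow>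
       finite A \<Longrightarrow> (\<And>i. i \<in> A \<Longrightarrow> distr M borel (\<epsilon> i) = \<nu>) \<Longrightarrow>
       distr M borel (\<lambda>\<omega>. (\<Sum>i\<in>A. \<epsilon> i \<omega>) / (\<sigma> * sqrt (card A))) = \<F> (card A)"
proof -
  define \<Omega> where "\<Omega> = PiM (UNIV :: nat set) (\<lambda>_. \<nu>)"
  interpret \<nu>: real_distribution \<nu> by fact
  have sb: "sets \<nu> = sets borel" by simp
  note coord = PiM_coordinates_indep[OF \<nu>.prob_space_axioms sb, folded \<Omega>_def]
  interpret O: prob_space \<Omega> by (rule coord(1))
  define \<F> where "\<F> r = distr \<Omega> borel (\<lambda>\<omega>. (\<Sum>i<r. \<omega> i) / sqrt (real r * \<sigma>\<^sup>2))" for r :: nat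
  have rv: "O.random_variable borel (\<lambda>\<omega>. \<omega> i)" for i using coord(2) by (auto simp: O.indep_vars_def)
  have I: "integrable \<Omega> (\<lambda>\<omega>. \<omega> i)" "O.expectation (\<lambda>\<omega>. \<omega> i) = 0" "integrable \<Omega> (\<lambda>\<omega>. (\<omega> i)\<^sup>2)"
     "O.expectation (\<lambda>\<omega>. (\<omega> i)\<^sup>2) = \<sigma>\<^sup>2" for i
  proof -
    note 1 = integrable_distr_eq[OF rv[of i], unfolded coord(3)] and 2 = integral_distr[OF rv[of i], unfolded coord(3)]
    have m: "(\<lambda>x::real. x) \<in> borel_measurable borel" "(\<lambda>x::real. x\<^sup>2) \<in> borel_measurable borel" by measurable
    show "integrable \<Omega> (\<lambda>\<omega>. \<omega> i)" using 1[OF m(1)] \<nu>(2) by metis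
    show "integrable \<Omega> (\<lambda>\<omega>. (\<omega> i)\<^sup>2)" using 1[OF m(2)] \<nu>(4) by metis
    show "O.expectation (\<lambda>\<omega>. \<omega> i) = 0" using 2[OF m(1)] \<nu>(3) by metis
    show "O.expectation (\<lambda>\<omega>. (\<omega> i)\<^sup>2) = \<sigma>\<^sup>2" using 2[OF m(2)] \<nu>(5) by metis
  qed
  show thesis
  proof (rule that)
    show "real_distribution (\<F> r)" for r
      unfolding \<F>_def using rv by (intro O.real_distribution_distr) (auto intro!: borel_measurable_divide borel_measurable_sum)
    show "weak_conv_m \<F> std_normal_distribution"
      unfolding \<F>_def
      by (rule O.central_limit_theorem_zero_mean[OF coord(2) I(2) s I(3)]) (use I coord in auto)
    fix M :: "'a measure" and \<epsilon> :: "'i \<Rightarrow> 'a \<Rightarrow> real" and A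
    assume M: "prob_space M" and ind: "prob_space.indep_vars M (\<lambda>_. borel) \<epsilon> A"
      and fin: "finite A" and d: "\<And>i. i \<in> A \<Longrightarrow> distr M borel (\<epsilon> i) = \<nu>"
    interpret M: prob_space M by fact
    have rvM: "M.random_variable borel (\<epsilon> i)" if "i \<in> A" for i using ind that by (auto simp: M.indep_vars_def)
    define c where "c = \<sigma> * sqrt (card A)"
    have c: "c = sqrt (real (card A) * \<sigma>\<^sup>2)" using s by (simp add: c_def real_sqrt_mult)
    have "char (distr M borel (\<lambda>\<omega>. \<Sum>i\<in>A. \<epsilon> i \<omega>)) = char (distr \<Omega> borel (\<lambda>\<omega>. \<Sum>i<card A. \<omega> i))"
    proof
      fix t
      have "O.indep_vars (\<lambda>_. borel) (\<lambda>i \<omega>. \<omega> i) {..<card A}" by (rule O.indep_vars_subset[OF coord(2)]) auto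
      then show "char (distr M borel (\<lambda>\<omega>. \<Sum>i\<in>A. \<epsilon> i \<omega>)) t = char (distr \<Omega> borel (\<lambda>\<omega>. \<Sum>i<card A. \<omega> i)) t"
        by (simp add: M.char_distr_sum[OF ind] O.char_distr_sum d coord(3))
    qed
    then have eq: "distr M borel (\<lambda>\<omega>. \<Sum>i\<in>A. \<epsilon> i \<omega>) = distr \<Omega> borel (\<lambda>\<omega>. \<Sum>i<card A. \<omega> i)"
      using rv rvM
      by (intro Levy_uniqueness M.real_distribution_distr O.real_distribution_distr) (auto intro!: borel_measurable_sum)
    have "distr M borel (\<lambda>\<omega>. (\<Sum>i\<in>A. \<epsilon> i \<omega>) / c) = distr (distr M borel (\<lambda>\<omega>. \<Sum>i\<in>A. \<epsilon> i \<omega>)) borel (\<lambda>x. x / c)"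
      using rvM by (subst distr_distr) (auto intro!: borel_measurable_sum simp: comp_def)
    also have "\<dots> = \<F> (card A)"
      unfolding eq \<F>_def c[symmetric]
      using rv by (subst distr_distr) (auto intro!: borel_measurable_sum simp: comp_def)
    finally show "distr M borel (\<lambda>\<omega>. (\<Sum>i\<in>A. \<epsilon> i \<omega>) / (\<sigma> * sqrt (card A))) = \<F> (card A)" by (simp add: c_def)
  qed
qed

text \<open>
  Monotonicity of distribution functions lets the argument of the distribution function move with the
  index.
\<close>

lemma cdf_weak_limit_uniform:
  assumes "\<And>r. real_distribution (\<F> r)" "weak_conv_m \<F> \<Phi>" and cont: "\<And>x. isCont (cdf \<Phi>) x"
    and r: "filterlim r at_top sequentially" and x: "x \<longlonglongrightarrow> (y::real)"
  shows "(\<lambda>m. cdf (\<F> (r m)) (x m)) \<longlonglongrightarrow> cdf \<Phi> y"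
proof (rule LIMSEQ_I)
  fix e :: real assume e: "e > 0"
  from cont[of y] obtain d where d: "d > 0" "\<And>z. \<bar>z - y\<bar> < d \<Longrightarrow> \<bar>cdf \<Phi> z - cdf \<Phi> y\<bar> < e / 2"
    unfolding continuous_at_eps_delta dist_real_def using e by (metis half_gt_zero)
  define a b where "a = y - d/2" and "b = y + d/2"
  have ab: "\<bar>cdf \<Phi> a - cdf \<Phi> y\<bar> < e/2" "\<bar>cdf \<Phi> b - cdf \<Phi> y\<bar> < e/2" using d by (auto simp: a_def b_def)
  have lim: "(\<lambda>m. cdf (\<F> (r m)) z) \<longlonglongrightarrow> cdf \<Phi> z" for z
    using assms(2) cont r unfolding weak_conv_m_def weak_conv_def by (auto intro: filterlim_compose)
  have "eventually (\<lambda>m. \<bar>cdf (\<F> (r m)) a - cdf \<Phi> a\<bar> < e/2) sequentially"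
    "eventually (\<lambda>m. \<bar>cdf (\<F> (r m)) b - cdf \<Phi> b\<bar> < e/2) sequentially"
    using lim[of a] lim[of b] e unfolding tendsto_iff dist_real_def by (metis half_gt_zero)+
  moreover have "eventually (\<lambda>m. \<bar>x m - y\<bar> < d/2) sequentially"
    using x d unfolding tendsto_iff dist_real_def by (metis half_gt_zero)
  ultimately have "eventually (\<lambda>m. \<bar>cdf (\<F> (r m)) (x m) - cdf \<Phi> y\<bar> < e) sequentially"
  proof eventually_elim
    case (elim m)
    interpret real_distribution "\<F> (r m)" by (rule assms(1))
    have "a \<le> x m" "x m \<le> b" using elim(3) by (auto simp: a_def b_def abs_if split: if_splits)
    then have "cdf (\<F> (r m)) a \<le> cdf (\<F> (r m)) (x m)" "cdf (\<F> (r m)) (x m) \<le> cdf (\<F> (r m)) b"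
      by (auto intro: cdf_nondecreasing)
    then show ?case using elim ab by linarith
  qed
  then show "\<exists>no. \<forall>m\<ge>no. norm (cdf (\<F> (r m)) (x m) - cdf \<Phi> y) < e"
    by (simp add: eventually_sequentially)
qed

section \<open>Independence, lower envelopes and anticoncentration\<close>

lemma (in prob_space) indep_vars_block_sums:
  fixes X :: "'i \<Rightarrow> 'a \<Rightarrow> real"
  assumes "indep_vars (\<lambda>_. borel) X I" "\<And>j. j \<in> L \<Longrightarrow> K j \<subseteq> I" "disjoint_family_on K L"
  shows "indep_vars (\<lambda>_. borel) (\<lambda>j \<omega>. \<Sum>i\<in>K j. X i \<omega>) L"
proof -
  have "indep_vars (\<lambda>_. borel) (\<lambda>j \<omega>. (\<lambda>x. \<Sum>i\<in>K j. x i) (restrict (\<lambda>i. X i \<omega>) (K j))) L"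
    by (rule indep_vars_compose2[OF indep_vars_restrict[OF assms]])
      (auto intro!: borel_measurable_sum measurable_component_singleton)
  then show ?thesis by simp
qed

lemma (in prob_space) indep_vars_reindex:
  fixes X :: "'i \<Rightarrow> 'a \<Rightarrow> real"
  assumes "indep_vars (\<lambda>_. borel) X I" "inj_on f L" "f ` L \<subseteq> I"
  shows "indep_vars (\<lambda>_. borel) (\<lambda>j. X (f j)) L"
  using indep_vars_block_sums[OF assms(1), of L "\<lambda>j. {f j}"] assms(2,3)
  by (auto simp: disjoint_family_on_def inj_on_def)

text \<open>
  In \<open>s\<close> the minimum is a lower envelope of lines of slopes \<open>- \<tau> i\<close>,
  and it inherits the bounds on these slopes.
\<close>

lemma min_affine_mono:
  fixes f \<tau> :: "'i \<Rightarrow> real"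
  assumes "finite I" "I \<noteq> {}" "s \<le> s'"
  defines "m \<equiv> \<lambda>s. Min ((\<lambda>i. f i - s * \<tau> i) ` I)"
  shows "(\<And>i. i \<in> I \<Longrightarrow> lo \<le> \<tau> i) \<Longrightarrow> m s' \<le> m s - (s' - s) * lo"
    and "(\<And>i. i \<in> I \<Longrightarrow> \<tau> i \<le> hi) \<Longrightarrow> m s' \<ge> m s - (s' - s) * hi"
proof -
  have le: "m s \<le> f i - s * \<tau> i" if "i \<in> I" for i s unfolding m_def using assms that by (intro Min_le) auto
  have ex: "\<exists>i\<in>I. m s = f i - s * \<tau> i" for s
  proof -
    have "m s \<in> (\<lambda>i. f i - s * \<tau> i) ` I" unfolding m_def using assms by (intro Min_in) auto
    then show ?thesis by auto
  qed
  show "m s' \<le> m s - (s' - s) * lo" if lo: "\<And>i. i \<in> I \<Longrightarrow> lo \<le> \<tau> i"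
  proof -
    obtain i where i: "i \<in> I" "m s = f i - s * \<tau> i" using ex by blast
    have "(s' - s) * lo \<le> (s' - s) * \<tau> i" using lo i assms by (intro mult_left_mono) auto
    then show ?thesis using le[OF i(1), of s'] i by (simp add: algebra_simps)
  qed
  show "m s' \<ge> m s - (s' - s) * hi" if hi: "\<And>i. i \<in> I \<Longrightarrow> \<tau> i \<le> hi"
  proof -
    obtain i where i: "i \<in> I" "m s' = f i - s' * \<tau> i" using ex by blast
    have "(s' - s) * \<tau> i \<le> (s' - s) * hi" using hi i assms by (intro mult_left_mono) auto
    then show ?thesis using le[OF i(1), of s] i by (simp add: algebra_simps)
  qed
qed

lemma min_affine_lipschitz:
  fixes f \<tau> :: "'i \<Rightarrow> real"
  assumes "finite I" "I \<noteq> {}" "\<And>i. i \<in> I \<Longrightarrow> \<bar>\<tau> i\<bar> \<le> T"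
  shows "\<bar>Min ((\<lambda>i. f i - s * \<tau> i) ` I) - Min ((\<lambda>i. f i - s' * \<tau> i) ` I)\<bar> \<le> \<bar>s - s'\<bar> * T"
proof -
  have *: "\<bar>Min ((\<lambda>i. f i - s * \<tau> i) ` I) - Min ((\<lambda>i. f i - s' * \<tau> i) ` I)\<bar> \<le> (s' - s) * T" if "s \<le> s'" for s s'
    using min_affine_mono(1)[OF assms(1,2) that, of "- T" \<tau> f] min_affine_mono(2)[OF assms(1,2) that, of \<tau> T f] assms(3)
    by (force simp: abs_le_iff)
  show ?thesis
  proof (cases "s \<le> s'")
    case False
    then show ?thesis using *[of s' s] by (simp add: abs_minus_commute)
  qed (use *[of s s'] in simp)
qed

text \<open>
  Condition on \<open>Y\<close>.  Each section of \<open>B\<close> then lies in an interval of length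
  \<open>2 * d\<close> for \<open>h (X \<omega>)\<close>, whatever the value of \<open>Y\<close>.
\<close>

lemma (in prob_space) anticoncentration:
  fixes X Y :: "'a \<Rightarrow> 'c" and h :: "'c \<Rightarrow> real"
  assumes iv: "indep_var N' X N Y" and h [measurable]: "h \<in> borel_measurable N'"
    and dens: "\<And>a b. a \<le> b \<Longrightarrow> prob {\<omega>\<in>space M. h (X \<omega>) \<in> {a..b}} \<le> c * (b - a)" and c: "c \<ge> 0"
    and B: "B \<in> sets (N' \<Otimes>\<^sub>M N)"
    and diam: "\<And>x x' y. (x, y) \<in> B \<Longrightarrow> (x', y) \<in> B \<Longrightarrow> \<bar>h x - h x'\<bar> \<le> d" and d: "d \<ge> 0"
  shows "prob {\<omega>\<in>space M. (X \<omega>, Y \<omega>) \<in> B} \<le> 2 * c * d"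
proof -
  have X [measurable]: "random_variable N' X" and Y: "random_variable N Y"
    using iv by (auto dest: indep_var_rv1 indep_var_rv2)
  interpret DX: prob_space "distr M N' X" by (rule prob_space_distr[OF X])
  interpret DY: prob_space "distr M N Y" by (rule prob_space_distr[OF Y])
  interpret pair_sigma_finite "distr M N' X" "distr M N Y" ..
  have eq: "distr M N' X \<Otimes>\<^sub>M distr M N Y = distr M (N' \<Otimes>\<^sub>M N) (\<lambda>x. (X x, Y x))"
    using iv indep_var_distribution_eq by blast
  have XY: "(\<lambda>\<omega>. (X \<omega>, Y \<omega>)) \<in> measurable M (N' \<Otimes>\<^sub>M N)" using X Y by measurable
  have Bsub: "B \<subseteq> space N' \<times> space N" using sets.sets_into_space[OF B] by (simp add: space_pair_measure)
  have "emeasure M {\<omega>\<in>space M. (X \<omega>, Y \<omega>) \<in> B} = emeasure (distr M (N' \<Otimes>\<^sub>M N) (\<lambda>x. (X x, Y x))) B"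
    using XY B by (subst emeasure_distr) (auto simp: vimage_def Int_def conj_commute)
  also have "\<dots> = emeasure (distr M N' X \<Otimes>\<^sub>M distr M N Y) B" by (simp add: eq)
  also have "\<dots> = (\<integral>\<^sup>+y. emeasure (distr M N' X) ((\<lambda>x. (x, y)) -` B) \<partial>distr M N Y)"
    by (rule emeasure_pair_measure_alt2) (use B in \<open>simp add: sets_pair_measure_cong[of "distr M N' X" N']\<close>)
  also have "\<dots> \<le> (\<integral>\<^sup>+y. ennreal (2 * c * d) \<partial>distr M N Y)"
  proof (rule nn_integral_mono)
    fix y
    show "emeasure (distr M N' X) ((\<lambda>x. (x, y)) -` B) \<le> ennreal (2 * c * d)"
    proof (cases "\<exists>x. (x, y) \<in> B")
      case True
      then obtain x where x: "(x, y) \<in> B" by blast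
      define J where "J = {x'\<in>space N'. h x' \<in> {h x - d..h x + d}}"
      have J: "J \<in> sets N'" unfolding J_def by measurable
      have "(\<lambda>x. (x, y)) -` B \<subseteq> J" using diam[OF x] Bsub by (fastforce simp: abs_le_iff J_def)
      then have "emeasure (distr M N' X) ((\<lambda>x. (x, y)) -` B) \<le> emeasure (distr M N' X) J"
        using J by (intro emeasure_mono) auto
      also have "\<dots> = emeasure M (X -` J \<inter> space M)"
        using J by (subst emeasure_distr) auto
      also have "X -` J \<inter> space M = {\<omega>\<in>space M. h (X \<omega>) \<in> {h x - d..h x + d}}"
        using measurable_space[OF X] by (auto simp: J_def)
      also have "emeasure M \<dots> \<le> ennreal (2 * c * d)"
        using dens[of "h x - d" "h x + d"] d
        unfolding emeasure_eq_measure by (intro ennreal_leI) (simp add: algebra_simps)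
      finally show ?thesis .
    next
      case False
      then have "(\<lambda>x. (x, y)) -` B = {}" by auto
      then show ?thesis by simp
    qed
  qed
  also have "\<dots> = ennreal (2 * c * d)" using DY.emeasure_space_1 by simp
  finally show ?thesis using c d by (simp add: emeasure_eq_measure)
qed

lemma normal_density_le:
  assumes "\<sigma> > 0" shows "normal_density \<mu> \<sigma> x \<le> 1 / \<sigma>"
proof -
  have "normal_density \<mu> \<sigma> x \<le> 1 / sqrt (2 * pi * \<sigma>\<^sup>2) * 1"
    unfolding normal_density_def by (intro mult_left_mono) auto
  also have "\<dots> \<le> 1 / \<sigma>"
  proof -
    have "1 \<le> 2 * pi" using pi_gt3 by simp
    then have "sqrt (1 * \<sigma>\<^sup>2) \<le> sqrt (2 * pi * \<sigma>\<^sup>2)" by (intro real_sqrt_le_mono mult_right_mono) auto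
    then show ?thesis using assms by (auto intro!: divide_left_mono)
  qed
  finally show ?thesis .
qed

section \<open>Two-sided Brownian motion\<close>

locale two_sided_bm =
  fixes P :: "'b measure" and W :: "real \<Rightarrow> 'b \<Rightarrow> real"
  assumes bm: "two_sided_brownian_motion P W"
begin

sublocale prob_space P using bm by (simp add: two_sided_brownian_motion_def)

lemma W_measurable [measurable]: "W t \<in> borel_measurable P"
  using bm by (simp add: two_sided_brownian_motion_def)

lemma W_increment: "s < t \<Longrightarrow> distributed P lborel (\<lambda>\<omega>. W t \<omega> - W s \<omega>) (normal_density 0 (sqrt (t - s)))"
  using bm by (simp add: two_sided_brownian_motion_def)

lemma W_indep: "strict_mono_on {..k} \<tau> \<Longrightarrow> indep_vars (\<lambda>_. borel) (\<lambda>i \<omega>. W (\<tau> (Suc i)) \<omega> - W (\<tau> i) \<omega>) {..<k}"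
  using bm by (simp add: two_sided_brownian_motion_def)

lemma W_path: "AE \<omega> in P. W 0 \<omega> = 0 \<and> continuous_on UNIV (\<lambda>t. W t \<omega>)"
  using bm by (auto simp: two_sided_brownian_motion_def)

lemma W_increment_std:
  assumes "s < t"
  shows "distr P borel (\<lambda>\<omega>. (W t \<omega> - W s \<omega>) / sqrt (t - s)) = std_normal_distribution"
proof -
  have "distributed P lborel (\<lambda>\<omega>. (W t \<omega> - W s \<omega> - 0) / sqrt (t - s)) std_normal_density"
    using W_increment[OF assms] assms by (subst normal_standard_normal_convert[symmetric]) auto
  then have "distr P lborel (\<lambda>\<omega>. (W t \<omega> - W s \<omega>) / sqrt (t - s)) = std_normal_distribution"
    by (simp add: distributed_def)
  moreover have "distr P lborel (\<lambda>\<omega>. (W t \<omega> - W s \<omega>) / sqrt (t - s)) = distr P borel (\<lambda>\<omega>. (W t \<omega> - W s \<omega>) / sqrt (t - s))"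
    by (rule distr_cong) auto
  ultimately show ?thesis by simp
qed

lemma W_increment_cdf:
  assumes "s < t"
  shows "prob {\<omega>\<in>space P. W t \<omega> - W s \<omega> \<le> x} = cdf std_normal_distribution (x / sqrt (t - s))"
proof -
  have "cdf std_normal_distribution (x / sqrt (t - s)) =
      prob ((\<lambda>\<omega>. (W t \<omega> - W s \<omega>) / sqrt (t - s)) -` {..x / sqrt (t - s)} \<inter> space P)"
    unfolding W_increment_std[OF assms, symmetric] cdf_def by (subst measure_distr) auto
  also have "(\<lambda>\<omega>. (W t \<omega> - W s \<omega>) / sqrt (t - s)) -` {..x / sqrt (t - s)} \<inter> space P =
      {\<omega>\<in>space P. W t \<omega> - W s \<omega> \<le> x}"
    using assms by (auto simp: divide_le_cancel)
  finally show ?thesis by simp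
qed

lemma W_increment_tail:
  assumes "s \<le> t" "a > 0"
  shows "prob {\<omega>\<in>space P. \<bar>W t \<omega> - W s \<omega>\<bar> > a} \<le> (t - s) / a\<^sup>2"
proof (cases "s = t")
  case False
  then have st: "s < t" using assms by simp
  have "expectation (\<lambda>\<omega>. W t \<omega> - W s \<omega>) = 0"
    by (rule normal_distributed_expectation[OF _ W_increment[OF st]]) (use st in simp)
  moreover have "variance (\<lambda>\<omega>. W t \<omega> - W s \<omega>) = (sqrt (t - s))\<^sup>2"
    by (rule normal_distributed_variance[OF _ W_increment[OF st]]) (use st in simp)
  ultimately have var: "expectation (\<lambda>\<omega>. (W t \<omega> - W s \<omega>)\<^sup>2) = t - s" using st by simp
  have int: "integrable P (\<lambda>\<omega>. (W t \<omega> - W s \<omega>)\<^sup>2)"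
  proof (rule ccontr)
    assume "\<not> integrable P (\<lambda>\<omega>. (W t \<omega> - W s \<omega>)\<^sup>2)"
    from not_integrable_integral_eq[OF this] show False using var st by simp
  qed
  have "prob {\<omega>\<in>space P. \<bar>W t \<omega> - W s \<omega>\<bar> > a} \<le> prob {\<omega>\<in>space P. (W t \<omega> - W s \<omega>)\<^sup>2 \<ge> a\<^sup>2}"
  proof (rule finite_measure_mono)
    show "{\<omega>\<in>space P. (W t \<omega> - W s \<omega>)\<^sup>2 \<ge> a\<^sup>2} \<in> events" by measurable
    have "a\<^sup>2 \<le> x\<^sup>2" if "a < \<bar>x\<bar>" for x :: real
      using that assms abs_le_square_iff[of a x] by simp
    then show "{\<omega>\<in>space P. \<bar>W t \<omega> - W s \<omega>\<bar> > a} \<subseteq> {\<omega>\<in>space P. (W t \<omega> - W s \<omega>)\<^sup>2 \<ge> a\<^sup>2}" by blast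
  qed
  also have "\<dots> \<le> expectation (\<lambda>\<omega>. (W t \<omega> - W s \<omega>)\<^sup>2) / a\<^sup>2"
    by (rule integral_Markov_inequality_measure[where A="{}"]) (use int assms in auto)
  finally show ?thesis using var by simp
qed (use assms in simp)

lemma W_increment_interval:
  assumes "w > 0" "s + w \<le> t" "a \<le> b"
  shows "prob {\<omega>\<in>space P. W t \<omega> - W s \<omega> \<in> {a..b}} \<le> 1 / sqrt w * (b - a)"
proof -
  have st: "s < t" using assms by simp
  have "emeasure P ((\<lambda>\<omega>. W t \<omega> - W s \<omega>) -` {a..b} \<inter> space P) =
      (\<integral>\<^sup>+x. ennreal (normal_density 0 (sqrt (t - s)) x) * indicator {a..b} x \<partial>lborel)"
    by (rule distributed_emeasure[OF W_increment[OF st]]) simp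
  also have "\<dots> \<le> (\<integral>\<^sup>+x. ennreal (1 / sqrt w) * indicator {a..b} x \<partial>lborel)"
  proof (intro nn_integral_mono mult_right_mono ennreal_leI)
    fix x
    have "normal_density 0 (sqrt (t - s)) x \<le> 1 / sqrt (t - s)" using st by (intro normal_density_le) simp
    also have "\<dots> \<le> 1 / sqrt w" using assms by (intro divide_left_mono) auto
    finally show "normal_density 0 (sqrt (t - s)) x \<le> 1 / sqrt w" .
  qed simp
  also have "\<dots> = ennreal (1 / sqrt w) * ennreal (b - a)" using assms by (subst nn_integral_cmult_indicator) auto
  also have "\<dots> = ennreal (1 / sqrt w * (b - a))" using assms by (intro ennreal_mult[symmetric]) auto
  finally have "emeasure P ((\<lambda>\<omega>. W t \<omega> - W s \<omega>) -` {a..b} \<inter> space P) \<le> ennreal (1 / sqrt w * (b - a))" .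
  then have "prob ((\<lambda>\<omega>. W t \<omega> - W s \<omega>) -` {a..b} \<inter> space P) \<le> 1 / sqrt w * (b - a)"
    using assms by (simp add: emeasure_eq_measure)
  then show ?thesis by (simp add: vimage_def Int_def conj_commute)
qed

text \<open>
  Statements about positive times carry over to negative times.
\<close>

lemma reverse: "two_sided_bm P (\<lambda>t. W (- t))"
proof
  have d: "distributed P lborel (\<lambda>\<omega>. W (- t) \<omega> - W (- s) \<omega>) (normal_density 0 (sqrt (t - s)))" if "s < t" for s t
    using normal_density_affine[OF W_increment[of "-t" "-s"], of "-1" 0] that by simp
  have i: "indep_vars (\<lambda>_. borel) (\<lambda>i \<omega>. W (- \<tau> (Suc i)) \<omega> - W (- \<tau> i) \<omega>) {..<k}"
    if \<tau>: "strict_mono_on {..k} \<tau>" for k and \<tau> :: "nat \<Rightarrow> real"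
  proof -
    define \<sigma> where "\<sigma> l = - \<tau> (k - l)" for l
    have "strict_mono_on {..k} \<sigma>"
      unfolding \<sigma>_def strict_mono_on_def using \<tau> by (auto intro!: strict_mono_onD[OF \<tau>])
    moreover have "inj_on (\<lambda>i. k - Suc i) {..<k}" by (rule inj_onI) auto
    moreover have "(\<lambda>i. k - Suc i) ` {..<k} \<subseteq> {..<k}" by auto
    ultimately
    have "indep_vars (\<lambda>_. borel) (\<lambda>i \<omega>. W (\<sigma> (Suc (k - Suc i))) \<omega> - W (\<sigma> (k - Suc i)) \<omega>) {..<k}"
      using indep_vars_reindex[OF W_indep, of k \<sigma> "\<lambda>i. k - Suc i" "{..<k}"] by auto
    then have "indep_vars (\<lambda>_. borel) (\<lambda>i \<omega>. - (W (\<sigma> (Suc (k - Suc i))) \<omega> - W (\<sigma> (k - Suc i)) \<omega>)) {..<k}"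
      by (rule indep_vars_compose2) auto
    moreover have "- (W (\<sigma> (Suc (k - Suc i))) \<omega> - W (\<sigma> (k - Suc i)) \<omega>) = W (- \<tau> (Suc i)) \<omega> - W (- \<tau> i) \<omega>"
      if "i \<in> {..<k}" for i \<omega> using that by (simp add: \<sigma>_def Suc_diff_Suc)
    ultimately show ?thesis by (subst indep_vars_cong[OF refl _ refl]) auto
  qed
  have c: "AE \<omega> in P. continuous_on UNIV (\<lambda>t. W (- t) \<omega>)"
  proof -
    have "AE \<omega> in P. continuous_on UNIV (\<lambda>t. W t \<omega>)" using W_path by eventually_elim auto
    then show ?thesis
      by eventually_elim (rule continuous_on_compose2[of UNIV "\<lambda>t. W t _"], auto intro: continuous_intros)
  qed
  show "two_sided_brownian_motion P (\<lambda>t. W (- t))"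
    unfolding two_sided_brownian_motion_def
    using d i c W_path prob_space_axioms by auto
qed

text \<open>
  The maximal inequality on each dyadic grid, with a bound that is the same for all grids, followed by
  continuity of the path.
\<close>

lemma max_bound:
  assumes b: "b > 0" and l: "l > 0"
  shows "holds_except P (8 * b / l\<^sup>2) (\<lambda>\<omega>. \<forall>t\<in>{0..b}. \<bar>W t \<omega>\<bar> \<le> l)"
proof -
  define \<tau> where "\<tau> q i = real i * b / 2 ^ q" for q i :: nat
  define Q where "Q q \<omega> \<longleftrightarrow> (\<forall>j\<in>{..2^q}. \<bar>W (\<tau> q j) \<omega> - W 0 \<omega>\<bar> \<le> l)" for q \<omega>
  have "holds_except P (8 * b / l\<^sup>2) (\<lambda>\<omega>. \<forall>q. Q q \<omega>)"
  proof (rule holds_except_incseq)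
    fix q
    show "{\<omega>\<in>space P. Q q \<omega>} \<in> sets P" unfolding Q_def by measurable
    show "Q q \<omega>" if "Q (Suc q) \<omega>" for \<omega>
      unfolding Q_def
    proof
      fix j :: nat assume j: "j \<in> {..2^q}"
      then have "2 * j \<in> {..2^Suc q}" by auto
      then have "\<bar>W (\<tau> (Suc q) (2 * j)) \<omega> - W 0 \<omega>\<bar> \<le> l" using that by (simp add: Q_def)
      moreover have "\<tau> (Suc q) (2 * j) = \<tau> q j" by (simp add: \<tau>_def)
      ultimately show "\<bar>W (\<tau> q j) \<omega> - W 0 \<omega>\<bar> \<le> l" by simp
    qed
    have sm: "strict_mono_on {..2^q} (\<tau> q)"
      unfolding strict_mono_on_def \<tau>_def using b by (auto intro!: divide_strict_right_mono)
    have tel: "(\<Sum>i\<in>{j..<j'}. W (\<tau> q (Suc i)) \<omega> - W (\<tau> q i) \<omega>) = W (\<tau> q j') \<omega> - W (\<tau> q j) \<omega>"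
      if "j \<le> j'" for j j' \<omega> using sum_Suc_diff'[OF that, of "\<lambda>i. W (\<tau> q i) \<omega>"] by simp
    have "prob {\<omega>\<in>space P. \<exists>j\<le>2^q. \<bar>\<Sum>i<j. W (\<tau> q (Suc i)) \<omega> - W (\<tau> q i) \<omega>\<bar> > l} \<le> 8 * b / l\<^sup>2"
    proof (rule maximal_inequality[OF W_indep[OF sm] l])
      fix j :: nat and a :: real assume j: "j \<le> 2^q" "a > 0"
      have t: "\<tau> q j \<le> \<tau> q (2^q)" "0 \<le> \<tau> q j" "\<tau> q (2^q) = b"
      proof -
        have "real j \<le> real (2^q)" using j(1) by (rule of_nat_mono)
        then have "real j * b \<le> 2^q * b" using b by (intro mult_right_mono) simp_all
        then show "\<tau> q j \<le> \<tau> q (2^q)" "0 \<le> \<tau> q j" "\<tau> q (2^q) = b"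
          unfolding \<tau>_def using b by (simp_all add: field_simps)
      qed
      have "prob {\<omega>\<in>space P. \<bar>\<Sum>i\<in>{j..<2^q}. W (\<tau> q (Suc i)) \<omega> - W (\<tau> q i) \<omega>\<bar> > a} \<le> (\<tau> q (2^q) - \<tau> q j) / a\<^sup>2"
        unfolding tel[OF j(1)] by (rule W_increment_tail[OF t(1) j(2)])
      also have "\<dots> \<le> b / a\<^sup>2" using t by (intro divide_right_mono) auto
      finally show "prob {\<omega>\<in>space P. \<bar>\<Sum>i\<in>{j..<2^q}. W (\<tau> q (Suc i)) \<omega> - W (\<tau> q i) \<omega>\<bar> > a} \<le> b / a\<^sup>2" .
    qed
    moreover have "(\<Sum>i<j. W (\<tau> q (Suc i)) \<omega> - W (\<tau> q i) \<omega>) = W (\<tau> q j) \<omega> - W 0 \<omega>" for j \<omega>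
      using tel[of 0 j \<omega>] by (simp add: atLeast0LessThan \<tau>_def)
    ultimately show "prob {\<omega>\<in>space P. \<not> Q q \<omega>} \<le> 8 * b / l\<^sup>2"
      by (simp add: Q_def not_le Bex_def)
  qed
  then have "holds_except P (8 * b / l\<^sup>2 + 0) (\<lambda>\<omega>. (\<forall>q. Q q \<omega>) \<and> (W 0 \<omega> = 0 \<and> continuous_on UNIV (\<lambda>t. W t \<omega>)))"
    by (intro holds_except_conj holds_except_AE[OF W_path])
  then show ?thesis
  proof (rule holds_except_mono)
    fix \<omega> assume "(\<forall>q. Q q \<omega>) \<and> (W 0 \<omega> = 0 \<and> continuous_on UNIV (\<lambda>t. W t \<omega>))"
    then have Q: "Q q \<omega>" and W0: "W 0 \<omega> = 0" and c: "continuous_on UNIV (\<lambda>t. W t \<omega>)" for q by auto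
    show "\<forall>t\<in>{0..b}. \<bar>W t \<omega>\<bar> \<le> l"
    proof
      fix t assume t: "t \<in> {0..b}"
      define j where "j q = nat \<lfloor>t / b * 2^q\<rfloor>" for q :: nat
      have jr: "real (j q) \<le> t / b * 2^q" "t / b * 2^q < real (j q) + 1" for q
        unfolding j_def using t b by auto
      have "(\<lambda>q. \<tau> q (j q)) \<longlonglongrightarrow> t"
      proof (rule real_tendsto_sandwich)
        show "eventually (\<lambda>q. t - b * (1/2)^q \<le> \<tau> q (j q)) sequentially"
        proof (intro always_eventually allI)
          fix q :: nat
          have "t * 2^q \<le> (real (j q) + 1) * b" using jr(2)[of q] b by (simp add: field_simps)
          then have "t \<le> (real (j q) + 1) * b / 2^q" by (simp add: pos_le_divide_eq)
          then show "t - b * (1/2)^q \<le> \<tau> q (j q)"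
            by (simp add: \<tau>_def power_one_over add_divide_distrib distrib_right)
        qed
        show "eventually (\<lambda>q. \<tau> q (j q) \<le> t) sequentially"
        proof (intro always_eventually allI)
          fix q :: nat
          have "real (j q) * b \<le> t * 2^q" using jr(1)[of q] b by (simp add: field_simps)
          then show "\<tau> q (j q) \<le> t" by (simp add: \<tau>_def field_simps)
        qed
        have "(\<lambda>q. t - b * (1/2)^q) \<longlonglongrightarrow> t - b * 0" by (intro tendsto_intros LIMSEQ_power_zero) auto
        then show "(\<lambda>q. t - b * (1/2)^q) \<longlonglongrightarrow> t" by simp
      qed simp
      then have "(\<lambda>q. \<bar>W (\<tau> q (j q)) \<omega>\<bar>) \<longlonglongrightarrow> \<bar>W t \<omega>\<bar>"
        using c by (intro tendsto_rabs) (auto intro: continuous_on_tendsto_compose)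
      moreover have "\<bar>W (\<tau> q (j q)) \<omega>\<bar> \<le> l" for q
      proof -
        have "real (j q) \<le> t / b * 2^q" by (rule jr)
        also have "\<dots> \<le> 1 * 2^q" using t b by (intro mult_right_mono) auto
        finally have "real (j q) \<le> real (2^q)" by simp
        then have "j q \<le> 2^q" by (simp only: of_nat_le_iff)
        then show ?thesis using Q[of q] W0 by (auto simp: Q_def)
      qed
      ultimately show "\<bar>W t \<omega>\<bar> \<le> l" by (intro LIMSEQ_le_const2) auto
    qed
  qed simp
qed

lemma growth_bound:
  assumes "T > 0" "\<theta> > 0"
  shows "holds_except P (32 / (\<theta>\<^sup>2 * T)) (\<lambda>\<omega>. \<forall>t\<ge>T. \<bar>W t \<omega>\<bar> \<le> \<theta> * t)"
proof -
  have "holds_except P (32 / (\<theta>\<^sup>2 * T)) (\<lambda>\<omega>. \<forall>t\<in>{0..}. t \<ge> T \<longrightarrow> \<bar>W t \<omega>\<bar> \<le> \<theta> * t)"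
  proof (rule linear_growth_bound[OF _ assms])
    fix R l :: real assume "R > 0" "l > 0"
    from max_bound[OF this] show "holds_except P (8 * R / l\<^sup>2) (\<lambda>\<omega>. \<forall>t\<in>{0..}. t \<le> R \<longrightarrow> \<bar>W t \<omega>\<bar> \<le> l)"
      by (rule holds_except_mono) auto
  qed
  then show ?thesis by (rule holds_except_mono) (use assms in auto)
qed

lemma growth_bound_two_sided:
  assumes "T > 0" "\<theta> > 0"
  shows "holds_except P (64 / (\<theta>\<^sup>2 * T)) (\<lambda>\<omega>. \<forall>t. \<bar>t\<bar> \<ge> T \<longrightarrow> \<bar>W t \<omega>\<bar> \<le> \<theta> * \<bar>t\<bar>)"
proof -
  interpret r: two_sided_bm P "\<lambda>t. W (- t)" by (rule reverse)
  have "holds_except P (32 / (\<theta>\<^sup>2 * T) + 32 / (\<theta>\<^sup>2 * T))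
      (\<lambda>\<omega>. (\<forall>t\<ge>T. \<bar>W t \<omega>\<bar> \<le> \<theta> * t) \<and> (\<forall>t\<ge>T. \<bar>W (- t) \<omega>\<bar> \<le> \<theta> * t))"
    by (intro holds_except_conj growth_bound r.growth_bound assms)
  then show ?thesis
  proof (rule holds_except_mono)
    fix \<omega> assume A: "(\<forall>t\<ge>T. \<bar>W t \<omega>\<bar> \<le> \<theta> * t) \<and> (\<forall>t\<ge>T. \<bar>W (- t) \<omega>\<bar> \<le> \<theta> * t)"
    show "\<forall>t. \<bar>t\<bar> \<ge> T \<longrightarrow> \<bar>W t \<omega>\<bar> \<le> \<theta> * \<bar>t\<bar>"
    proof (intro allI impI)
      fix t assume "\<bar>t\<bar> \<ge> T"
      then show "\<bar>W t \<omega>\<bar> \<le> \<theta> * \<bar>t\<bar>"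
        using A[THEN conjunct1, rule_format, of t] A[THEN conjunct2, rule_format, of "-t"] by (cases "t \<ge> 0") auto
    qed
  qed (simp add: mult.commute)
qed

lemma max_bound_two_sided:
  assumes "b > 0" "l > 0"
  shows "holds_except P (16 * b / l\<^sup>2) (\<lambda>\<omega>. \<forall>t. \<bar>t\<bar> \<le> b \<longrightarrow> \<bar>W t \<omega>\<bar> \<le> l)"
proof -
  interpret r: two_sided_bm P "\<lambda>t. W (- t)" by (rule reverse)
  have "holds_except P (8 * b / l\<^sup>2 + 8 * b / l\<^sup>2)
      (\<lambda>\<omega>. (\<forall>t\<in>{0..b}. \<bar>W t \<omega>\<bar> \<le> l) \<and> (\<forall>t\<in>{0..b}. \<bar>W (- t) \<omega>\<bar> \<le> l))"
    by (intro holds_except_conj max_bound r.max_bound assms)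
  then show ?thesis
  proof (rule holds_except_mono)
    fix \<omega> assume A: "(\<forall>t\<in>{0..b}. \<bar>W t \<omega>\<bar> \<le> l) \<and> (\<forall>t\<in>{0..b}. \<bar>W (- t) \<omega>\<bar> \<le> l)"
    show "\<forall>t. \<bar>t\<bar> \<le> b \<longrightarrow> \<bar>W t \<omega>\<bar> \<le> l"
    proof (intro allI impI)
      fix t assume "\<bar>t\<bar> \<le> b"
      then show "\<bar>W t \<omega>\<bar> \<le> l"
        using A[THEN conjunct1, rule_format, of t] A[THEN conjunct2, rule_format, of "-t"] by (cases "t \<ge> 0") auto
    qed
  qed simp
qed

end

section \<open>The supporting chord of Brownian motion with parabolic drift\<close>

lemma std_normal_cdf_pos: "cdf std_normal_distribution x > 0"
proof (rule ccontr)
  interpret N: prob_space std_normal_distribution by (rule prob_space_normal_density) simp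
  assume "\<not> ?thesis"
  then have "measure std_normal_distribution {..x} = 0" by (simp add: cdf_def zero_less_measure_iff)
  then have "{..x} \<in> null_sets std_normal_distribution"
    by (auto simp: N.emeasure_eq_measure null_sets_def)
  then have "AE y in lborel. y \<in> {..x} \<longrightarrow> ennreal (std_normal_density y) = 0"
    by (subst (asm) null_sets_density_iff) auto
  then have "AE y in lborel. y \<notin> {..x}"
    by eventually_elim (use normal_density_pos[of 1 0] in \<open>simp add: ennreal_eq_0_iff not_le[symmetric] del: not_le\<close>)
  then have "{..x} \<in> null_sets lborel" by (subst AE_iff_null_sets) auto
  then have "{x - 1..x} \<in> null_sets lborel" by (rule null_sets_subset) auto
  then have "emeasure lborel {x - 1..x} = 0" by (rule null_setsD1)
  then show False by simp
qed

context two_sided_bm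
begin

text \<open>
  On the geometrically separated times \<open>\<tau> l\<close> the normalised increments of
  \<open>W\<close> are independent and each is below a fixed negative multiple of the square root of
  its time with positive probability, so with probability near one at least one of them is.  At that
  time the path lies below every line of slope at most \<open>B\<close> in modulus through a graph
  point over \<open>[0, \<tau> 0]\<close>, since near zero the square root dominates all linear terms.
\<close>

lemma not_vertex_right:
  assumes B: "B > 0" and p: "p > 0"
  shows "\<exists>\<eta>>0. holds_except P p (\<lambda>\<omega>. \<forall>q\<in>{0..\<eta>}. \<forall>s\<in>{-B..B}. \<exists>t. W t \<omega> + t\<^sup>2 < W q \<omega> + q\<^sup>2 + s * (t - q))"
proof -
  \<comment> \<open>A lower bound for the probability of each favourable increment.\<close>
  define \<pi>0 where "\<pi>0 = cdf std_normal_distribution (-4)"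
  have pi0: "\<pi>0 > 0" "\<pi>0 \<le> 1"
  proof -
    interpret N: real_distribution std_normal_distribution by (rule real_dist_normal_dist)
    show "\<pi>0 > 0" "\<pi>0 \<le> 1" unfolding \<pi>0_def by (auto intro: std_normal_cdf_pos N.cdf_bounded_prob)
  qed
  have "(\<lambda>r. (1 - \<pi>0) ^ r) \<longlonglongrightarrow> 0" using pi0 by (intro LIMSEQ_power_zero) auto
  then have "eventually (\<lambda>r. (1 - \<pi>0) ^ r < p / 2) sequentially" using p by (intro order_tendstoD) auto
  then obtain r where r: "(1 - \<pi>0) ^ r < p / 2" by (auto simp: eventually_sequentially)
  \<comment> \<open>The ratio \<open>M\<^sup>2\<close> of consecutive times keeps the path before \<open>\<tau> l\<close> below half the root of
    \<open>\<tau> (Suc l)\<close>, for all \<open>r\<close> times simultaneously.\<close>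
  define M where "M = 2 + sqrt (64 * (real r) / p)"
  have M: "M \<ge> 2" "32 * real r / M\<^sup>2 \<le> p / 2"
  proof -
    show M2: "M \<ge> 2" using p by (simp add: M_def)
    have "64 * real r / p = (sqrt (64 * real r / p))\<^sup>2" using p by simp
    also have "\<dots> \<le> M\<^sup>2" using p by (intro power_mono) (auto simp: M_def)
    finally show "32 * real r / M\<^sup>2 \<le> p / 2" using M2 p by (simp add: field_simps)
  qed
  \<comment> \<open>Below \<open>t0\<close> the square root of the time exceeds \<open>(B + 1)\<close> times the time.\<close>
  define t0 where "t0 = (1 / (2 * (B + 1)))\<^sup>2"
  have t0: "t0 > 0" using B by (simp add: t0_def)
  define \<tau> where "\<tau> l = t0 / (M\<^sup>2) ^ (r - l)" for l
  have \<tau>0: "\<tau> l > 0" "\<tau> l \<le> t0" for l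
  proof -
    show "\<tau> l > 0" using t0 M by (simp add: \<tau>_def)
    have "1 \<le> M" using M by simp
    then have "1 \<le> (M\<^sup>2) ^ (r - l)" by simp
    then show "\<tau> l \<le> t0" unfolding \<tau>_def using t0 by (simp add: divide_le_eq mult_le_cancel_left1)
  qed
  have \<tau>S: "\<tau> (Suc l) = M\<^sup>2 * \<tau> l" if "l < r" for l
  proof -
    have "r - l = Suc (r - Suc l)" using that by simp
    then show ?thesis using M by (simp add: \<tau>_def)
  qed
  have sm: "strict_mono_on {..r} \<tau>"
  proof -
    have "\<tau> l < \<tau> (Suc l)" if "l < r" for l
    proof -
      have "1 < M" using M by simp
      then have "1 < M\<^sup>2" by (simp add: one_less_power)
      then show ?thesis using \<tau>S[OF that] \<tau>0(1)[of l] by simp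
    qed
    then have "\<tau> l < \<tau> l'" if "l < l'" "l' \<le> r" for l l'
      using that
    proof (induction l')
      case (Suc l')
      then show ?case using \<open>\<And>l. l < r \<Longrightarrow> \<tau> l < \<tau> (Suc l)\<close>[of l'] by (cases "l = l'") (auto intro: less_trans)
    qed simp
    then show ?thesis by (auto simp: strict_mono_on_def)
  qed
  define X where "X l \<omega> = W (\<tau> (Suc l)) \<omega> - W (\<tau> l) \<omega>" for l \<omega>
  have ind: "indep_vars (\<lambda>_. borel) X {..<r}" using W_indep[OF sm] by (simp add: X_def[abs_def])
  define A where "A = {\<omega>\<in>space P. \<forall>l\<in>{..<r}. X l \<omega> > - 2 * sqrt (\<tau> (Suc l))}"
  have A: "A \<in> events" unfolding A_def X_def by measurable
  have pA: "prob A \<le> (1 - \<pi>0) ^ r"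
  proof (cases "r = 0")
    case False
    have "A = (\<Inter>l\<in>{..<r}. X l -` {- 2 * sqrt (\<tau> (Suc l))<..} \<inter> space P)" using False by (auto simp: A_def)
    also have "prob \<dots> = (\<Prod>l\<in>{..<r}. prob (X l -` {- 2 * sqrt (\<tau> (Suc l))<..} \<inter> space P))"
      by (rule indep_varsD_finite[OF ind]) (use False in auto)
    also have "\<dots> \<le> (\<Prod>l\<in>{..<r}. 1 - \<pi>0)"
    proof (intro prod_mono conjI)
      fix l assume l: "l \<in> {..<r}"
      have lt: "\<tau> l < \<tau> (Suc l)" using sm l by (intro strict_mono_onD[OF sm]) auto
      have d: "\<tau> (Suc l) / 4 \<le> \<tau> (Suc l) - \<tau> l"
      proof -
        have "4 * \<tau> l \<le> M\<^sup>2 * \<tau> l" using M \<tau>0(1)[of l] power_mono[of 2 M 2] by (intro mult_right_mono) auto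
        moreover have "\<tau> (Suc l) = M\<^sup>2 * \<tau> l" using \<tau>S l by simp
        ultimately show ?thesis using \<tau>0(1)[of l] by linarith
      qed
      have "sqrt (\<tau> (Suc l)) / 2 \<le> sqrt (\<tau> (Suc l) - \<tau> l)"
        using real_sqrt_le_mono[OF d] by (simp add: real_sqrt_divide)
      then have "-4 \<le> (- 2 * sqrt (\<tau> (Suc l))) / sqrt (\<tau> (Suc l) - \<tau> l)"
        using lt by (simp add: field_simps)
      then have "\<pi>0 \<le> prob {\<omega>\<in>space P. X l \<omega> \<le> - 2 * sqrt (\<tau> (Suc l))}"
        unfolding X_def W_increment_cdf[OF lt] \<pi>0_def
        by (intro finite_borel_measure.cdf_nondecreasing real_distribution.axioms)
          (use real_distribution.finite_borel_measure_M[OF real_dist_normal_dist] in auto)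
      moreover have "X l -` {- 2 * sqrt (\<tau> (Suc l))<..} \<inter> space P = space P - {\<omega>\<in>space P. X l \<omega> \<le> - 2 * sqrt (\<tau> (Suc l))}"
        by auto
      moreover have "{\<omega>\<in>space P. X l \<omega> \<le> - 2 * sqrt (\<tau> (Suc l))} \<in> events" unfolding X_def by measurable
      ultimately show "prob (X l -` {- 2 * sqrt (\<tau> (Suc l))<..} \<inter> space P) \<le> 1 - \<pi>0"
        by (simp add: prob_compl)
    qed simp
    finally show ?thesis by simp
  qed simp
  have "holds_except P (p / 2) (\<lambda>\<omega>. \<exists>l<r. X l \<omega> \<le> - 2 * sqrt (\<tau> (Suc l)))"
    by (rule holds_exceptI[of A]) (use A pA r in \<open>auto simp: A_def not_less\<close>)
  moreover have "holds_except P (\<Sum>l<r. 32 / M\<^sup>2) (\<lambda>\<omega>. \<forall>l\<in>{..<r}. \<forall>t\<in>{0..\<tau> l}. \<bar>W t \<omega>\<bar> \<le> M / 2 * sqrt (\<tau> l))"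
  proof (rule holds_except_ball)
    fix l
    have "8 * \<tau> l / (M / 2 * sqrt (\<tau> l))\<^sup>2 = 32 / M\<^sup>2"
      using \<tau>0(1)[of l] M by (simp add: power_mult_distrib power_divide field_simps)
    then show "holds_except P (32 / M\<^sup>2) (\<lambda>\<omega>. \<forall>t\<in>{0..\<tau> l}. \<bar>W t \<omega>\<bar> \<le> M / 2 * sqrt (\<tau> l))"
      using max_bound[OF \<tau>0(1)[of l], of "M / 2 * sqrt (\<tau> l)"] \<tau>0(1)[of l] M by simp
  qed simp
  ultimately have "holds_except P (p / 2 + (\<Sum>l<r. 32 / M\<^sup>2)) (\<lambda>\<omega>. (\<exists>l<r. X l \<omega> \<le> - 2 * sqrt (\<tau> (Suc l))) \<and>
      (\<forall>l\<in>{..<r}. \<forall>t\<in>{0..\<tau> l}. \<bar>W t \<omega>\<bar> \<le> M / 2 * sqrt (\<tau> l)))"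
    by (rule holds_except_conj)
  then have "holds_except P p (\<lambda>\<omega>. \<forall>q\<in>{0..\<tau> 0}. \<forall>s\<in>{-B..B}. \<exists>t. W t \<omega> + t\<^sup>2 < W q \<omega> + q\<^sup>2 + s * (t - q))"
  proof (rule holds_except_mono)
    have "(\<Sum>l<r. 32 / M\<^sup>2) = 32 * real r / M\<^sup>2" by simp
    then show "p / 2 + (\<Sum>l<r. 32 / M\<^sup>2) \<le> p" using M(2) by linarith
    fix \<omega> assume H: "(\<exists>l<r. X l \<omega> \<le> - 2 * sqrt (\<tau> (Suc l))) \<and>
      (\<forall>l\<in>{..<r}. \<forall>t\<in>{0..\<tau> l}. \<bar>W t \<omega>\<bar> \<le> M / 2 * sqrt (\<tau> l))"
    then obtain l where l: "l < r" "X l \<omega> \<le> - 2 * sqrt (\<tau> (Suc l))" by auto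
    show "\<forall>q\<in>{0..\<tau> 0}. \<forall>s\<in>{-B..B}. \<exists>t. W t \<omega> + t\<^sup>2 < W q \<omega> + q\<^sup>2 + s * (t - q)"
    proof (intro ballI exI)
      fix q s assume q: "q \<in> {0..\<tau> 0}" and s: "s \<in> {-B..B}"
      define u where "u = \<tau> (Suc l)"
      have "\<tau> 0 \<le> \<tau> l" using strict_mono_onD[OF sm, of 0 l] l by (cases "l = 0") auto
      then have ql: "q \<in> {0..\<tau> l}" using q by auto
      have lu: "\<tau> l < u" unfolding u_def using l by (intro strict_mono_onD[OF sm]) auto
      have b: "\<bar>W t \<omega>\<bar> \<le> M / 2 * sqrt (\<tau> l)" if "t \<in> {0..\<tau> l}" for t using H l that by auto
      have "\<bar>W (\<tau> l) \<omega>\<bar> \<le> M / 2 * sqrt (\<tau> l)" "\<bar>W q \<omega>\<bar> \<le> M / 2 * sqrt (\<tau> l)"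
        using b[of "\<tau> l"] b[OF ql] \<tau>0(1)[of l] by auto
      moreover have "M * sqrt (\<tau> l) = sqrt u"
        using \<tau>S[OF l(1)] M by (simp add: u_def real_sqrt_mult)
      ultimately have "W (\<tau> l) \<omega> - W q \<omega> \<le> sqrt u" by (simp add: abs_le_iff)
      then have main: "W u \<omega> - W q \<omega> \<le> - sqrt u" using l(2) by (simp add: X_def u_def)
      have u: "0 < u" "u \<le> t0" using \<tau>0 by (auto simp: u_def)
      have "sqrt u \<le> sqrt t0" using u by simp
      also have "sqrt t0 = 1 / (2 * (B + 1))" using B by (simp add: t0_def)
      finally have su: "(B + 1) * sqrt u \<le> 1 / 2" using B by (simp add: field_simps)
      have "(B + 1) * sqrt u * sqrt u < 1 * sqrt u" using su u by (intro mult_strict_right_mono) auto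
      then have *: "(B + 1) * u < sqrt u" using u by (simp add: mult.assoc)
      have "1 / (2 * (B + 1)) \<le> 1" using B by simp
      then have "t0 \<le> 1" unfolding t0_def using B by (intro power_le_one) auto
      then have "u * u \<le> 1 * u" using u by (intro mult_right_mono) auto
      then have u2: "u\<^sup>2 \<le> u" by (simp add: power2_eq_square)
      have "\<bar>s\<bar> * \<bar>u - q\<bar> \<le> B * u" using s ql lu q by (intro mult_mono) auto
      then have "s * (u - q) \<ge> - (B * u)" by (simp add: abs_mult[symmetric] abs_le_iff)
      moreover have "B * u + u < sqrt u" using * by (simp add: algebra_simps)
      ultimately show "W u \<omega> + u\<^sup>2 < W q \<omega> + q\<^sup>2 + s * (u - q)"
        using main u2 zero_le_power2[of q] by linarith
    qed
  qed
  then show ?thesis using \<tau>0(1)[of 0] by blast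
qed

text \<open>
  The path is bounded below everywhere and bounded above at \<open>1\<close> and \<open>- 1\<close>.
  A line that supports it at a point left of zero and at a point right of zero can therefore be
  neither too steep nor too flat.
\<close>

lemma chord_slope_bounded:
  assumes p: "p > 0"
  shows "\<exists>B>0. holds_except P p (\<lambda>\<omega>. \<forall>l q s. l \<le> 0 \<longrightarrow> 0 \<le> q \<longrightarrow>
     (\<forall>t. W t \<omega> + t\<^sup>2 \<ge> W l \<omega> + l\<^sup>2 + s * (t - l)) \<longrightarrow>
     W q \<omega> + q\<^sup>2 = W l \<omega> + l\<^sup>2 + s * (q - l) \<longrightarrow> \<bar>s\<bar> \<le> B)"
proof -
  \<comment> \<open>Beyond \<open>T\<close> the parabola dominates the path, off a set of probability \<open>p / 2\<close>.\<close>
  define T where "T = max 1 (2048 / p)"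
  have T: "T \<ge> 1" "T > 0" by (auto simp: T_def)
  have "1024 / T^3 \<le> p / 2"
  proof -
    have "T * 1 \<le> T * T^2" using T by (intro mult_left_mono) auto
    then have T3: "T \<le> T^3" by (simp add: power3_eq_cube power2_eq_square)
    have "2048 / p \<le> T" by (simp add: T_def)
    then have "2048 \<le> p * T" using p by (simp add: field_simps)
    also have "\<dots> \<le> p * T^3" using T3 p by (intro mult_left_mono) auto
    finally show ?thesis using T by (simp add: field_simps)
  qed
  moreover have "64 / ((T / 4)\<^sup>2 * T) = 1024 / T^3" using T by (simp add: power2_eq_square power3_eq_cube field_simps)
  ultimately have g: "holds_except P (p / 2) (\<lambda>\<omega>. \<forall>t. \<bar>t\<bar> \<ge> T \<longrightarrow> \<bar>W t \<omega>\<bar> \<le> T / 4 * \<bar>t\<bar>)"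
    using growth_bound_two_sided[of T "T / 4"] T by simp (erule holds_except_mono, auto)
  define l where "l = sqrt (32 * T / p)"
  have l: "l > 0" "16 * T / l\<^sup>2 = p / 2" using T p by (auto simp: l_def)
  have "holds_except P (p / 2 + p / 2) (\<lambda>\<omega>. (\<forall>t. \<bar>t\<bar> \<ge> T \<longrightarrow> \<bar>W t \<omega>\<bar> \<le> T / 4 * \<bar>t\<bar>) \<and> (\<forall>t. \<bar>t\<bar> \<le> T \<longrightarrow> \<bar>W t \<omega>\<bar> \<le> l))"
    using max_bound_two_sided[OF T(2) l(1)] l(2) by (intro holds_except_conj g) simp
  then have "holds_except P p (\<lambda>\<omega>. \<forall>ll q s. ll \<le> 0 \<longrightarrow> 0 \<le> q \<longrightarrow>
     (\<forall>t. W t \<omega> + t\<^sup>2 \<ge> W ll \<omega> + ll\<^sup>2 + s * (t - ll)) \<longrightarrow>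
     W q \<omega> + q\<^sup>2 = W ll \<omega> + ll\<^sup>2 + s * (q - ll) \<longrightarrow> \<bar>s\<bar> \<le> 2 * l + 1)"
  proof (rule holds_except_mono)
    fix \<omega> assume H: "(\<forall>t. \<bar>t\<bar> \<ge> T \<longrightarrow> \<bar>W t \<omega>\<bar> \<le> T / 4 * \<bar>t\<bar>) \<and> (\<forall>t. \<bar>t\<bar> \<le> T \<longrightarrow> \<bar>W t \<omega>\<bar> \<le> l)"
    define V where "V t = W t \<omega> + t\<^sup>2" for t
    have low: "V t \<ge> - l" for t
    proof (cases "\<bar>t\<bar> \<le> T")
      case True
      then have "\<bar>W t \<omega>\<bar> \<le> l" using H by blast
      then show ?thesis using zero_le_power2[of t] unfolding V_def by linarith
    next
      case False
      then have 1: "\<bar>W t \<omega>\<bar> \<le> T / 4 * \<bar>t\<bar>" using H by auto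
      have "T / 4 * \<bar>t\<bar> \<le> \<bar>t\<bar> * \<bar>t\<bar>" using False T by (intro mult_right_mono) auto
      then have "T / 4 * \<bar>t\<bar> \<le> t\<^sup>2" by (simp add: power2_eq_square)
      then show ?thesis using 1 l unfolding V_def by linarith
    qed
    have one: "V 1 \<le> l + 1" "V (- 1) \<le> l + 1"
      using H[THEN conjunct2, rule_format, of 1] H[THEN conjunct2, rule_format, of "-1"] T unfolding V_def by auto
    show "\<forall>ll q s. ll \<le> 0 \<longrightarrow> 0 \<le> q \<longrightarrow> (\<forall>t. W t \<omega> + t\<^sup>2 \<ge> W ll \<omega> + ll\<^sup>2 + s * (t - ll)) \<longrightarrow>
       W q \<omega> + q\<^sup>2 = W ll \<omega> + ll\<^sup>2 + s * (q - ll) \<longrightarrow> \<bar>s\<bar> \<le> 2 * l + 1"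
    proof (intro allI impI)
      fix ll q s :: real
      assume a: "ll \<le> 0" "0 \<le> q" and s1: "\<forall>t. W t \<omega> + t\<^sup>2 \<ge> W ll \<omega> + ll\<^sup>2 + s * (t - ll)"
        and s2: "W q \<omega> + q\<^sup>2 = W ll \<omega> + ll\<^sup>2 + s * (q - ll)"
      have s1: "V t \<ge> V ll + s * (t - ll)" for t using s1 by (simp add: V_def)
      have s2: "V q = V ll + s * (q - ll)" using s2 by (simp add: V_def)
      have "s * (1 - ll) \<le> 2 * l + 1" using s1[of 1] one low[of ll] by linarith
      then have "s \<le> 2 * l + 1"
      proof (cases "s \<le> 0")
        case False
        then have "s * 1 \<le> s * (1 - ll)" using a by (intro mult_left_mono) auto
        then show ?thesis using \<open>s * (1 - ll) \<le> 2 * l + 1\<close> by linarith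
      qed (use l in linarith)
      moreover have "s * (q + 1) \<ge> - (2 * l + 1)"
        using s1[of "-1"] s2 one low[of q] by (simp add: algebra_simps)
      then have "s \<ge> - (2 * l + 1)"
      proof (cases "s \<ge> 0")
        case False
        then have "s * (q + 1) \<le> s * 1" using a by (intro mult_left_mono_neg) auto
        then show ?thesis using \<open>s * (q + 1) \<ge> - (2 * l + 1)\<close> by linarith
      qed (use l in linarith)
      ultimately show "\<bar>s\<bar> \<le> 2 * l + 1" by linarith
    qed
  qed simp
  then show ?thesis using l by (intro exI[of _ "2 * l + 1"]) auto
qed

text \<open>
  Fix all increments except the one, of variance at least \<open>w\<close>, between the times of
  \<open>I2\<close> and those of \<open>I3\<close>.  The lower envelopes over \<open>I1\<close> and
  \<open>I2\<close> differ in their rate of change in \<open>s\<close> by at least \<open>w\<close>,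
  so a near tie between them determines \<open>s\<close> up to \<open>2 * \<kappa> / w\<close>.  The
  envelope over \<open>I3\<close> moves one for one with the remaining increment, so a second near tie
  determines that increment up to a multiple of \<open>\<kappa>\<close>, and its density is bounded.
  Rational \<open>s\<close> keep the bad event measurable.
\<close>

lemma tie_indexed:
  fixes \<tau> :: "nat \<Rightarrow> real"
  assumes sm: "strict_mono_on {..k} \<tau>" and i0: "i0 < k" and gap: "\<tau> i0 + w \<le> \<tau> (Suc i0)" and w: "w > 0"
    and I: "I1 \<subseteq> {..i0}" "I2 \<subseteq> {..i0}" "I3 \<subseteq> {Suc i0..k}" "I1 \<noteq> {}" "I2 \<noteq> {}" "I3 \<noteq> {}"
    and lo: "\<And>i. i \<in> I1 \<Longrightarrow> \<tau> i \<le> lo" "\<And>i. i \<in> I2 \<Longrightarrow> lo + w \<le> \<tau> i"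
    and T: "\<And>i. i \<le> k \<Longrightarrow> \<bar>\<tau> i\<bar> \<le> T" and \<kappa>: "\<kappa> > 0"
  defines "m \<equiv> \<lambda>I \<omega> s. Min ((\<lambda>i. (W (\<tau> i) \<omega> + (\<tau> i)\<^sup>2) - s * \<tau> i) ` I)"
  shows "holds_except P (2 * (1 / sqrt w) * (2 * \<kappa> * (1 + 2 * T / w)))
    (\<lambda>\<omega>. \<not> (\<exists>s::rat. \<bar>m I1 \<omega> (of_rat s) - m I2 \<omega> (of_rat s)\<bar> < \<kappa> \<and> \<bar>m I3 \<omega> (of_rat s) - m I1 \<omega> (of_rat s)\<bar> < \<kappa>))"
proof -
  have T0: "T \<ge> 0" using T[of 0] by simp
  have fin: "finite I1" "finite I2" "finite I3" using I by (auto intro: finite_subset)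
  define X where "X i \<omega> = W (\<tau> (Suc i)) \<omega> - W (\<tau> i) \<omega>" for i \<omega>
  define R where "R = {..<k} - {i0}"
  define N where "N = PiM R (\<lambda>_. borel :: real measure)"
  define Y where "Y \<omega> = restrict (\<lambda>i. X i \<omega>) R" for \<omega>
  define N' where "N' = PiM {i0} (\<lambda>_. borel :: real measure)"
  define X0 where "X0 \<omega> = restrict (\<lambda>i. X i \<omega>) {i0}" for \<omega>
  have ind: "indep_vars (\<lambda>_. borel) X {..<k}" using W_indep[OF sm] by (simp add: X_def[abs_def])
  have "indep_var (PiM {i0} (\<lambda>_. borel)) (\<lambda>\<omega>. restrict (\<lambda>i. X i \<omega>) {i0}) N Y"
    unfolding N_def Y_def[abs_def] by (rule indep_var_restrict[OF ind]) (use i0 in \<open>auto simp: R_def\<close>)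
  then have iv: "indep_var N' X0 N Y" by (simp add: N'_def X0_def[abs_def])
  \<comment> \<open>The path at the times \<open>\<tau> i\<close>, up to its value at \<open>\<tau> 0\<close>, as a function of the singled out increment
    and of the others.\<close>
  define S where "S z i = (\<Sum>l<i. if l = i0 then fst z i0 else snd z l)" for z :: "(nat \<Rightarrow> real) \<times> (nat \<Rightarrow> real)" and i
  define mm where "mm I z s = Min ((\<lambda>i. (S z i + (\<tau> i)\<^sup>2) - s * \<tau> i) ` I)" for I z s
  have SW: "S (X0 \<omega>, Y \<omega>) i = W (\<tau> i) \<omega> - W (\<tau> 0) \<omega>" if "i \<le> k" for i \<omega>
  proof -
    have "S (X0 \<omega>, Y \<omega>) i = (\<Sum>l<i. X l \<omega>)"
      unfolding S_def by (intro sum.cong) (use that in \<open>auto simp: Y_def R_def X0_def\<close>)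
    also have "\<dots> = W (\<tau> i) \<omega> - W (\<tau> 0) \<omega>"
      unfolding X_def using sum_Suc_diff'[of 0 i "\<lambda>i. W (\<tau> i) \<omega>"] by (simp add: atLeast0LessThan)
    finally show ?thesis .
  qed
  have mmW: "mm I (X0 \<omega>, Y \<omega>) s = m I \<omega> s - W (\<tau> 0) \<omega>" if "finite I" "I \<noteq> {}" "I \<subseteq> {..k}" for I \<omega> s
  proof -
    have "mm I (X0 \<omega>, Y \<omega>) s = Min ((\<lambda>i. ((W (\<tau> i) \<omega> + (\<tau> i)\<^sup>2) - s * \<tau> i) + - W (\<tau> 0) \<omega>) ` I)"
      unfolding mm_def using SW that by (intro arg_cong[where f=Min] image_cong) auto
    also have "\<dots> = m I \<omega> s + - W (\<tau> 0) \<omega>"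
      unfolding m_def by (rule Min_add_commute) (use that in auto)
    finally show ?thesis by simp
  qed
  have Sm: "(\<lambda>z. S z i) \<in> borel_measurable (N' \<Otimes>\<^sub>M N)" if "i \<le> k" for i
    unfolding S_def
  proof (rule borel_measurable_sum)
    fix l assume l: "l \<in> {..<i}"
    have m0: "(\<lambda>x. x i0) \<in> borel_measurable N'" unfolding N'_def by (rule measurable_component_singleton) simp
    show "(\<lambda>z. if l = i0 then fst z i0 else snd z l) \<in> borel_measurable (N' \<Otimes>\<^sub>M N)"
    proof (cases "l = i0")
      case False
      then have "l \<in> R" using l that by (auto simp: R_def)
      then have "(\<lambda>y. y l) \<in> borel_measurable N" unfolding N_def by (rule measurable_component_singleton)
      then show ?thesis using False by (simp add: measurable_compose[OF measurable_snd])
    qed (use m0 in \<open>simp add: measurable_compose[OF measurable_fst]\<close>)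
  qed
  have mmm: "(\<lambda>z. mm I z s) \<in> borel_measurable (N' \<Otimes>\<^sub>M N)" if "finite I" "I \<subseteq> {..k}" for I s
    unfolding mm_def using that Sm
    by (intro borel_measurable_Min borel_measurable_diff borel_measurable_add) auto
  define B where "B = {z \<in> space (N' \<Otimes>\<^sub>M N). \<exists>s::rat. \<bar>mm I1 z (of_rat s) - mm I2 z (of_rat s)\<bar> < \<kappa> \<and>
      \<bar>mm I3 z (of_rat s) - mm I1 z (of_rat s)\<bar> < \<kappa>}"
  have Ik: "I1 \<subseteq> {..k}" "I2 \<subseteq> {..k}" "I3 \<subseteq> {..k}" using I i0 by auto
  note [measurable] = mmm[OF fin(1) Ik(1)] mmm[OF fin(2) Ik(2)] mmm[OF fin(3) Ik(3)]
  have B: "B \<in> sets (N' \<Otimes>\<^sub>M N)" unfolding B_def by measurable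
  have gapk: "\<tau> i0 + w \<le> \<tau> (Suc i0)" by fact
  define d where "d = 2 * \<kappa> * (1 + 2 * T / w)"
  have d0: "d \<ge> 0" using \<kappa> T0 w by (simp add: d_def)
  \<comment> \<open>Two values of the singled out increment that both allow a near tie, possibly at different slopes.\<close>
  have diam: "\<bar>x i0 - x' i0\<bar> \<le> d" if xB: "(x, y) \<in> B" "(x', y) \<in> B" for x x' y
  proof -
    obtain s where s: "\<bar>mm I1 (x, y) s - mm I2 (x, y) s\<bar> < \<kappa>" "\<bar>mm I3 (x, y) s - mm I1 (x, y) s\<bar> < \<kappa>"
      using xB(1) unfolding B_def by blast
    obtain s' where s': "\<bar>mm I1 (x', y) s' - mm I2 (x', y) s'\<bar> < \<kappa>" "\<bar>mm I3 (x', y) s' - mm I1 (x', y) s'\<bar> < \<kappa>"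
      using xB(2) unfolding B_def by blast
    define Q where "Q i = (\<Sum>l<i. if l = i0 then 0 else y l)" for i
    have Slow: "S (z, y) i = Q i" if "i \<le> i0" for i z
      unfolding S_def Q_def by (intro sum.cong) (use that in auto)
    have Shigh: "S (z, y) i = Q i + z i0" if "i > i0" for i z
    proof -
      have "S (z, y) i = (\<Sum>l<i. (if l = i0 then 0 else y l) + (if l = i0 then z i0 else 0))"
        unfolding S_def by (intro sum.cong) auto
      also have "\<dots> = Q i + (\<Sum>l<i. if l = i0 then z i0 else 0)" by (simp add: sum.distrib Q_def)
      also have "(\<Sum>l<i. if l = i0 then z i0 else 0) = z i0" using that by simp
      finally show ?thesis .
    qed
    define n where "n I s = Min ((\<lambda>i. (Q i + (\<tau> i)\<^sup>2) - s * \<tau> i) ` I)" for I s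
    have n1: "mm I (z, y) s = n I s" if "I \<subseteq> {..i0}" for I z s
      unfolding mm_def n_def using that Slow by (intro arg_cong[where f=Min] image_cong) auto
    have n3: "mm I3 (z, y) s = n I3 s + z i0" for z s
    proof -
      have "mm I3 (z, y) s = Min ((\<lambda>i. ((Q i + (\<tau> i)\<^sup>2) - s * \<tau> i) + z i0) ` I3)"
        unfolding mm_def using I Shigh by (intro arg_cong[where f=Min] image_cong) (auto simp: Suc_le_eq subset_eq)
      also have "\<dots> = n I3 s + z i0" unfolding n_def by (rule Min_add_commute) (use fin I in auto)
      finally show ?thesis .
    qed
    have lip: "\<bar>n I s - n I s'\<bar> \<le> \<bar>s - s'\<bar> * T" if "finite I" "I \<noteq> {}" "I \<subseteq> {..k}" for I
      unfolding n_def by (rule min_affine_lipschitz) (use that T in auto)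
    have close: "(b - a) * w \<le> 2 * \<kappa>" if ab: "a \<le> b" and
      "\<bar>n I1 a - n I2 a\<bar> < \<kappa>" "\<bar>n I1 b - n I2 b\<bar> < \<kappa>" for a b
    proof -
      have "n I1 b \<ge> n I1 a - (b - a) * lo" unfolding n_def
        by (rule min_affine_mono(2)) (use fin I lo ab in auto)
      moreover have "n I2 b \<le> n I2 a - (b - a) * (lo + w)" unfolding n_def
        by (rule min_affine_mono(1)) (use fin I lo ab in auto)
      ultimately show ?thesis using that by (simp add: algebra_simps abs_less_iff)
    qed
    have "\<bar>s - s'\<bar> * w \<le> 2 * \<kappa>"
      using close[of s s'] close[of s' s] s s' by (cases "s \<le> s'") (auto simp: n1[OF I(1)] n1[OF I(2)] abs_if)
    then have "\<bar>s - s'\<bar> \<le> 2 * \<kappa> / w" using w by (simp add: field_simps)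
    then have sT: "\<bar>s - s'\<bar> * T \<le> 2 * \<kappa> / w * T" using T0 by (rule mult_right_mono)
    have "\<bar>x i0 - x' i0\<bar> \<le> 2 * \<kappa> + 2 * (\<bar>s - s'\<bar> * T)"
      using s(2) s'(2) lip[OF fin(1) I(4) Ik(1)] lip[OF fin(3) I(6) Ik(3)]
      unfolding n1[OF I(1)] n3 by (simp add: abs_le_iff abs_less_iff)
    also have "\<dots> \<le> d" using sT w by (simp add: d_def field_simps)
    finally show ?thesis .
  qed
  have pB: "prob {\<omega>\<in>space P. (X0 \<omega>, Y \<omega>) \<in> B} \<le> 2 * (1 / sqrt w) * d"
  proof (rule anticoncentration[OF iv _ _ _ B, where h="\<lambda>x. x i0"])
    show "(\<lambda>x. x i0) \<in> borel_measurable N'" unfolding N'_def by (rule measurable_component_singleton) simp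
    show "prob {\<omega> \<in> space P. X0 \<omega> i0 \<in> {a..b}} \<le> 1 / sqrt w * (b - a)" if "a \<le> b" for a b
      using W_increment_interval[OF w gapk that] by (simp add: X0_def X_def)
  qed (use diam d0 w in auto)
  have mY: "(\<lambda>\<omega>. (X0 \<omega>, Y \<omega>)) \<in> measurable P (N' \<Otimes>\<^sub>M N)"
    using iv by (intro measurable_Pair) (auto dest: indep_var_rv1 indep_var_rv2)
  show ?thesis
  proof (rule holds_exceptI)
    have "{\<omega>\<in>space P. (X0 \<omega>, Y \<omega>) \<in> B} = (\<lambda>\<omega>. (X0 \<omega>, Y \<omega>)) -` B \<inter> space P" by auto
    then show "{\<omega>\<in>space P. (X0 \<omega>, Y \<omega>) \<in> B} \<in> sets P" using measurable_sets[OF mY B] by simp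
    show "prob {\<omega>\<in>space P. (X0 \<omega>, Y \<omega>) \<in> B} \<le> 2 * (1 / sqrt w) * (2 * \<kappa> * (1 + 2 * T / w))"
      using pB by (simp add: d_def)
    fix \<omega> assume \<omega>: "\<omega> \<in> space P" "\<omega> \<notin> {\<omega>\<in>space P. (X0 \<omega>, Y \<omega>) \<in> B}"
    then have "(X0 \<omega>, Y \<omega>) \<notin> B" by simp
    moreover have "(X0 \<omega>, Y \<omega>) \<in> space (N' \<Otimes>\<^sub>M N)" using mY \<omega>(1) by (rule measurable_space)
    ultimately show "\<not> (\<exists>s::rat. \<bar>m I1 \<omega> (of_rat s) - m I2 \<omega> (of_rat s)\<bar> < \<kappa> \<and> \<bar>m I3 \<omega> (of_rat s) - m I1 \<omega> (of_rat s)\<bar> < \<kappa>)"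
      unfolding B_def using mmW[OF fin(1) I(4) Ik(1)] mmW[OF fin(2) I(5) Ik(2)] mmW[OF fin(3) I(6) Ik(3)] by simp
  qed
qed

end

section \<open>Near ties along a grid\<close>

text \<open>
  Up to \<open>\<kappa>\<close>, one line of some slope \<open>s\<close> touches the graph of
  \<open>v\<close> from below over each of the three sets.
\<close>

definition tied :: "(real \<Rightarrow> real) \<Rightarrow> real \<Rightarrow> real set \<Rightarrow> real set \<Rightarrow> real set \<Rightarrow> bool" where
  "tied v \<kappa> F1 F2 F3 \<longleftrightarrow> (\<exists>s. \<bar>Min ((\<lambda>t. v t - s * t) ` F1) - Min ((\<lambda>t. v t - s * t) ` F2)\<bar> < \<kappa> \<and>
      \<bar>Min ((\<lambda>t. v t - s * t) ` F3) - Min ((\<lambda>t. v t - s * t) ` F1)\<bar> < \<kappa>)"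

definition cell :: "real \<Rightarrow> real set \<Rightarrow> int \<Rightarrow> real set" where
  "cell w G c = {t\<in>G. \<lfloor>t / w\<rfloor> = c}"

text \<open>
  A segment from index \<open>i\<close> to index \<open>q\<close> that spans time zero and lies on a
  line of slope \<open>s\<close> supporting the diagram of the points \<open>(t k, v k)\<close>.
\<close>

definition discrete_chord :: "'i set \<Rightarrow> ('i \<Rightarrow> real) \<Rightarrow> ('i \<Rightarrow> real) \<Rightarrow> 'i \<Rightarrow> 'i \<Rightarrow> real \<Rightarrow> bool" where
  "discrete_chord I t v i q s \<longleftrightarrow> i \<in> I \<and> q \<in> I \<and> t i \<le> 0 \<and> 0 \<le> t q \<and>
     (\<forall>k\<in>I. v k \<ge> v i + s * (t k - t i)) \<and> v q = v i + s * (t q - t i)"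

text \<open>
  The diagram is close to \<open>V\<close> on \<open>[- T, T]\<close>, too high outside to take part
  in a supporting chord, and its times are dense in \<open>[- T, T]\<close>.
\<close>

definition tracks :: "real \<Rightarrow> real \<Rightarrow> 'i set \<Rightarrow> ('i \<Rightarrow> real) \<Rightarrow> ('i \<Rightarrow> real) \<Rightarrow> (real \<Rightarrow> real) \<Rightarrow> bool" where
  "tracks T \<kappa> I t v V \<longleftrightarrow> (\<forall>k\<in>I. \<bar>t k\<bar> \<le> T \<longrightarrow> \<bar>v k - V (t k)\<bar> \<le> \<kappa>) \<and>
     (\<forall>k\<in>I. \<bar>t k\<bar> \<ge> T \<longrightarrow> v k \<ge> T / 4 * \<bar>t k\<bar>) \<and>
     (\<forall>x. \<bar>x\<bar> \<le> T \<longrightarrow> (\<exists>k\<in>I. \<bar>t k\<bar> \<le> T \<and> \<bar>t k - x\<bar> \<le> \<kappa>))"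

context two_sided_bm
begin

text \<open>
  The envelopes are Lipschitz in the slope, so ties at real slopes follow from those at rational
  slopes at the price of doubling \<open>\<kappa>\<close>.
\<close>

lemma tie_sets:
  assumes fin: "finite F1" "finite F2" "finite F3" and ne: "F1 \<noteq> {}" "F2 \<noteq> {}" "F3 \<noteq> {}"
    and T: "\<And>x. x \<in> F1 \<union> F2 \<union> F3 \<Longrightarrow> \<bar>x\<bar> \<le> T" and w: "w > 0"
    and sep: "\<And>x. x \<in> F1 \<Longrightarrow> x \<le> lo" "\<And>x. x \<in> F2 \<Longrightarrow> lo + w \<le> x" "\<And>x. x \<in> F2 \<Longrightarrow> x \<le> hi" "\<And>x. x \<in> F3 \<Longrightarrow> hi + w \<le> x"
    and \<kappa>: "\<kappa> > 0"
  shows "holds_except P (2 * (1 / sqrt w) * (2 * (2 * \<kappa>) * (1 + 2 * T / w))) (\<lambda>\<omega>. \<not> tied (\<lambda>t. W t \<omega> + t\<^sup>2) \<kappa> F1 F2 F3)"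
proof -
  define F where "F = F1 \<union> F2 \<union> F3"
  have F: "finite F" "F \<noteq> {}" using fin ne by (auto simp: F_def)
  define xs where "xs = sorted_list_of_set F"
  have xs: "set xs = F" "sorted_wrt (<) xs" "xs \<noteq> []"
    using F by (auto simp: xs_def)
  define k where "k = length xs - 1"
  define \<tau> where "\<tau> i = xs ! i" for i
  have kl: "i \<le> k \<longleftrightarrow> i < length xs" for i using xs(3) by (cases xs) (auto simp: k_def)
  have sm: "strict_mono_on {..k} \<tau>"
    unfolding strict_mono_on_def \<tau>_def using xs(2) by (auto simp: kl sorted_wrt_iff_nth_less)
  have \<tau>F: "\<tau> ` {..k} = F" unfolding \<tau>_def xs(1)[symmetric] by (auto simp: set_conv_nth kl)
  define J where "J G = {i\<in>{..k}. \<tau> i \<in> G}" for G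
  have \<tau>J: "\<tau> ` J G = G" if "G \<subseteq> F" for G
  proof
    show "G \<subseteq> \<tau> ` J G"
    proof
      fix x assume x: "x \<in> G"
      then have "x \<in> \<tau> ` {..k}" using that \<tau>F by auto
      then show "x \<in> \<tau> ` J G" using x by (auto simp: J_def)
    qed
  qed (auto simp: J_def)
  have sub: "F1 \<subseteq> F" "F2 \<subseteq> F" "F3 \<subseteq> F" by (auto simp: F_def)
  have Jne: "J F1 \<noteq> {}" "J F2 \<noteq> {}" "J F3 \<noteq> {}" using \<tau>J[OF sub(1)] \<tau>J[OF sub(2)] \<tau>J[OF sub(3)] ne by auto
  have Jfin: "finite (J G)" for G by (auto simp: J_def)
  define i0 where "i0 = Max (J F1 \<union> J F2)"
  have i0: "i0 \<in> J F1 \<union> J F2" unfolding i0_def using Jne Jfin by (intro Max_in) auto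
  have J0: "i \<le> i0" if "i \<in> J F1 \<union> J F2" for i unfolding i0_def using Jfin that by (intro Max_ge) auto
  have lohi: "lo \<le> hi" using sep(2,3) ne(2) w by fastforce
  have ti0: "\<tau> i0 \<le> hi" using i0 sep lohi by (force simp: J_def)
  have J3: "i0 < i" if "i \<in> J F3" for i
  proof (rule ccontr)
    assume "\<not> i0 < i"
    then have "\<tau> i \<le> \<tau> i0" using strict_mono_onD[OF sm, of i i0] i0 that by (cases "i = i0") (auto simp: J_def)
    moreover have "hi + w \<le> \<tau> i" using that sep by (auto simp: J_def)
    ultimately show False using ti0 w by linarith
  qed
  obtain i3 where i3: "i3 \<in> J F3" using Jne by auto
  have i0k: "i0 < k" using J3[OF i3] i3 by (auto simp: J_def)
  have "\<tau> (Suc i0) \<in> F" using \<tau>F i0k by auto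
  moreover have "Suc i0 \<notin> J F1 \<union> J F2" using J0[of "Suc i0"] by auto
  ultimately have "\<tau> (Suc i0) \<in> F3" using i0k by (auto simp: J_def F_def)
  then have gap: "\<tau> i0 + w \<le> \<tau> (Suc i0)" using sep(4) ti0 by fastforce
  have TT: "\<bar>\<tau> i\<bar> \<le> T" if "i \<le> k" for i using T \<tau>F that by (auto simp: F_def)
  have T0: "T \<ge> 0" using TT[of 0] by simp
  have "holds_except P (2 * (1 / sqrt w) * (2 * (2 * \<kappa>) * (1 + 2 * T / w)))
    (\<lambda>\<omega>. \<not> (\<exists>s::rat. \<bar>Min ((\<lambda>i. (W (\<tau> i) \<omega> + (\<tau> i)\<^sup>2) - of_rat s * \<tau> i) ` J F1) - Min ((\<lambda>i. (W (\<tau> i) \<omega> + (\<tau> i)\<^sup>2) - of_rat s * \<tau> i) ` J F2)\<bar> < 2 * \<kappa> \<and>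
      \<bar>Min ((\<lambda>i. (W (\<tau> i) \<omega> + (\<tau> i)\<^sup>2) - of_rat s * \<tau> i) ` J F3) - Min ((\<lambda>i. (W (\<tau> i) \<omega> + (\<tau> i)\<^sup>2) - of_rat s * \<tau> i) ` J F1)\<bar> < 2 * \<kappa>))"
  proof (rule tie_indexed[OF sm i0k gap w])
    show "J F1 \<subseteq> {..i0}" "J F2 \<subseteq> {..i0}" using J0 by auto
    show "J F3 \<subseteq> {Suc i0..k}" using J3 by (auto simp: J_def Suc_le_eq)
    show "J F1 \<noteq> {}" "J F2 \<noteq> {}" "J F3 \<noteq> {}" by fact+
    show "\<tau> i \<le> lo" if "i \<in> J F1" for i using that sep by (auto simp: J_def)
    show "lo + w \<le> \<tau> i" if "i \<in> J F2" for i using that sep by (auto simp: J_def)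
  qed (use TT \<kappa> in auto)
  then show ?thesis
  proof (rule holds_except_mono)
    fix \<omega>
    define V where "V t = W t \<omega> + t\<^sup>2" for t
    define m where "m G s = Min ((\<lambda>t. V t - s * t) ` G)" for G s
    have mJ: "Min ((\<lambda>i. (W (\<tau> i) \<omega> + (\<tau> i)\<^sup>2) - s * \<tau> i) ` J G) = m G s" if "G \<subseteq> F" for G s
    proof -
      have "m G s = Min ((\<lambda>t. V t - s * t) ` (\<tau> ` J G))" using \<tau>J[OF that] by (simp add: m_def)
      then show ?thesis by (simp add: image_image V_def)
    qed
    assume H: "\<not> (\<exists>s::rat. \<bar>Min ((\<lambda>i. (W (\<tau> i) \<omega> + (\<tau> i)\<^sup>2) - of_rat s * \<tau> i) ` J F1) - Min ((\<lambda>i. (W (\<tau> i) \<omega> + (\<tau> i)\<^sup>2) - of_rat s * \<tau> i) ` J F2)\<bar> < 2 * \<kappa> \<and>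
      \<bar>Min ((\<lambda>i. (W (\<tau> i) \<omega> + (\<tau> i)\<^sup>2) - of_rat s * \<tau> i) ` J F3) - Min ((\<lambda>i. (W (\<tau> i) \<omega> + (\<tau> i)\<^sup>2) - of_rat s * \<tau> i) ` J F1)\<bar> < 2 * \<kappa>)"
    then have H: "\<not> (\<bar>m F1 (of_rat s) - m F2 (of_rat s)\<bar> < 2 * \<kappa> \<and> \<bar>m F3 (of_rat s) - m F1 (of_rat s)\<bar> < 2 * \<kappa>)" for s
      unfolding mJ[OF sub(1)] mJ[OF sub(2)] mJ[OF sub(3)] by blast
    show "\<not> tied (\<lambda>t. W t \<omega> + t\<^sup>2) \<kappa> F1 F2 F3"
    proof
      assume "tied (\<lambda>t. W t \<omega> + t\<^sup>2) \<kappa> F1 F2 F3"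
      then obtain s where s: "\<bar>m F1 s - m F2 s\<bar> < \<kappa>" "\<bar>m F3 s - m F1 s\<bar> < \<kappa>" unfolding tied_def m_def V_def by blast
      \<comment> \<open>A rational slope just below \<open>s\<close>, close enough to change each envelope by at most \<open>\<kappa> / 2\<close>.\<close>
      have "s - \<kappa> / (2 * (T + 1)) < s" using \<kappa> T0 by simp
      then obtain r :: rat where r: "s - \<kappa> / (2 * (T + 1)) < of_rat r" "of_rat r < s"
        using of_rat_dense by blast
      then have "\<bar>s - of_rat r\<bar> * T \<le> \<kappa> / (2 * (T + 1)) * T" using T0 by (intro mult_right_mono) auto
      also have "\<dots> \<le> \<kappa> / 2" using \<kappa> T0 by (simp add: field_simps)
      finally have rT: "\<bar>s - of_rat r\<bar> * T \<le> \<kappa> / 2" .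
      have lip: "\<bar>m G s - m G (of_rat r)\<bar> \<le> \<bar>s - of_rat r\<bar> * T" if "G \<subseteq> F" "G \<noteq> {}" for G
        unfolding m_def using that F T
        by (intro min_affine_lipschitz[where \<tau>="\<lambda>t. t"]) (auto simp: F_def intro: finite_subset)
      show False using H[of r] s lip[OF sub(1) ne(1)] lip[OF sub(2) ne(2)] lip[OF sub(3) ne(3)] rT by linarith
    qed
  qed simp
qed

text \<open>
  \<open>\<kappa>\<close> is chosen before \<open>G\<close>.  This is possible because the bound in
  \<open>tie_sets\<close> does not depend on the number of grid points and the number of cells of
  width \<open>w\<close> that meet \<open>[- T, T]\<close> is bounded.
\<close>

lemma no_ties_on_grid:
  assumes w: "w > 0" and T: "T > 0" and p: "p > 0"
  shows "\<exists>\<kappa>>0. \<forall>G. finite G \<longrightarrow> G \<subseteq> {-T..T} \<longrightarrow> holds_except P p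
    (\<lambda>\<omega>. \<forall>c1 c2 c3. c1 + 2 \<le> c2 \<longrightarrow> c2 + 2 \<le> c3 \<longrightarrow> cell w G c1 \<noteq> {} \<longrightarrow> cell w G c2 \<noteq> {} \<longrightarrow> cell w G c3 \<noteq> {} \<longrightarrow>
       \<not> tied (\<lambda>t. W t \<omega> + t\<^sup>2) \<kappa> (cell w G c1) (cell w G c2) (cell w G c3))"
proof -
  define C where "C = \<lceil>T / w\<rceil>"
  define I where "I = {-C..C} \<times> {-C..C} \<times> {-C..C}"
  define n where "n = real (card I)"
  define a where "a = 2 * (1 / sqrt w) * (1 + 2 * T / w)"
  have "2 * T / w > 0" using w T by simp
  then have a: "a > 0" using w unfolding a_def by (intro mult_pos_pos) auto
  \<comment> \<open>The exceptional probability of a single triple is \<open>4 * a * \<kappa>\<close>, and there are at most \<open>n\<close> triples.\<close>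
  define \<kappa> where "\<kappa> = p / (4 * a * (n + 1))"
  have n: "n \<ge> 0" by (simp add: n_def)
  have \<kappa>: "\<kappa> > 0" using p a n by (simp add: \<kappa>_def)
  have b: "2 * (1 / sqrt w) * (2 * (2 * \<kappa>) * (1 + 2 * T / w)) = p / (n + 1)"
  proof -
    have "2 * (1 / sqrt w) * (2 * (2 * \<kappa>) * (1 + 2 * T / w)) = 4 * a * \<kappa>" by (simp add: a_def)
    also have "\<dots> = p / (n + 1)" using a n by (simp add: \<kappa>_def)
    finally show ?thesis .
  qed
  show ?thesis
  proof (intro exI[of _ \<kappa>] conjI allI impI \<kappa>)
    fix G assume G: "finite G" "G \<subseteq> {-T..T}"
    define bad where "bad c \<omega> \<longleftrightarrow> (case c of (c1, c2, c3) \<Rightarrow> c1 + 2 \<le> c2 \<and> c2 + 2 \<le> c3 \<and> cell w G c1 \<noteq> {} \<and> cell w G c2 \<noteq> {} \<and> cell w G c3 \<noteq> {} \<and>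
       tied (\<lambda>t. W t \<omega> + t\<^sup>2) \<kappa> (cell w G c1) (cell w G c2) (cell w G c3))" for c \<omega>
    have cellC: "\<bar>c\<bar> \<le> C" if "cell w G c \<noteq> {}" for c
    proof -
      obtain t where t: "t \<in> G" "\<lfloor>t / w\<rfloor> = c" using \<open>cell w G c \<noteq> {}\<close> by (auto simp: cell_def)
      have "t / w \<le> T / w" "- (T / w) \<le> t / w" using t G w by (auto simp: field_simps subset_eq)
      then show ?thesis using t unfolding C_def by linarith
    qed
    have "holds_except P (\<Sum>c\<in>I. p / (n + 1)) (\<lambda>\<omega>. \<forall>c\<in>I. \<not> bad c \<omega>)"
    proof (rule holds_except_ball)
      show "finite I" by (simp add: I_def)
      fix c assume "c \<in> I"
      obtain c1 c2 c3 where c: "c = (c1, c2, c3)" by (cases c)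
      show "holds_except P (p / (n + 1)) (\<lambda>\<omega>. \<not> bad c \<omega>)"
      proof (cases "c1 + 2 \<le> c2 \<and> c2 + 2 \<le> c3 \<and> cell w G c1 \<noteq> {} \<and> cell w G c2 \<noteq> {} \<and> cell w G c3 \<noteq> {}")
        case True
        have cl: "of_int c * w \<le> t \<and> t < (of_int c + 1) * w" if "t \<in> cell w G c" for t c
        proof -
          have "of_int c \<le> t / w" "t / w < of_int c + 1" using that by (auto simp: cell_def)
          then show ?thesis using w by (simp add: field_simps)
        qed
        have step: "(of_int c + 1) * w + w \<le> t" if "t \<in> cell w G c'" "c + 2 \<le> c'" for t c c'
        proof -
          have "(of_int c + 2) * w \<le> of_int c' * w" using that w by (intro mult_right_mono) linarith+
          then show ?thesis using cl[OF that(1)] by (simp add: algebra_simps)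
        qed
        have "holds_except P (p / (n + 1)) (\<lambda>\<omega>. \<not> tied (\<lambda>t. W t \<omega> + t\<^sup>2) \<kappa> (cell w G c1) (cell w G c2) (cell w G c3))"
          unfolding b[symmetric]
        proof (rule tie_sets[where lo="(of_int c1 + 1) * w" and hi="(of_int c2 + 1) * w"])
          show "finite (cell w G c1)" "finite (cell w G c2)" "finite (cell w G c3)" using G by (auto simp: cell_def)
          show "\<bar>x\<bar> \<le> T" if "x \<in> cell w G c1 \<union> cell w G c2 \<union> cell w G c3" for x
            using that G by (auto simp: cell_def abs_le_iff subset_eq)
        qed (use True step cl w \<kappa> in \<open>auto intro: less_imp_le\<close>)
        then show ?thesis by (rule holds_except_mono) (auto simp: bad_def c)
      next
        case False
        then show ?thesis using p n by (intro holds_exceptI[of "{}"]) (auto simp: bad_def c)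
      qed
    qed
    then show "holds_except P p (\<lambda>\<omega>. \<forall>c1 c2 c3. c1 + 2 \<le> c2 \<longrightarrow> c2 + 2 \<le> c3 \<longrightarrow> cell w G c1 \<noteq> {} \<longrightarrow> cell w G c2 \<noteq> {} \<longrightarrow> cell w G c3 \<noteq> {} \<longrightarrow>
       \<not> tied (\<lambda>t. W t \<omega> + t\<^sup>2) \<kappa> (cell w G c1) (cell w G c2) (cell w G c3))"
    proof (rule holds_except_mono)
      show "(\<Sum>c\<in>I. p / (n + 1)) \<le> p" using p n by (simp add: n_def[symmetric] field_simps)
      fix \<omega> assume H: "\<forall>c\<in>I. \<not> bad c \<omega>"
      have "\<not> bad (c1, c2, c3) \<omega>" if "cell w G c1 \<noteq> {}" "cell w G c2 \<noteq> {}" "cell w G c3 \<noteq> {}" for c1 c2 c3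
        using cellC[OF that(1)] cellC[OF that(2)] cellC[OF that(3)] by (intro H[rule_format]) (auto simp: I_def)
      then show "\<forall>c1 c2 c3. c1 + 2 \<le> c2 \<longrightarrow> c2 + 2 \<le> c3 \<longrightarrow> cell w G c1 \<noteq> {} \<longrightarrow> cell w G c2 \<noteq> {} \<longrightarrow> cell w G c3 \<noteq> {} \<longrightarrow>
       \<not> tied (\<lambda>t. W t \<omega> + t\<^sup>2) \<kappa> (cell w G c1) (cell w G c2) (cell w G c3)"
        by (auto simp: bad_def)
    qed
  qed
qed

text \<open>
  Almost every path is uniformly continuous on a compact interval, so one modulus works off a small
  set.  The condition is stated at rational times first, where it is measurable.
\<close>

lemma path_modulus:
  assumes T: "T > 0" and e: "e > 0" and p: "p > 0"
  shows "\<exists>r0. \<forall>r\<ge>r0. holds_except P p (\<lambda>\<omega>. \<forall>s t. \<bar>s\<bar> \<le> T \<longrightarrow> \<bar>t\<bar> \<le> T \<longrightarrow> \<bar>s - t\<bar> \<le> 1 / real (Suc r) \<longrightarrow> \<bar>W s \<omega> - W t \<omega>\<bar> \<le> e)"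
proof -
  define Q where "Q r \<omega> \<longleftrightarrow> (\<forall>s t::rat. \<bar>of_rat s\<bar> \<le> T + 1 \<longrightarrow> \<bar>of_rat t\<bar> \<le> T + 1 \<longrightarrow> \<bar>of_rat s - of_rat t\<bar> \<le> 2 / real (Suc r) \<longrightarrow>
     \<bar>W (of_rat s) \<omega> - W (of_rat t) \<omega>\<bar> \<le> e)" for r \<omega>
  have "\<exists>r0. \<forall>r\<ge>r0. holds_except P p (Q r)"
  proof (rule holds_except_eventually)
    show "{\<omega> \<in> space P. Q r \<omega>} \<in> events" for r unfolding Q_def by measurable
    show "Q (Suc r) \<omega>" if "Q r \<omega>" for r \<omega>
      unfolding Q_def
    proof (intro allI impI)
      fix s t :: rat assume st: "\<bar>of_rat s\<bar> \<le> T + 1" "\<bar>of_rat t\<bar> \<le> T + 1" "\<bar>of_rat s - of_rat t\<bar> \<le> 2 / real (Suc (Suc r))"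
      have "2 / real (Suc (Suc r)) \<le> 2 / real (Suc r)" by (intro divide_left_mono) auto
      then show "\<bar>W (of_rat s) \<omega> - W (of_rat t) \<omega>\<bar> \<le> e" using that st unfolding Q_def by (meson order_trans)
    qed
    show "AE \<omega> in P. \<exists>r. Q r \<omega>" using W_path
    proof eventually_elim
      case (elim \<omega>)
      then have "continuous_on {-(T+1)..T+1} (\<lambda>t. W t \<omega>)" using continuous_on_subset by blast
      then have "uniformly_continuous_on {-(T+1)..T+1} (\<lambda>t. W t \<omega>)"
        by (rule compact_uniformly_continuous) simp
      then obtain d where d: "d > 0" "\<And>x x'. x \<in> {-(T+1)..T+1} \<Longrightarrow> x' \<in> {-(T+1)..T+1} \<Longrightarrow> dist x' x < d \<Longrightarrow> dist (W x' \<omega>) (W x \<omega>) < e"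
        using e unfolding uniformly_continuous_on_def by metis
      obtain r where r: "2 / real (Suc r) < d"
      proof -
        obtain r where "inverse (real (Suc r)) < d / 2" using reals_Archimedean[of "d / 2"] d by auto
        then show ?thesis using that[of r] by (simp add: field_simps)
      qed
      have "Q r \<omega>" unfolding Q_def
      proof (intro allI impI)
        fix s t :: rat assume st: "\<bar>of_rat s\<bar> \<le> T + 1" "\<bar>of_rat t\<bar> \<le> T + 1" "\<bar>of_rat s - of_rat t\<bar> \<le> 2 / real (Suc r)"
        have "dist (W (of_rat s) \<omega>) (W (of_rat t) \<omega>) < e"
        proof (rule d(2))
          show "real_of_rat t \<in> {-(T+1)..T+1}" "real_of_rat s \<in> {-(T+1)..T+1}"
            using st(1,2) unfolding atLeastAtMost_iff by linarith+
          show "dist (real_of_rat s) (real_of_rat t) < d" using st(3) r unfolding dist_real_def by linarith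
        qed
        then show "\<bar>W (of_rat s) \<omega> - W (of_rat t) \<omega>\<bar> \<le> e" by (simp add: dist_real_def)
      qed
      then show ?case by blast
    qed
  qed fact
  then obtain r0 where r0: "\<And>r. r \<ge> r0 \<Longrightarrow> holds_except P p (Q r)" by blast
  have "holds_except P p (\<lambda>\<omega>. \<forall>s t. \<bar>s\<bar> \<le> T \<longrightarrow> \<bar>t\<bar> \<le> T \<longrightarrow> \<bar>s - t\<bar> \<le> 1 / real (Suc r) \<longrightarrow> \<bar>W s \<omega> - W t \<omega>\<bar> \<le> e)"
    if r: "r \<ge> r0" for r
  proof -
    have "holds_except P (p + 0) (\<lambda>\<omega>. Q r \<omega> \<and> (W 0 \<omega> = 0 \<and> continuous_on UNIV (\<lambda>t. W t \<omega>)))"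
      by (intro holds_except_conj r0 r holds_except_AE W_path)
    then show ?thesis
    proof (rule holds_except_mono)
      fix \<omega> assume A: "Q r \<omega> \<and> (W 0 \<omega> = 0 \<and> continuous_on UNIV (\<lambda>t. W t \<omega>))"
      show "\<forall>s t. \<bar>s\<bar> \<le> T \<longrightarrow> \<bar>t\<bar> \<le> T \<longrightarrow> \<bar>s - t\<bar> \<le> 1 / real (Suc r) \<longrightarrow> \<bar>W s \<omega> - W t \<omega>\<bar> \<le> e"
      proof (intro allI impI, rule ccontr)
        fix s t assume st: "\<bar>s\<bar> \<le> T" "\<bar>t\<bar> \<le> T" "\<bar>s - t\<bar> \<le> 1 / real (Suc r)" and "\<not> \<bar>W s \<omega> - W t \<omega>\<bar> \<le> e"
        define a where "a = \<bar>W s \<omega> - W t \<omega>\<bar> - e"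
        have a: "a > 0" using \<open>\<not> _\<close> by (simp add: a_def)
        have ap: "\<exists>q::rat. \<bar>of_rat q - x\<bar> < \<rho> \<and> \<bar>W (of_rat q) \<omega> - W x \<omega>\<bar> < a / 2" if "\<rho> > 0" for x \<rho>
        proof -
          have "isCont (\<lambda>t. W t \<omega>) x" using A by (simp add: continuous_on_eq_continuous_at)
          then obtain d where d: "d > 0" "\<And>y. \<bar>y - x\<bar> < d \<Longrightarrow> \<bar>W y \<omega> - W x \<omega>\<bar> < a / 2"
            using a unfolding continuous_at_eps_delta dist_real_def by (metis half_gt_zero)
          have "x < x + min d \<rho>" using d that by simp
          then obtain q :: rat where "x < of_rat q" "of_rat q < x + min d \<rho>" using of_rat_dense by blast
          then show ?thesis using d(2)[of "of_rat q"] by (intro exI[of _ q]) auto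
        qed
        define \<rho> where "\<rho> = min 1 (1 / (2 * real (Suc r)))"
        have \<rho>: "\<rho> > 0" "\<rho> \<le> 1" "2 * \<rho> \<le> 1 / real (Suc r)" by (auto simp: \<rho>_def min_def field_simps)
        obtain q1 where q1: "\<bar>of_rat q1 - s\<bar> < \<rho>" "\<bar>W (of_rat q1) \<omega> - W s \<omega>\<bar> < a / 2" using ap[OF \<rho>(1)] by blast
        obtain q2 where q2: "\<bar>of_rat q2 - t\<bar> < \<rho>" "\<bar>W (of_rat q2) \<omega> - W t \<omega>\<bar> < a / 2" using ap[OF \<rho>(1)] by blast
        have e2: "2 / real (Suc r) = 1 / real (Suc r) + 1 / real (Suc r)" by simp
        have "\<bar>W (of_rat q1) \<omega> - W (of_rat q2) \<omega>\<bar> \<le> e"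
        proof (rule A[THEN conjunct1, unfolded Q_def, rule_format])
          show "\<bar>of_rat q1\<bar> \<le> T + 1" "\<bar>of_rat q2\<bar> \<le> T + 1" using st q1 q2 \<rho> by linarith+
          show "\<bar>of_rat q1 - of_rat q2\<bar> \<le> 2 / real (Suc r)" unfolding e2 using st(3) q1(1) q2(1) \<rho>(3) by linarith
        qed
        moreover have "\<bar>W s \<omega> - W t \<omega>\<bar> \<le> \<bar>W (of_rat q1) \<omega> - W s \<omega>\<bar> + \<bar>W (of_rat q1) \<omega> - W (of_rat q2) \<omega>\<bar> + \<bar>W (of_rat q2) \<omega> - W t \<omega>\<bar>"
          by linarith
        moreover have "\<bar>W s \<omega> - W t \<omega>\<bar> = a + e" by (simp add: a_def)
        ultimately show False using q1(2) q2(2) by argo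
      qed
    qed simp
  qed
  then show ?thesis by blast
qed

end

section \<open>Stability of the limiting chord\<close>

lemma sqrt_diff_le:
  fixes x y :: real assumes "x \<ge> 0" "y \<ge> 0" shows "\<bar>sqrt x - sqrt y\<bar> \<le> sqrt \<bar>x - y\<bar>"
proof -
  have *: "sqrt a - sqrt b \<le> sqrt (a - b)" if "0 \<le> b" "b \<le> a" for a b :: real
    using sqrt_add_le_add_sqrt[of b "a - b"] that by simp
  show ?thesis using *[of x y] *[of y x] assms by (cases "x \<le> y") (auto simp: abs_if)
qed

text \<open>
  A point \<open>t\<close> close to the line and away from \<open>p\<close> and \<open>q\<close> would
  put three grid cells at mutual distance into a near tie at the slope of the line.
\<close>

lemma margin_of_no_ties:
  fixes V :: "real \<Rightarrow> real"
  assumes sup: "\<And>t. V t \<ge> a + s * t" and eq: "V p = a + s * p" "V q = a + s * q"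
    and pq: "\<bar>p\<bar> \<le> T" "\<bar>q\<bar> \<le> T" "p + \<eta> < q" and t: "\<bar>t\<bar> \<le> T" "\<bar>t - p\<bar> > \<eta>" "\<bar>t - q\<bar> > \<eta>"
    and grid: "\<And>x. \<bar>x\<bar> \<le> T \<Longrightarrow> \<exists>y\<in>G. \<bar>y - x\<bar> \<le> h \<and> V y \<le> V x + d - \<bar>s\<bar> * h" and G: "finite G"
    and w: "w > 0" "3 * w + 2 * h \<le> \<eta>" and d: "0 \<le> d" "2 * d < \<kappa>"
    and nt: "\<And>c1 c2 c3. c1 + 2 \<le> c2 \<Longrightarrow> c2 + 2 \<le> c3 \<Longrightarrow> cell w G c1 \<noteq> {} \<Longrightarrow> cell w G c2 \<noteq> {} \<Longrightarrow> cell w G c3 \<noteq> {} \<Longrightarrow>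
       \<not> tied V \<kappa> (cell w G c1) (cell w G c2) (cell w G c3)"
  shows "V t \<ge> a + s * t + \<kappa> / 2"
proof (rule ccontr)
  assume neg: "\<not> ?thesis"
  have \<kappa>: "\<kappa> > 0" using d by simp
  define m where "m c = Min ((\<lambda>t. V t - s * t) ` cell w G c)" for c
  have pt: "\<exists>c. cell w G c \<noteq> {} \<and> a \<le> m c \<and> m c < a + \<kappa> \<and> (\<exists>y. \<bar>y - x\<bar> \<le> h \<and> \<lfloor>y / w\<rfloor> = c)"
    if x: "\<bar>x\<bar> \<le> T" "V x < a + s * x + \<kappa> / 2" for x
  proof -
    obtain y where y: "y \<in> G" "\<bar>y - x\<bar> \<le> h" "V y \<le> V x + d - \<bar>s\<bar> * h" using grid[OF x(1)] by blast
    define c where "c = \<lfloor>y / w\<rfloor>"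
    have yc: "y \<in> cell w G c" using y by (simp add: cell_def c_def)
    have fc: "finite (cell w G c)" using G by (simp add: cell_def)
    have "a \<le> m c" unfolding m_def using fc yc sup by (subst Min_ge_iff) (auto simp: algebra_simps)
    moreover have "m c \<le> V y - s * y" unfolding m_def using fc yc by (intro Min_le) auto
    moreover have "s * (x - y) \<le> \<bar>s\<bar> * h"
    proof -
      have "s * (x - y) \<le> \<bar>s\<bar> * \<bar>x - y\<bar>" by (metis abs_ge_self abs_mult)
      also have "\<dots> \<le> \<bar>s\<bar> * h" using y(2) by (intro mult_left_mono) (auto simp: abs_minus_commute)
      finally show ?thesis .
    qed
    ultimately have "a \<le> m c \<and> m c < a + \<kappa>" using y x d by (simp add: algebra_simps)
    then show ?thesis using yc y c_def by blast
  qed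
  obtain cp yp where cp: "cell w G cp \<noteq> {}" "a \<le> m cp" "m cp < a + \<kappa>" "\<bar>yp - p\<bar> \<le> h" "\<lfloor>yp / w\<rfloor> = cp"
    using pt[of p] pq eq \<kappa> by auto
  obtain cq yq where cq: "cell w G cq \<noteq> {}" "a \<le> m cq" "m cq < a + \<kappa>" "\<bar>yq - q\<bar> \<le> h" "\<lfloor>yq / w\<rfloor> = cq"
    using pt[of q] pq eq \<kappa> by auto
  obtain ct yt where ct: "cell w G ct \<noteq> {}" "a \<le> m ct" "m ct < a + \<kappa>" "\<bar>yt - t\<bar> \<le> h" "\<lfloor>yt / w\<rfloor> = ct"
    using pt[of t] t neg by auto
  have sep: "\<lfloor>y / w\<rfloor> + 2 \<le> \<lfloor>y' / w\<rfloor>" if "\<bar>y - x\<bar> \<le> h" "\<bar>y' - x'\<bar> \<le> h" "x + \<eta> < x'" for x x' y y'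
  proof -
    have "y + 3 * w \<le> y'" using that w by linarith
    then have "(y + 3 * w) / w \<le> y' / w" using w by (intro divide_right_mono) auto
    then have "y / w + 3 \<le> y' / w" using w by (simp add: add_divide_distrib)
    then show ?thesis by linarith
  qed
  have nt': False if "c1 + 2 \<le> c2" "c2 + 2 \<le> c3" "cell w G c1 \<noteq> {}" "cell w G c2 \<noteq> {}" "cell w G c3 \<noteq> {}"
     "a \<le> m c1" "m c1 < a + \<kappa>" "a \<le> m c2" "m c2 < a + \<kappa>" "a \<le> m c3" "m c3 < a + \<kappa>" for c1 c2 c3
  proof -
    have "tied V \<kappa> (cell w G c1) (cell w G c2) (cell w G c3)" unfolding tied_def
      by (rule exI[of _ s]) (use that in \<open>auto simp: m_def abs_less_iff\<close>)
    then show False using nt that by blast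
  qed
  have pqc: "cp + 2 \<le> cq" using sep[OF cp(4) cq(4) pq(3)] cp(5) cq(5) by simp
  consider "t + \<eta> < p" | "p + \<eta> < t" "t + \<eta> < q" | "q + \<eta> < t" using t by linarith
  then show False
  proof cases
    case 1
    then show ?thesis using sep[OF ct(4) cp(4)] nt'[of ct cp cq] pqc ct cp cq by auto
  next
    case 2
    then show ?thesis using sep[OF ct(4) cq(4)] sep[OF cp(4) ct(4)] nt'[of cp ct cq] ct cp cq by auto
  next
    case 3
    then show ?thesis using sep[OF cq(4) ct(4)] nt'[of cp cq ct] pqc ct cp cq by auto
  qed
qed

text \<open>
  A diagram that tracks \<open>V\<close> satisfies the hypotheses of \<open>chord_stable\<close> for
  the line of \<open>V\<close>: nearness and margin on \<open>[- T, T]\<close> come from tracking, and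
  outside from the growth of the diagram, since \<open>\<bar>s1\<bar> \<le> T / 16\<close>.
\<close>

lemma discrete_chord_close:
  fixes V :: "real \<Rightarrow> real" and v t :: "'i \<Rightarrow> real"
  assumes chord: "discrete_chord I t v i q s" and tr: "tracks T \<kappa> I t v V"
    and sup: "\<forall>x. V x \<ge> a1 + s1 * x" and eq: "V p1 = a1 + s1 * p1" "V q1 = a1 + s1 * q1" and a1: "a1 \<le> 0"
    and margin: "\<forall>x. \<bar>x\<bar> \<le> T \<longrightarrow> \<bar>x - p1\<bar> > \<eta> \<longrightarrow> \<bar>x - q1\<bar> > \<eta> \<longrightarrow> V x \<ge> a1 + s1 * x + \<kappa>1"
    and mod: "\<forall>x y. \<bar>x\<bar> \<le> T \<longrightarrow> \<bar>y\<bar> \<le> T \<longrightarrow> \<bar>x - y\<bar> \<le> \<kappa> \<longrightarrow> V x \<le> V y + e / 4"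
    and B: "\<bar>s1\<bar> \<le> B" "B \<ge> 1" "16 * B \<le> T" and pqT: "\<bar>p1\<bar> \<le> T" "\<bar>q1\<bar> \<le> T" "p1 \<le> - 3 * \<eta>" "q1 \<ge> 3 * \<eta>"
    and \<eta>: "0 < \<eta>" "\<eta> \<le> 1" and \<kappa>: "0 < \<kappa>" "\<kappa> \<le> \<eta>" "B * \<kappa> \<le> e / 4" "\<kappa> \<le> e / 4" 
    and e: "0 < e" "e \<le> \<kappa>1 / 2" "e \<le> 1 / 2" "8 * T * e < min (\<kappa>1 / 2) (1 / 8) * \<eta>"
    and \<kappa>1: "\<kappa>1 > 0"
  shows "\<bar>t i\<bar> \<le> 2 * T" "\<bar>t q\<bar> \<le> 2 * T"
    "\<bar>sqrt (t q - t i) * s - sqrt (q1 - p1) * s1\<bar> \<le> 4 * T * (e / \<eta>) + B * sqrt (2 * \<eta>)"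
proof -
  note sup = sup[rule_format] and margin = margin[rule_format] and mod = mod[rule_format]
  have T: "T \<ge> 1" using B by simp
  have c: "i \<in> I" "q \<in> I" "t i \<le> 0" "0 \<le> t q" "\<And>k. k \<in> I \<Longrightarrow> v k \<ge> v i + s * (t k - t i)" "v q = v i + s * (t q - t i)"
    using chord by (auto simp: discrete_chord_def)
  have tr1: "\<And>k. k \<in> I \<Longrightarrow> \<bar>t k\<bar> \<le> T \<Longrightarrow> \<bar>v k - V (t k)\<bar> \<le> \<kappa>"
    and tr2: "\<And>k. k \<in> I \<Longrightarrow> \<bar>t k\<bar> \<ge> T \<Longrightarrow> v k \<ge> T / 4 * \<bar>t k\<bar>"
    and tr3: "\<And>x. \<bar>x\<bar> \<le> T \<Longrightarrow> \<exists>k\<in>I. \<bar>t k\<bar> \<le> T \<and> \<bar>t k - x\<bar> \<le> \<kappa>"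
    using tr by (auto simp: tracks_def)
  obtain ip where ip: "ip \<in> I" "\<bar>t ip\<bar> \<le> T" "\<bar>t ip - p1\<bar> \<le> \<kappa>" using tr3[OF pqT(1)] by blast
  obtain iq where iq: "iq \<in> I" "\<bar>t iq\<bar> \<le> T" "\<bar>t iq - q1\<bar> \<le> \<kappa>" using tr3[OF pqT(2)] by blast
  have lin: "s1 * x \<le> s1 * y + e / 4" if "\<bar>x - y\<bar> \<le> \<kappa>" for x y
  proof -
    have "s1 * (x - y) \<le> \<bar>s1\<bar> * \<bar>x - y\<bar>" by (metis abs_ge_self abs_mult)
    also have "\<dots> \<le> B * \<kappa>" using that B by (intro mult_mono) auto
    finally show ?thesis using \<kappa> by (simp add: algebra_simps)
  qed
  have linB: "s1 * x \<le> B * \<bar>x\<bar>" for x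
  proof -
    have "s1 * x \<le> \<bar>s1\<bar> * \<bar>x\<bar>" by (metis abs_ge_self abs_mult)
    also have "\<dots> \<le> B * \<bar>x\<bar>" using B by (intro mult_right_mono) auto
    finally show ?thesis .
  qed
  have outside: "v k \<ge> a1 + s1 * t k + (1 / 8) * max 1 (\<bar>t k\<bar> / T)" if k: "k \<in> I" "\<bar>t k\<bar> \<ge> T" for k
  proof -
    have "s1 * t k \<le> T / 16 * \<bar>t k\<bar>" using linB[of "t k"] B mult_right_mono[of B "T/16" "\<bar>t k\<bar>"] by simp
    moreover have "v k \<ge> T / 4 * \<bar>t k\<bar>" using tr2[OF k] .
    moreover have "1 / 8 * \<bar>t k\<bar> \<le> T / 8 * \<bar>t k\<bar>" using T by (intro mult_right_mono) auto
    moreover have "max 1 (\<bar>t k\<bar> / T) \<le> \<bar>t k\<bar>" using T k mult_right_mono[of 1 T "\<bar>t k\<bar>"] by (simp add: field_simps)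
    ultimately show ?thesis using a1 by linarith
  qed
  have mx: "max 1 (\<bar>x\<bar> / T) = 1" if "\<bar>x\<bar> \<le> T" for x using that T by (simp add: field_simps max_def)
  \<comment> \<open>The smaller of the margin inside \<open>[- T, T]\<close>, after the tracking error, and the margin outside.\<close>
  define K where "K = min (\<kappa>1 / 2) (1 / 8)"
  have K: "K > 0" using \<kappa>1 by (simp add: K_def)
  have *: "\<bar>t i - p1\<bar> \<le> \<eta> \<and> \<bar>t q - q1\<bar> \<le> \<eta> \<and> \<bar>s - s1\<bar> \<le> e / \<eta>"
  proof (intro conjI)
    have near: "v k \<ge> a1 + s1 * t k - e" if k: "k \<in> I" for k
    proof (cases "\<bar>t k\<bar> \<le> T")
      case True
      then show ?thesis using tr1[OF k True] sup[of "t k"] \<kappa> by linarith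
    next
      case False
      have "0 \<le> (1 / 8) * max 1 (\<bar>t k\<bar> / T)" by simp
      then show ?thesis using outside[OF k] False e by linarith
    qed
    have far: "v k \<ge> a1 + s1 * t k + K * max 1 (\<bar>t k\<bar> / T)"
      if k: "k \<in> I" "\<bar>t k - p1\<bar> > \<eta>" "\<bar>t k - q1\<bar> > \<eta>" for k
    proof (cases "\<bar>t k\<bar> \<le> T")
      case True
      have "K \<le> \<kappa>1 / 2" by (simp add: K_def)
      then show ?thesis using tr1[OF k(1) True] margin[OF True k(2,3)] \<kappa> e mx[OF True] by simp
    next
      case False
      have "K * max 1 (\<bar>t k\<bar> / T) \<le> (1 / 8) * max 1 (\<bar>t k\<bar> / T)" by (intro mult_right_mono) (auto simp: K_def)
      then show ?thesis using outside[OF k(1)] False by linarith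
    qed
    have hit: "v k \<le> a1 + s1 * t k + e" if k: "k \<in> I" "\<bar>t k\<bar> \<le> T" "\<bar>t k - x\<bar> \<le> \<kappa>" "\<bar>x\<bar> \<le> T" "V x = a1 + s1 * x" for k x
      using tr1[OF k(1,2)] mod[OF k(2,4,3)] k(5) lin[of x "t k"] k(3) \<kappa> by (simp add: abs_minus_commute abs_le_iff)
    note cs = chord_stable[where I=I and t=t and v=v and p=i and q=q and ip=ip and iq=iq and ?a2.0="v i - s * t i" and ?s2.0=s
      and ?a1.0=a1 and ?s1.0=s1 and e=e and ?p1.0=p1 and ?q1.0=q1 and \<eta>=\<eta> and \<kappa>=K and T=T]
    have s1': "v k \<ge> v i - s * t i + s * t k" if "k \<in> I" for k using c(5)[OF that] by (simp add: algebra_simps)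
    have s2': "v i = v i - s * t i + s * t i" by simp
    have s3': "v q = v i - s * t i + s * t q" using c(6) by (simp add: algebra_simps)
    have n: "\<bar>t ip - p1\<bar> \<le> \<eta>" "v ip \<le> a1 + s1 * t ip + e" "\<bar>t iq - q1\<bar> \<le> \<eta>" "v iq \<le> a1 + s1 * t iq + e"
      using ip iq \<kappa> hit[OF ip pqT(1) eq(1)] hit[OF iq pqT(2) eq(2)] by auto
    have eK: "8 * T * e < K * \<eta>" using e(4) by (simp add: K_def)
    show "\<bar>t i - p1\<bar> \<le> \<eta>" by (rule cs(1); (fact c ip iq n s2' s3' pqT \<eta> T K e eK | (rule near far s1'; assumption)))
    show "\<bar>t q - q1\<bar> \<le> \<eta>" by (rule cs(2); (fact c ip iq n s2' s3' pqT \<eta> T K e eK | (rule near far s1'; assumption)))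
    show "\<bar>s - s1\<bar> \<le> e / \<eta>" by (rule cs(3); (fact c ip iq n s2' s3' pqT \<eta> T K e eK | (rule near far s1'; assumption)))
  qed
  show r: "\<bar>t i\<bar> \<le> 2 * T" "\<bar>t q\<bar> \<le> 2 * T" using * pqT \<eta> T by linarith+
  have "sqrt (t q - t i) * s - sqrt (q1 - p1) * s1 = sqrt (t q - t i) * (s - s1) + s1 * (sqrt (t q - t i) - sqrt (q1 - p1))"
    by (simp add: algebra_simps)
  also have "\<bar>\<dots>\<bar> \<le> \<bar>sqrt (t q - t i)\<bar> * \<bar>s - s1\<bar> + \<bar>s1\<bar> * \<bar>sqrt (t q - t i) - sqrt (q1 - p1)\<bar>"
    by (metis abs_mult abs_triangle_ineq)
  also have "\<bar>sqrt (t q - t i)\<bar> * \<bar>s - s1\<bar> \<le> (4 * T) * (e / \<eta>)"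
  proof (intro mult_mono)
    have "sqrt (t q - t i) \<le> sqrt (4 * T)" using r by simp
    also have "\<dots> \<le> sqrt ((4 * T)\<^sup>2)" using T by (intro real_sqrt_le_mono) (simp add: power2_eq_square)
    also have "sqrt ((4 * T)\<^sup>2) = \<bar>4 * T\<bar>" by (rule real_sqrt_abs)
    also have "\<dots> = 4 * T" using T by simp
    finally show "\<bar>sqrt (t q - t i)\<bar> \<le> 4 * T" using c(3,4) by (simp only: abs_of_nonneg real_sqrt_ge_zero diff_ge_0_iff_ge order_trans[OF c(3,4)])
  qed (use * T in auto)
  also have "\<bar>s1\<bar> * \<bar>sqrt (t q - t i) - sqrt (q1 - p1)\<bar> \<le> B * sqrt (2 * \<eta>)"
  proof (intro mult_mono)
    have "\<bar>sqrt (t q - t i) - sqrt (q1 - p1)\<bar> \<le> sqrt \<bar>(t q - t i) - (q1 - p1)\<bar>"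
      by (rule sqrt_diff_le) (use c pqT \<eta> in auto)
    also have "\<dots> \<le> sqrt (2 * \<eta>)" using * by (intro real_sqrt_le_mono) linarith
    finally show "\<bar>sqrt (t q - t i) - sqrt (q1 - p1)\<bar> \<le> sqrt (2 * \<eta>)" .
  qed (use B in auto)
  finally show "\<bar>sqrt (t q - t i) * s - sqrt (q1 - p1) * s1\<bar> \<le> 4 * T * (e / \<eta>) + B * sqrt (2 * \<eta>)" by simp
qed

context two_sided_bm
begin

text \<open>
  The slope of the supporting chord, times the root of its length, depends continuously on the path,
  off a set of small probability and uniformly over all finite diagrams near the path.  The parameters
  are chosen in the order \<open>B\<close>, \<open>T\<close>, \<open>\<eta>\<close>,
  \<open>\<kappa>0\<close>, \<open>e\<close>, \<open>h\<close>, \<open>\<kappa>\<close>, each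
  depending on the earlier ones only.
\<close>

theorem limit_chord_stable:
  assumes lim: "is_limit_variable P W L" and p: "p > 0" and e0: "e0 > 0"
  shows "\<exists>(T::nat) \<kappa>. real T \<ge> T0 \<and> T \<ge> 1 \<and> \<kappa> > 0 \<and> holds_except P p (\<lambda>\<omega>. \<forall>(I::'i set) t v i q s.
     discrete_chord I t v i q s \<longrightarrow> tracks T \<kappa> I t v (\<lambda>t. W t \<omega> + t\<^sup>2) \<longrightarrow>
     \<bar>t i\<bar> \<le> 2 * T \<and> \<bar>t q\<bar> \<le> 2 * T \<and> \<bar>sqrt (t q - t i) * s - L \<omega>\<bar> \<le> e0)"
proof -
  \<comment> \<open>Six exceptional sets of equal probability; continuity and attainment of the min-max cost
    nothing.\<close>
  define p' where "p' = p / 6"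
  have p': "p' > 0" using p by (simp add: p'_def)
  interpret r: two_sided_bm P "\<lambda>t. W (- t)" by (rule reverse)
  obtain B0 where B0: "B0 > 0" and H1: "holds_except P p' (\<lambda>\<omega>. \<forall>l q s. l \<le> 0 \<longrightarrow> 0 \<le> q \<longrightarrow>
     (\<forall>t. W t \<omega> + t\<^sup>2 \<ge> W l \<omega> + l\<^sup>2 + s * (t - l)) \<longrightarrow>
     W q \<omega> + q\<^sup>2 = W l \<omega> + l\<^sup>2 + s * (q - l) \<longrightarrow> \<bar>s\<bar> \<le> B0)"
    using chord_slope_bounded[OF p'] by blast
  define B where "B = B0 + 1"
  have B: "B \<ge> 1" "B > 0" "B0 \<le> B" using B0 by (auto simp: B_def)
  define T where "T = nat \<lceil>max (max T0 (16 * B)) (1024 / p')\<rceil>"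
  have T: "real T \<ge> T0" "real T \<ge> 16 * B" "real T \<ge> 1024 / p'" unfolding T_def by linarith+
  have T1: "real T \<ge> 1" "real T > 0" using T(2) B by linarith+
  have H2: "holds_except P p' (\<lambda>\<omega>. \<forall>t::real. \<bar>t\<bar> \<ge> T \<longrightarrow> \<bar>W t \<omega>\<bar> \<le> T / 4 * \<bar>t\<bar>)"
  proof (rule holds_except_mono[OF growth_bound_two_sided[of "real T" "T / 4"]])
    have "real T * 1 \<le> real T * real T^2" using T1 by (intro mult_left_mono) auto
    then have T3: "real T \<le> real T^3" by (simp add: power3_eq_cube power2_eq_square)
    have "1024 \<le> p' * T" using T(3) p' by (simp add: field_simps)
    also have "\<dots> \<le> p' * real T^3" using T3 p' by (intro mult_left_mono) auto
    finally show "64 / ((T / 4)\<^sup>2 * T) \<le> p'" using T1 by (simp add: power2_eq_square power3_eq_cube field_simps)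
  qed (use T1 in auto)
  obtain \<eta>1 where \<eta>1: "\<eta>1 > 0" and H3: "holds_except P p' (\<lambda>\<omega>. \<forall>q\<in>{0..\<eta>1}. \<forall>s\<in>{-B..B}. \<exists>t. W t \<omega> + t\<^sup>2 < W q \<omega> + q\<^sup>2 + s * (t - q))"
    using not_vertex_right[OF B(2) p'] by blast
  obtain \<eta>2 where \<eta>2: "\<eta>2 > 0" and H4: "holds_except P p' (\<lambda>\<omega>. \<forall>q\<in>{0..\<eta>2}. \<forall>s\<in>{-B..B}. \<exists>t. W (- t) \<omega> + t\<^sup>2 < W (- q) \<omega> + q\<^sup>2 + s * (t - q))"
    using r.not_vertex_right[OF B(2) p'] by blast
  define \<eta> where "\<eta> = min (min 1 (\<eta>1 / 4)) (min (\<eta>2 / 4) ((e0 / (2 * B))\<^sup>2 / 2))"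
  have \<eta>: "\<eta> > 0" "\<eta> \<le> 1" "4 * \<eta> \<le> \<eta>1" "4 * \<eta> \<le> \<eta>2" "2 * \<eta> \<le> (e0 / (2 * B))\<^sup>2"
    using \<eta>1 \<eta>2 e0 B by (auto simp: \<eta>_def)
  have Beta: "B * sqrt (2 * \<eta>) \<le> e0 / 2"
  proof -
    have "sqrt (2 * \<eta>) \<le> sqrt ((e0 / (2 * B))\<^sup>2)" using \<eta> by (intro real_sqrt_le_mono) auto
    also have "\<dots> = e0 / (2 * B)" using e0 B by simp
    finally show ?thesis using B by (simp add: field_simps)
  qed
  define w where "w = \<eta> / 6"
  have w: "w > 0" using \<eta> by (simp add: w_def)
  obtain \<kappa>0 where \<kappa>0: "\<kappa>0 > 0" and H5: "\<And>G. finite G \<Longrightarrow> G \<subseteq> {-real T..real T} \<Longrightarrow> holds_except P p'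
    (\<lambda>\<omega>. \<forall>c1 c2 c3. c1 + 2 \<le> c2 \<longrightarrow> c2 + 2 \<le> c3 \<longrightarrow> cell w G c1 \<noteq> {} \<longrightarrow> cell w G c2 \<noteq> {} \<longrightarrow> cell w G c3 \<noteq> {} \<longrightarrow>
       \<not> tied (\<lambda>t. W t \<omega> + t\<^sup>2) \<kappa>0 (cell w G c1) (cell w G c2) (cell w G c3))"
    using no_ties_on_grid[OF w T1(2) p'] by blast
  define \<kappa>1 where "\<kappa>1 = \<kappa>0 / 2"
  define e where "e = min (min (\<kappa>1 / 4) (1 / 2)) (min (min (\<kappa>1 / 2) (1 / 8) * \<eta> / (16 * T)) (e0 * \<eta> / (8 * T)))"
  have \<kappa>1: "\<kappa>1 > 0" using \<kappa>0 by (simp add: \<kappa>1_def)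
  have mpos: "min (\<kappa>1 / 2) (1 / 8) * \<eta> > 0" using \<kappa>1 \<eta> by simp
  have e: "e > 0" "e \<le> \<kappa>1 / 4" "e \<le> 1 / 2" "e \<le> min (\<kappa>1 / 2) (1 / 8) * \<eta> / (16 * T)" "e \<le> e0 * \<eta> / (8 * T)"
    using mpos \<kappa>1 T1 \<eta> e0 by (auto simp: e_def)
  have e4: "8 * T * e < min (\<kappa>1 / 2) (1 / 8) * \<eta>"
  proof -
    have "16 * T * e \<le> min (\<kappa>1 / 2) (1 / 8) * \<eta>" using e(4) T1 by (simp add: pos_le_divide_eq mult.commute)
    moreover have "T * e > 0" using T1 e by simp
    ultimately show ?thesis by linarith
  qed
  have e5: "4 * T * (e / \<eta>) \<le> e0 / 2"
    using e(5) T1 \<eta> by (simp add: field_simps)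
  obtain r0 where r0: "\<And>r. r \<ge> r0 \<Longrightarrow> holds_except P p' (\<lambda>\<omega>. \<forall>s t. \<bar>s\<bar> \<le> real T \<longrightarrow> \<bar>t\<bar> \<le> real T \<longrightarrow> \<bar>s - t\<bar> \<le> 1 / real (Suc r) \<longrightarrow> \<bar>W s \<omega> - W t \<omega>\<bar> \<le> e / 8)"
    using path_modulus[OF T1(2) _ p', of "e / 8"] e by auto
  define hm where "hm = min (\<eta> / 4) (e / (8 * (2 * T + B)))"
  have hm: "hm > 0" using \<eta> e T1 B by (simp add: hm_def)
  obtain r1 where r1: "inverse (real (Suc r1)) < hm" using reals_Archimedean[OF hm] by blast
  define rr where "rr = max r0 r1"
  define h where "h = 1 / real (Suc rr)"
  have "h \<le> inverse (real (Suc r1))" unfolding h_def rr_def by (simp add: field_simps)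
  then have h: "h > 0" "h \<le> \<eta> / 4" "h \<le> e / (8 * (2 * T + B))" using r1 by (auto simp: h_def hm_def)
  have h2: "(2 * T + B) * h \<le> e / 8" using h(3) T1 B by (simp add: field_simps)
  have H6: "holds_except P p' (\<lambda>\<omega>. \<forall>s t. \<bar>s\<bar> \<le> real T \<longrightarrow> \<bar>t\<bar> \<le> real T \<longrightarrow> \<bar>s - t\<bar> \<le> h \<longrightarrow> \<bar>W s \<omega> - W t \<omega>\<bar> \<le> e / 8)"
    unfolding h_def by (rule r0) (simp add: rr_def)
  define G where "G = (\<lambda>z. of_int z * h) ` {- int (T * Suc rr)..int (T * Suc rr)}"
  have G: "finite G" "G \<subseteq> {-real T..real T}"
  proof -
    show "G \<subseteq> {-real T..real T}"
    proof
      fix x assume "x \<in> G"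
      then obtain z where "x = of_int z * h" "z \<in> {- int (T * Suc rr)..int (T * Suc rr)}" unfolding G_def by blast
      then have z: "x = of_int z * h" "- int (T * Suc rr) \<le> z" "z \<le> int (T * Suc rr)" by (simp_all only: atLeastAtMost_iff)
      have zr: "- (real T * real (Suc rr)) \<le> of_int z" "of_int z \<le> real T * real (Suc rr)" using z(2,3) by (metis of_int_le_iff of_int_minus of_int_of_nat_eq of_nat_mult)+
      have Th: "real T * real (Suc rr) * h = real T" "- (real T * real (Suc rr)) * h = - real T" by (simp_all add: h_def)
      have "- real T \<le> of_int z * h" unfolding Th(2)[symmetric] by (rule mult_right_mono[OF zr(1)]) (use h(1) in simp)
      moreover have "of_int z * h \<le> real T" by (subst Th(1)[symmetric], rule mult_right_mono[OF zr(2)]) (use h(1) in simp)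
      ultimately show "x \<in> {-real T..real T}" unfolding z(1) by simp
    qed
  qed (simp add: G_def)
  have Gnear: "\<exists>y\<in>G. \<bar>y - x\<bar> \<le> h" if x: "\<bar>x\<bar> \<le> T" for x :: real
  proof -
    define z where "z = \<lfloor>x / h\<rfloor>"
    have eqT: "real_of_int (int (T * Suc rr)) = real T * real (Suc rr)" by (metis of_int_of_nat_eq of_nat_mult)
    have xh: "x / h = x * real (Suc rr)" by (simp add: h_def)
    have "- real T \<le> x" "x \<le> real T" using x by (simp_all only: abs_le_iff) linarith
    then have "- real T * real (Suc rr) \<le> x * real (Suc rr)" "x * real (Suc rr) \<le> real T * real (Suc rr)"
      by (intro mult_right_mono; simp)+
    then have "real_of_int (- int (T * Suc rr)) \<le> x / h" "x / h \<le> real_of_int (int (T * Suc rr))"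
      unfolding xh of_int_minus eqT by (simp_all only: mult_minus_left)
    then have "- int (T * Suc rr) \<le> z" "z \<le> int (T * Suc rr)" unfolding z_def by linarith+
    then have "z \<in> {- int (T * Suc rr)..int (T * Suc rr)}" by (simp only: atLeastAtMost_iff simp_thms)
    then have "of_int z * h \<in> G" unfolding G_def by (rule imageI)
    moreover have "\<bar>of_int z * h - x\<bar> \<le> h"
    proof -
      have "of_int z \<le> x / h" "x / h < of_int z + 1" unfolding z_def by linarith+
      then have "of_int z * h \<le> x" "x < (of_int z + 1) * h" using h(1) by (auto simp: field_simps)
      then show ?thesis using h(1) by (simp add: algebra_simps abs_le_iff)
    qed
    ultimately show ?thesis by (rule bexI[rotated])
  qed
  have H7: "holds_except P 0 (\<lambda>\<omega>. (W 0 \<omega> = 0 \<and> continuous_on UNIV (\<lambda>t. W t \<omega>)) \<and> (\<exists>g h. minmax_attained_at (\<lambda>t. W t \<omega>) g h \<and>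
        L \<omega> = sqrt (g + h) * real_of_ereal (minmax_value (\<lambda>t. W t \<omega>))))"
    by (rule holds_except_AE, rule AE_conjI[OF W_path lim[unfolded is_limit_variable_def, THEN conjunct2]])
  define \<kappa> where "\<kappa> = min h (min \<eta> (e / (4 * B)))"
  have \<kappa>: "\<kappa> > 0" "\<kappa> \<le> h" "\<kappa> \<le> \<eta>" "\<kappa> \<le> e / (4 * B)" using h \<eta> e B by (auto simp: \<kappa>_def)
  have \<kappa>B: "B * \<kappa> \<le> e / 4" "\<kappa> \<le> e / 4"
  proof -
    show "B * \<kappa> \<le> e / 4" using \<kappa>(4) B by (simp add: field_simps)
    moreover have "1 * \<kappa> \<le> B * \<kappa>" using B \<kappa> by (intro mult_right_mono) auto
    ultimately show "\<kappa> \<le> e / 4" by simp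
  qed
  note all = holds_except_conj[OF H1 holds_except_conj[OF H2 holds_except_conj[OF H3 holds_except_conj[OF H4 holds_except_conj[OF H5[OF G] holds_except_conj[OF H6 H7]]]]]]
  show ?thesis
  proof (intro exI conjI)
    show "real T \<ge> T0" "1 \<le> T" "\<kappa> > 0" using T T1 \<kappa> by auto
    show "holds_except P p (\<lambda>\<omega>. \<forall>(I::'i set) t v i q s. discrete_chord I t v i q s \<longrightarrow> tracks T \<kappa> I t v (\<lambda>t. W t \<omega> + t\<^sup>2) \<longrightarrow>
     \<bar>t i\<bar> \<le> 2 * T \<and> \<bar>t q\<bar> \<le> 2 * T \<and> \<bar>sqrt (t q - t i) * s - L \<omega>\<bar> \<le> e0)"
      using all
    proof (rule holds_except_mono, goal_cases)
      case 1
      show ?case using p by (simp add: p'_def)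
    next
      case (2 \<omega>)
      define V where "V t = W t \<omega> + t\<^sup>2" for t
      from 2 obtain g hh where at: "minmax_attained_at (\<lambda>t. W t \<omega>) g hh" and L: "L \<omega> = sqrt (g + hh) * real_of_ereal (minmax_value (\<lambda>t. W t \<omega>))"
        by blast
      from 2 have cont: "continuous_on UNIV (\<lambda>t. W t \<omega>)" and W0: "W 0 \<omega> = 0" by blast+
      from 2 have tail: "\<bar>t\<bar> \<ge> T \<Longrightarrow> \<bar>W t \<omega>\<bar> \<le> T / 4 * \<bar>t\<bar>" for t :: real by blast
      from 2 have modW: "\<bar>x\<bar> \<le> real T \<Longrightarrow> \<bar>y\<bar> \<le> real T \<Longrightarrow> \<bar>x - y\<bar> \<le> h \<Longrightarrow> \<bar>W x \<omega> - W y \<omega>\<bar> \<le> e / 8" for x y by blast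
      from 2 have nt: "c1 + 2 \<le> c2 \<Longrightarrow> c2 + 2 \<le> c3 \<Longrightarrow> cell w G c1 \<noteq> {} \<Longrightarrow> cell w G c2 \<noteq> {} \<Longrightarrow> cell w G c3 \<noteq> {} \<Longrightarrow>
       \<not> tied V \<kappa>0 (cell w G c1) (cell w G c2) (cell w G c3)" for c1 c2 c3
        unfolding V_def by blast
      define s1 where "s1 = real_of_ereal (minmax_value (\<lambda>t. W t \<omega>))"
      have tail': "t \<le> - real T \<Longrightarrow> \<bar>W t \<omega>\<bar> \<le> T / 4 * \<bar>t\<bar>" for t :: real using tail[of t] by simp
      have ch: "W t \<omega> + t\<^sup>2 \<ge> (W (- hh) \<omega> + hh\<^sup>2) + s1 * (t + hh)" "W g \<omega> + g\<^sup>2 = (W (- hh) \<omega> + hh\<^sup>2) + s1 * (g + hh)" for t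
        unfolding s1_def
        by (rule chord_of_minmax(1)[OF cont _ at], erule tail', rule chord_of_minmax(2)[OF cont _ at], erule tail')
      have gh: "g \<ge> 0" "hh > 0" using at by (auto simp: minmax_attained_at_def)
      define a1 where "a1 = V (- hh) + s1 * hh"
      have sup: "V x \<ge> a1 + s1 * x" for x using ch(1)[of x] by (simp add: V_def a1_def s1_def algebra_simps)
      have eqp: "V (- hh) = a1 + s1 * (- hh)" by (simp add: a1_def)
      have eqq: "V g = a1 + s1 * g" using ch(2) by (simp add: V_def a1_def s1_def algebra_simps)
      have s1B: "\<bar>s1\<bar> \<le> B"
      proof -
        have "\<bar>s1\<bar> \<le> B0"
        proof (rule 2(2)[THEN conjunct1, rule_format, of "- hh" g s1])
          show "- hh \<le> 0" "0 \<le> g" using gh by auto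
          show "W t \<omega> + t\<^sup>2 \<ge> W (- hh) \<omega> + (- hh)\<^sup>2 + s1 * (t - - hh)" for t using ch(1)[of t] by (simp add: s1_def)
          show "W g \<omega> + g\<^sup>2 = W (- hh) \<omega> + (- hh)\<^sup>2 + s1 * (g - - hh)" using ch(2) by (simp add: s1_def)
        qed
        then show ?thesis using B by simp
      qed
      have a10: "a1 \<le> 0" using sup[of 0] W0 by (simp add: V_def)
      have inT: "\<bar>x\<bar> \<le> T" if "V x = a1 + s1 * x" for x :: real
      proof (rule ccontr)
        assume "\<not> \<bar>x\<bar> \<le> T"
        then have x: "\<bar>x\<bar> \<ge> T" "\<bar>x\<bar> > 0" using T1 by linarith+
        have "V x \<ge> \<bar>x\<bar> * \<bar>x\<bar> - T / 4 * \<bar>x\<bar>" using tail[OF x(1)] by (simp add: V_def power2_eq_square abs_le_iff)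
        moreover have "T * \<bar>x\<bar> \<le> \<bar>x\<bar> * \<bar>x\<bar>" using x by (intro mult_right_mono) auto
        moreover have "s1 * x \<le> T / 16 * \<bar>x\<bar>"
        proof -
          have "s1 * x \<le> \<bar>s1\<bar> * \<bar>x\<bar>" by (metis abs_ge_self abs_mult)
          also have "\<dots> \<le> T / 16 * \<bar>x\<bar>" using s1B T(2) by (intro mult_right_mono) auto
          finally show ?thesis .
        qed
        moreover have "T * \<bar>x\<bar> > 0" using x T1 by simp
        ultimately show False using that a10 by linarith
      qed
      have gpos: "g \<ge> 4 * \<eta>"
      proof (rule ccontr)
        assume "\<not> g \<ge> 4 * \<eta>"
        then have "g \<in> {0..\<eta>1}" using \<eta> gh by auto
        moreover have "s1 \<in> {-B..B}" using s1B by auto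
        ultimately have "\<exists>t. W t \<omega> + t\<^sup>2 < W g \<omega> + g\<^sup>2 + s1 * (t - g)" using 2 by blast
        then obtain t where "W t \<omega> + t\<^sup>2 < W g \<omega> + g\<^sup>2 + s1 * (t - g)" ..
        then have "V t < V g + s1 * (t - g)" by (simp add: V_def)
        then show False using sup[of t] eqq by (simp add: algebra_simps)
      qed
      have hpos: "hh \<ge> 4 * \<eta>"
      proof (rule ccontr)
        assume "\<not> hh \<ge> 4 * \<eta>"
        then have "hh \<in> {0..\<eta>2}" using \<eta> gh by auto
        moreover have "- s1 \<in> {-B..B}" using s1B by auto
        ultimately have "\<exists>t. W (- t) \<omega> + t\<^sup>2 < W (- hh) \<omega> + hh\<^sup>2 + (- s1) * (t - hh)" using 2 by blast
        then obtain t where "W (- t) \<omega> + t\<^sup>2 < W (- hh) \<omega> + hh\<^sup>2 + (- s1) * (t - hh)" ..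
        then have "V (- t) < V (- hh) + (- s1) * (t - hh)" by (simp add: V_def)
        then show False using sup[of "- t"] eqp by (simp add: algebra_simps)
      qed
      have modV: "V x \<le> V y + (e / 8 + 2 * T * h)" if "\<bar>x\<bar> \<le> real T" "\<bar>y\<bar> \<le> real T" "\<bar>x - y\<bar> \<le> h" for x y
      proof -
        have "x\<^sup>2 - y\<^sup>2 = (x + y) * (x - y)" by (simp add: power2_eq_square algebra_simps)
        also have "\<dots> \<le> \<bar>x + y\<bar> * \<bar>x - y\<bar>" by (metis abs_ge_self abs_mult)
        also have "\<dots> \<le> (2 * T) * h" using that by (intro mult_mono) auto
        finally show ?thesis using modW[OF that] unfolding V_def by linarith
      qed
      have pT: "\<bar>- hh\<bar> \<le> T" "\<bar>g\<bar> \<le> T" using inT[OF eqp] inT[OF eqq] by auto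
      have Bh: "B * h \<ge> 0" "T * h \<ge> 0" "(2 * T + B) * h = 2 * T * h + B * h" using B h T1 by (auto simp: algebra_simps)
      have sBh: "\<bar>s1\<bar> * h \<le> B * h" using s1B h by (intro mult_right_mono) auto
      have margin: "V x \<ge> a1 + s1 * x + \<kappa>1" if x: "\<bar>x\<bar> \<le> T" "\<bar>x - (- hh)\<bar> > \<eta>" "\<bar>x - g\<bar> > \<eta>" for x :: real
        unfolding \<kappa>1_def
      proof (rule margin_of_no_ties[where V=V and T="real T" and G=G and h=h and w=w and d="e/8 + (2 * T + B) * h", OF sup eqp eqq pT])
        show "- hh + \<eta> < g" using gpos hpos \<eta> by linarith
        show "\<exists>y\<in>G. \<bar>y - x\<bar> \<le> h \<and> V y \<le> V x + (e / 8 + (2 * T + B) * h) - \<bar>s1\<bar> * h" if xT: "\<bar>x\<bar> \<le> T" for x :: real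
        proof -
          obtain y where y: "y \<in> G" "\<bar>y - x\<bar> \<le> h" using Gnear[OF xT] by blast
          then have "\<bar>y\<bar> \<le> T" using G(2) by (auto simp: abs_le_iff subset_eq)
          from modV[OF this xT y(2)] y show ?thesis using sBh Bh by (intro bexI[of _ y]) auto
        qed
        show "3 * w + 2 * h \<le> \<eta>" using h by (simp add: w_def)
        show "0 \<le> e / 8 + (2 * T + B) * h" using e Bh by auto
        have "2 * (e / 8 + (2 * T + B) * h) \<le> 2 * (e / 8 + e / 8)" by (intro mult_left_mono add_left_mono h2) simp
        also have "\<dots> = e / 2" by simp
        also have "\<dots> < \<kappa>0" using e(1,2) \<kappa>0 by (simp add: \<kappa>1_def)
        finally show "2 * (e / 8 + (2 * T + B) * h) < \<kappa>0" .
      qed (use x G w nt in auto)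
      have modV2: "V x \<le> V y + e / 4" if "\<bar>x\<bar> \<le> real T" "\<bar>y\<bar> \<le> real T" "\<bar>x - y\<bar> \<le> \<kappa>" for x y
        using modV[OF that(1,2)] that(3) \<kappa>(2) h2 Bh by simp
      show ?case
      proof (intro allI impI)
        fix I :: "'i set" and t v i q s
        assume dc: "discrete_chord I t v i q s" and tr: "tracks T \<kappa> I t v (\<lambda>t. W t \<omega> + t\<^sup>2)"
        have tr: "tracks T \<kappa> I t v V" using tr by (simp add: V_def[abs_def])
        have k: "- hh \<le> - 3 * \<eta>" "g \<ge> 3 * \<eta>" "e \<le> \<kappa>1 / 2" using gpos hpos \<eta> e by linarith+
        have f: "\<forall>x. V x \<ge> a1 + s1 * x" "\<forall>x. \<bar>x\<bar> \<le> real T \<longrightarrow> \<bar>x - (- hh)\<bar> > \<eta> \<longrightarrow> \<bar>x - g\<bar> > \<eta> \<longrightarrow> V x \<ge> a1 + s1 * x + \<kappa>1"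
          "\<forall>x y. \<bar>x\<bar> \<le> real T \<longrightarrow> \<bar>y\<bar> \<le> real T \<longrightarrow> \<bar>x - y\<bar> \<le> \<kappa> \<longrightarrow> V x \<le> V y + e / 4"
          using sup margin modV2 by blast+
        have e4': "8 * real T * e < min (\<kappa>1 / 2) (1 / 8) * \<eta>" using e4 by simp
        note dcc = discrete_chord_close[OF dc tr f(1) eqp eqq a10 f(2,3) s1B B(1) T(2) pT k(1,2) \<eta>(1,2) \<kappa>(1,3) \<kappa>B e(1) k(3) e(3) e4' \<kappa>1]
        have "L \<omega> = sqrt (g - - hh) * s1" using L by (simp add: s1_def)
        then show "\<bar>t i\<bar> \<le> 2 * T \<and> \<bar>t q\<bar> \<le> 2 * T \<and> \<bar>sqrt (t q - t i) * s - L \<omega>\<bar> \<le> e0"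
          using dcc e5 Beta by auto
      qed
    qed
  qed
qed

end

section \<open>Approximation of independent increments\<close>

lemma ceiling_box: "b > 0 \<Longrightarrow> \<lceil>x / b\<rceil> = c \<longleftrightarrow> x \<in> {(of_int c - 1) * b <.. of_int c * b}"
  by (auto simp: ceiling_eq_iff pos_less_divide_eq pos_divide_le_eq)

text \<open>
  Round both vectors up to a lattice of mesh \<open>b\<close>.  Up to small probability
  \<open>Y\<close> visits on \<open>G\<close> only finitely many lattice boxes.  The probability that
  \<open>X m\<close> is in one of them converges by independence and convergence of the marginals, to
  a limit not much below the probability of \<open>G\<close>.  A sample point with \<open>X m\<close>
  in a visited box has a partner in \<open>G\<close>.
\<close>

lemma box_convergence:
  fixes X :: "nat \<Rightarrow> nat \<Rightarrow> 'a \<Rightarrow> real" and Y :: "nat \<Rightarrow> 'b \<Rightarrow> real"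
  assumes M: "\<And>m. prob_space (M m)" and P: "prob_space P"
    and X: "\<forall>\<^sub>F m in sequentially. prob_space.indep_vars (M m) (\<lambda>_. borel) (X m) {..<r}"
    and Y: "prob_space.indep_vars P (\<lambda>_. borel) Y {..<r}" and r: "r > 0"
    and lim: "\<And>l u v. l < r \<Longrightarrow> u < v \<Longrightarrow>
      (\<lambda>m. measure (M m) {\<omega>\<in>space (M m). X m l \<omega> \<in> {u<..v}}) \<longlonglongrightarrow> measure P {\<omega>\<in>space P. Y l \<omega> \<in> {u<..v}}"
    and G: "G \<in> sets P" and b: "b > 0" and p: "p > 0"
  shows "\<forall>\<^sub>F m in sequentially. \<exists>E\<in>sets (M m). measure (M m) E \<ge> measure P G - p \<and>
    (\<forall>\<omega>'\<in>E. \<exists>\<omega>\<in>G. \<forall>l<r. \<bar>X m l \<omega>' - Y l \<omega>\<bar> \<le> b)"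
proof -
  interpret P: prob_space P by fact
  have Yrv: "Y l \<in> borel_measurable P" if "l < r" for l using Y that by (auto simp: P.indep_vars_def)
  have box: "{\<omega>\<in>space Q. \<forall>l\<in>{..<r}. \<lceil>Z l \<omega> / b\<rceil> = c l} \<in> sets Q"
      "measure Q {\<omega>\<in>space Q. \<forall>l\<in>{..<r}. \<lceil>Z l \<omega> / b\<rceil> = c l} =
       (\<Prod>l<r. measure Q {\<omega>\<in>space Q. Z l \<omega> \<in> {(of_int (c l) - 1) * b <.. of_int (c l) * b}})"
    if Q: "prob_space Q" and ind: "prob_space.indep_vars Q (\<lambda>_. borel) Z {..<r}" for Q :: "'c measure" and Z c
  proof -
    interpret Q: prob_space Q by fact
    have Zrv: "Z l \<in> borel_measurable Q" if "l < r" for l using ind that by (auto simp: Q.indep_vars_def)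
    have eq: "{\<omega>\<in>space Q. \<forall>l\<in>{..<r}. \<lceil>Z l \<omega> / b\<rceil> = c l} =
        (\<Inter>l\<in>{..<r}. Z l -` {(of_int (c l) - 1) * b <.. of_int (c l) * b} \<inter> space Q)"
      using r by (auto simp: ceiling_box[OF b])
    show "{\<omega>\<in>space Q. \<forall>l\<in>{..<r}. \<lceil>Z l \<omega> / b\<rceil> = c l} \<in> sets Q"
      unfolding eq using r Zrv by (intro sets.finite_INT measurable_sets[of _ _ borel]) auto
    show "measure Q {\<omega>\<in>space Q. \<forall>l\<in>{..<r}. \<lceil>Z l \<omega> / b\<rceil> = c l} =
       (\<Prod>l<r. measure Q {\<omega>\<in>space Q. Z l \<omega> \<in> {(of_int (c l) - 1) * b <.. of_int (c l) * b}})"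
      unfolding eq by (subst Q.indep_varsD_finite[OF ind])
        (use r in \<open>auto simp: vimage_def Int_def conj_commute intro!: prod.cong arg_cong[where f="measure Q"]\<close>)
  qed
  have union: "measure Q (\<Union>c\<in>C. {\<omega>\<in>space Q. \<forall>l\<in>{..<r}. \<lceil>Z l \<omega> / b\<rceil> = c l}) =
      (\<Sum>c\<in>C. \<Prod>l<r. measure Q {\<omega>\<in>space Q. Z l \<omega> \<in> {(of_int (c l) - 1) * b <.. of_int (c l) * b}})"
    if Q: "prob_space Q" and ind: "prob_space.indep_vars Q (\<lambda>_. borel) Z {..<r}" and C: "finite C" "C \<subseteq> PiE {..<r} (\<lambda>_. UNIV)"
    for Q :: "'c measure" and Z C
  proof -
    interpret Q: prob_space Q by fact
    have "measure Q (\<Union>c\<in>C. {\<omega>\<in>space Q. \<forall>l\<in>{..<r}. \<lceil>Z l \<omega> / b\<rceil> = c l}) =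
        (\<Sum>c\<in>C. measure Q {\<omega>\<in>space Q. \<forall>l\<in>{..<r}. \<lceil>Z l \<omega> / b\<rceil> = c l})"
    proof (rule Q.finite_measure_finite_Union[OF C(1)])
      show "(\<lambda>c. {\<omega>\<in>space Q. \<forall>l\<in>{..<r}. \<lceil>Z l \<omega> / b\<rceil> = c l}) ` C \<subseteq> Q.events" using box(1)[OF Q ind] by blast
      show "disjoint_family_on (\<lambda>c. {\<omega>\<in>space Q. \<forall>l\<in>{..<r}. \<lceil>Z l \<omega> / b\<rceil> = c l}) C"
        unfolding disjoint_family_on_def
      proof (intro ballI impI)
        fix c c' assume "c \<in> C" "c' \<in> C" "c \<noteq> c'"
        then obtain l where "l < r" "c l \<noteq> c' l" using C(2) PiE_ext[of c "{..<r}" _ c'] by (metis lessThan_iff subsetD)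
        then show "{\<omega>\<in>space Q. \<forall>l\<in>{..<r}. \<lceil>Z l \<omega> / b\<rceil> = c l} \<inter> {\<omega>\<in>space Q. \<forall>l\<in>{..<r}. \<lceil>Z l \<omega> / b\<rceil> = c' l} = {}" by auto
      qed
    qed
    then show ?thesis using box(2)[OF Q ind] by simp
  qed
  have "\<exists>q0. \<forall>q\<ge>q0. holds_except P (p / 2) (\<lambda>\<omega>. \<forall>l\<in>{..<r}. \<bar>\<lceil>Y l \<omega> / b\<rceil>\<bar> \<le> int q)"
  proof (rule P.holds_except_eventually)
    fix q :: nat
    have "{\<omega>\<in>space P. \<bar>\<lceil>Y l \<omega> / b\<rceil>\<bar> \<le> int q} \<in> sets P" if "l < r" for l
    proof -
      note [measurable] = Yrv[OF that]
      have "{\<omega>\<in>space P. \<bar>\<lceil>Y l \<omega> / b\<rceil>\<bar> \<le> int q} = {\<omega>\<in>space P. Y l \<omega> / b \<le> real q \<and> - real q - 1 < Y l \<omega> / b}"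
        by (auto simp: abs_le_iff minus_le_iff le_ceiling_iff ceiling_le_iff)
      also have "\<dots> \<in> sets P" by measurable
      finally show ?thesis .
    qed
    then show "{\<omega>\<in>space P. \<forall>l\<in>{..<r}. \<bar>\<lceil>Y l \<omega> / b\<rceil>\<bar> \<le> int q} \<in> P.events" by (intro sets.sets_Collect_finite_All) auto
    show "\<forall>l\<in>{..<r}. \<bar>\<lceil>Y l \<omega> / b\<rceil>\<bar> \<le> int (Suc q)" if "\<forall>l\<in>{..<r}. \<bar>\<lceil>Y l \<omega> / b\<rceil>\<bar> \<le> int q" for \<omega>
    proof
      fix l assume "l \<in> {..<r}"
      then have "\<bar>\<lceil>Y l \<omega> / b\<rceil>\<bar> \<le> int q" using that by blast
      then show "\<bar>\<lceil>Y l \<omega> / b\<rceil>\<bar> \<le> int (Suc q)" by simp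
    qed
    show "AE \<omega> in P. \<exists>q. \<forall>l\<in>{..<r}. \<bar>\<lceil>Y l \<omega> / b\<rceil>\<bar> \<le> int q"
    proof (rule AE_I2)
      fix \<omega>
      have "\<bar>\<lceil>Y l \<omega> / b\<rceil>\<bar> \<le> int (nat (\<Sum>l<r. \<bar>\<lceil>Y l \<omega> / b\<rceil>\<bar>))" if "l \<in> {..<r}" for l
      proof -
        have "\<bar>\<lceil>Y l \<omega> / b\<rceil>\<bar> \<le> (\<Sum>l<r. \<bar>\<lceil>Y l \<omega> / b\<rceil>\<bar>)" by (rule member_le_sum) (use that in auto)
        then show ?thesis by simp
      qed
      then show "\<exists>q. \<forall>l\<in>{..<r}. \<bar>\<lceil>Y l \<omega> / b\<rceil>\<bar> \<le> int q" by blast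
    qed
  qed (use p in simp)
  then obtain q where "holds_except P (p / 2) (\<lambda>\<omega>. \<forall>l\<in>{..<r}. \<bar>\<lceil>Y l \<omega> / b\<rceil>\<bar> \<le> int q)" by blast
  then obtain Bd where Bd: "Bd \<in> sets P" "measure P Bd \<le> p / 2"
     "\<And>\<omega>. \<omega> \<in> space P \<Longrightarrow> \<omega> \<notin> Bd \<Longrightarrow> \<forall>l\<in>{..<r}. \<bar>\<lceil>Y l \<omega> / b\<rceil>\<bar> \<le> int q"
    unfolding holds_except_def by blast
  \<comment> \<open>The bounded boxes that \<open>Y\<close> visits on \<open>G\<close>.\<close>
  define C where "C = {c \<in> PiE {..<r} (\<lambda>_. {- int q..int q}). \<exists>\<omega>\<in>G. \<forall>l\<in>{..<r}. \<lceil>Y l \<omega> / b\<rceil> = c l}"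
  have C: "finite C" "C \<subseteq> PiE {..<r} (\<lambda>_. UNIV)"
  proof -
    have sub: "C \<subseteq> PiE {..<r} (\<lambda>_. {- int q..int q})" unfolding C_def by (rule Collect_restrict)
    then show "finite C" by (rule finite_subset) (intro finite_PiE; simp)
    have "PiE {..<r} (\<lambda>_. {- int q..int q}) \<subseteq> PiE {..<r} (\<lambda>_. UNIV)" by (rule PiE_mono) simp
    with sub show "C \<subseteq> PiE {..<r} (\<lambda>_. UNIV)" by (rule subset_trans)
  qed
  define E where "E m = (\<Union>c\<in>C. {\<omega>\<in>space (M m). \<forall>l\<in>{..<r}. \<lceil>X m l \<omega> / b\<rceil> = c l})" for m
  define F where "F = (\<Union>c\<in>C. {\<omega>\<in>space P. \<forall>l\<in>{..<r}. \<lceil>Y l \<omega> / b\<rceil> = c l})"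
  have "(\<lambda>m. \<Sum>c\<in>C. \<Prod>l<r. measure (M m) {\<omega>\<in>space (M m). X m l \<omega> \<in> {(of_int (c l) - 1) * b <.. of_int (c l) * b}}) \<longlonglongrightarrow>
      (\<Sum>c\<in>C. \<Prod>l<r. measure P {\<omega>\<in>space P. Y l \<omega> \<in> {(of_int (c l) - 1) * b <.. of_int (c l) * b}})"
    using b by (intro tendsto_sum tendsto_prod lim) (auto intro!: mult_strict_right_mono)
  also have "(\<Sum>c\<in>C. \<Prod>l<r. measure P {\<omega>\<in>space P. Y l \<omega> \<in> {(of_int (c l) - 1) * b <.. of_int (c l) * b}}) = measure P F"
    unfolding F_def by (rule union[OF P Y C, symmetric])
  finally have limE: "(\<lambda>m. \<Sum>c\<in>C. \<Prod>l<r. measure (M m) {\<omega>\<in>space (M m). X m l \<omega> \<in> {(of_int (c l) - 1) * b <.. of_int (c l) * b}}) \<longlonglongrightarrow> measure P F" .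
  have Fm: "F \<in> sets P" unfolding F_def using box(1)[OF P Y] C by (intro sets.finite_UN) auto
  have "G \<subseteq> F \<union> Bd"
  proof
    fix \<omega> assume \<omega>: "\<omega> \<in> G"
    then have \<omega>s: "\<omega> \<in> space P" using G sets.sets_into_space by blast
    show "\<omega> \<in> F \<union> Bd"
    proof (cases "\<omega> \<in> Bd")
      case False
      define c where "c = (\<lambda>l\<in>{..<r}. \<lceil>Y l \<omega> / b\<rceil>)"
      have "c \<in> C" unfolding C_def c_def using Bd(3)[OF \<omega>s False] \<omega> by (force simp: abs_le_iff)
      moreover have "\<forall>l\<in>{..<r}. \<lceil>Y l \<omega> / b\<rceil> = c l" by (simp add: c_def)
      ultimately show ?thesis using \<omega>s unfolding F_def by blast
    qed simp
  qed
  then have "measure P G \<le> measure P (F \<union> Bd)" using Fm Bd by (intro P.finite_measure_mono) auto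
  also have "\<dots> \<le> measure P F + measure P Bd" using Fm Bd by (intro measure_Un_le) auto
  finally have GF: "measure P F > measure P G - p" using Bd p by simp
  have "\<forall>\<^sub>F m in sequentially. (\<Sum>c\<in>C. \<Prod>l<r. measure (M m) {\<omega>\<in>space (M m). X m l \<omega> \<in> {(of_int (c l) - 1) * b <.. of_int (c l) * b}}) > measure P G - p"
    using limE GF by (rule order_tendstoD)
  with X show ?thesis
  proof eventually_elim
    case (elim m)
    show ?case
    proof (intro bexI[of _ "E m"] conjI ballI)
      show "E m \<in> sets (M m)" unfolding E_def using box(1)[OF M elim(1)] C by (intro sets.finite_UN) auto
      show "measure P G - p \<le> measure (M m) (E m)"
        unfolding E_def union[OF M elim(1) C] using elim(2) by simp
      fix \<omega>' assume "\<omega>' \<in> E m"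
      then obtain c where c: "c \<in> C" "\<forall>l\<in>{..<r}. \<lceil>X m l \<omega>' / b\<rceil> = c l" by (auto simp: E_def)
      then obtain \<omega> where \<omega>: "\<omega> \<in> G" "\<forall>l\<in>{..<r}. \<lceil>Y l \<omega> / b\<rceil> = c l" by (auto simp: C_def)
      have "\<bar>X m l \<omega>' - Y l \<omega>\<bar> \<le> b" if "l < r" for l
      proof -
        have "X m l \<omega>' \<in> {(of_int (c l) - 1) * b <.. of_int (c l) * b}" "Y l \<omega> \<in> {(of_int (c l) - 1) * b <.. of_int (c l) * b}"
          using c \<omega> that ceiling_box[OF b, of _ "c l"] by blast+
        then show ?thesis by (simp add: algebra_simps abs_le_iff)
      qed
      then show "\<exists>\<omega>\<in>G. \<forall>l<r. \<bar>X m l \<omega>' - Y l \<omega>\<bar> \<le> b" using \<omega> by blast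
    qed
  qed
qed

lemma telescope_close:
  fixes F H :: "nat \<Rightarrow> real"
  assumes "F a = H a" "a \<le> r" "i \<le> r" and d: "\<And>l. l < r \<Longrightarrow> \<bar>(F (Suc l) - F l) - (H (Suc l) - H l)\<bar> \<le> b"
  shows "\<bar>F i - H i\<bar> \<le> real r * b"
proof -
  have b: "b \<ge> 0" if "l < r" for l using d[OF that] by linarith
  have *: "\<bar>(F j - H j) - (F i - H i)\<bar> \<le> real (j - i) * b" if "i \<le> j" "j \<le> r" for i j
    using that
  proof (induction j)
    case (Suc j)
    show ?case
    proof (cases "i = Suc j")
      case False
      then have "\<bar>(F j - H j) - (F i - H i)\<bar> \<le> real (j - i) * b" using Suc by simp
      moreover have "\<bar>(F (Suc j) - F j) - (H (Suc j) - H j)\<bar> \<le> b" using d Suc by simp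
      moreover have "real (Suc j - i) * b = real (j - i) * b + b" using False Suc by (simp add: Suc_diff_le algebra_simps)
      ultimately show ?thesis by linarith
    qed simp
  qed simp
  have mul: "real x * b \<le> real r * b" if "x \<le> r" for x
    using b[of 0] that by (cases "r = 0") (auto intro!: mult_right_mono)
  show ?thesis
  proof (cases "i \<le> a")
    case True
    have "a - i \<le> r" using assms(2) by simp
    then have "real (a - i) * b \<le> real r * b" by (rule mul)
    moreover have "\<bar>F i - H i\<bar> \<le> real (a - i) * b" using *[OF True assms(2)] assms(1) by (simp add: abs_minus_commute)
    ultimately show ?thesis by linarith
  next
    case False
    have "i - a \<le> r" using assms(3) by simp
    then have "real (i - a) * b \<le> real r * b" by (rule mul)
    moreover have "\<bar>F i - H i\<bar> \<le> real (i - a) * b" using *[of a i] False assms(1,3) by simp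
    ultimately show ?thesis by linarith
  qed
qed

section \<open>The rescaled drift of a monotone array\<close>

lemma cumsum_diff_bound:
  fixes f :: "nat \<Rightarrow> real"
  assumes "\<And>i. (a < i \<and> i \<le> k) \<or> (k < i \<and> i \<le> a) \<Longrightarrow> \<bar>f i\<bar> \<le> b"
  shows "\<bar>(\<Sum>i=1..k. f i) - (\<Sum>i=1..a. f i)\<bar> \<le> \<bar>real k - real a\<bar> * b"
proof -
  have *: "\<bar>(\<Sum>i=1..k. f i) - (\<Sum>i=1..a. f i)\<bar> \<le> (real k - real a) * b"
    if "a \<le> k" "\<And>i. a < i \<Longrightarrow> i \<le> k \<Longrightarrow> \<bar>f i\<bar> \<le> b" for a k
  proof -
    have "(\<Sum>i=1..k. f i) - (\<Sum>i=1..a. f i) = (\<Sum>i=Suc a..k. f i)"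
      using sum.ub_add_nat[of 1 a f "k - a"] that(1) by simp
    also have "\<bar>\<dots>\<bar> \<le> (\<Sum>i=Suc a..k. b)" by (rule order_trans[OF sum_abs sum_mono]) (use that in auto)
    also have "\<dots> = (real k - real a) * b" using that(1) by (simp add: of_nat_diff)
    finally show ?thesis .
  qed
  show ?thesis
  proof (cases "a \<le> k")
    case True
    then show ?thesis using *[of a k] assms by simp
  next
    case False
    then show ?thesis using *[of k a] assms by (simp add: abs_minus_commute)
  qed
qed

lemma cumsum_subgradient:
  fixes f :: "nat \<Rightarrow> real"
  assumes mono: "\<And>i i'. 1 \<le> i \<Longrightarrow> i \<le> i' \<Longrightarrow> i' \<le> N \<Longrightarrow> f i \<le> f i'" and a: "1 \<le> a" "a \<le> N" and k: "k \<le> N"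
  shows "(\<Sum>i=1..k. f i) - (\<Sum>i=1..a. f i) \<ge> (real k - real a) * f a"
proof (cases "a \<le> k")
  case True
  have "(\<Sum>i=1..k. f i) - (\<Sum>i=1..a. f i) = (\<Sum>i=Suc a..k. f i)"
    using sum.ub_add_nat[of 1 a f "k - a"] True by simp
  also have "\<dots> \<ge> (\<Sum>i=Suc a..k. f a)" by (rule sum_mono) (use a k mono in auto)
  finally show ?thesis using True by (simp add: of_nat_diff)
next
  case False
  have "(\<Sum>i=1..a. f i) - (\<Sum>i=1..k. f i) = (\<Sum>i=Suc k..a. f i)"
    using sum.ub_add_nat[of 1 k f "a - k"] False by simp
  also have "\<dots> \<le> (\<Sum>i=Suc k..a. f a)" by (rule sum_mono) (use a k mono in auto)
  finally show ?thesis using False by (simp add: of_nat_diff algebra_simps)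
qed

lemma cumsum_centered: "(\<Sum>i=1..k. real i - real a) - (\<Sum>i=1..a. real i - real a) = (real k - real a) * (real k - real a + 1) / 2"
proof -
  have *: "(\<Sum>i=1..k. real i - real a) = real k * (real k + 1) / 2 - real k * real a" for k
    by (induction k) (auto simp: field_simps)
  show ?thesis unfolding *[of k] *[of a] by (simp add: field_simps)
qed

text \<open>
  Reads the supremum in \<open>locally_linear_at\<close> as a bound at every point; monotonicity makes
  the supremum finite.
\<close>

lemma locally_linear_bound:
  assumes g: "mono_on {0..1} g" and x0: "0 < x0" "x0 < 1" and D: "locally_linear_at g x0 D" and L: "L > 0" and e: "e > 0"
  shows "\<forall>\<^sub>F \<delta> in at_right 0. \<forall>x\<in>{0..1}. \<bar>x - x0\<bar> \<le> L * \<delta> \<longrightarrow> \<bar>g x - g x0 - D * (x - x0)\<bar> \<le> e * \<delta>"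
proof -
  have "((\<lambda>\<delta>. (SUP x\<in>{x\<in>{0..1}. \<bar>x - x0\<bar> \<le> L * \<delta>}. \<bar>g x - g x0 - D * (x - x0)\<bar>) / \<delta>) \<longlongrightarrow> 0) (at_right 0)"
    using D L unfolding locally_linear_at_def by blast
  then have "\<forall>\<^sub>F \<delta> in at_right 0. (SUP x\<in>{x\<in>{0..1}. \<bar>x - x0\<bar> \<le> L * \<delta>}. \<bar>g x - g x0 - D * (x - x0)\<bar>) / \<delta> < e"
    using e by (rule order_tendstoD)
  moreover have "\<forall>\<^sub>F \<delta> in at_right (0::real). \<delta> > 0" by (rule eventually_at_right_less)
  ultimately show ?thesis
  proof eventually_elim
    case (elim \<delta>)
    show ?case
    proof (intro ballI impI)
      fix x assume x: "x \<in> {0..1}" "\<bar>x - x0\<bar> \<le> L * \<delta>"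
      have bdd: "bdd_above ((\<lambda>x. \<bar>g x - g x0 - D * (x - x0)\<bar>) ` {x\<in>{0..1}. \<bar>x - x0\<bar> \<le> L * \<delta>})"
      proof (rule bdd_aboveI2)
        fix x assume "x \<in> {x\<in>{0..1}. \<bar>x - x0\<bar> \<le> L * \<delta>}"
        then have x: "x \<in> {0..1}" by simp
        have "g 0 \<le> g x" "g x \<le> g 1" "g 0 \<le> g x0" "g x0 \<le> g 1"
          using x x0 by (auto intro!: mono_onD[OF g])
        moreover have "\<bar>D * (x - x0)\<bar> \<le> \<bar>D\<bar> * 1" unfolding abs_mult using x x0 by (intro mult_left_mono) auto
        ultimately show "\<bar>g x - g x0 - D * (x - x0)\<bar> \<le> (g 1 - g 0) + \<bar>D\<bar>" by linarith
      qed
      have "\<bar>g x - g x0 - D * (x - x0)\<bar> \<le> (SUP x\<in>{x\<in>{0..1}. \<bar>x - x0\<bar> \<le> L * \<delta>}. \<bar>g x - g x0 - D * (x - x0)\<bar>)"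
        by (rule cSUP_upper[OF _ bdd]) (use x in auto)
      also have "\<dots> \<le> e * \<delta>" using elim by (simp add: pos_divide_less_eq)
      finally show "\<bar>g x - g x0 - D * (x - x0)\<bar> \<le> e * \<delta>" .
    qed
  qed
qed

text \<open>
  What remains of the model after the reduction to one coordinate: \<open>N m\<close> groups \<open>R
  m k\<close> of \<open>K m\<close> errors each, group \<open>k\<close> being located at \<open>k / N
  m\<close>, and the point of interest \<open>x0\<close> at group \<open>k0 m\<close>.
\<close>

locale monotone_array =
  fixes M :: "nat \<Rightarrow> 'a measure" and \<epsilon> :: "nat \<Rightarrow> nat \<Rightarrow> 'a \<Rightarrow> real" and \<nu> :: "real measure" and \<sigma> :: real
    and n N K k0 :: "nat \<Rightarrow> nat" and R :: "nat \<Rightarrow> nat \<Rightarrow> nat set" and g :: "real \<Rightarrow> real" and D x0 :: real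
  assumes ps: "\<And>m. prob_space (M m)"
    and indep: "\<And>m. prob_space.indep_vars (M m) (\<lambda>_. borel) (\<epsilon> m) {1..n m}"
    and distr: "\<And>m i. i \<in> {1..n m} \<Longrightarrow> distr (M m) borel (\<epsilon> m i) = \<nu>"
    and law: "real_distribution \<nu>" "integrable \<nu> (\<lambda>x. x)" "(\<integral>x. x \<partial>\<nu>) = 0"
      "integrable \<nu> (\<lambda>x. x\<^sup>2)" "(\<integral>x. x\<^sup>2 \<partial>\<nu>) = \<sigma>\<^sup>2"
    and \<sigma>: "\<sigma> > 0"
    and NK: "\<And>m. N m * K m = n m" "\<And>m. K m > 0"
    and R: "\<And>m k. k \<in> {1..N m} \<Longrightarrow> R m k \<subseteq> {1..n m}" "\<And>m k. k \<in> {1..N m} \<Longrightarrow> card (R m k) = K m"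
      "\<And>m k k'. k \<noteq> k' \<Longrightarrow> R m k \<inter> R m k' = {}"
    and k0: "\<And>m. k0 m \<in> {1..N m}" "\<And>m. real (k0 m) = x0 * real (N m)" and x0: "0 < x0" "x0 < 1"
    and D: "D > 0" "mono_on {0..1} g" "locally_linear_at g x0 D"
    and nlim: "filterlim n at_top sequentially"
    and Nlim: "filterlim (\<lambda>m. real (N m) * real (n m) powr (- 1 / 3)) at_top sequentially"
begin

text \<open>
  The unit of distance \<open>\<rho>\<close> and the unit \<open>A\<close> of the diagram solve two equations: the noise has variance
  one per unit of time (\<open>A_squared\<close>) and the drift has second derivative two.  \<open>tm\<close> is rescaled time,
  \<open>z\<close> the noise of one group and \<open>cz\<close> its cumulative sum from \<open>k0\<close>, \<open>sl\<close> the slope of the drift and \<open>dr\<close>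
  the drift.  Cumulative sums that run backwards from \<open>k0\<close> are differences of sums from \<open>1\<close>.
\<close>

definition \<rho> :: "nat \<Rightarrow> real" where "\<rho> m = (4 * \<sigma>\<^sup>2 / (D\<^sup>2 * real (n m))) powr (1 / 3)"
definition A :: "nat \<Rightarrow> real" where "A m = D * (\<rho> m)\<^sup>2 / 2"
definition tm :: "nat \<Rightarrow> nat \<Rightarrow> real" where "tm m k = (real k - real (k0 m)) / (real (N m) * \<rho> m)"
definition z :: "nat \<Rightarrow> nat \<Rightarrow> 'a \<Rightarrow> real" where "z m k \<omega> = (\<Sum>i\<in>R m k. \<epsilon> m i \<omega>) / (A m * real (n m))"
definition cz :: "nat \<Rightarrow> nat \<Rightarrow> 'a \<Rightarrow> real" where "cz m k \<omega> = (\<Sum>i=1..k. z m i \<omega>) - (\<Sum>i=1..k0 m. z m i \<omega>)"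
definition sl :: "nat \<Rightarrow> nat \<Rightarrow> real" where "sl m k = \<rho> m * (g (real k / real (N m)) - g x0) / A m"
definition dr :: "nat \<Rightarrow> nat \<Rightarrow> real" where "dr m k = ((\<Sum>i=1..k. sl m i) - (\<Sum>i=1..k0 m. sl m i)) / (real (N m) * \<rho> m)"
definition V :: "nat \<Rightarrow> nat \<Rightarrow> 'a \<Rightarrow> real" where "V m k \<omega> = dr m k + cz m k \<omega>"

lemma N0: "N m > 0" and n0: "n m > 0"
proof -
  show "N m > 0" using k0(1)[of m] by auto
  then show "n m > 0" using NK[of m] by (metis nat_0_less_mult_iff)
qed

lemma rho_pos: "\<rho> m > 0"
  using n0[of m] \<sigma> D by (simp add: \<rho>_def)

lemma A_pos: "A m > 0"
  using rho_pos[of m] D by (simp add: A_def)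

lemma rho_cubed: "\<rho> m ^ 3 = 4 * \<sigma>\<^sup>2 / (D\<^sup>2 * real (n m))"
proof -
  have "\<rho> m ^ 3 = (4 * \<sigma>\<^sup>2 / (D\<^sup>2 * real (n m))) powr (1 / 3 * 3)"
    unfolding \<rho>_def powr_powr[symmetric] using n0[of m] \<sigma> D by (subst powr_numeral) auto
  then show ?thesis using n0[of m] \<sigma> D by simp
qed

lemma A_squared: "(A m)\<^sup>2 = \<sigma>\<^sup>2 * \<rho> m / real (n m)"
proof -
  have "(A m)\<^sup>2 = D\<^sup>2 * \<rho> m * (\<rho> m ^ 3) / 4"
    by (simp add: A_def power2_eq_square power3_eq_cube)
  also have "\<dots> = \<sigma>\<^sup>2 * \<rho> m / real (n m)" unfolding rho_cubed using D n0[of m] by (simp add: field_simps)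
  finally show ?thesis .
qed

lemma rho_eq: "\<rho> m = (4 * \<sigma>\<^sup>2 / D\<^sup>2) powr (1/3) * real (n m) powr (- 1 / 3)"
proof -
  have "\<rho> m = ((4 * \<sigma>\<^sup>2 / D\<^sup>2) * (1 / real (n m))) powr (1 / 3)" by (simp add: \<rho>_def)
  also have "\<dots> = (4 * \<sigma>\<^sup>2 / D\<^sup>2) powr (1/3) * (1 / real (n m)) powr (1/3)" by (rule powr_mult)
  also have "(1 / real (n m)) powr (1/3) = real (n m) powr (- 1 / 3)"
    using n0[of m] by (simp add: powr_minus_divide powr_divide)
  finally show ?thesis .
qed

lemma rho_tendsto: "\<rho> \<longlonglongrightarrow> 0"
proof -
  have "filterlim (\<lambda>m. real (n m)) at_top sequentially"
    by (rule filterlim_compose[OF filterlim_real_sequentially nlim])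
  then have "(\<lambda>m. real (n m) powr (- 1 / 3)) \<longlonglongrightarrow> 0" by (intro tendsto_neg_powr) auto
  then have "(\<lambda>m. (4 * \<sigma>\<^sup>2 / D\<^sup>2) powr (1/3) * real (n m) powr (- 1 / 3)) \<longlonglongrightarrow> (4 * \<sigma>\<^sup>2 / D\<^sup>2) powr (1/3) * 0"
    by (intro tendsto_intros)
  then show ?thesis by (simp add: rho_eq[abs_def])
qed

lemma rho_at_right: "filterlim \<rho> (at_right 0) sequentially"
  unfolding filterlim_at using rho_tendsto rho_pos by (auto intro!: always_eventually simp: less_imp_neq[THEN not_sym])

lemma Nrho: "filterlim (\<lambda>m. real (N m) * \<rho> m) at_top sequentially"
proof -
  have "filterlim (\<lambda>m. (4 * \<sigma>\<^sup>2 / D\<^sup>2) powr (1/3) * (real (N m) * real (n m) powr (- 1 / 3))) at_top sequentially"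
    by (rule filterlim_tendsto_pos_mult_at_top[OF tendsto_const _ Nlim]) (use \<sigma> D in simp)
  then show ?thesis by (simp add: rho_eq[abs_def] mult_ac)
qed

lemma Nrho_pos: "real (N m) * \<rho> m > 0"
  using N0[of m] rho_pos[of m] by simp

lemma Nrho_inverse: "(\<lambda>m. 1 / (real (N m) * \<rho> m)) \<longlonglongrightarrow> 0"
  by (rule tendsto_divide_0[OF tendsto_const]) (rule filterlim_at_top_imp_at_infinity[OF Nrho])

lemma slope_limit:
  assumes T: "T > 0" and e: "e > 0"
  shows "\<forall>\<^sub>F m in sequentially. \<forall>k\<le>N m. \<bar>tm m k\<bar> \<le> T \<longrightarrow> \<bar>sl m k - 2 * tm m k\<bar> \<le> e"
proof -
  have "\<forall>\<^sub>F \<delta> in at_right 0. \<forall>x\<in>{0..1}. \<bar>x - x0\<bar> \<le> T * \<delta> \<longrightarrow> \<bar>g x - g x0 - D * (x - x0)\<bar> \<le> (D * e / 2) * \<delta>"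
    by (rule locally_linear_bound[OF D(2) x0 D(3) T]) (use D e in simp)
  from eventually_compose_filterlim[OF this rho_at_right] show ?thesis
  proof eventually_elim
    case (elim m)
    show ?case
    proof (intro allI impI)
      fix k assume k: "k \<le> N m" "\<bar>tm m k\<bar> \<le> T"
      define x where "x = real k / real (N m)"
      have x01: "x \<in> {0..1}" using k N0[of m] by (simp add: x_def)
      have xt: "x - x0 = \<rho> m * tm m k"
        using N0[of m] rho_pos[of m] k0(2)[of m] by (simp add: x_def tm_def field_simps)
      have "\<bar>x - x0\<bar> \<le> T * \<rho> m" unfolding xt using k rho_pos[of m] by (simp add: abs_mult mult.commute)
      then have b: "\<bar>g x - g x0 - D * (x - x0)\<bar> \<le> (D * e / 2) * \<rho> m" using elim x01 by blast
      have c: "\<rho> m / A m = 2 / (D * \<rho> m)" using rho_pos[of m] D by (simp add: A_def power2_eq_square)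
      have "sl m k - 2 * tm m k = (\<rho> m / A m) * (g x - g x0 - D * (x - x0))"
      proof -
        have "(\<rho> m / A m) * (D * (x - x0)) = 2 * tm m k" unfolding xt c using rho_pos[of m] D by simp
        moreover have "sl m k = (\<rho> m / A m) * (g x - g x0)" unfolding sl_def x_def by simp
        ultimately show ?thesis by (simp only: right_diff_distrib)
      qed
      also have "\<bar>\<dots>\<bar> \<le> (2 / (D * \<rho> m)) * ((D * e / 2) * \<rho> m)"
        unfolding abs_mult c using b rho_pos[of m] D by (intro mult_mono) auto
      also have "\<dots> = e" using rho_pos[of m] D by simp
      finally show "\<bar>sl m k - 2 * tm m k\<bar> \<le> e" .
    qed
  qed
qed

lemma tm_between: "\<bar>tm m k\<bar> \<le> T \<Longrightarrow> (k0 m < i \<and> i \<le> k) \<or> (k < i \<and> i \<le> k0 m) \<Longrightarrow> \<bar>tm m i\<bar> \<le> T"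
proof -
  assume k: "\<bar>tm m k\<bar> \<le> T" and i: "(k0 m < i \<and> i \<le> k) \<or> (k < i \<and> i \<le> k0 m)"
  have "\<bar>real i - real (k0 m)\<bar> \<le> \<bar>real k - real (k0 m)\<bar>" using i by auto
  then have "\<bar>tm m i\<bar> \<le> \<bar>tm m k\<bar>" unfolding tm_def abs_divide by (intro divide_right_mono) auto
  then show ?thesis using k by simp
qed

lemma drift_limit:
  assumes T: "T > 0" and e: "e > 0"
  shows "\<forall>\<^sub>F m in sequentially. \<forall>k\<le>N m. \<bar>tm m k\<bar> \<le> T \<longrightarrow> \<bar>dr m k - (tm m k)\<^sup>2\<bar> \<le> e"
proof -
  define e1 where "e1 = e / (2 * T)"
  have e1: "e1 > 0" using T e by (simp add: e1_def)
  have "\<forall>\<^sub>F m in sequentially. 1 / (real (N m) * \<rho> m) < e / (2 * T)"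
    using Nrho_inverse by (rule order_tendstoD) (use T e in simp)
  with slope_limit[OF T e1] show ?thesis
  proof eventually_elim
    case (elim m)
    show ?case
    proof (intro allI impI)
      fix k assume k: "k \<le> N m" "\<bar>tm m k\<bar> \<le> T"
      define q where "q = real (N m) * \<rho> m"
      have q: "q > 0" using Nrho_pos by (simp add: q_def)
      define r where "r = real k - real (k0 m)"
      have tr: "tm m k = r / q" by (simp add: tm_def r_def q_def)
      have "\<bar>(\<Sum>i=1..k. sl m i - 2 * tm m i) - (\<Sum>i=1..k0 m. sl m i - 2 * tm m i)\<bar> \<le> \<bar>r\<bar> * e1"
        unfolding r_def
      proof (rule cumsum_diff_bound)
        fix i assume i: "(k0 m < i \<and> i \<le> k) \<or> (k < i \<and> i \<le> k0 m)"
        then have "i \<le> N m" using k k0(1)[of m] by auto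
        then show "\<bar>sl m i - 2 * tm m i\<bar> \<le> e1" using elim(1) tm_between[OF k(2) i] by blast
      qed
      moreover have "(\<Sum>i=1..k. sl m i - 2 * tm m i) - (\<Sum>i=1..k0 m. sl m i - 2 * tm m i) =
          ((\<Sum>i=1..k. sl m i) - (\<Sum>i=1..k0 m. sl m i)) - 2 * ((\<Sum>i=1..k. tm m i) - (\<Sum>i=1..k0 m. tm m i))"
        by (simp add: sum_subtractf sum_distrib_left algebra_simps)
      moreover have "(\<Sum>i=1..k. tm m i) - (\<Sum>i=1..k0 m. tm m i) = (r * (r + 1) / 2) / q"
      proof -
        have "(\<Sum>i=1..k. tm m i) - (\<Sum>i=1..k0 m. tm m i) =
            ((\<Sum>i=1..k. real i - real (k0 m)) - (\<Sum>i=1..k0 m. real i - real (k0 m))) / q"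
          unfolding tm_def q_def by (simp only: sum_divide_distrib[symmetric] diff_divide_distrib[symmetric])
        then show ?thesis unfolding cumsum_centered r_def .
      qed
      ultimately have "\<bar>dr m k * q - r * (r + 1) / q\<bar> \<le> \<bar>r\<bar> * e1"
        using q by (simp add: dr_def q_def[symmetric])
      then have "\<bar>dr m k * q - r * (r + 1) / q\<bar> / q \<le> \<bar>r\<bar> * e1 / q" using q by (intro divide_right_mono) auto
      moreover have "\<bar>dr m k * q - r * (r + 1) / q\<bar> / q = \<bar>dr m k - ((tm m k)\<^sup>2 + tm m k / q)\<bar>"
      proof -
        have "(dr m k * q - r * (r + 1) / q) / q = dr m k - ((tm m k)\<^sup>2 + tm m k / q)"
          using q unfolding tr by (simp add: field_simps power2_eq_square)
        then show ?thesis using q by (metis abs_divide abs_of_pos)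
      qed
      moreover have "\<bar>r\<bar> * e1 / q \<le> e / 2"
      proof -
        have "\<bar>r\<bar> * e1 / q = \<bar>tm m k\<bar> * e1" using q by (simp add: tr)
        also have "\<dots> \<le> T * e1" using k e1 by (intro mult_right_mono) auto
        finally show ?thesis using T by (simp add: e1_def)
      qed
      moreover have "\<bar>tm m k / q\<bar> \<le> e / 2"
      proof -
        have "\<bar>tm m k / q\<bar> = \<bar>tm m k\<bar> * (1 / q)" using q by simp
        also have "\<dots> \<le> T * (e / (2 * T))" using k elim(2) q T by (intro mult_mono) (auto simp: q_def)
        finally show ?thesis using T by simp
      qed
      ultimately show "\<bar>dr m k - (tm m k)\<^sup>2\<bar> \<le> e" by linarith
    qed
  qed
qed

text \<open>
  The last index whose time does not exceed \<open>\<tau>\<close>, once \<open>m\<close> is large.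
\<close>

definition idx :: "nat \<Rightarrow> real \<Rightarrow> nat" where "idx m \<tau> = nat \<lfloor>real (N m) * (x0 + \<rho> m * \<tau>)\<rfloor>"

lemma idx_props:
  assumes T: "T > 0"
  shows "\<forall>\<^sub>F m in sequentially. \<forall>\<tau>. \<bar>\<tau>\<bar> \<le> T \<longrightarrow> 1 \<le> idx m \<tau> \<and> idx m \<tau> \<le> N m \<and>
     tm m (idx m \<tau>) \<le> \<tau> \<and> \<tau> < tm m (idx m \<tau>) + 1 / (real (N m) * \<rho> m) \<and> (\<forall>k. tm m k \<le> \<tau> \<longleftrightarrow> k \<le> idx m \<tau>)"
proof -
  have r: "\<forall>\<^sub>F m in sequentially. \<rho> m < min (x0 / 2) (1 - x0) / T"
    using rho_tendsto by (rule order_tendstoD) (use x0 T in auto)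
  have "\<forall>\<^sub>F m in sequentially. 1 / (real (N m) * \<rho> m) < x0 / 2" by (rule order_tendstoD(2)[OF Nrho_inverse]) (use x0 in simp)
  moreover have "\<forall>\<^sub>F m in sequentially. \<rho> m < 1" by (rule order_tendstoD(2)[OF rho_tendsto]) simp
  moreover note r
  ultimately
  show ?thesis
  proof eventually_elim
    case (elim m)
    show ?case
    proof (intro allI impI)
      fix \<tau> assume \<tau>: "\<bar>\<tau>\<bar> \<le> T"
      define y where "y = real (N m) * (x0 + \<rho> m * \<tau>)"
      have "\<rho> m * T < min (x0 / 2) (1 - x0)" using elim(3) T by (simp add: pos_less_divide_eq)
      moreover have "\<bar>\<rho> m * \<tau>\<bar> \<le> \<rho> m * T" unfolding abs_mult using \<tau> rho_pos[of m] by (simp add: mult_left_mono)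
      ultimately have b: "x0 / 2 \<le> x0 + \<rho> m * \<tau>" "x0 + \<rho> m * \<tau> \<le> 1" by (auto simp: abs_le_iff)
      have "1 \<le> real (N m) * (x0 / 2)"
      proof -
        have "1 < x0 / 2 * (real (N m) * \<rho> m)" using elim(1) Nrho_pos[of m] by (simp add: pos_divide_less_eq)
        also have "\<dots> \<le> x0 / 2 * (real (N m) * 1)" using elim(2) x0 by (intro mult_left_mono) auto
        finally show ?thesis by (simp add: mult.commute)
      qed
      also have "\<dots> \<le> y" unfolding y_def using b by (intro mult_left_mono) auto
      finally have y1: "1 \<le> y" .
      have yN: "y \<le> real (N m)" unfolding y_def using b mult_left_mono[of "x0 + \<rho> m * \<tau>" 1 "real (N m)"] by simp
      have i: "real (idx m \<tau>) \<le> y" "y < real (idx m \<tau>) + 1" "idx m \<tau> = nat \<lfloor>y\<rfloor>"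
        unfolding idx_def y_def[symmetric] using y1 by linarith+
      have le: "k \<le> idx m \<tau> \<longleftrightarrow> real k \<le> y" for k unfolding i(3) using y1 by linarith
      have ty: "tm m k \<le> \<tau> \<longleftrightarrow> real k \<le> y" for k
      proof -
        have "tm m k \<le> \<tau> \<longleftrightarrow> real k - real (k0 m) \<le> \<tau> * (real (N m) * \<rho> m)"
          unfolding tm_def using Nrho_pos[of m] by (simp add: pos_divide_le_eq)
        also have "\<dots> \<longleftrightarrow> real k \<le> y" unfolding y_def k0(2) by (simp add: algebra_simps)
        finally show ?thesis .
      qed
      have "\<tau> < tm m (idx m \<tau>) + 1 / (real (N m) * \<rho> m)"
      proof -
        have "\<tau> * (real (N m) * \<rho> m) < real (idx m \<tau>) - real (k0 m) + 1"
          using i(2) unfolding y_def k0(2) by (simp add: algebra_simps)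
        then have "\<tau> < (real (idx m \<tau>) - real (k0 m) + 1) / (real (N m) * \<rho> m)" using Nrho_pos[of m] by (simp add: pos_less_divide_eq)
        then show ?thesis by (simp add: tm_def add_divide_distrib)
      qed
      moreover have "1 \<le> idx m \<tau>" using le[of 1] y1 by simp
      moreover have "idx m \<tau> \<le> N m" using i(1) yN by linarith
      ultimately show "1 \<le> idx m \<tau> \<and> idx m \<tau> \<le> N m \<and>
        tm m (idx m \<tau>) \<le> \<tau> \<and> \<tau> < tm m (idx m \<tau>) + 1 / (real (N m) * \<rho> m) \<and> (\<forall>k. tm m k \<le> \<tau> \<longleftrightarrow> k \<le> idx m \<tau>)"
        using ty le by blast
    qed
  qed
qed

lemma sl_mono: "1 \<le> i \<Longrightarrow> i \<le> i' \<Longrightarrow> i' \<le> N m \<Longrightarrow> sl m i \<le> sl m i'"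
proof -
  assume i: "1 \<le> i" "i \<le> i'" "i' \<le> N m"
  have "g (real i / real (N m)) \<le> g (real i' / real (N m))"
    by (rule mono_onD[OF D(2)]) (use i N0[of m] in \<open>auto intro!: divide_right_mono\<close>)
  then show ?thesis unfolding sl_def using rho_pos[of m] A_pos[of m] by (intro divide_right_mono mult_left_mono) auto
qed

text \<open>
  The drift is convex in time, so its behaviour on a bounded window controls it globally.
\<close>

lemma dr_subgradient:
  assumes "1 \<le> a" "a \<le> N m" "k \<le> N m"
  shows "dr m k \<ge> dr m a + (tm m k - tm m a) * sl m a"
proof -
  have "(\<Sum>i=1..k. sl m i) - (\<Sum>i=1..a. sl m i) \<ge> (real k - real a) * sl m a"
    by (rule cumsum_subgradient[where N="N m"]) (use assms sl_mono in auto)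
  then have "((\<Sum>i=1..k. sl m i) - (\<Sum>i=1..a. sl m i)) / (real (N m) * \<rho> m) \<ge> (real k - real a) * sl m a / (real (N m) * \<rho> m)"
    using Nrho_pos[of m] by (intro divide_right_mono) auto
  moreover have "(real k - real a) * sl m a / (real (N m) * \<rho> m) = (tm m k - tm m a) * sl m a"
    by (simp add: tm_def diff_divide_distrib[symmetric])
  moreover have "((\<Sum>i=1..k. sl m i) - (\<Sum>i=1..a. sl m i)) / (real (N m) * \<rho> m) = dr m k - dr m a"
    by (simp add: dr_def diff_divide_distrib[symmetric])
  ultimately show ?thesis by linarith
qed

text \<open>
  Local linearity determines the drift only on bounded windows.  Beyond, convexity keeps it above its
  tangent at a time next to \<open>T\<close> or \<open>- T\<close>, where both value and slope are
  known approximately.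
\<close>

lemma drift_tail:
  assumes T: "T \<ge> 2"
  shows "\<forall>\<^sub>F m in sequentially. \<forall>k\<le>N m. \<bar>tm m k\<bar> \<ge> T \<longrightarrow> dr m k \<ge> T / 2 * \<bar>tm m k\<bar>"
proof -
  have T0: "T > 0" "T + 1 > 0" using T by auto
  have q4: "1 / 4 > (0::real)" and q8: "1 / 8 > (0::real)" by auto
  have "\<forall>\<^sub>F m in sequentially. 1 / (real (N m) * \<rho> m) < 1 / 8"
    using Nrho_inverse by (rule order_tendstoD) simp
  then show ?thesis using idx_props[OF T0(1)] slope_limit[OF T0(2) q4] drift_limit[OF T0(2) q8]
  proof eventually_elim
    case (elim m)
    show ?case
    proof (intro allI impI)
      fix k assume k: "k \<le> N m" "T \<le> \<bar>tm m k\<bar>"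
      define s where "s = (if tm m k \<ge> 0 then 1 else - 1 :: real)"
      have s: "s * tm m k = \<bar>tm m k\<bar>" "s = 1 \<or> s = - 1" "s * s = 1" by (auto simp: s_def)
      \<comment> \<open>The tangent is taken at the index next to \<open>s * T\<close>, on the side of zero where \<open>k\<close> lies.\<close>
      define a where "a = idx m (s * T)"
      have "\<bar>s * T\<bar> \<le> T" using s T0 by (auto simp: abs_mult)
      then have ap: "1 \<le> a" "a \<le> N m" "tm m a \<le> s * T" "s * T < tm m a + 1 / 8"
      proof -
        have "1 \<le> idx m (s * T) \<and> idx m (s * T) \<le> N m \<and> tm m (idx m (s * T)) \<le> s * T \<and>
            s * T < tm m (idx m (s * T)) + 1 / (real (N m) * \<rho> m)"
          using elim(2) \<open>\<bar>s * T\<bar> \<le> T\<close> by blast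
        then show "1 \<le> a" "a \<le> N m" "tm m a \<le> s * T" "s * T < tm m a + 1 / 8"
          using elim(1) unfolding a_def by linarith+
      qed
      have ta: "T - 1 / 8 \<le> s * tm m a" "s * tm m a \<le> T + 1 / 8" "\<bar>tm m a\<bar> \<le> T + 1"
        using s(2) ap(3,4) T by auto
      have sla: "\<bar>sl m a - 2 * tm m a\<bar> \<le> 1 / 4" and dra: "\<bar>dr m a - (tm m a)\<^sup>2\<bar> \<le> 1 / 8"
        using elim(3,4) ap(2) ta(3) by auto
      define u where "u = s * tm m a"
      have u2: "(tm m a)\<^sup>2 = u\<^sup>2" using s(2) by (auto simp: u_def)
      have su2: "s * sl m a \<ge> 2 * u - 1 / 4 \<and> s * sl m a \<le> 2 * u + 1 / 4"
        using s(2) sla unfolding u_def by (elim disjE; simp; linarith)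
      then have "s * sl m a \<ge> 2 * u - 1 / 4" ..
      then have su: "s * sl m a \<ge> T / 2" using ta(1) T by (simp add: u_def)
      have eq: "(tm m k - tm m a) * sl m a = (s * tm m k - u) * (s * sl m a)"
        using s(2) by (auto simp: u_def)
      have "dr m k \<ge> dr m a + (tm m k - tm m a) * sl m a" by (rule dr_subgradient[OF ap(1,2) k(1)])
      then have d: "dr m k \<ge> dr m a + (\<bar>tm m k\<bar> - u) * (s * sl m a)" unfolding eq s(1) .
      have uT: "u \<ge> T - 1 / 8" "u \<le> T + 1 / 8" using ta by (auto simp: u_def)
      have dra': "dr m a \<ge> u * u - 1 / 8" using dra unfolding u2 by (simp only: power2_eq_square abs_le_iff) linarith
      show "T / 2 * \<bar>tm m k\<bar> \<le> dr m k"
      proof (cases "u \<le> \<bar>tm m k\<bar>")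
        case True
        have "(\<bar>tm m k\<bar> - u) * (s * sl m a) \<ge> (\<bar>tm m k\<bar> - u) * (T / 2)" using True su by (intro mult_left_mono) auto
        moreover have "u * u \<ge> (T - 1/8) * u" using uT T by (intro mult_right_mono) auto
        moreover have "(T - 1 / 8) * u - T / 2 * u = (T / 2 - 1 / 8) * u" by (simp add: algebra_simps)
        moreover have "(T / 2 - 1 / 8) * u \<ge> (3 / 8) * (7 / 8)" using uT T by (intro mult_mono) auto
        moreover have "(\<bar>tm m k\<bar> - u) * (T / 2) = T / 2 * \<bar>tm m k\<bar> - T / 2 * u" by (simp add: algebra_simps)
        ultimately show ?thesis using d dra' by argo
      next
        case False
        have "s * sl m a \<le> 2 * u + 1 / 4" using su2 ..
        also have "\<dots> \<le> 2 * T + 1 / 2" using uT by simp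
        finally have "(u - \<bar>tm m k\<bar>) * (s * sl m a) \<le> (1 / 8) * (2 * T + 1 / 2)" using False k uT su T by (intro mult_mono) auto
        moreover have "u * u \<ge> (T - 1/8) * (T - 1/8)" using uT T by (intro mult_mono) auto
        moreover have "T / 2 * \<bar>tm m k\<bar> \<le> T / 2 * (T + 1 / 8)" using False uT T by (intro mult_left_mono) auto
        moreover have "T * 2 \<le> T * T" using T by (intro mult_left_mono) auto
        moreover have "(\<bar>tm m k\<bar> - u) * (s * sl m a) = - ((u - \<bar>tm m k\<bar>) * (s * sl m a))" by (simp add: algebra_simps)
        moreover have "(T - 1/8) * (T - 1/8) = T * T - T / 4 + 1 / 64" "T / 2 * (T + 1 / 8) = T * T / 2 + T / 16" by (simp_all add: algebra_simps)
        ultimately show ?thesis using d dra' T by argo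
      qed
    qed
  qed
qed

end

section \<open>The rescaled noise of a monotone array\<close>

context two_sided_bm
begin

text \<open>
  The fourth moment makes the bound quadratic in the length of the time interval, so that it can be
  summed over the cells of a fine partition.
\<close>

lemma W_increment_fourth:
  assumes "s < t" "a > 0"
  shows "prob {\<omega>\<in>space P. \<bar>W t \<omega> - W s \<omega>\<bar> \<ge> a} \<le> 3 * (t - s)\<^sup>2 / a ^ 4"
proof -
  define \<sigma> where "\<sigma> = sqrt (t - s)"
  have \<sigma>: "\<sigma> > 0" "\<sigma>^4 = (t - s)\<^sup>2" using assms by (auto simp: \<sigma>_def power4_eq_xxxx power2_eq_square)
  have D: "distributed P lborel (\<lambda>\<omega>. W t \<omega> - W s \<omega>) (normal_density 0 \<sigma>)" using W_increment[OF assms(1)] by (simp add: \<sigma>_def)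
  have "has_bochner_integral lborel (\<lambda>x. normal_density 0 \<sigma> x * x ^ 4) (3 * \<sigma> ^ 4)"
    using normal_moment_even[OF \<sigma>(1), of 0 2] by (simp add: fact_numeral power2_eq_square power4_eq_xxxx mult.assoc)
  then have hb: "has_bochner_integral lborel (\<lambda>x. normal_density 0 \<sigma> x * x ^ 4) (3 * (t - s)\<^sup>2)"
    unfolding \<sigma>(2) .
  have int: "integrable P (\<lambda>\<omega>. (W t \<omega> - W s \<omega>) ^ 4)"
    using distributed_integrable[OF D, of "\<lambda>x. x^4"] hb by (auto simp: has_bochner_integral_iff)
  have ex: "expectation (\<lambda>\<omega>. (W t \<omega> - W s \<omega>) ^ 4) = 3 * (t - s)\<^sup>2"
    using distributed_integral[OF D, of "\<lambda>x. x^4"] hb by (auto simp: has_bochner_integral_iff)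
  have "prob {\<omega>\<in>space P. \<bar>W t \<omega> - W s \<omega>\<bar> \<ge> a} \<le> prob {\<omega>\<in>space P. (W t \<omega> - W s \<omega>) ^ 4 \<ge> a ^ 4}"
  proof (rule finite_measure_mono)
    show "{\<omega>\<in>space P. (W t \<omega> - W s \<omega>) ^ 4 \<ge> a ^ 4} \<in> events" by measurable
    have "a ^ 4 \<le> x ^ 4" if "a \<le> \<bar>x\<bar>" for x :: real
      using power_mono[OF that, of 4] assms by simp
    then show "{\<omega>\<in>space P. \<bar>W t \<omega> - W s \<omega>\<bar> \<ge> a} \<subseteq> {\<omega>\<in>space P. (W t \<omega> - W s \<omega>) ^ 4 \<ge> a ^ 4}" by blast
  qed
  also have "\<dots> \<le> expectation (\<lambda>\<omega>. (W t \<omega> - W s \<omega>) ^ 4) / a ^ 4"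
    by (rule integral_Markov_inequality_measure[where A="{}"]) (use int assms in auto)
  finally show ?thesis by (simp add: ex)
qed

lemma W_increment_window:
  assumes "s < t" "u < v"
  shows "prob {\<omega>\<in>space P. W t \<omega> - W s \<omega> \<in> {u<..v}} =
    cdf std_normal_distribution (v / sqrt (t - s)) - cdf std_normal_distribution (u / sqrt (t - s))"
proof -
  have "{\<omega>\<in>space P. W t \<omega> - W s \<omega> \<in> {u<..v}} = {\<omega>\<in>space P. W t \<omega> - W s \<omega> \<le> v} - {\<omega>\<in>space P. W t \<omega> - W s \<omega> \<le> u}"
    by auto
  also have "prob \<dots> = prob {\<omega>\<in>space P. W t \<omega> - W s \<omega> \<le> v} - prob {\<omega>\<in>space P. W t \<omega> - W s \<omega> \<le> u}"
    using assms by (intro finite_measure_Diff) auto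
  finally show ?thesis by (simp add: W_increment_cdf[OF assms(1)])
qed

end

lemma isCont_std_normal_cdf: "isCont (cdf std_normal_distribution) x"
proof -
  interpret N: real_distribution std_normal_distribution by (rule real_dist_normal_dist)
  have "emeasure std_normal_distribution {x} = (\<integral>\<^sup>+y. ennreal (std_normal_density y) * indicator {x} y \<partial>lborel)"
    by (rule emeasure_density) auto
  also have "\<dots> = 0" by (subst nn_integral_0_iff_AE) (auto intro!: AE_I[where N="{x}"] simp: indicator_def)
  finally show ?thesis unfolding N.isCont_cdf by (simp add: measure_def)
qed

context monotone_array
begin

lemma eps_rv: "i \<in> {1..n m} \<Longrightarrow> \<epsilon> m i \<in> borel_measurable (M m)"
  using indep[of m] by (auto simp: prob_space.indep_vars_def[OF ps])

lemma eps_moments: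
  assumes i: "i \<in> {1..n m}"
  shows "integrable (M m) (\<epsilon> m i)" "(\<integral>\<omega>. \<epsilon> m i \<omega> \<partial>M m) = 0"
    "integrable (M m) (\<lambda>\<omega>. (\<epsilon> m i \<omega>)\<^sup>2)" "(\<integral>\<omega>. (\<epsilon> m i \<omega>)\<^sup>2 \<partial>M m) = \<sigma>\<^sup>2"
proof -
  note rv = eps_rv[OF i]
  note 1 = integrable_distr_eq[OF rv, unfolded distr[OF i]] and 2 = integral_distr[OF rv, unfolded distr[OF i]]
  have b: "(\<lambda>x::real. x) \<in> borel_measurable borel" "(\<lambda>x::real. x\<^sup>2) \<in> borel_measurable borel" by measurable
  show "integrable (M m) (\<epsilon> m i)" using 1[OF b(1)] law(2) by metis
  show "integrable (M m) (\<lambda>\<omega>. (\<epsilon> m i \<omega>)\<^sup>2)" using 1[OF b(2)] law(4) by metis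
  show "(\<integral>\<omega>. \<epsilon> m i \<omega> \<partial>M m) = 0" using 2[OF b(1)] law(3) by metis
  show "(\<integral>\<omega>. (\<epsilon> m i \<omega>)\<^sup>2 \<partial>M m) = \<sigma>\<^sup>2" using 2[OF b(2)] law(5) by metis
qed

lemma rows_UN:
  assumes J: "J \<subseteq> {1..N m}"
  shows "(\<Union>k\<in>J. R m k) \<subseteq> {1..n m}" "card (\<Union>k\<in>J. R m k) = card J * K m"
    "(\<Sum>k\<in>J. \<Sum>i\<in>R m k. f i) = (\<Sum>i\<in>(\<Union>k\<in>J. R m k). f i :: real)"
proof -
  have fin: "finite J" "finite (R m k)" if "k \<in> J" for k
    using J that finite_subset[OF R(1)[of k m]] finite_subset[OF J] by auto
  have finJ: "finite J" using J by (rule finite_subset) simp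
  have Rf: "\<forall>k\<in>J. finite (R m k)" using fin by blast
  have dj: "\<forall>i\<in>J. \<forall>j\<in>J. i \<noteq> j \<longrightarrow> R m i \<inter> R m j = {}" using R(3) by blast
  show "(\<Union>k\<in>J. R m k) \<subseteq> {1..n m}" using J R(1) by blast
  have "card (\<Union>k\<in>J. R m k) = (\<Sum>k\<in>J. card (R m k))" by (rule card_UN_disjoint[OF finJ Rf dj])
  also have "\<dots> = (\<Sum>k\<in>J. K m)" using J R(2) by (intro sum.cong) auto
  finally show "card (\<Union>k\<in>J. R m k) = card J * K m" by simp
  show "(\<Sum>k\<in>J. \<Sum>i\<in>R m k. f i) = (\<Sum>i\<in>(\<Union>k\<in>J. R m k). f i)" by (rule sum.UNION_disjoint[OF finJ Rf dj, symmetric])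
qed

lemma z_sum: "J \<subseteq> {1..N m} \<Longrightarrow> (\<Sum>k\<in>J. z m k \<omega>) = (\<Sum>i\<in>(\<Union>k\<in>J. R m k). \<epsilon> m i \<omega>) / (A m * real (n m))"
  unfolding z_def sum_divide_distrib[symmetric] by (subst rows_UN(3)) auto

lemma z_indep: "prob_space.indep_vars (M m) (\<lambda>_. borel) (z m) {1..N m}"
proof -
  interpret prob_space "M m" by (rule ps)
  have "indep_vars (\<lambda>_. borel) (\<lambda>k \<omega>. \<Sum>i\<in>R m k. \<epsilon> m i \<omega>) {1..N m}"
    by (rule indep_vars_block_sums[OF indep]) (use R in \<open>auto simp: disjoint_family_on_def\<close>)
  then have "indep_vars (\<lambda>_. borel) (\<lambda>k \<omega>. (\<Sum>i\<in>R m k. \<epsilon> m i \<omega>) / (A m * real (n m))) {1..N m}"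
    by (rule indep_vars_compose2) auto
  then show ?thesis by (simp add: z_def[abs_def])
qed

lemma z_rv: "k \<in> {1..N m} \<Longrightarrow> z m k \<in> borel_measurable (M m)"
  using z_indep[of m] by (auto simp: prob_space.indep_vars_def[OF ps])

text \<open>
  The variance of the noise per unit of time is one, which is the purpose of the choice of
  \<open>\<rho>\<close> and \<open>A\<close>.
\<close>

lemma z_tail:
  assumes J: "J \<subseteq> {1..N m}" and a: "a > 0"
  shows "measure (M m) {\<omega>\<in>space (M m). \<bar>\<Sum>k\<in>J. z m k \<omega>\<bar> > a} \<le> real (card J) / (real (N m) * \<rho> m) / a\<^sup>2"
proof -
  interpret prob_space "M m" by (rule ps)
  define U where "U = (\<Union>k\<in>J. R m k)"
  have U: "U \<subseteq> {1..n m}" "card U = card J * K m" using rows_UN[OF J] by (auto simp: U_def)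
  have An: "A m * real (n m) > 0" using A_pos n0 by simp
  have "{\<omega>\<in>space (M m). \<bar>\<Sum>k\<in>J. z m k \<omega>\<bar> > a} = {\<omega>\<in>space (M m). \<bar>\<Sum>i\<in>U. \<epsilon> m i \<omega>\<bar> > a * (A m * real (n m))}"
    unfolding z_sum[OF J] U_def[symmetric] using An by (simp add: abs_divide pos_less_divide_eq)
  also have "prob \<dots> \<le> real (card U) * \<sigma>\<^sup>2 / (a * (A m * real (n m)))\<^sup>2"
    by (rule chebyshev_iid_sum)
      (use U a An eps_moments indep_vars_subset[OF indep U(1)] finite_subset[OF U(1)] in \<open>auto simp: subset_eq\<close>)
  also have "(a * (A m * real (n m)))\<^sup>2 = a\<^sup>2 * (\<sigma>\<^sup>2 * \<rho> m * real (n m))"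
  proof -
    have "(a * (A m * real (n m)))\<^sup>2 = a\<^sup>2 * ((A m)\<^sup>2 * (real (n m))\<^sup>2)" by (simp add: power_mult_distrib)
    also have "\<dots> = a\<^sup>2 * (\<sigma>\<^sup>2 * \<rho> m * real (n m))" unfolding A_squared using n0[of m] by (simp add: power2_eq_square)
    finally show ?thesis .
  qed
  also have "real (card U) * \<sigma>\<^sup>2 / (a\<^sup>2 * (\<sigma>\<^sup>2 * \<rho> m * real (n m))) = real (card J) / (real (N m) * \<rho> m) / a\<^sup>2"
    unfolding U(2) NK(1)[symmetric] using \<sigma> NK(2)[of m] by simp
  finally show ?thesis .
qed

lemma z_indep_reindex:
  assumes "inj_on f {..<r}" "f ` {..<r} \<subseteq> {1..N m}"
  shows "prob_space.indep_vars (M m) (\<lambda>_. borel) (\<lambda>i. z m (f i)) {..<r}"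
  by (rule prob_space.indep_vars_reindex[OF ps z_indep assms])

lemma z_reindex_tail:
  assumes f: "inj_on f {..<r}" "f ` {..<r} \<subseteq> {1..N m}" and j: "j \<le> r" and a: "a > 0"
  shows "measure (M m) {\<omega>\<in>space (M m). \<bar>\<Sum>i\<in>{j..<r}. z m (f i) \<omega>\<bar> > a} \<le> real r / (real (N m) * \<rho> m) / a\<^sup>2"
proof -
  have inj: "inj_on f {j..<r}" using f(1) by (rule inj_on_subset) auto
  have "(\<Sum>i\<in>{j..<r}. z m (f i) \<omega>) = (\<Sum>k\<in>f ` {j..<r}. z m k \<omega>)" for \<omega> by (simp add: sum.reindex[OF inj])
  then have "measure (M m) {\<omega>\<in>space (M m). \<bar>\<Sum>i\<in>{j..<r}. z m (f i) \<omega>\<bar> > a} \<le> real (card (f ` {j..<r})) / (real (N m) * \<rho> m) / a\<^sup>2"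
    using z_tail[OF subset_trans[OF image_mono f(2)] a, of "{j..<r}"] by (simp add: subset_eq)
  also have "card (f ` {j..<r}) = r - j" using card_image[OF inj] by simp
  also have "real (r - j) / (real (N m) * \<rho> m) / a\<^sup>2 \<le> real r / (real (N m) * \<rho> m) / a\<^sup>2"
    using Nrho_pos[of m] by (intro divide_right_mono) auto
  finally show ?thesis .
qed

lemma z_max:
  assumes f: "inj_on f {..<r}" "f ` {..<r} \<subseteq> {1..N m}" and l: "l > 0"
  shows "holds_except (M m) (8 * (real r / (real (N m) * \<rho> m)) / l\<^sup>2) (\<lambda>\<omega>. \<forall>j\<le>r. \<bar>\<Sum>i<j. z m (f i) \<omega>\<bar> \<le> l)"
proof -
  interpret prob_space "M m" by (rule ps)
  have [measurable]: "(\<lambda>\<omega>. \<Sum>i<j. z m (f i) \<omega>) \<in> borel_measurable (M m)" if "j \<le> r" for j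
    by (rule borel_measurable_sum, rule z_rv) (use f(2) that in \<open>auto simp: image_subset_iff\<close>)
  show ?thesis
  proof (rule holds_exceptI)
    have "{\<omega>\<in>space (M m). \<exists>j\<le>r. \<bar>\<Sum>i<j. z m (f i) \<omega>\<bar> > l} = (\<Union>j\<in>{..r}. {\<omega>\<in>space (M m). \<bar>\<Sum>i<j. z m (f i) \<omega>\<bar> > l})" by auto
    also have "\<dots> \<in> events" by (intro sets.finite_UN) auto
    finally show "{\<omega>\<in>space (M m). \<exists>j\<le>r. \<bar>\<Sum>i<j. z m (f i) \<omega>\<bar> > l} \<in> events" .
    show "prob {\<omega>\<in>space (M m). \<exists>j\<le>r. \<bar>\<Sum>i<j. z m (f i) \<omega>\<bar> > l} \<le> 8 * (real r / (real (N m) * \<rho> m)) / l\<^sup>2"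
      by (rule maximal_inequality[OF z_indep_reindex[OF f] l z_reindex_tail[OF f]])
  qed (auto simp: not_less)
qed

lemma cz_right: "k0 m \<le> k \<Longrightarrow> cz m k \<omega> = (\<Sum>i<k - k0 m. z m (Suc (k0 m + i)) \<omega>)"
proof -
  assume k: "k0 m \<le> k"
  have "cz m k \<omega> = (\<Sum>i=Suc (k0 m)..k. z m i \<omega>)"
    unfolding cz_def using sum.ub_add_nat[of 1 "k0 m" "\<lambda>i. z m i \<omega>" "k - k0 m"] k by simp
  also have "\<dots> = (\<Sum>i<k - k0 m. z m (Suc (k0 m + i)) \<omega>)"
    by (rule sum.reindex_bij_witness[of _ "\<lambda>i. Suc (k0 m + i)" "\<lambda>i. i - Suc (k0 m)"]) auto
  finally show ?thesis .
qed

lemma cz_left: "k \<le> k0 m \<Longrightarrow> cz m k \<omega> = - (\<Sum>i<k0 m - k. z m (k0 m - i) \<omega>)"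
proof -
  assume k: "k \<le> k0 m"
  have "cz m k \<omega> = - (\<Sum>i=Suc k..k0 m. z m i \<omega>)"
    unfolding cz_def using sum.ub_add_nat[of 1 k "\<lambda>i. z m i \<omega>" "k0 m - k"] k by simp
  also have "(\<Sum>i=Suc k..k0 m. z m i \<omega>) = (\<Sum>i<k0 m - k. z m (k0 m - i) \<omega>)"
    by (rule sum.reindex_bij_witness[of _ "\<lambda>i. k0 m - i" "\<lambda>i. k0 m - i"]) auto
  finally show ?thesis .
qed

text \<open>
  Dyadic peeling in both time directions from \<open>k0 m\<close>, with a bound uniform in
  \<open>m\<close>.
\<close>

lemma noise_growth:
  assumes T: "T > 0" and \<theta>: "\<theta> > 0"
  shows "holds_except (M m) (64 / (\<theta>\<^sup>2 * T)) (\<lambda>\<omega>. \<forall>k\<le>N m. \<bar>tm m k\<bar> \<ge> T \<longrightarrow> \<bar>cz m k \<omega>\<bar> \<le> \<theta> * \<bar>tm m k\<bar>)"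
proof -
  interpret prob_space "M m" by (rule ps)
  define q where "q = real (N m) * \<rho> m"
  have q: "q > 0" using Nrho_pos by (simp add: q_def)
  have right: "holds_except (M m) (8 * Rd / l\<^sup>2) (\<lambda>\<omega>. \<forall>k\<in>{k0 m..N m}. tm m k \<le> Rd \<longrightarrow> \<bar>cz m k \<omega>\<bar> \<le> l)" if "Rd > 0" "l > 0" for Rd l
  proof -
    define r where "r = min (N m - k0 m) (nat \<lfloor>Rd * q\<rfloor>)"
    have "r \<le> nat \<lfloor>Rd * q\<rfloor>" "Rd * q \<ge> 0" using that q by (auto simp: r_def)
    then have "real r \<le> Rd * q" by linarith
    then have rq: "real r / q \<le> Rd" using q by (simp add: pos_divide_le_eq)
    have "holds_except (M m) (8 * (real r / q) / l\<^sup>2) (\<lambda>\<omega>. \<forall>j\<le>r. \<bar>\<Sum>i<j. z m (Suc (k0 m + i)) \<omega>\<bar> \<le> l)"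
      unfolding q_def by (rule z_max[where f="\<lambda>i. Suc (k0 m + i)", OF _ _ that(2)]) (auto simp: inj_on_def r_def)
    then show ?thesis
    proof (rule holds_except_mono)
      show "8 * (real r / q) / l\<^sup>2 \<le> 8 * Rd / l\<^sup>2" using rq by (intro divide_right_mono mult_left_mono) auto
      fix \<omega> assume H: "\<forall>j\<le>r. \<bar>\<Sum>i<j. z m (Suc (k0 m + i)) \<omega>\<bar> \<le> l"
      show "\<forall>k\<in>{k0 m..N m}. tm m k \<le> Rd \<longrightarrow> \<bar>cz m k \<omega>\<bar> \<le> l"
      proof (intro ballI impI)
        fix k assume k: "k \<in> {k0 m..N m}" "tm m k \<le> Rd"
        then have "real (k - k0 m) \<le> Rd * q" using q by (simp add: tm_def q_def[symmetric] pos_divide_le_eq of_nat_diff)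
        then have "k - k0 m \<le> nat \<lfloor>Rd * q\<rfloor>" by (simp add: le_nat_iff le_floor_iff)
        moreover have "k - k0 m \<le> N m - k0 m" using k by (intro diff_le_mono) auto
        ultimately have "k - k0 m \<le> r" by (simp add: r_def)
        then show "\<bar>cz m k \<omega>\<bar> \<le> l" using H k by (simp add: cz_right)
      qed
    qed
  qed
  have left: "holds_except (M m) (8 * Rd / l\<^sup>2) (\<lambda>\<omega>. \<forall>k\<in>{0..k0 m}. - tm m k \<le> Rd \<longrightarrow> \<bar>cz m k \<omega>\<bar> \<le> l)" if "Rd > 0" "l > 0" for Rd l
  proof -
    define r where "r = min (k0 m) (nat \<lfloor>Rd * q\<rfloor>)"
    have "r \<le> nat \<lfloor>Rd * q\<rfloor>" "Rd * q \<ge> 0" using that q by (auto simp: r_def)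
    then have "real r \<le> Rd * q" by linarith
    then have rq: "real r / q \<le> Rd" using q by (simp add: pos_divide_le_eq)
    have "holds_except (M m) (8 * (real r / q) / l\<^sup>2) (\<lambda>\<omega>. \<forall>j\<le>r. \<bar>\<Sum>i<j. z m (k0 m - i) \<omega>\<bar> \<le> l)"
      unfolding q_def by (rule z_max[where f="\<lambda>i. k0 m - i", OF _ _ that(2)]) (use k0(1)[of m] in \<open>auto simp: inj_on_def r_def\<close>)
    then show ?thesis
    proof (rule holds_except_mono)
      show "8 * (real r / q) / l\<^sup>2 \<le> 8 * Rd / l\<^sup>2" using rq by (intro divide_right_mono mult_left_mono) auto
      fix \<omega> assume H: "\<forall>j\<le>r. \<bar>\<Sum>i<j. z m (k0 m - i) \<omega>\<bar> \<le> l"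
      show "\<forall>k\<in>{0..k0 m}. - tm m k \<le> Rd \<longrightarrow> \<bar>cz m k \<omega>\<bar> \<le> l"
      proof (intro ballI impI)
        fix k assume k: "k \<in> {0..k0 m}" "- tm m k \<le> Rd"
        have "- tm m k = real (k0 m - k) / q" using k by (simp add: tm_def q_def[symmetric] of_nat_diff minus_divide_left)
        then have "real (k0 m - k) \<le> Rd * q" using k q by (simp add: pos_divide_le_eq)
        then have "k0 m - k \<le> nat \<lfloor>Rd * q\<rfloor>" by (simp add: le_nat_iff le_floor_iff)
        then have "k0 m - k \<le> r" by (simp add: r_def)
        then show "\<bar>cz m k \<omega>\<bar> \<le> l" using H k by (simp add: cz_left)
      qed
    qed
  qed
  have "holds_except (M m) (32 / (\<theta>\<^sup>2 * T) + 32 / (\<theta>\<^sup>2 * T)) (\<lambda>\<omega>. (\<forall>k\<in>{k0 m..N m}. tm m k \<ge> T \<longrightarrow> \<bar>cz m k \<omega>\<bar> \<le> \<theta> * tm m k) \<and>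
      (\<forall>k\<in>{0..k0 m}. - tm m k \<ge> T \<longrightarrow> \<bar>cz m k \<omega>\<bar> \<le> \<theta> * - tm m k))"
    by (intro holds_except_conj linear_growth_bound right left T \<theta>)
  then show ?thesis
  proof (rule holds_except_mono)
    fix \<omega> assume H: "(\<forall>k\<in>{k0 m..N m}. tm m k \<ge> T \<longrightarrow> \<bar>cz m k \<omega>\<bar> \<le> \<theta> * tm m k) \<and>
      (\<forall>k\<in>{0..k0 m}. - tm m k \<ge> T \<longrightarrow> \<bar>cz m k \<omega>\<bar> \<le> \<theta> * - tm m k)"
    show "\<forall>k\<le>N m. \<bar>tm m k\<bar> \<ge> T \<longrightarrow> \<bar>cz m k \<omega>\<bar> \<le> \<theta> * \<bar>tm m k\<bar>"
    proof (intro allI impI)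
      fix k assume k: "k \<le> N m" "\<bar>tm m k\<bar> \<ge> T"
      show "\<bar>cz m k \<omega>\<bar> \<le> \<theta> * \<bar>tm m k\<bar>"
      proof (cases "k0 m \<le> k")
        case True
        then have "tm m k \<ge> 0" using Nrho_pos[of m] by (simp add: tm_def)
        then show ?thesis using H True k by auto
      next
        case False
        then have "tm m k \<le> 0" using Nrho_pos[of m] by (simp add: tm_def divide_le_0_iff)
        then show ?thesis using H False k by auto
      qed
    qed
  qed (simp add: mult.commute)
qed

text \<open>
  The central limit theorem for the noise over a window of limiting length \<open>s\<close>.  The
  window contains \<open>K m\<close> errors for each of its indices, hence more and more errors.
  Their number and the exact variance vary with \<open>m\<close>, which
  \<open>cdf_weak_limit_uniform\<close> absorbs.
\<close>

lemma window_limit: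
  assumes ab: "\<forall>\<^sub>F m in sequentially. a m \<le> b m \<and> b m \<le> N m"
    and s: "(\<lambda>m. (real (b m) - real (a m)) / (real (N m) * \<rho> m)) \<longlonglongrightarrow> s" "s > 0" and uv: "u < v"
  shows "(\<lambda>m. measure (M m) {\<omega>\<in>space (M m). (\<Sum>k\<in>{a m<..b m}. z m k \<omega>) \<in> {u<..v}}) \<longlonglongrightarrow>
    cdf std_normal_distribution (v / sqrt s) - cdf std_normal_distribution (u / sqrt s)"
proof -
  obtain \<F> :: "nat \<Rightarrow> real measure" where F: "\<And>r. real_distribution (\<F> r)" "weak_conv_m \<F> std_normal_distribution"
    "\<And>(M :: 'a measure) (\<epsilon> :: nat \<Rightarrow> 'a \<Rightarrow> real) A. prob_space M \<Longrightarrow> prob_space.indep_vars M (\<lambda>_. borel) \<epsilon> A \<Longrightarrow>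
       finite A \<Longrightarrow> (\<And>i. i \<in> A \<Longrightarrow> distr M borel (\<epsilon> i) = \<nu>) \<Longrightarrow>
       distr M borel (\<lambda>\<omega>. (\<Sum>i\<in>A. \<epsilon> i \<omega>) / (\<sigma> * sqrt (card A))) = \<F> (card A)"
    using iid_sum_clt[OF law \<sigma>, where 'a='a and 'i=nat] by blast
  define U where "U m = (\<Union>k\<in>{a m<..b m}. R m k)" for m
  define sc where "sc m = sqrt ((real (b m) - real (a m)) / (real (N m) * \<rho> m))" for m
  have sc: "sc \<longlonglongrightarrow> sqrt s" unfolding sc_def[abs_def] by (intro tendsto_real_sqrt s)
  have "filterlim (\<lambda>m. (real (b m) - real (a m)) / (real (N m) * \<rho> m) * (real (N m) * \<rho> m)) at_top sequentially"
    by (rule filterlim_tendsto_pos_mult_at_top[OF s Nrho])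
  then have ba: "filterlim (\<lambda>m. real (b m) - real (a m)) at_top sequentially"
  proof -
    have "x / q * q = x" if "q > 0" for x q :: real using that by simp
    then have "(real (b m) - real (a m)) / (real (N m) * \<rho> m) * (real (N m) * \<rho> m) = real (b m) - real (a m)" for m
      using Nrho_pos[of m] by blast
    then show ?thesis using \<open>filterlim _ at_top sequentially\<close> by (simp only:)
  qed
  have cardU: "\<forall>\<^sub>F m in sequentially. U m \<subseteq> {1..n m} \<and> card (U m) = (b m - a m) * K m"
    using ab
  proof eventually_elim
    case (elim m)
    then have "{a m<..b m} \<subseteq> {1..N m}" by auto
    from rows_UN(1,2)[OF this] show ?case by (simp add: U_def)
  qed
  have cU: "filterlim (\<lambda>m. card (U m)) at_top sequentially"
    unfolding filterlim_at_top
  proof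
    fix Z :: nat
    have "\<forall>\<^sub>F m in sequentially. real Z \<le> real (b m) - real (a m)" using ba unfolding filterlim_at_top by blast
    with cardU ab show "\<forall>\<^sub>F m in sequentially. Z \<le> card (U m)"
    proof eventually_elim
      case (elim m)
      then have "Z * 1 \<le> (b m - a m) * K m" using NK(2)[of m] by (intro mult_le_mono) auto
      then show ?case using elim by simp
    qed
  qed
  have "(\<lambda>m. cdf (\<F> (card (U m))) (v / sc m) - cdf (\<F> (card (U m))) (u / sc m)) \<longlonglongrightarrow>
    cdf std_normal_distribution (v / sqrt s) - cdf std_normal_distribution (u / sqrt s)"
    using s(2) by (intro tendsto_diff cdf_weak_limit_uniform[OF F(1,2) isCont_std_normal_cdf cU] tendsto_divide tendsto_const sc) auto
  moreover have "\<forall>\<^sub>F m in sequentially. real 1 \<le> real (b m) - real (a m)" using ba unfolding filterlim_at_top by blast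
  then have "\<forall>\<^sub>F m in sequentially. cdf (\<F> (card (U m))) (v / sc m) - cdf (\<F> (card (U m))) (u / sc m) =
      measure (M m) {\<omega>\<in>space (M m). (\<Sum>k\<in>{a m<..b m}. z m k \<omega>) \<in> {u<..v}}"
    using cardU ab
  proof eventually_elim
    case (elim m)
    interpret prob_space "M m" by (rule ps)
    have sub: "{a m<..b m} \<subseteq> {1..N m}" using elim(3) by auto
    have scp: "sc m > 0" unfolding sc_def using elim(1) Nrho_pos[of m] by simp
    define Q where "Q \<omega> = (\<Sum>i\<in>U m. \<epsilon> m i \<omega>) / (\<sigma> * sqrt (card (U m)))" for \<omega>
    have Qrv: "Q \<in> borel_measurable (M m)" unfolding Q_def[abs_def] using elim(2) eps_rv by (intro borel_measurable_divide borel_measurable_sum) auto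
    have dQ: "distr (M m) borel Q = \<F> (card (U m))"
      unfolding Q_def[abs_def]
      by (rule F(3)[OF ps indep_vars_subset[OF indep]]) (use elim(2) distr in \<open>auto intro: finite_subset\<close>)
    have Nc: "real (card (U m)) = (real (b m) - real (a m)) * real (K m)" using elim by (simp add: of_nat_diff)
    have key: "\<sigma> * sqrt (card (U m)) = sc m * (A m * real (n m))"
    proof -
      have "(\<sigma> * sqrt (card (U m)))\<^sup>2 = (sc m * (A m * real (n m)))\<^sup>2"
      proof -
        have sc2: "(sc m)\<^sup>2 = (real (b m) - real (a m)) / (real (N m) * \<rho> m)"
          unfolding sc_def using elim(1) Nrho_pos[of m] by (intro real_sqrt_pow2) simp
        have nn: "real (n m) = real (N m) * real (K m)" using NK(1)[of m] by (metis of_nat_mult)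
        have c2: "(sqrt (real (card (U m))))\<^sup>2 = (real (b m) - real (a m)) * real (K m)"
          using Nc by (subst real_sqrt_pow2) auto
        show ?thesis
          unfolding power_mult_distrib sc2 A_squared c2 nn
          using N0[of m] rho_pos[of m] NK(2)[of m] by (simp add: field_simps power2_eq_square)
      qed
      moreover have "\<sigma> * sqrt (card (U m)) \<ge> 0" "sc m * (A m * real (n m)) \<ge> 0" using \<sigma> scp A_pos[of m] by auto
      ultimately show ?thesis by (rule power2_eq_imp_eq)
    qed
    have eq: "(\<Sum>k\<in>{a m<..b m}. z m k \<omega>) = sc m * Q \<omega>" for \<omega>
      unfolding z_sum[OF sub] U_def[symmetric] Q_def key using scp A_pos[of m] n0[of m] by simp
    have mem: "(\<Sum>k\<in>{a m<..b m}. z m k \<omega>) \<in> {u<..v} \<longleftrightarrow> Q \<omega> \<le> v / sc m \<and> \<not> Q \<omega> \<le> u / sc m" for \<omega>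
      unfolding eq using scp by (auto simp: pos_le_divide_eq pos_divide_less_eq not_le mult.commute)
    have c: "cdf (\<F> (card (U m))) x = prob {\<omega>\<in>space (M m). Q \<omega> \<le> x}" for x
    proof -
      have "cdf (\<F> (card (U m))) x = prob (Q -` {..x} \<inter> space (M m))"
        unfolding dQ[symmetric] cdf_def using Qrv by (subst measure_distr) auto
      also have "Q -` {..x} \<inter> space (M m) = {\<omega>\<in>space (M m). Q \<omega> \<le> x}" by auto
      finally show ?thesis .
    qed
    have "{\<omega>\<in>space (M m). (\<Sum>k\<in>{a m<..b m}. z m k \<omega>) \<in> {u<..v}} = {\<omega>\<in>space (M m). Q \<omega> \<le> v / sc m} - {\<omega>\<in>space (M m). Q \<omega> \<le> u / sc m}"
      unfolding mem by auto
    also have "prob \<dots> = prob {\<omega>\<in>space (M m). Q \<omega> \<le> v / sc m} - prob {\<omega>\<in>space (M m). Q \<omega> \<le> u / sc m}"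
    proof (rule finite_measure_Diff)
      note [measurable] = Qrv
      show "{\<omega>\<in>space (M m). Q \<omega> \<le> v / sc m} \<in> events" "{\<omega>\<in>space (M m). Q \<omega> \<le> u / sc m} \<in> events" by measurable
      have "u / sc m \<le> v / sc m" using uv scp by (intro divide_right_mono) auto
      then show "{\<omega>\<in>space (M m). Q \<omega> \<le> u / sc m} \<subseteq> {\<omega>\<in>space (M m). Q \<omega> \<le> v / sc m}" by auto
    qed
    finally show ?case by (simp add: c)
  qed
  ultimately show ?thesis by (rule Lim_transform_eventually)
qed

end

section \<open>Approximation of the array by Brownian motion\<close>

text \<open>
  The samples and the Brownian motion live on unrelated probability spaces.
\<close>

locale array_and_bm = monotone_array M \<epsilon> \<nu> \<sigma> n N K k0 R g D x0 + two_sided_bm P W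
  for M :: "nat \<Rightarrow> 'a measure" and \<epsilon> \<nu> \<sigma> n N K k0 R g D x0 and P :: "'b measure" and W
begin

text \<open>
  Ottaviani inside one cell of a partition: the probability that the noise oscillates is bounded
  through its total increment over the cell, whose law is controlled by \<open>window_limit\<close>.
\<close>

lemma cell_modulus:
  assumes idx: "a \<le> b" "b \<le> N m" and e: "e > 0" and small: "(real b - real a) / (real (N m) * \<rho> m) \<le> e\<^sup>2 / 2"
    and inc: "measure (M m) {\<omega>\<in>space (M m). (\<Sum>k\<in>{a<..b}. z m k \<omega>) \<in> {-e<..e}} \<ge> 1 - p"
  shows "holds_except (M m) (2 * p) (\<lambda>\<omega>. \<forall>k. a \<le> k \<longrightarrow> k \<le> b \<longrightarrow> \<bar>cz m k \<omega> - cz m a \<omega>\<bar> \<le> 2 * e)"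
proof -
  interpret Mm: prob_space "M m" by (rule ps)
  define f where "f i = Suc (a + i)" for i
  define r where "r = b - a"
  have f: "inj_on f {..<r}" "f ` {..<r} \<subseteq> {1..N m}" using idx by (auto simp: f_def inj_on_def r_def)
  have sumf: "(\<Sum>i<j. z m (f i) \<omega>) = (\<Sum>k\<in>{a<..a + j}. z m k \<omega>)" for j \<omega>
    by (rule sum.reindex_bij_witness[of _ "\<lambda>k. k - Suc a" f]) (auto simp: f_def)
  have czd: "cz m k \<omega> - cz m a \<omega> = (\<Sum>i<k - a. z m (f i) \<omega>)" if "a \<le> k" for k \<omega>
  proof -
    have "cz m k \<omega> - cz m a \<omega> = (\<Sum>i=Suc a..k. z m i \<omega>)"
      unfolding cz_def using sum.ub_add_nat[of 1 a "\<lambda>i. z m i \<omega>" "k - a"] that by simp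
    also have "{Suc a..k} = {a<..a + (k - a)}" using that by auto
    finally show ?thesis by (simp add: sumf)
  qed
  have rv: "(\<lambda>\<omega>. \<Sum>i<j. z m (f i) \<omega>) \<in> borel_measurable (M m)" if "j \<le> r" for j
    by (rule borel_measurable_sum, rule z_rv) (use f(2) that in \<open>auto simp: image_subset_iff\<close>)
  have "Mm.prob {\<omega>\<in>space (M m). \<exists>j\<le>r. \<bar>\<Sum>i<j. z m (f i) \<omega>\<bar> > 2 * e} \<le> 2 * Mm.prob {\<omega>\<in>space (M m). \<bar>\<Sum>i<r. z m (f i) \<omega>\<bar> > e}"
  proof (rule Mm.ottaviani[OF z_indep_reindex[OF f] e])
    fix j assume j: "j \<le> r"
    have "Mm.prob {\<omega>\<in>space (M m). \<bar>\<Sum>i\<in>{j..<r}. z m (f i) \<omega>\<bar> > e} \<le> real r / (real (N m) * \<rho> m) / e\<^sup>2"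
      by (rule z_reindex_tail[OF f j e])
    also have "\<dots> \<le> (e\<^sup>2 / 2) / e\<^sup>2" using small idx by (intro divide_right_mono) (auto simp: r_def of_nat_diff)
    finally show "Mm.prob {\<omega>\<in>space (M m). \<bar>\<Sum>i\<in>{j..<r}. z m (f i) \<omega>\<bar> > e} \<le> 1 / 2" using e by simp
  qed
  also have "Mm.prob {\<omega>\<in>space (M m). \<bar>\<Sum>i<r. z m (f i) \<omega>\<bar> > e} \<le> p"
  proof -
    have ar: "a + r = b" using idx by (simp add: r_def)
    define G where "G = {\<omega>\<in>space (M m). (\<Sum>i<r. z m (f i) \<omega>) \<in> {-e<..e}}"
    note [measurable] = rv[OF order_refl]
    have G: "G \<in> Mm.events" unfolding G_def by measurable
    have "Mm.prob {\<omega>\<in>space (M m). \<bar>\<Sum>i<r. z m (f i) \<omega>\<bar> > e} \<le> Mm.prob (space (M m) - G)"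
      by (rule Mm.finite_measure_mono) (use G in \<open>auto simp: G_def\<close>)
    also have "\<dots> = 1 - Mm.prob G" by (rule Mm.prob_compl[OF G])
    also have "\<dots> \<le> p" using inc unfolding G_def sumf ar by simp
    finally show ?thesis .
  qed
  finally have pr: "Mm.prob {\<omega>\<in>space (M m). \<exists>j\<le>r. \<bar>\<Sum>i<j. z m (f i) \<omega>\<bar> > 2 * e} \<le> 2 * p" by simp
  show ?thesis
  proof (rule holds_exceptI[OF _ pr])
    have "{\<omega>\<in>space (M m). \<exists>j\<le>r. \<bar>\<Sum>i<j. z m (f i) \<omega>\<bar> > 2 * e} = (\<Union>j\<in>{..r}. {\<omega>\<in>space (M m). \<bar>\<Sum>i<j. z m (f i) \<omega>\<bar> > 2 * e})" by auto
    also have "\<dots> \<in> Mm.events"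
    proof (rule sets.finite_UN)
      fix j assume "j \<in> {..r}"
      then have [measurable]: "(\<lambda>\<omega>. \<Sum>i<j. z m (f i) \<omega>) \<in> borel_measurable (M m)" using rv by simp
      show "{\<omega>\<in>space (M m). \<bar>\<Sum>i<j. z m (f i) \<omega>\<bar> > 2 * e} \<in> Mm.events" by measurable
    qed simp
    finally show "{\<omega>\<in>space (M m). \<exists>j\<le>r. \<bar>\<Sum>i<j. z m (f i) \<omega>\<bar> > 2 * e} \<in> Mm.events" .
    fix \<omega> assume \<omega>: "\<omega> \<in> space (M m)" "\<omega> \<notin> {\<omega>\<in>space (M m). \<exists>j\<le>r. \<bar>\<Sum>i<j. z m (f i) \<omega>\<bar> > 2 * e}"
    show "\<forall>k. a \<le> k \<longrightarrow> k \<le> b \<longrightarrow> \<bar>cz m k \<omega> - cz m a \<omega>\<bar> \<le> 2 * e"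
    proof (intro allI impI)
      fix k assume k: "a \<le> k" "k \<le> b"
      then have "k - a \<le> r" by (simp add: r_def)
      then show "\<bar>cz m k \<omega> - cz m a \<omega>\<bar> \<le> 2 * e" using \<omega> czd[OF k(1)] by (auto simp: not_less)
    qed
  qed
qed

lemma idx_increment_limit:
  assumes "s \<le> t"
  shows "(\<lambda>m. (real (idx m t) - real (idx m s)) / (real (N m) * \<rho> m)) \<longlonglongrightarrow> t - s"
proof -
  define T where "T = max \<bar>s\<bar> \<bar>t\<bar> + 1"
  have T: "T > 0" "\<bar>s\<bar> \<le> T" "\<bar>t\<bar> \<le> T" by (auto simp: T_def)
  have lim: "(\<lambda>m. tm m (idx m \<tau>)) \<longlonglongrightarrow> \<tau>" if "\<bar>\<tau>\<bar> \<le> T" for \<tau>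
  proof (rule real_tendsto_sandwich)
    show "\<forall>\<^sub>F m in sequentially. tm m (idx m \<tau>) \<le> \<tau>" using idx_props[OF T(1)] by eventually_elim (use that in blast)
    show "\<forall>\<^sub>F m in sequentially. \<tau> - 1 / (real (N m) * \<rho> m) \<le> tm m (idx m \<tau>)" using idx_props[OF T(1)]
    proof eventually_elim
      case (elim m)
      then have "\<tau> < tm m (idx m \<tau>) + 1 / (real (N m) * \<rho> m)" using that by blast
      then show ?case by linarith
    qed
    have "(\<lambda>m. \<tau> - 1 / (real (N m) * \<rho> m)) \<longlonglongrightarrow> \<tau> - 0" by (intro tendsto_diff tendsto_const Nrho_inverse)
    then show "(\<lambda>m. \<tau> - 1 / (real (N m) * \<rho> m)) \<longlonglongrightarrow> \<tau>" by simp
  qed simp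
  have "(\<lambda>m. tm m (idx m t) - tm m (idx m s)) \<longlonglongrightarrow> t - s" by (intro tendsto_diff lim T)
  then show ?thesis by (simp add: tm_def diff_divide_distrib[symmetric])
qed

lemma idx_mono_eventually:
  assumes T: "T > 0"
  shows "\<forall>\<^sub>F m in sequentially. \<forall>s t. \<bar>s\<bar> \<le> T \<longrightarrow> \<bar>t\<bar> \<le> T \<longrightarrow> s \<le> t \<longrightarrow> idx m s \<le> idx m t \<and> idx m t \<le> N m"
  using idx_props[OF T]
proof eventually_elim
  case (elim m)
  show ?case
  proof (intro allI impI)
    fix s t assume st: "\<bar>s\<bar> \<le> T" "\<bar>t\<bar> \<le> T" "s \<le> t"
    have "tm m (idx m s) \<le> s" using elim st by blast
    then have "tm m (idx m s) \<le> t" using st by simp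
    then show "idx m s \<le> idx m t \<and> idx m t \<le> N m" using elim st by blast
  qed
qed

text \<open>
  Increments over a fine partition of \<open>[- T, T]\<close> are matched by
  \<open>box_convergence\<close>, the oscillation inside the cells is small for both processes, the
  drift converges to \<open>t\<^sup>2\<close>, and outside \<open>[- T, T]\<close> the drift dominates
  the noise.  The condition on \<open>T\<close> and \<open>p\<close> pays for the last point, where
  the failure probability decays only with \<open>T\<close>.
\<close>

theorem array_tracks_bm:
  fixes T :: nat
  assumes T: "T \<ge> 2" and Tp: "4096 / real T ^ 3 \<le> p" and p: "p > 0" and \<kappa>: "\<kappa> > 0" and G: "G \<in> sets P"
  shows "\<forall>\<^sub>F m in sequentially. \<exists>E\<in>sets (M m). measure (M m) E \<ge> measure P G - p \<and>
    (\<forall>\<omega>'\<in>E. \<exists>\<omega>\<in>G. tracks T \<kappa> {0..N m} (tm m) (\<lambda>k. V m k \<omega>') (\<lambda>t. W t \<omega> + t\<^sup>2))"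
proof -
  define a where "a = \<kappa> / 16"
  have a: "a > 0" using \<kappa> by (simp add: a_def)
  have T0: "real T > 0" "real T \<ge> 2" using T by auto
  obtain r0 where r0: "\<And>r. r \<ge> r0 \<Longrightarrow> holds_except P (p / 8) (\<lambda>\<omega>. \<forall>s t. \<bar>s\<bar> \<le> real T \<longrightarrow> \<bar>t\<bar> \<le> real T \<longrightarrow> \<bar>s - t\<bar> \<le> 1 / real (Suc r) \<longrightarrow> \<bar>W s \<omega> - W t \<omega>\<bar> \<le> \<kappa> / 8)"
    using path_modulus[OF T0(1), of "\<kappa> / 8" "p / 8"] \<kappa> p by auto
  \<comment> \<open>The cells have length \<open>1 / kk\<close>: short enough for the Chebyshev bound required by Ottaviani's
    inequality, and for the sum of the fourth moment bounds over all cells.\<close>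
  obtain r1 :: nat where r1: "real r1 \<ge> max (4 / a\<^sup>2) (64 * real T / (a^4 * p))" using real_arch_simple by blast
  define kk where "kk = Suc (max r0 r1)"
  have kk: "real kk > 0" "real kk \<ge> 4 / a\<^sup>2" "real kk \<ge> 64 * real T / (a^4 * p)" using r1 by (auto simp: kk_def)
  have modW: "holds_except P (p / 8) (\<lambda>\<omega>. \<forall>s t. \<bar>s\<bar> \<le> real T \<longrightarrow> \<bar>t\<bar> \<le> real T \<longrightarrow> \<bar>s - t\<bar> \<le> 1 / real kk \<longrightarrow> \<bar>W s \<omega> - W t \<omega>\<bar> \<le> \<kappa> / 8)"
    unfolding kk_def by (rule r0) simp
  define r where "r = 2 * T * kk"
  have r: "r > 0" using T by (simp add: r_def kk_def)
  define \<tau> where "\<tau> l = (real l - real T * real kk) / real kk" for l :: nat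
  have \<tau>d: "\<tau> (Suc l) - \<tau> l = 1 / real kk" for l by (simp add: \<tau>_def diff_divide_distrib[symmetric])
  have \<tau>T: "\<bar>\<tau> l\<bar> \<le> real T" if "l \<le> r" for l
  proof -
    have "real l \<le> real r" using that by simp
    then have "real l \<le> 2 * real T * real kk" by (simp add: r_def)
    then have "\<bar>real l - real T * real kk\<bar> \<le> real T * real kk" using kk by (simp add: abs_le_iff)
    then show ?thesis unfolding \<tau>_def abs_divide using kk by (simp add: pos_divide_le_eq)
  qed
  have \<tau>lt: "\<tau> l < \<tau> (Suc l)" for l using \<tau>d[of l] kk by (smt (verit) divide_pos_pos)
  have sm: "strict_mono_on {..r} \<tau>"
    unfolding strict_mono_on_def \<tau>_def using kk by (auto intro!: divide_strict_right_mono)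
  define xi where "xi m l \<omega> = (\<Sum>k\<in>{idx m (\<tau> l)<..idx m (\<tau> (Suc l))}. z m k \<omega>)" for m l \<omega>
  define Y where "Y l \<omega> = W (\<tau> (Suc l)) \<omega> - W (\<tau> l) \<omega>" for l \<omega>
  have mono: "\<forall>\<^sub>F m in sequentially. \<forall>s t. \<bar>s\<bar> \<le> real T \<longrightarrow> \<bar>t\<bar> \<le> real T \<longrightarrow> s \<le> t \<longrightarrow> idx m s \<le> idx m t \<and> idx m t \<le> N m"
    by (rule idx_mono_eventually[OF T0(1)])
  have mono': "\<forall>\<^sub>F m in sequentially. \<forall>l l'. l \<le> l' \<longrightarrow> l' \<le> r \<longrightarrow> idx m (\<tau> l) \<le> idx m (\<tau> l') \<and> idx m (\<tau> l') \<le> N m"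
    using mono
  proof eventually_elim
    case (elim m)
    have "\<tau> l \<le> \<tau> l'" if "l \<le> l'" for l l' unfolding \<tau>_def using that kk by (intro divide_right_mono) auto
    then show ?case using elim \<tau>T by (meson order_trans)
  qed
  have mono_l: "\<forall>\<^sub>F m in sequentially. idx m (\<tau> l) \<le> idx m (\<tau> (Suc l)) \<and> idx m (\<tau> (Suc l)) \<le> N m" if "l < r" for l
    using mono'
  proof eventually_elim
    case (elim m)
    show ?case using elim[rule_format, of l "Suc l"] that by simp
  qed
  have winlim: "(\<lambda>m. measure (M m) {\<omega>\<in>space (M m). xi m l \<omega> \<in> {u<..v}}) \<longlonglongrightarrow> prob {\<omega>\<in>space P. Y l \<omega> \<in> {u<..v}}"
    if l: "l < r" and uv: "u < v" for l u v
    unfolding xi_def Y_def W_increment_window[OF \<tau>lt uv]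
    by (rule window_limit[OF mono_l[OF l] idx_increment_limit _ uv]) (use \<tau>lt[of l] in auto)
  have Yind: "indep_vars (\<lambda>_. borel) Y {..<r}" unfolding Y_def[abs_def] by (rule W_indep[OF sm])
  have xind: "\<forall>\<^sub>F m in sequentially. prob_space.indep_vars (M m) (\<lambda>_. borel) (xi m) {..<r}"
    using mono'
  proof eventually_elim
    case (elim m)
    show ?case unfolding xi_def[abs_def]
    proof (rule prob_space.indep_vars_block_sums[OF ps z_indep])
      show "{idx m (\<tau> l)<..idx m (\<tau> (Suc l))} \<subseteq> {1..N m}" if "l \<in> {..<r}" for l
        using elim[rule_format, of l "Suc l"] that by auto
      show "disjoint_family_on (\<lambda>l. {idx m (\<tau> l)<..idx m (\<tau> (Suc l))}) {..<r}"
        unfolding disjoint_family_on_def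
      proof (intro ballI impI)
        fix l l' assume l: "l \<in> {..<r}" "l' \<in> {..<r}" "l \<noteq> l'"
        have "idx m (\<tau> (Suc l)) \<le> idx m (\<tau> l') \<or> idx m (\<tau> (Suc l')) \<le> idx m (\<tau> l)"
          using elim[rule_format, of "Suc l" l'] elim[rule_format, of "Suc l'" l] l by (cases "l < l'") auto
        then show "{idx m (\<tau> l)<..idx m (\<tau> (Suc l))} \<inter> {idx m (\<tau> l')<..idx m (\<tau> (Suc l'))} = {}" by auto
      qed
    qed
  qed
  have "holds_except P (p / 8 + 0) (\<lambda>\<omega>. (\<forall>s t. \<bar>s\<bar> \<le> real T \<longrightarrow> \<bar>t\<bar> \<le> real T \<longrightarrow> \<bar>s - t\<bar> \<le> 1 / real kk \<longrightarrow> \<bar>W s \<omega> - W t \<omega>\<bar> \<le> \<kappa> / 8) \<and>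
      (W 0 \<omega> = 0 \<and> continuous_on UNIV (\<lambda>t. W t \<omega>)))"
    by (rule holds_except_conj[OF modW holds_except_AE[OF W_path]])
  then obtain Bw where Bw: "Bw \<in> sets P" "measure P Bw \<le> p / 8"
    "\<And>\<omega>. \<omega> \<in> space P \<Longrightarrow> \<omega> \<notin> Bw \<Longrightarrow> (\<forall>s t. \<bar>s\<bar> \<le> real T \<longrightarrow> \<bar>t\<bar> \<le> real T \<longrightarrow> \<bar>s - t\<bar> \<le> 1 / real kk \<longrightarrow> \<bar>W s \<omega> - W t \<omega>\<bar> \<le> \<kappa> / 8) \<and> W 0 \<omega> = 0"
    unfolding holds_except_def by auto
  \<comment> \<open>The errors of the \<open>r\<close> increments add up along the grid.\<close>
  define b where "b = \<kappa> / (8 * real r)"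
  have b: "b > 0" using \<kappa> r by (simp add: b_def)
  have GB: "G - Bw \<in> sets P" using G Bw by auto
  have GBp: "measure P (G - Bw) \<ge> measure P G - p / 8"
  proof -
    have "measure P G \<le> measure P ((G - Bw) \<union> Bw)" by (rule finite_measure_mono) (use G Bw in auto)
    also have "\<dots> \<le> measure P (G - Bw) + measure P Bw" by (rule measure_Un_le) (use G Bw in auto)
    finally show ?thesis using Bw by simp
  qed
  have p8: "p / 8 > 0" using p by simp
  have boxes: "\<forall>\<^sub>F m in sequentially. \<exists>E\<in>sets (M m). measure (M m) E \<ge> measure P (G - Bw) - p / 8 \<and>
    (\<forall>\<omega>'\<in>E. \<exists>\<omega>\<in>G - Bw. \<forall>l<r. \<bar>xi m l \<omega>' - Y l \<omega>\<bar> \<le> b)"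
    by (rule box_convergence[OF ps prob_space_axioms xind Yind r _ GB b p8]) (rule winlim)
  \<comment> \<open>Each of the \<open>r\<close> cells fails with probability of order \<open>kk\<close> to the power \<open>-2\<close>, by the fourth moment;
    the second moment would give a total that does not tend to zero.\<close>
  define pc where "pc = 4 / (real kk ^ 2 * a ^ 4)"
  have inc: "\<forall>\<^sub>F m in sequentially. measure (M m) {\<omega>\<in>space (M m). xi m l \<omega> \<in> {-a<..a}} \<ge> 1 - pc" if l: "l < r" for l
  proof -
    have "prob {\<omega>\<in>space P. \<bar>Y l \<omega>\<bar> \<ge> a} \<le> 3 * (\<tau> (Suc l) - \<tau> l)\<^sup>2 / a ^ 4"
      unfolding Y_def by (rule W_increment_fourth[OF \<tau>lt a])
    also have "\<dots> = 3 / (real kk ^ 2 * a ^ 4)" unfolding \<tau>d by (simp add: power_divide)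
    also have "\<dots> < pc" unfolding pc_def using kk a by (intro divide_strict_right_mono) auto
    finally have "prob {\<omega>\<in>space P. \<bar>Y l \<omega>\<bar> \<ge> a} < pc" .
    moreover have "prob (space P - {\<omega>\<in>space P. \<bar>Y l \<omega>\<bar> \<ge> a}) \<le> prob {\<omega>\<in>space P. Y l \<omega> \<in> {-a<..a}}"
      unfolding Y_def by (rule finite_measure_mono) auto
    moreover have "prob (space P - {\<omega>\<in>space P. \<bar>Y l \<omega>\<bar> \<ge> a}) = 1 - prob {\<omega>\<in>space P. \<bar>Y l \<omega>\<bar> \<ge> a}"
      unfolding Y_def by (rule prob_compl) measurable
    ultimately have "prob {\<omega>\<in>space P. Y l \<omega> \<in> {-a<..a}} > 1 - pc" by linarith
    then have "\<forall>\<^sub>F m in sequentially. measure (M m) {\<omega>\<in>space (M m). xi m l \<omega> \<in> {-a<..a}} > 1 - pc"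
      by (intro order_tendstoD(1)[OF winlim[OF l]]) (use a in auto)
    then show ?thesis by eventually_elim simp
  qed
  have small: "\<forall>\<^sub>F m in sequentially. (real (idx m (\<tau> (Suc l))) - real (idx m (\<tau> l))) / (real (N m) * \<rho> m) \<le> a\<^sup>2 / 2" if l: "l < r" for l
  proof -
    have "4 / a\<^sup>2 \<le> real kk" by (rule kk(2))
    then have "1 / real kk \<le> a\<^sup>2 / 4" using a kk(1) by (simp add: field_simps)
    moreover have "a\<^sup>2 > 0" using a by simp
    ultimately have "\<tau> (Suc l) - \<tau> l < a\<^sup>2 / 2" unfolding \<tau>d by linarith
    then have "\<forall>\<^sub>F m in sequentially. (real (idx m (\<tau> (Suc l))) - real (idx m (\<tau> l))) / (real (N m) * \<rho> m) < a\<^sup>2 / 2"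
      by (intro order_tendstoD(2)[OF idx_increment_limit]) (use \<tau>lt[of l] in auto)
    then show ?thesis by eventually_elim simp
  qed
  have "\<forall>\<^sub>F m in sequentially. \<forall>l\<in>{..<r}. holds_except (M m) (2 * pc) (\<lambda>\<omega>. \<forall>k. idx m (\<tau> l) \<le> k \<longrightarrow> k \<le> idx m (\<tau> (Suc l)) \<longrightarrow> \<bar>cz m k \<omega> - cz m (idx m (\<tau> l)) \<omega>\<bar> \<le> 2 * a)"
  proof (rule eventually_ball_finite)
    show "\<forall>l\<in>{..<r}. \<forall>\<^sub>F m in sequentially. holds_except (M m) (2 * pc) (\<lambda>\<omega>. \<forall>k. idx m (\<tau> l) \<le> k \<longrightarrow> k \<le> idx m (\<tau> (Suc l)) \<longrightarrow> \<bar>cz m k \<omega> - cz m (idx m (\<tau> l)) \<omega>\<bar> \<le> 2 * a)"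
    proof
      fix l assume "l \<in> {..<r}"
      then have l: "l < r" by simp
      show "\<forall>\<^sub>F m in sequentially. holds_except (M m) (2 * pc) (\<lambda>\<omega>. \<forall>k. idx m (\<tau> l) \<le> k \<longrightarrow> k \<le> idx m (\<tau> (Suc l)) \<longrightarrow> \<bar>cz m k \<omega> - cz m (idx m (\<tau> l)) \<omega>\<bar> \<le> 2 * a)"
        using inc[OF l] small[OF l] mono_l[OF l]
      proof eventually_elim
        case (elim m)
        show ?case by (rule cell_modulus[OF _ _ a elim(2) elim(1)[unfolded xi_def]]) (use elim(3) in auto)
      qed
    qed
  qed simp
  then have cells: "\<forall>\<^sub>F m in sequentially. holds_except (M m) (p / 4) (\<lambda>\<omega>. \<forall>l\<in>{..<r}. \<forall>k. idx m (\<tau> l) \<le> k \<longrightarrow> k \<le> idx m (\<tau> (Suc l)) \<longrightarrow> \<bar>cz m k \<omega> - cz m (idx m (\<tau> l)) \<omega>\<bar> \<le> 2 * a)"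
  proof eventually_elim
    case (elim m)
    interpret Mm: prob_space "M m" by (rule ps)
    have "holds_except (M m) (\<Sum>l<r. 2 * pc) (\<lambda>\<omega>. \<forall>l\<in>{..<r}. \<forall>k. idx m (\<tau> l) \<le> k \<longrightarrow> k \<le> idx m (\<tau> (Suc l)) \<longrightarrow> \<bar>cz m k \<omega> - cz m (idx m (\<tau> l)) \<omega>\<bar> \<le> 2 * a)"
      by (rule Mm.holds_except_ball) (use elim in auto)
    then show ?case
    proof (rule holds_except_mono)
      have "(\<Sum>l<r. 2 * pc) = 16 * real T / (real kk * a ^ 4)"
        using kk a by (simp add: r_def pc_def power2_eq_square)
      also have "\<dots> \<le> p / 4"
      proof -
        have "64 * real T \<le> real kk * (a ^ 4 * p)" using kk(3) a p by (simp add: pos_divide_le_eq)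
        then show ?thesis using kk(1) a by (simp add: pos_divide_le_eq field_simps)
      qed
      finally show "(\<Sum>l<r. 2 * pc) \<le> p / 4" .
    qed
  qed
  have k8: "\<kappa> / 8 > 0" and rT1: "real T + 1 > 0" using \<kappa> by auto
  have mesh: "\<forall>\<^sub>F m in sequentially. 1 / (real (N m) * \<rho> m) < \<kappa>" by (rule order_tendstoD(2)[OF Nrho_inverse \<kappa>])
  have idx0: "\<forall>\<^sub>F m in sequentially. idx m 0 = k0 m"
  proof (intro always_eventually allI)
    fix m
    have "real (N m) * (x0 + \<rho> m * 0) = real (k0 m)" by (simp add: k0(2) mult.commute)
    then show "idx m 0 = k0 m" unfolding idx_def by simp
  qed
  show ?thesis
    using boxes cells drift_limit[OF T0(1) k8] drift_tail[OF T0(2)] mesh idx0 idx_props[OF T0(1)]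
  proof eventually_elim
    case (elim m)
    interpret Mm: prob_space "M m" by (rule ps)
    obtain E1 where E1: "E1 \<in> sets (M m)" "measure (M m) E1 \<ge> measure P (G - Bw) - p / 8"
      "\<And>\<omega>'. \<omega>' \<in> E1 \<Longrightarrow> \<exists>\<omega>\<in>G - Bw. \<forall>l<r. \<bar>xi m l \<omega>' - Y l \<omega>\<bar> \<le> b" using elim(1) by blast
    have T3: "64 / ((real T / 4)\<^sup>2 * real T) \<le> p / 4"
    proof -
      have "64 / ((real T / 4)\<^sup>2 * real T) = 1024 / real T ^ 3" using T0 by (simp add: power2_eq_square power3_eq_cube field_simps)
      also have "\<dots> = (4096 / real T ^ 3) / 4" by simp
      also have "\<dots> \<le> p / 4" using Tp by (intro divide_right_mono) auto
      finally show ?thesis .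
    qed
    have tail: "holds_except (M m) (p / 4) (\<lambda>\<omega>. \<forall>k\<le>N m. \<bar>tm m k\<bar> \<ge> real T \<longrightarrow> \<bar>cz m k \<omega>\<bar> \<le> real T / 4 * \<bar>tm m k\<bar>)"
      by (rule holds_except_mono[OF noise_growth[OF T0(1)] T3]) (use T0 in auto)
    obtain B2 where B2: "B2 \<in> sets (M m)" "measure (M m) B2 \<le> p / 4 + p / 4"
      "\<And>\<omega>. \<omega> \<in> space (M m) \<Longrightarrow> \<omega> \<notin> B2 \<Longrightarrow> (\<forall>l\<in>{..<r}. \<forall>k. idx m (\<tau> l) \<le> k \<longrightarrow> k \<le> idx m (\<tau> (Suc l)) \<longrightarrow> \<bar>cz m k \<omega> - cz m (idx m (\<tau> l)) \<omega>\<bar> \<le> 2 * a) \<and>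
       (\<forall>k\<le>N m. \<bar>tm m k\<bar> \<ge> real T \<longrightarrow> \<bar>cz m k \<omega>\<bar> \<le> real T / 4 * \<bar>tm m k\<bar>)"
      using Mm.holds_except_conj[OF elim(2) tail] unfolding holds_except_def by auto
    show ?case
    proof (intro bexI[of _ "E1 - B2"] conjI ballI)
      show "E1 - B2 \<in> sets (M m)" using E1 B2 by auto
      have "measure (M m) E1 \<le> measure (M m) ((E1 - B2) \<union> B2)" by (rule Mm.finite_measure_mono) (use E1 B2 in auto)
      also have "\<dots> \<le> measure (M m) (E1 - B2) + measure (M m) B2" by (rule measure_Un_le) (use E1 B2 in auto)
      finally show "measure P G - p \<le> measure (M m) (E1 - B2)" using E1(2) B2(2) GBp p by linarith
      fix \<omega>' assume \<omega>': "\<omega>' \<in> E1 - B2"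
      then have sp: "\<omega>' \<in> space (M m)" "\<omega>' \<notin> B2" using E1(1) sets.sets_into_space by auto
      obtain \<omega> where \<omega>: "\<omega> \<in> G - Bw" and xY: "\<And>l. l < r \<Longrightarrow> \<bar>xi m l \<omega>' - Y l \<omega>\<bar> \<le> b" using E1(3) \<omega>' by blast
      have \<omega>P: "\<omega> \<in> space P" "\<omega> \<notin> Bw" using \<omega> G sets.sets_into_space by auto
      have mW: "\<bar>W s \<omega> - W t \<omega>\<bar> \<le> \<kappa> / 8" if "\<bar>s\<bar> \<le> real T" "\<bar>t\<bar> \<le> real T" "\<bar>s - t\<bar> \<le> 1 / real kk" for s t
        using Bw(3)[OF \<omega>P] that by blast
      have W0: "W 0 \<omega> = 0" using Bw(3)[OF \<omega>P] by blast
      have ip: "1 \<le> idx m t \<and> idx m t \<le> N m \<and> tm m (idx m t) \<le> t \<and> t < tm m (idx m t) + 1 / (real (N m) * \<rho> m) \<and> (\<forall>k. tm m k \<le> t \<longleftrightarrow> k \<le> idx m t)" if "\<bar>t\<bar> \<le> real T" for t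
        using elim(7) that by blast
      have grid: "\<bar>cz m (idx m (\<tau> l)) \<omega>' - W (\<tau> l) \<omega>\<bar> \<le> \<kappa> / 8" if l: "l \<le> r" for l
      proof -
        have "\<bar>cz m (idx m (\<tau> l)) \<omega>' - W (\<tau> l) \<omega>\<bar> \<le> real r * b"
        proof (rule telescope_close[where a="T * kk"])
          have "\<tau> (T * kk) = 0" by (simp add: \<tau>_def)
          then show "cz m (idx m (\<tau> (T * kk))) \<omega>' = W (\<tau> (T * kk)) \<omega>" using elim(6) W0 by (simp add: cz_def)
          show "T * kk \<le> r" by (simp add: r_def)
          fix l assume l: "l < r"
          have le: "idx m (\<tau> l) \<le> idx m (\<tau> (Suc l))"
            using ip[OF \<tau>T[of l]] ip[OF \<tau>T[of "Suc l"]] \<tau>lt[of l] l by (metis Suc_leI less_imp_le order_trans)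
          have "cz m (idx m (\<tau> (Suc l))) \<omega>' - cz m (idx m (\<tau> l)) \<omega>' = (\<Sum>k=Suc (idx m (\<tau> l))..idx m (\<tau> (Suc l)). z m k \<omega>')"
            unfolding cz_def using sum.ub_add_nat[of 1 "idx m (\<tau> l)" "\<lambda>i. z m i \<omega>'" "idx m (\<tau> (Suc l)) - idx m (\<tau> l)"] le by simp
          also have "\<dots> = xi m l \<omega>'" unfolding xi_def by (intro sum.cong) auto
          finally show "\<bar>cz m (idx m (\<tau> (Suc l))) \<omega>' - cz m (idx m (\<tau> l)) \<omega>' - (W (\<tau> (Suc l)) \<omega> - W (\<tau> l) \<omega>)\<bar> \<le> b"
            using xY[OF l] by (simp add: Y_def)
        qed (use l in simp)
        then show ?thesis using r by (simp add: b_def)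
      qed
      have inner: "\<bar>V m k \<omega>' - (W (tm m k) \<omega> + (tm m k)\<^sup>2)\<bar> \<le> \<kappa>" if k: "k \<le> N m" "\<bar>tm m k\<bar> \<le> real T" for k
      proof -
        define y where "y = (tm m k + real T) * real kk"
        have y: "0 \<le> y" "y \<le> real r"
        proof -
          have "0 \<le> tm m k + real T" "tm m k + real T \<le> 2 * real T" using k(2) by (auto simp: abs_le_iff)
          then show "0 \<le> y" "y \<le> real r" using kk(1) by (auto simp: y_def r_def)
        qed
        define l where "l = min (nat \<lfloor>y\<rfloor>) (r - 1)"
        have lr: "l < r" using r by (auto simp: l_def)
        have ly: "real l \<le> y" "y \<le> real (Suc l)"
        proof -
          show "real l \<le> y" using y unfolding l_def by linarith
          show "y \<le> real (Suc l)"
          proof (cases "nat \<lfloor>y\<rfloor> \<le> r - 1")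
            case True
            then have "l = nat \<lfloor>y\<rfloor>" by (simp add: l_def)
            then show ?thesis using y by linarith
          next
            case False
            then have "l = r - 1" by (simp add: l_def)
            then show ?thesis using y r by simp
          qed
        qed
        have ty: "tm m k = y / real kk - real T" using kk by (simp add: y_def)
        have \<tau>e: "\<tau> l' = real l' / real kk - real T" for l' using kk by (simp add: \<tau>_def diff_divide_distrib)
        have tl: "\<tau> l \<le> tm m k" "tm m k \<le> \<tau> (Suc l)" unfolding ty \<tau>e using ly kk by (auto intro!: divide_right_mono)
        have "k \<le> idx m (\<tau> (Suc l))" using ip[OF \<tau>T[of "Suc l"]] tl(2) lr by (metis Suc_leI)
        moreover have "idx m (\<tau> l) \<le> k"
        proof -
          have "tm m (idx m (\<tau> l)) \<le> tm m k" using ip[OF \<tau>T[of l]] tl(1) lr by (metis less_imp_le order_trans)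
          then have "real (idx m (\<tau> l)) - real (k0 m) \<le> real k - real (k0 m)"
            unfolding tm_def using Nrho_pos[of m] by (simp add: divide_le_cancel)
          then show ?thesis by simp
        qed
        ultimately have 1: "\<bar>cz m k \<omega>' - cz m (idx m (\<tau> l)) \<omega>'\<bar> \<le> 2 * a" using B2(3)[OF sp] lr by blast
        have 2: "\<bar>cz m (idx m (\<tau> l)) \<omega>' - W (\<tau> l) \<omega>\<bar> \<le> \<kappa> / 8" using grid lr by simp
        have 3: "\<bar>W (\<tau> l) \<omega> - W (tm m k) \<omega>\<bar> \<le> \<kappa> / 8"
          by (rule mW) (use \<tau>T[of l] lr k tl \<tau>d[of l] in auto)
        have 4: "\<bar>dr m k - (tm m k)\<^sup>2\<bar> \<le> \<kappa> / 8" using elim(3) k by blast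
        show ?thesis using 1 2 3 4 \<kappa> unfolding V_def a_def by linarith
      qed
      have outer: "V m k \<omega>' \<ge> real T / 4 * \<bar>tm m k\<bar>" if k: "k \<le> N m" "\<bar>tm m k\<bar> \<ge> real T" for k
      proof -
        have "dr m k \<ge> real T / 2 * \<bar>tm m k\<bar>" using elim(4) k by blast
        moreover have "\<bar>cz m k \<omega>'\<bar> \<le> real T / 4 * \<bar>tm m k\<bar>" using B2(3)[OF sp] k by blast
        ultimately show ?thesis unfolding V_def by linarith
      qed
      have msh: "\<exists>k\<in>{0..N m}. \<bar>tm m k\<bar> \<le> real T \<and> \<bar>tm m k - x\<bar> \<le> \<kappa>" if x: "\<bar>x\<bar> \<le> real T" for x
      proof -
        have "\<bar>real T\<bar> \<le> real T" by simp
        from ip[OF this] have ipT: "idx m (real T) \<le> N m" "\<And>k. tm m k \<le> real T \<longleftrightarrow> k \<le> idx m (real T)" by blast+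
        have i: "idx m x \<le> N m" "tm m (idx m x) \<le> x" "x < tm m (idx m x) + 1 / (real (N m) * \<rho> m)" using ip[OF x] by blast+
        show ?thesis
        proof (cases "tm m (idx m x) \<ge> - real T")
          case True
          moreover have "tm m (idx m x) \<le> real T" using i(2) x by linarith
          ultimately have "\<bar>tm m (idx m x)\<bar> \<le> real T" by linarith
          moreover have "\<bar>tm m (idx m x) - x\<bar> \<le> \<kappa>" using i(2,3) elim(5) by linarith
          ultimately show ?thesis using i(1) by (intro bexI[of _ "idx m x"]) simp_all
        next
          case False
          have c: "tm m (Suc (idx m x)) = tm m (idx m x) + 1 / (real (N m) * \<rho> m)"
            by (simp add: tm_def add_divide_distrib[symmetric])
          have "idx m x < idx m (real T)"
          proof -
            have "tm m (k0 m) = 0" by (simp add: tm_def)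
            have "idx m x < k0 m"
            proof (rule ccontr)
              assume "\<not> idx m x < k0 m"
              then have "tm m (idx m x) \<ge> 0" using Nrho_pos[of m] by (simp add: tm_def)
              then show False using False T0 by simp
            qed
            moreover have "k0 m \<le> idx m (real T)" using ipT(2)[of "k0 m"] \<open>tm m (k0 m) = 0\<close> by simp
            ultimately show ?thesis by simp
          qed
          then have s: "Suc (idx m x) \<le> idx m (real T)" by simp
          then have sT: "tm m (Suc (idx m x)) \<le> real T" "Suc (idx m x) \<le> N m" using ipT(1) ipT(2)[of "Suc (idx m x)"] by linarith+
          have x': "- real T \<le> x" using x by linarith
          have "tm m (Suc (idx m x)) \<ge> - real T" using c i(3) x' by linarith
          then have "\<bar>tm m (Suc (idx m x))\<bar> \<le> real T" using sT(1) by linarith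
          moreover have "\<bar>tm m (Suc (idx m x)) - x\<bar> \<le> \<kappa>" using c i(2,3) elim(5) by linarith
          ultimately show ?thesis using sT(2) by (intro bexI[of _ "Suc (idx m x)"]) simp_all
        qed
      qed
      show "\<exists>\<omega>\<in>G. tracks (real T) \<kappa> {0..N m} (tm m) (\<lambda>k. V m k \<omega>') (\<lambda>t. W t \<omega> + t\<^sup>2)"
      proof (rule bexI)
        show "\<omega> \<in> G" using \<omega> by blast
        show "tracks (real T) \<kappa> {0..N m} (tm m) (\<lambda>k. V m k \<omega>') (\<lambda>t. W t \<omega> + t\<^sup>2)"
          unfolding tracks_def
        proof (intro conjI ballI allI impI)
          fix k assume "k \<in> {0..N m}" "\<bar>tm m k\<bar> \<le> real T"
          then show "\<bar>V m k \<omega>' - (W (tm m k) \<omega> + (tm m k)\<^sup>2)\<bar> \<le> \<kappa>" by (intro inner) simp_all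
        next
          fix k assume "k \<in> {0..N m}" "real T \<le> \<bar>tm m k\<bar>"
          then show "real T / 4 * \<bar>tm m k\<bar> \<le> V m k \<omega>'" by (intro outer) simp_all
        qed (rule msh)
      qed
    qed
  qed
qed

end

section \<open>Coverage of the confidence interval\<close>

text \<open>
  The interval covers \<open>f0\<close> exactly if \<open>\<bar>sqrt Nh * (F - f0)\<bar> \<le> c *
  sqrt \<sigma>2\<close>.  Replacing the estimated by the true standard deviation and dropping the
  remainder changes this by less than \<open>\<sigma> * e\<close>.
\<close>

lemma coverage_transfer:
  fixes F f0 \<sigma> c e Tn R Nh \<sigma>2 :: real
  assumes Nh: "Nh > 0" and eq: "sqrt Nh * (F - f0) = \<sigma> * Tn + R" and R: "\<bar>R\<bar> \<le> \<sigma> * e / 2"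
    and \<sigma>: "\<sigma> > 0" "0 \<le> \<sigma>2" "\<bar>\<sigma>2 - \<sigma>\<^sup>2\<bar> \<le> \<sigma>\<^sup>2 * e / (2 * (c + 1))" and c: "c \<ge> 0" and e: "e > 0"
  defines "J \<equiv> {F - c * sqrt \<sigma>2 / sqrt Nh .. F + c * sqrt \<sigma>2 / sqrt Nh}"
  shows "\<bar>Tn\<bar> \<le> c - e \<Longrightarrow> f0 \<in> J" and "\<bar>Tn\<bar> \<ge> c + e \<Longrightarrow> f0 \<notin> J"
proof -
  define s where "s = sqrt \<sigma>2"
  have s0: "s \<ge> 0" "s\<^sup>2 = \<sigma>2" using \<sigma> by (auto simp: s_def)
  have "\<bar>s - \<sigma>\<bar> * \<sigma> \<le> \<bar>s - \<sigma>\<bar> * (s + \<sigma>)" using s0 by (intro mult_left_mono) auto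
  also have "\<dots> = \<bar>(s - \<sigma>) * (s + \<sigma>)\<bar>" using s0 \<sigma> by (simp add: abs_mult)
  also have "(s - \<sigma>) * (s + \<sigma>) = \<sigma>2 - \<sigma>\<^sup>2" unfolding s0(2)[symmetric] by (simp add: power2_eq_square algebra_simps)
  also have "\<bar>\<sigma>2 - \<sigma>\<^sup>2\<bar> \<le> (\<sigma> * e / (2 * (c + 1))) * \<sigma>" using \<sigma>(3) by (simp add: power2_eq_square mult_ac)
  finally have sd: "\<bar>s - \<sigma>\<bar> \<le> \<sigma> * e / (2 * (c + 1))" using \<sigma>(1) by (rule mult_right_le_imp_le)
  have csd: "c * \<bar>s - \<sigma>\<bar> < \<sigma> * e / 2"
  proof -
    have "c * \<bar>s - \<sigma>\<bar> \<le> c * (\<sigma> * e / (2 * (c + 1)))" using sd c by (intro mult_left_mono) auto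
    also have "\<dots> = (\<sigma> * e / 2) * (c / (c + 1))" using c by (simp add: field_simps)
    also have "\<dots> < (\<sigma> * e / 2) * 1" using \<sigma> e c by (intro mult_strict_left_mono) auto
    finally show ?thesis by simp
  qed
  have cs: "\<bar>c * s - c * \<sigma>\<bar> < \<sigma> * e / 2"
    using csd c by (simp add: right_diff_distrib[symmetric] abs_mult)
  have J: "f0 \<in> J \<longleftrightarrow> \<bar>sqrt Nh * (F - f0)\<bar> \<le> c * s"
  proof -
    have "f0 \<in> J \<longleftrightarrow> \<bar>F - f0\<bar> \<le> c * s / sqrt Nh" unfolding J_def s_def by auto
    also have "\<dots> \<longleftrightarrow> \<bar>sqrt Nh * (F - f0)\<bar> \<le> c * s" using Nh by (simp add: pos_le_divide_eq abs_mult mult.commute)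
    finally show ?thesis .
  qed
  have aT: "\<bar>\<sigma> * Tn\<bar> = \<sigma> * \<bar>Tn\<bar>" using \<sigma> by (simp add: abs_mult)
  show "f0 \<in> J" if "\<bar>Tn\<bar> \<le> c - e"
  proof -
    have "\<sigma> * \<bar>Tn\<bar> \<le> \<sigma> * (c - e)" using that \<sigma> by (intro mult_left_mono) auto
    then have "\<sigma> * \<bar>Tn\<bar> \<le> c * \<sigma> - \<sigma> * e" by (simp add: algebra_simps)
    then show ?thesis unfolding J eq using aT R cs by linarith
  qed
  show "f0 \<notin> J" if "\<bar>Tn\<bar> \<ge> c + e"
  proof -
    have "\<sigma> * \<bar>Tn\<bar> \<ge> \<sigma> * (c + e)" using that \<sigma> by (intro mult_left_mono) auto
    then have "\<sigma> * \<bar>Tn\<bar> \<ge> c * \<sigma> + \<sigma> * e" by (simp add: algebra_simps)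
    then show ?thesis unfolding J eq using aT R cs by linarith
  qed
qed

theorem corollary3p2:
  fixes nl :: "nat \<Rightarrow> 'd::finite \<Rightarrow> nat"
    and \<beta> :: "'d \<Rightarrow> real"
    and X :: "nat \<Rightarrow> nat \<Rightarrow> real ^ 'd"
    and x0 :: "real ^ 'd"
    and M :: "nat \<Rightarrow> 'a measure"
    and \<epsilon> :: "nat \<Rightarrow> nat \<Rightarrow> 'a \<Rightarrow> real"
    and \<nu> :: "real measure"
    and \<sigma> \<mu> :: real
    and g :: "'d \<Rightarrow> real \<Rightarrow> real"
    and D :: "'d \<Rightarrow> real"
    and Y :: "nat \<Rightarrow> nat \<Rightarrow> 'a \<Rightarrow> real"
    and \<mu>hat :: "nat \<Rightarrow> 'a \<Rightarrow> real"
    and fhat :: "nat \<Rightarrow> 'a \<Rightarrow> 'd \<Rightarrow> real \<Rightarrow> real"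
    and \<sigma>2hat :: "nat \<Rightarrow> 'a \<Rightarrow> real"
    and P :: "'b measure"
    and W :: "real \<Rightarrow> 'b \<Rightarrow> real"
    and L :: "'b \<Rightarrow> real"
    and \<delta> c :: real
    and j :: 'd
  defines "n \<equiv> \<lambda>m. lattice_size (nl m)"
    and "fstar \<equiv> \<lambda>m l. centered (nl m l) (g l)"
    and "Nhat \<equiv> \<lambda>m \<omega>. block_size (lattice_size (nl m)) (X m) j
                        (grid (nl m j)) (fhat m \<omega> j) (x0 $ j)"
  assumes design_exponents: "\<And>l. 0 < \<beta> l \<and> \<beta> l < 1" "(\<Sum>l\<in>UNIV. \<beta> l) = 1"
    and design_sizes: "\<And>l. filterlim (\<lambda>m. nl m l) at_top sequentially"
      "\<And>m l. real (nl m l) = real (n m) powr \<beta> l"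
    and design_points: "\<And>m. bij_betw (X m) {1..n m} (lattice (nl m))"
    and fixed_point: "\<And>l. 0 < x0 $ l \<and> x0 $ l < 1" "\<And>m. x0 \<in> lattice (nl m)"
    and prob_spaces: "\<And>m. prob_space (M m)"
    and errors_indep: "\<And>m. prob_space.indep_vars (M m) (\<lambda>_. borel) (\<epsilon> m) {1..n m}"
    and errors_distr: "\<And>m i. i \<in> {1..n m} \<Longrightarrow> distr (M m) borel (\<epsilon> m i) = \<nu>"
    and errors_law: "real_distribution \<nu>"
      "integrable \<nu> (\<lambda>x. x)" "(\<integral>x. x \<partial>\<nu>) = 0"
      "integrable \<nu> (\<lambda>x. x\<^sup>2)" "(\<integral>x. x\<^sup>2 \<partial>\<nu>) = \<sigma>\<^sup>2"
    and sigma_pos: "\<sigma> > 0"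
    and model: "\<And>m i \<omega>. i \<in> {1..n m} \<Longrightarrow> \<omega> \<in> space (M m) \<Longrightarrow>
      Y m i \<omega> = \<mu> + (\<Sum>l\<in>UNIV. fstar m l (X m i $ l)) + \<epsilon> m i \<omega>"
    and monotone: "\<And>l. mono_on {0..1} (g l)"
    and smooth: "\<And>l. locally_linear_at (g l) (x0 $ l) (D l)" "\<And>l. D l > 0"
    and estimator: "\<And>m \<omega>. \<omega> \<in> space (M m) \<Longrightarrow>
      additive_isotonic_lse (n m) (X m) (\<lambda>i. Y m i \<omega>) (\<mu>hat m \<omega>) (fhat m \<omega>)"
    and variance_estimator: "converges_in_prob M \<sigma>2hat (\<sigma>\<^sup>2)"
      "\<And>m \<omega>. \<omega> \<in> space (M m) \<Longrightarrow> 0 \<le> \<sigma>2hat m \<omega>"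
    and brownian: "two_sided_brownian_motion P W"
    and limit_variable: "is_limit_variable P W L"
    and level: "0 < \<delta>" "\<delta> < 1"
    and critical_value: "isCont (cdf (distr P borel (\<lambda>\<omega>. \<bar>L \<omega>\<bar>))) c"
      "measure P {\<omega> \<in> space P. \<bar>L \<omega>\<bar> > c} = \<delta>"
    and beta_j: "\<beta> j > 1 / 3"
  shows "(\<lambda>m. measure (M m) {\<omega> \<in> space (M m). fstar m j (x0 $ j) \<in>
            {fhat m \<omega> j (x0 $ j) - c * sqrt (\<sigma>2hat m \<omega>) / sqrt (real (Nhat m \<omega>)) ..
             fhat m \<omega> j (x0 $ j) + c * sqrt (\<sigma>2hat m \<omega>) / sqrt (real (Nhat m \<omega>))}})
         \<longlonglongrightarrow> 1 - \<delta>"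
proof -
  interpret bm: two_sided_bm P W by unfold_locales (rule brownian)
  define N where "N m = nl m j" for m
  define K where "K m = n m div N m" for m
  define R where "R m k = slice (n m) (X m) j (N m) k" for m k
  have bij: "bij_betw (X m) {1..n m} (lattice (nl m))" for m by (rule design_points)
  have nl0: "nl m l > 0" for m l
  proof -
    have "x0 $ l \<in> grid (nl m l)" using fixed_point(2)[of m] by (simp add: lattice_def)
    then show ?thesis by (auto simp: grid_def)
  qed
  have N0: "N m > 0" for m by (simp add: N_def nl0)
  have n0: "n m > 0" for m unfolding n_def lattice_size_def using nl0 by (simp add: prod_pos)
  have "\<exists>k. k \<in> {1..N m} \<and> x0 $ j = real k / real (N m)" for m
  proof -
    have "x0 $ j \<in> grid (N m)" using fixed_point(2)[of m] by (simp add: lattice_def N_def)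
    then show ?thesis by (auto simp: grid_def)
  qed
  then obtain k0 where k0: "\<And>m. k0 m \<in> {1..N m}" "\<And>m. x0 $ j = real (k0 m) / real (N m)" by metis
  have cR: "N m * card (R m k) = n m" if "k \<in> {1..N m}" for m k
    unfolding R_def N_def by (rule card_slice[OF bij nl0]) (use that in \<open>simp add: N_def\<close>)
  have NK: "N m * K m = n m" and Rcard: "k \<in> {1..N m} \<Longrightarrow> card (R m k) = K m" for m k
  proof -
    show "N m * K m = n m" unfolding K_def using cR[OF k0(1)[of m]] by (metis dvd_mult_div_cancel dvd_triv_left)
    then show "k \<in> {1..N m} \<Longrightarrow> card (R m k) = K m" using cR[of k m] N0[of m] by (metis nat_mult_eq_cancel1)
  qed
  have K0: "K m > 0" for m using NK[of m] n0[of m] by (metis nat_0_less_mult_iff)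
  have nlim: "filterlim n at_top sequentially"
  proof (rule filterlim_at_top_mono[OF design_sizes(1)[of j]])
    show "\<forall>\<^sub>F m in sequentially. nl m j \<le> n m"
    proof (intro always_eventually allI)
      fix m
      show "nl m j \<le> n m" using NK[of m] K0[of m] by (metis N_def mult_le_mono2 mult.right_neutral Suc_leI One_nat_def)
    qed
  qed
  have Nlim: "filterlim (\<lambda>m. real (N m) * real (n m) powr (- 1 / 3)) at_top sequentially"
  proof -
    have "filterlim (\<lambda>m. real (n m) powr (\<beta> j - 1 / 3)) at_top sequentially"
    proof -
      have "(\<lambda>m. real (n m) powr (- (\<beta> j - 1 / 3))) \<longlonglongrightarrow> 0"
        by (rule tendsto_neg_powr[OF _ filterlim_compose[OF filterlim_real_sequentially nlim]]) (use beta_j in simp)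
      then have "filterlim (\<lambda>m. inverse (real (n m) powr (- (\<beta> j - 1 / 3)))) at_top sequentially"
        by (rule filterlim_inverse_at_top) (use n0 in \<open>auto intro!: always_eventually\<close>)
      then show ?thesis unfolding powr_minus inverse_inverse_eq .
    qed
    moreover have "real (n m) powr (\<beta> j - 1 / 3) = real (N m) * real (n m) powr (- 1 / 3)" for m
      unfolding N_def design_sizes(2) powr_add[symmetric] by simp
    ultimately show ?thesis by simp
  qed
  have x0p: "0 < x0 $ j" "x0 $ j < 1" using fixed_point(1)[of j] by auto
  interpret arr: array_and_bm M \<epsilon> \<nu> \<sigma> n N K k0 R "g j" "D j" "x0 $ j" P W
  proof (intro array_and_bm.intro monotone_array.intro bm.two_sided_bm_axioms)
    show "k \<in> {1..N m} \<Longrightarrow> R m k \<subseteq> {1..n m}" for m k by (auto simp: R_def slice_def)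
    show "k \<noteq> k' \<Longrightarrow> R m k \<inter> R m k' = {}" for m k k' unfolding R_def by (rule slice_disjoint[OF N0])
    show "real (k0 m) = x0 $ j * real (N m)" for m using k0(2)[of m] N0[of m] by simp
  qed (rule prob_spaces errors_indep errors_distr errors_law sigma_pos NK K0 Rcard k0(1) x0p smooth monotone nlim Nlim | assumption)+
  have fstar_zero: "(\<Sum>i=1..n m. fstar m l (X m i $ l)) = 0" for m l
    unfolding fstar_def by (rule centered_sum_zero[OF bij nl0])
  define f0 where "f0 m = fstar m j (x0 $ j)" for m
  define Fh where "Fh m \<omega> = fhat m \<omega> j (x0 $ j)" for m \<omega>
  have mean: "real (n m) * (\<mu> - \<mu>hat m \<omega>) = - (\<Sum>i=1..n m. \<epsilon> m i \<omega>)" if \<omega>: "\<omega> \<in> space (M m)" for m \<omega>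
  proof -
    have "real (n m) * \<mu>hat m \<omega> = (\<Sum>i=1..n m. Y m i \<omega>)"
      using lse_mean[OF bij nl0[of m j] estimator[OF \<omega>]] by simp
    also have "\<dots> = (\<Sum>i=1..n m. \<mu> + (\<Sum>l\<in>UNIV. fstar m l (X m i $ l)) + \<epsilon> m i \<omega>)"
      by (intro sum.cong refl model) (use \<omega> in auto)
    also have "\<dots> = real (n m) * \<mu> + (\<Sum>l\<in>UNIV. \<Sum>i=1..n m. fstar m l (X m i $ l)) + (\<Sum>i=1..n m. \<epsilon> m i \<omega>)"
      by (simp add: sum.distrib) (rule sum.swap)
    finally show ?thesis unfolding fstar_zero by (simp add: algebra_simps)
  qed
  \<comment> \<open>Normalisation makes the other components of the regression function invisible to slice sums, so each
    slice mean is the constant plus the \<open>j\<close>-th component plus an average of errors.\<close>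
  have rowmean: "(\<Sum>i\<in>R m k. Y m i \<omega>) / real (K m) = \<mu> + fstar m j (real k / real (N m)) + (\<Sum>i\<in>R m k. \<epsilon> m i \<omega>) / real (K m)"
    if \<omega>: "\<omega> \<in> space (M m)" and k: "k \<in> {1..N m}" for m k \<omega>
  proof -
    have "(\<Sum>i\<in>R m k. Y m i \<omega>) = (\<Sum>i\<in>R m k. \<mu> + (\<Sum>l\<in>UNIV. fstar m l (X m i $ l)) + \<epsilon> m i \<omega>)"
      by (intro sum.cong refl model) (use \<omega> in \<open>auto simp: R_def slice_def\<close>)
    also have "\<dots> = real (K m) * \<mu> + (\<Sum>l\<in>UNIV. \<Sum>i\<in>R m k. fstar m l (X m i $ l)) + (\<Sum>i\<in>R m k. \<epsilon> m i \<omega>)"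
      by (simp add: sum.distrib sum.swap[of _ "R m k"] Rcard[OF k])
    also have "(\<Sum>l\<in>UNIV. \<Sum>i\<in>R m k. fstar m l (X m i $ l)) = (\<Sum>i\<in>R m k. fstar m j (X m i $ j))"
    proof (subst sum.remove[of UNIV j])
      have "(\<Sum>i\<in>R m k. fstar m l (X m i $ l)) = 0" if "l \<noteq> j" for l
        unfolding R_def N_def by (rule slice_sum_other_zero[OF bij nl0 that fstar_zero]) (use k in \<open>simp add: N_def\<close>)
      then show "(\<Sum>i\<in>R m k. fstar m j (X m i $ j)) + (\<Sum>l\<in>UNIV - {j}. \<Sum>i\<in>R m k. fstar m l (X m i $ l)) = (\<Sum>i\<in>R m k. fstar m j (X m i $ j))"
        by simp
    qed auto
    also have "(\<Sum>i\<in>R m k. fstar m j (X m i $ j)) = (\<Sum>i\<in>R m k. fstar m j (real k / real (N m)))"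
      by (intro sum.cong) (auto simp: R_def slice_def)
    also have "\<dots> = real (K m) * fstar m j (real k / real (N m))" using Rcard[OF k] by simp
    finally show ?thesis using K0[of m] by (simp add: field_simps)
  qed
  have x0k: "x0 $ j = real (k0 m) / real (N m)" for m by (rule k0(2))
  have chord: "\<exists>a b s. discrete_chord {0..N m} (arr.tm m) (\<lambda>k. arr.V m k \<omega>) a b s \<and>
      real (Nhat m \<omega>) = real (n m) * arr.\<rho> m * (arr.tm m b - arr.tm m a) \<and> Nhat m \<omega> > 0 \<and>
      sqrt (real (Nhat m \<omega>)) * (Fh m \<omega> - f0 m) = \<sigma> * (sqrt (arr.tm m b - arr.tm m a) * s) + sqrt (real (Nhat m \<omega>)) * (\<mu> - \<mu>hat m \<omega>)"
    if \<omega>: "\<omega> \<in> space (M m)" for m \<omega>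
  proof -
    define C where "C a = (\<Sum>k=1..a. (\<Sum>i\<in>slice (n m) (X m) j (nl m j) k. Y m i \<omega>) / real (K m) - \<mu>hat m \<omega>)" for a
    have k0': "k0 m \<in> {1..nl m j}" "nl m j * K m = n m" using k0(1)[of m] NK[of m] by (auto simp: N_def)
    obtain a b where ab: "a < k0 m" "k0 m \<le> b" "b \<le> nl m j"
      "block_size (n m) (X m) j (grid (nl m j)) (fhat m \<omega> j) (real (k0 m) / real (nl m j)) = K m * (b - a)"
      "\<And>k. k \<le> nl m j \<Longrightarrow> C k \<ge> C a + fhat m \<omega> j (real (k0 m) / real (nl m j)) * (real k - real a)"
      "C b = C a + fhat m \<omega> j (real (k0 m) / real (nl m j)) * (real b - real a)"
      using lse_block_chord[OF bij nl0 k0'(1) estimator[OF \<omega>] k0'(2) K0] unfolding C_def by blast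
    have Fe: "fhat m \<omega> j (real (k0 m) / real (nl m j)) = Fh m \<omega>" unfolding Fh_def x0k[of m] N_def by simp
    have Ne: "Nhat m \<omega> = K m * (b - a)"
      using ab(4) unfolding Nhat_def n_def x0k[of m] N_def by simp
    define A where "A = arr.A m"
    define q where "q = real (N m) * arr.\<rho> m"
    have A0: "A > 0" and q0: "q > 0" and \<rho>0: "arr.\<rho> m > 0" using arr.A_pos arr.Nrho_pos arr.rho_pos by (auto simp: A_def q_def)
    \<comment> \<open>Subtracting a line from the diagram changes chords by that line only.  With slope \<open>h\<close> the
      difference is the rescaled array.\<close>
    define h where "h = \<mu> - \<mu>hat m \<omega> + f0 m"
    have VC: "arr.V m k \<omega> = (C k - C (k0 m) - (real k - real (k0 m)) * h) / (A * real (N m))" if k: "k \<le> N m" for k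
    proof -
      define u where "u i = g j (real i / real (N m)) - g j (x0 $ j) + (\<Sum>r\<in>R m i. \<epsilon> m r \<omega>) / real (K m)" for i
      have Ck: "C k = (\<Sum>i=1..k. u i) + real k * h" if k: "k \<le> N m" for k
      proof -
        have "C k = (\<Sum>i=1..k. u i + h)" unfolding C_def
        proof (intro sum.cong refl)
          fix i assume i: "i \<in> {1..k}"
          then have "i \<in> {1..N m}" using k by auto
          then have "(\<Sum>r\<in>slice (n m) (X m) j (nl m j) i. Y m r \<omega>) / real (K m) = \<mu> + fstar m j (real i / real (N m)) + (\<Sum>r\<in>R m i. \<epsilon> m r \<omega>) / real (K m)"
            using rowmean[OF \<omega>] unfolding R_def N_def by blast
          moreover have "fstar m j (real i / real (N m)) - f0 m = g j (real i / real (N m)) - g j (x0 $ j)"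
            unfolding f0_def fstar_def centered_def by simp
          ultimately show "(\<Sum>r\<in>slice (n m) (X m) j (nl m j) i. Y m r \<omega>) / real (K m) - \<mu>hat m \<omega> = u i + h"
            unfolding u_def h_def by linarith
        qed
        then show ?thesis by (simp add: sum.distrib)
      qed
      have usum: "(\<Sum>i=1..k'. u i) / (A * real (N m)) = (\<Sum>i=1..k'. arr.sl m i) / q + (\<Sum>i=1..k'. arr.z m i \<omega>)" for k'
      proof -
        have "u i / (A * real (N m)) = arr.sl m i / q + arr.z m i \<omega>" for i
        proof -
          have "arr.sl m i / q = (g j (real i / real (N m)) - g j (x0 $ j)) / (A * real (N m))"
            unfolding arr.sl_def q_def A_def using \<rho>0 by simp
          moreover have "arr.z m i \<omega> = ((\<Sum>r\<in>R m i. \<epsilon> m r \<omega>) / real (K m)) / (A * real (N m))"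
            unfolding arr.z_def A_def NK[of m, symmetric] by (simp add: mult_ac)
          ultimately show ?thesis unfolding u_def by (simp add: add_divide_distrib)
        qed
        then show ?thesis by (simp add: sum_divide_distrib sum.distrib)
      qed
      have k0N: "k0 m \<le> N m" using k0(1)[of m] by simp
      have "arr.V m k \<omega> = ((\<Sum>i=1..k. u i) - (\<Sum>i=1..k0 m. u i)) / (A * real (N m))"
        unfolding arr.V_def arr.dr_def arr.cz_def q_def[symmetric] diff_divide_distrib usum by simp
      then show ?thesis unfolding Ck[OF k] Ck[OF k0N] by (simp add: algebra_simps)
    qed
    define s where "s = (Fh m \<omega> - h) * arr.\<rho> m / A"
    have td: "real k - real a' = (arr.tm m k - arr.tm m a') * q" for k a'
      unfolding arr.tm_def q_def[symmetric] using q0 by (simp add: diff_divide_distrib[symmetric])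
    have Vd: "arr.V m k \<omega> - arr.V m a \<omega> = (C k - C a - (real k - real a) * h) / (A * real (N m))" if "k \<le> N m" for k
    proof -
      have "a \<le> N m" using ab by (simp add: N_def)
      then show ?thesis unfolding VC[OF that] VC[OF \<open>a \<le> N m\<close>] by (simp add: diff_divide_distrib[symmetric] algebra_simps)
    qed
    have sl: "(real k - real a) * (Fh m \<omega> - h) / (A * real (N m)) = s * (arr.tm m k - arr.tm m a)" for k
      unfolding td s_def q_def using A0 N0[of m] by simp
    have AN: "A * real (N m) > 0" using A0 N0[of m] by simp
    have tab: "arr.tm m b - arr.tm m a = (real b - real a) / q" unfolding td using q0 by simp
    have dc: "discrete_chord {0..N m} (arr.tm m) (\<lambda>k. arr.V m k \<omega>) a b s"
      unfolding discrete_chord_def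
    proof (intro conjI ballI)
      show "a \<in> {0..N m}" "b \<in> {0..N m}" using ab by (auto simp: N_def)
      show "arr.tm m a \<le> 0" "0 \<le> arr.tm m b" using ab q0 unfolding arr.tm_def q_def[symmetric] by (simp_all add: divide_le_0_iff)
      fix k assume "k \<in> {0..N m}"
      then have k: "k \<le> N m" by simp
      have "C k \<ge> C a + Fh m \<omega> * (real k - real a)" using ab(5)[of k] k Fe by (simp add: N_def)
      then have "C k - C a - (real k - real a) * h \<ge> (real k - real a) * (Fh m \<omega> - h)" by (simp add: algebra_simps)
      then have "(C k - C a - (real k - real a) * h) / (A * real (N m)) \<ge> (real k - real a) * (Fh m \<omega> - h) / (A * real (N m))"
        using AN by (intro divide_right_mono) auto
      then show "arr.V m a \<omega> + s * (arr.tm m k - arr.tm m a) \<le> arr.V m k \<omega>" using Vd[OF k] sl[of k] by linarith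
    next
      have b: "b \<le> N m" using ab by (simp add: N_def)
      have "C b - C a - (real b - real a) * h = (real b - real a) * (Fh m \<omega> - h)" using ab(6) Fe by (simp add: algebra_simps)
      then show "arr.V m b \<omega> = arr.V m a \<omega> + s * (arr.tm m b - arr.tm m a)" using Vd[OF b] sl[of b] by simp
    qed
    have nn: "real (n m) = real (N m) * real (K m)" using NK[of m] by (metis of_nat_mult)
    have Nr: "real (Nhat m \<omega>) = real (K m) * (real b - real a)" using Ne ab by (simp add: of_nat_diff)
    have Nr2: "real (Nhat m \<omega>) = real (n m) * arr.\<rho> m * (arr.tm m b - arr.tm m a)"
      unfolding Nr tab nn q_def using N0[of m] \<rho>0 by simp
    have Npos: "Nhat m \<omega> > 0" using Ne K0[of m] ab by simp
    have scaled: "sqrt (real (n m) * arr.\<rho> m) * (Fh m \<omega> - h) = \<sigma> * s"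
    proof -
      have "(sqrt (real (n m) * arr.\<rho> m) * A)\<^sup>2 = (\<sigma> * arr.\<rho> m)\<^sup>2"
      proof -
        have "(sqrt (real (n m) * arr.\<rho> m) * A)\<^sup>2 = (real (n m) * arr.\<rho> m) * A\<^sup>2" using \<rho>0 by (simp add: power_mult_distrib)
        also have "\<dots> = (\<sigma> * arr.\<rho> m)\<^sup>2" unfolding A_def arr.A_squared using n0[of m] by (simp add: power2_eq_square)
        finally show ?thesis .
      qed
      then have "sqrt (real (n m) * arr.\<rho> m) * A = \<sigma> * arr.\<rho> m"
        by (rule power2_eq_imp_eq) (use A0 \<rho>0 sigma_pos in auto)
      then have "sqrt (real (n m) * arr.\<rho> m) = \<sigma> * arr.\<rho> m / A" using A0 by (simp add: field_simps)
      then show ?thesis by (simp add: s_def)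
    qed
    have "sqrt (real (Nhat m \<omega>)) * (Fh m \<omega> - h)
        = (sqrt (real (n m) * arr.\<rho> m) * (Fh m \<omega> - h)) * sqrt (arr.tm m b - arr.tm m a)"
      unfolding Nr2 real_sqrt_mult by (simp only: mult_ac)
    then have "sqrt (real (Nhat m \<omega>)) * (Fh m \<omega> - h) = \<sigma> * (sqrt (arr.tm m b - arr.tm m a) * s)"
      unfolding scaled by (simp only: mult_ac)
    then have "sqrt (real (Nhat m \<omega>)) * (Fh m \<omega> - f0 m) = \<sigma> * (sqrt (arr.tm m b - arr.tm m a) * s) + sqrt (real (Nhat m \<omega>)) * (\<mu> - \<mu>hat m \<omega>)"
      unfolding h_def by (simp add: algebra_simps)
    with dc Nr2 Npos show ?thesis by blast
  qed
  \<comment> \<open>The coverage event.  By the max-min formula it is measurable, which is needed to bound its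
    complement.\<close>
  define S where "S m = {\<omega> \<in> space (M m). f0 m \<in> {Fh m \<omega> - c * sqrt (\<sigma>2hat m \<omega>) / sqrt (real (Nhat m \<omega>)) .. Fh m \<omega> + c * sqrt (\<sigma>2hat m \<omega>) / sqrt (real (Nhat m \<omega>))}}" for m
  have Smeas: "S m \<in> sets (M m)" for m
  proof -
    have Yrv: "Y m i \<in> borel_measurable (M m)" if "i \<in> {1..n m}" for i
    proof -
      note [measurable] = arr.eps_rv[OF that]
      have "(\<lambda>\<omega>. \<mu> + (\<Sum>l\<in>UNIV. fstar m l (X m i $ l)) + \<epsilon> m i \<omega>) \<in> borel_measurable (M m)" by measurable
      then show ?thesis by (subst measurable_cong[OF model[OF that]]) auto
    qed
    have muh: "\<mu>hat m \<in> borel_measurable (M m)"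
    proof -
      have "(\<lambda>\<omega>. (\<Sum>i=1..n m. Y m i \<omega>) / real (n m)) \<in> borel_measurable (M m)"
        using Yrv by (intro borel_measurable_divide borel_measurable_sum) auto
      moreover have "\<mu>hat m \<omega> = (\<Sum>i=1..n m. Y m i \<omega>) / real (n m)" if "\<omega> \<in> space (M m)" for \<omega>
        using lse_mean[OF bij nl0[of m j] estimator[OF that]] n0[of m] by simp
      ultimately show ?thesis by (subst measurable_cong) auto
    qed
    have kK: "nl m j * K m = n m" using NK[of m] by (simp add: N_def)
    have Frv: "(\<lambda>\<omega>. fhat m \<omega> j (real k / real (nl m j))) \<in> borel_measurable (M m)" if k: "k \<in> {1..nl m j}" for k
    proof -
      define C where "C a \<omega> = (\<Sum>k=1..a. (\<Sum>i\<in>slice (n m) (X m) j (nl m j) k. Y m i \<omega>) / real (K m) - \<mu>hat m \<omega>)" for a \<omega>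
      have Cm: "C a \<in> borel_measurable (M m)" for a
        unfolding C_def[abs_def] using muh Yrv
        by (intro borel_measurable_sum borel_measurable_diff borel_measurable_divide) (auto simp: slice_def)
      have "(\<lambda>\<omega>. Max ((\<lambda>a. Min ((\<lambda>b. (C b \<omega> - C a \<omega>) / (real b - real a)) ` {k..nl m j})) ` {..<k})) \<in> borel_measurable (M m)"
        using Cm by (intro borel_measurable_Max borel_measurable_Min borel_measurable_divide borel_measurable_diff borel_measurable_const) auto
      moreover have "fhat m \<omega> j (real k / real (nl m j)) = Max ((\<lambda>a. Min ((\<lambda>b. (C b \<omega> - C a \<omega>) / (real b - real a)) ` {k..nl m j})) ` {..<k})"
        if "\<omega> \<in> space (M m)" for \<omega>
        unfolding C_def by (rule lse_maxmin[OF bij nl0 k estimator[OF that] kK K0])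
      ultimately show ?thesis by (subst measurable_cong) auto
    qed
    have k0': "k0 m \<in> {1..nl m j}" using k0(1)[of m] by (simp add: N_def)
    have x0e: "x0 $ j = real (k0 m) / real (nl m j)" using x0k[of m] by (simp add: N_def)
    have Fhrv [measurable]: "Fh m \<in> borel_measurable (M m)" unfolding Fh_def[abs_def] x0e by (rule Frv[OF k0'])
    have Nrv: "(\<lambda>\<omega>. real (Nhat m \<omega>)) \<in> borel_measurable (M m)"
    proof -
      have "(\<lambda>\<omega>. real (K m) * (\<Sum>k=1..nl m j. if fhat m \<omega> j (real k / real (nl m j)) = Fh m \<omega> then 1 else 0)) \<in> borel_measurable (M m)"
      proof (intro borel_measurable_times borel_measurable_const borel_measurable_sum)
        fix k assume "k \<in> {1..nl m j}"
        note [measurable] = Frv[OF this]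
        show "(\<lambda>\<omega>. if fhat m \<omega> j (real k / real (nl m j)) = Fh m \<omega> then 1 else 0) \<in> borel_measurable (M m)" by measurable
      qed
      moreover have "real (Nhat m \<omega>) = real (K m) * (\<Sum>k=1..nl m j. if fhat m \<omega> j (real k / real (nl m j)) = Fh m \<omega> then 1 else 0)"
        if \<omega>: "\<omega> \<in> space (M m)" for \<omega>
      proof -
        obtain a b where ab: "block_size (n m) (X m) j (grid (nl m j)) (fhat m \<omega> j) (real (k0 m) / real (nl m j)) = K m * (b - a)"
          "b - a = card {k\<in>{1..nl m j}. fhat m \<omega> j (real k / real (nl m j)) = fhat m \<omega> j (real (k0 m) / real (nl m j))}"
          using lse_block_chord[OF bij nl0 k0' estimator[OF \<omega>] kK K0] by blast
        have "Nhat m \<omega> = K m * card {k\<in>{1..nl m j}. fhat m \<omega> j (real k / real (nl m j)) = Fh m \<omega>}"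
          using ab unfolding Nhat_def n_def Fh_def x0e by simp
        then show ?thesis by (simp add: sum.If_cases Int_def)
      qed
      ultimately show ?thesis by (subst measurable_cong) auto
    qed
    have [measurable]: "\<sigma>2hat m \<in> borel_measurable (M m)" using variance_estimator(1) by (simp add: converges_in_prob_def)
    define Nr where "Nr \<omega> = real (Nhat m \<omega>)" for \<omega>
    have [measurable]: "Nr \<in> borel_measurable (M m)" using Nrv by (simp add: Nr_def[abs_def])
    have "S m = {\<omega> \<in> space (M m). Fh m \<omega> - c * sqrt (\<sigma>2hat m \<omega>) / sqrt (Nr \<omega>) \<le> f0 m \<and> f0 m \<le> Fh m \<omega> + c * sqrt (\<sigma>2hat m \<omega>) / sqrt (Nr \<omega>)}"
      by (simp add: S_def Nr_def)
    also have "\<dots> \<in> sets (M m)" by measurable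
    finally show ?thesis .
  qed
  have Lrv [measurable]: "L \<in> borel_measurable P" using limit_variable by (simp add: is_limit_variable_def)
  \<comment> \<open>Otherwise the tail probability at \<open>c\<close> would be one, which is excluded by \<open>\<delta> < 1\<close>.\<close>
  have c0: "c \<ge> 0"
  proof (rule ccontr)
    assume "\<not> c \<ge> 0"
    then have "{\<omega> \<in> space P. \<bar>L \<omega>\<bar> > c} = space P" by (auto intro: less_le_trans)
    then show False using critical_value(2) level bm.prob_space by simp
  qed
  \<comment> \<open>Coverage is implied by \<open>\<bar>L\<bar> \<le> c - 2 * e\<close> and excluded by \<open>\<bar>L\<bar> \<ge> c + 2 * e\<close>, up to the exceptional
    sets.\<close>
  have approx: "\<forall>\<^sub>F m in sequentially. measure (M m) (S m) \<ge> bm.prob {\<omega>\<in>space P. \<bar>L \<omega>\<bar> \<le> c - 2 * e} - 4 * p \<and>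
      1 - measure (M m) (S m) \<ge> bm.prob {\<omega>\<in>space P. \<bar>L \<omega>\<bar> \<ge> c + 2 * e} - 4 * p"
    if e: "e > 0" and p: "p > 0" for e p
  proof -
    obtain T \<kappa> where T: "real T \<ge> max 2 (4096 / p)" and \<kappa>: "\<kappa> > 0" and
      Hst: "holds_except P p (\<lambda>\<omega>. \<forall>(I::nat set) t v i q s. discrete_chord I t v i q s \<longrightarrow> tracks T \<kappa> I t v (\<lambda>t. W t \<omega> + t\<^sup>2) \<longrightarrow>
       \<bar>t i\<bar> \<le> 2 * T \<and> \<bar>t q\<bar> \<le> 2 * T \<and> \<bar>sqrt (t q - t i) * s - L \<omega>\<bar> \<le> e)"
      using bm.limit_chord_stable[OF limit_variable p e, where ?T0.0 = "max 2 (4096 / p)"] by blast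
    have T2: "T \<ge> 2" "real T > 0" using T by linarith+
    have Tp: "4096 / real T ^ 3 \<le> p"
    proof -
      have "real T * 1 \<le> real T * real T^2" using T2 by (intro mult_left_mono) auto
      then have T3: "real T \<le> real T^3" by (simp add: power3_eq_cube power2_eq_square)
      have "4096 \<le> p * real T" using T p by (simp add: field_simps)
      also have "\<dots> \<le> p * real T^3" using T3 p by (intro mult_left_mono) auto
      finally show ?thesis using T2 by (simp add: pos_divide_le_eq)
    qed
    obtain Bd where Bd: "Bd \<in> sets P" "measure P Bd \<le> p"
      "\<And>\<omega>. \<omega> \<in> space P \<Longrightarrow> \<omega> \<notin> Bd \<Longrightarrow> \<forall>(I::nat set) t v i q s. discrete_chord I t v i q s \<longrightarrow> tracks T \<kappa> I t v (\<lambda>t. W t \<omega> + t\<^sup>2) \<longrightarrow>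
       \<bar>t i\<bar> \<le> 2 * T \<and> \<bar>t q\<bar> \<le> 2 * T \<and> \<bar>sqrt (t q - t i) * s - L \<omega>\<bar> \<le> e"
      using Hst unfolding holds_except_def by auto
    define \<eta> where "\<eta> = \<sigma>\<^sup>2 * e / (2 * (c + 1))"
    have \<eta>: "\<eta> > 0" using sigma_pos e c0 by (simp add: \<eta>_def)
    define B1 where "B1 m = {\<omega> \<in> space (M m). \<bar>\<sigma>2hat m \<omega> - \<sigma>\<^sup>2\<bar> > \<eta>}" for m
    have "(\<lambda>m. measure (M m) (B1 m)) \<longlonglongrightarrow> 0"
      using variance_estimator(1) \<eta> unfolding converges_in_prob_def B1_def by blast
    then have E1: "\<forall>\<^sub>F m in sequentially. measure (M m) (B1 m) < p" using p by (rule order_tendstoD)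
    have B1m: "B1 m \<in> sets (M m)" for m
    proof -
      have [measurable]: "\<sigma>2hat m \<in> borel_measurable (M m)" using variance_estimator(1) by (simp add: converges_in_prob_def)
      show ?thesis unfolding B1_def by measurable
    qed
    \<comment> \<open>The fitted constant is the overall mean, with error of order \<open>n\<close> to the power \<open>- 1 / 2\<close>, while
      the block has at most \<open>n * \<rho> * 4 * T\<close> observations and \<open>\<rho>\<close> tends to zero.\<close>
    define \<theta> where "\<theta> m = (\<sigma> * e / 2) * real (n m) / sqrt (real (n m) * arr.\<rho> m * (4 * real T))" for m
    define B2 where "B2 m = {\<omega> \<in> space (M m). \<bar>\<Sum>i\<in>{1..n m}. \<epsilon> m i \<omega>\<bar> > \<theta> m}" for m
    have \<theta>0: "\<theta> m > 0" for m unfolding \<theta>_def using sigma_pos e n0[of m] arr.rho_pos[of m] T2 by simp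
    have B2m: "B2 m \<in> sets (M m)" for m
    proof -
      have [measurable]: "(\<lambda>\<omega>. \<Sum>i\<in>{1..n m}. \<epsilon> m i \<omega>) \<in> borel_measurable (M m)" by (intro borel_measurable_sum arr.eps_rv)
      show ?thesis unfolding B2_def by measurable
    qed
    have B2p: "measure (M m) (B2 m) \<le> 16 * real T / e\<^sup>2 * arr.\<rho> m" for m
    proof -
      have "measure (M m) (B2 m) \<le> real (card {1..n m}) * \<sigma>\<^sup>2 / (\<theta> m)\<^sup>2"
        unfolding B2_def by (rule prob_space.chebyshev_iid_sum[OF prob_spaces _ errors_indep])
          (use arr.eps_moments \<theta>0 in auto)
      also have "(\<theta> m)\<^sup>2 = (\<sigma> * e / 2)\<^sup>2 * (real (n m))\<^sup>2 / (real (n m) * arr.\<rho> m * (4 * real T))"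
        unfolding \<theta>_def power_divide[of "_ * real (n m)"] power_mult_distrib[of "\<sigma> * e / 2"]
        using n0[of m] arr.rho_pos[of m] T2 by (subst real_sqrt_pow2) auto
      also have "real (card {1..n m}) * \<sigma>\<^sup>2 / \<dots> = 16 * real T / e\<^sup>2 * arr.\<rho> m"
        using n0[of m] arr.rho_pos[of m] T2 sigma_pos e by (simp add: field_simps power2_eq_square)
      finally show ?thesis .
    qed
    have "(\<lambda>m. 16 * real T / e\<^sup>2 * arr.\<rho> m) \<longlonglongrightarrow> 16 * real T / e\<^sup>2 * 0" by (intro tendsto_intros arr.rho_tendsto)
    then have E2: "\<forall>\<^sub>F m in sequentially. 16 * real T / e\<^sup>2 * arr.\<rho> m < p" by (rule order_tendstoD) (use p in simp)
    have transfer: "\<exists>Tn. \<bar>Tn - L \<omega>\<bar> \<le> e \<and> (\<bar>Tn\<bar> \<le> c - e \<longrightarrow> \<omega>' \<in> S m) \<and> (\<bar>Tn\<bar> \<ge> c + e \<longrightarrow> \<omega>' \<notin> S m)"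
      if \<omega>': "\<omega>' \<in> space (M m)" "\<omega>' \<notin> B1 m" "\<omega>' \<notin> B2 m" and \<omega>: "\<omega> \<in> space P" "\<omega> \<notin> Bd"
        and tr: "tracks T \<kappa> {0..N m} (arr.tm m) (\<lambda>k. arr.V m k \<omega>') (\<lambda>t. W t \<omega> + t\<^sup>2)" for m \<omega> \<omega>'
    proof -
      obtain a b s where dc: "discrete_chord {0..N m} (arr.tm m) (\<lambda>k. arr.V m k \<omega>') a b s"
        and Nr: "real (Nhat m \<omega>') = real (n m) * arr.\<rho> m * (arr.tm m b - arr.tm m a)" and Np: "Nhat m \<omega>' > 0"
        and eq: "sqrt (real (Nhat m \<omega>')) * (Fh m \<omega>' - f0 m) = \<sigma> * (sqrt (arr.tm m b - arr.tm m a) * s) + sqrt (real (Nhat m \<omega>')) * (\<mu> - \<mu>hat m \<omega>')"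
        using chord[OF \<omega>'(1)] by blast
      from Bd(3)[OF \<omega>] dc tr have b: "\<bar>arr.tm m a\<bar> \<le> 2 * T" "\<bar>arr.tm m b\<bar> \<le> 2 * T"
        "\<bar>sqrt (arr.tm m b - arr.tm m a) * s - L \<omega>\<bar> \<le> e" by blast+
      define w where "w = sqrt (real (n m) * arr.\<rho> m * (4 * real T))"
      have w0: "w > 0" unfolding w_def using n0[of m] arr.rho_pos[of m] T2 by simp
      have "\<bar>sqrt (real (Nhat m \<omega>')) * (\<mu> - \<mu>hat m \<omega>')\<bar> \<le> \<sigma> * e / 2"
      proof -
        have "arr.tm m b - arr.tm m a \<le> 4 * real T" using b by linarith
        then have "real (Nhat m \<omega>') \<le> real (n m) * arr.\<rho> m * (4 * real T)"
          unfolding Nr using arr.rho_pos[of m] by (intro mult_left_mono) auto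
        then have s1: "sqrt (real (Nhat m \<omega>')) \<le> w" unfolding w_def by simp
        have h1: "\<bar>\<Sum>i\<in>{1..n m}. \<epsilon> m i \<omega>'\<bar> \<le> \<theta> m" using \<omega>' by (auto simp: B2_def)
        have h2: "\<bar>\<Sum>i\<in>{1..n m}. \<epsilon> m i \<omega>'\<bar> = real (n m) * \<bar>\<mu> - \<mu>hat m \<omega>'\<bar>"
          using mean[OF \<omega>'(1)] by (metis abs_minus_cancel abs_mult abs_of_nat)
        have h3: "\<theta> m = real (n m) * ((\<sigma> * e / 2) / w)" by (simp add: \<theta>_def w_def mult_ac)
        have "real (n m) * \<bar>\<mu> - \<mu>hat m \<omega>'\<bar> \<le> real (n m) * ((\<sigma> * e / 2) / w)"
          using h1 unfolding h2 h3 .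
        then have "\<bar>\<mu> - \<mu>hat m \<omega>'\<bar> \<le> (\<sigma> * e / 2) / w" by (rule mult_left_le_imp_le) (use n0[of m] in simp)
        then have "sqrt (real (Nhat m \<omega>')) * \<bar>\<mu> - \<mu>hat m \<omega>'\<bar> \<le> w * ((\<sigma> * e / 2) / w)"
          using s1 w0 by (intro mult_mono) auto
        then show ?thesis using w0 by (simp add: abs_mult)
      qed
      moreover have "\<bar>\<sigma>2hat m \<omega>' - \<sigma>\<^sup>2\<bar> \<le> \<sigma>\<^sup>2 * e / (2 * (c + 1))" using \<omega>' by (auto simp: B1_def \<eta>_def)
      ultimately have ct: "\<bar>sqrt (arr.tm m b - arr.tm m a) * s\<bar> \<le> c - e \<Longrightarrow> \<omega>' \<in> S m"
          "\<bar>sqrt (arr.tm m b - arr.tm m a) * s\<bar> \<ge> c + e \<Longrightarrow> \<omega>' \<notin> S m"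
        using coverage_transfer[OF _ eq, of e "\<sigma>2hat m \<omega>'" c] Np sigma_pos variance_estimator(2)[OF \<omega>'(1)] c0 e \<omega>'(1)
        unfolding S_def by auto
      then show ?thesis using b(3) by blast
    qed
    have side: "\<forall>\<^sub>F m in sequentially. \<exists>E\<in>sets (M m). measure (M m) E \<ge> measure P G - 4 * p \<and> (\<forall>\<omega>'\<in>E. \<exists>\<omega>\<in>G. \<exists>Tn. \<bar>Tn - L \<omega>\<bar> \<le> e \<and> (\<bar>Tn\<bar> \<le> c - e \<longrightarrow> \<omega>' \<in> S m) \<and> (\<bar>Tn\<bar> \<ge> c + e \<longrightarrow> \<omega>' \<notin> S m))"
      if G: "G \<in> sets P" for G
    proof -
      have GB: "G - Bd \<in> sets P" using G Bd by auto
      have "measure P G \<le> measure P ((G - Bd) \<union> Bd)" by (rule bm.finite_measure_mono) (use G Bd in auto)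
      also have "\<dots> \<le> measure P (G - Bd) + measure P Bd" by (rule measure_Un_le) (use G Bd in auto)
      finally have GBp: "measure P (G - Bd) \<ge> measure P G - p" using Bd by simp
      show ?thesis using arr.array_tracks_bm[OF T2(1) Tp p \<kappa> GB] E1 E2
      proof eventually_elim
        case (elim m)
        interpret Mm: prob_space "M m" by (rule prob_spaces)
        obtain E where E: "E \<in> sets (M m)" "measure (M m) E \<ge> measure P (G - Bd) - p"
          "\<And>\<omega>'. \<omega>' \<in> E \<Longrightarrow> \<exists>\<omega>\<in>G - Bd. tracks T \<kappa> {0..N m} (arr.tm m) (\<lambda>k. arr.V m k \<omega>') (\<lambda>t. W t \<omega> + t\<^sup>2)"
          using elim(1) by blast
        show ?case
        proof (intro bexI[of _ "E - (B1 m \<union> B2 m)"] conjI ballI)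
          show "E - (B1 m \<union> B2 m) \<in> sets (M m)" using E B1m B2m by auto
          have "measure (M m) E \<le> measure (M m) ((E - (B1 m \<union> B2 m)) \<union> (B1 m \<union> B2 m))"
            by (rule Mm.finite_measure_mono) (use E B1m B2m in auto)
          also have "\<dots> \<le> measure (M m) (E - (B1 m \<union> B2 m)) + measure (M m) (B1 m \<union> B2 m)"
            by (rule measure_Un_le) (use E B1m B2m in auto)
          also have "measure (M m) (B1 m \<union> B2 m) \<le> measure (M m) (B1 m) + measure (M m) (B2 m)"
            by (rule measure_Un_le) (use B1m B2m in auto)
          finally show "measure P G - 4 * p \<le> measure (M m) (E - (B1 m \<union> B2 m))"
            using E(2) GBp elim(2,3) B2p[of m] by linarith
          fix \<omega>' assume \<omega>': "\<omega>' \<in> E - (B1 m \<union> B2 m)"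
          then have sp: "\<omega>' \<in> space (M m)" using E(1) sets.sets_into_space by auto
          obtain \<omega> where \<omega>: "\<omega> \<in> G - Bd" "tracks T \<kappa> {0..N m} (arr.tm m) (\<lambda>k. arr.V m k \<omega>') (\<lambda>t. W t \<omega> + t\<^sup>2)"
            using E(3) \<omega>' by blast
          have \<omega>P: "\<omega> \<in> space P" "\<omega> \<notin> Bd" "\<omega> \<in> G" using \<omega>(1) G sets.sets_into_space by auto
          have "\<omega>' \<notin> B1 m" "\<omega>' \<notin> B2 m" using \<omega>' by auto
          from transfer[OF sp this \<omega>P(1,2) \<omega>(2)] \<omega>P(3)
          show "\<exists>\<omega>\<in>G. \<exists>Tn. \<bar>Tn - L \<omega>\<bar> \<le> e \<and> (\<bar>Tn\<bar> \<le> c - e \<longrightarrow> \<omega>' \<in> S m) \<and> (\<bar>Tn\<bar> \<ge> c + e \<longrightarrow> \<omega>' \<notin> S m)" by blast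
        qed
      qed
    qed
    have G1: "{\<omega>\<in>space P. \<bar>L \<omega>\<bar> \<le> c - 2 * e} \<in> sets P" and G2: "{\<omega>\<in>space P. \<bar>L \<omega>\<bar> \<ge> c + 2 * e} \<in> sets P" by measurable
    show ?thesis using side[OF G1] side[OF G2]
    proof eventually_elim
      case (elim m)
      interpret Mm: prob_space "M m" by (rule prob_spaces)
      obtain E where E: "E \<in> sets (M m)" "measure (M m) E \<ge> bm.prob {\<omega>\<in>space P. \<bar>L \<omega>\<bar> \<le> c - 2 * e} - 4 * p"
        "\<And>\<omega>'. \<omega>' \<in> E \<Longrightarrow> \<exists>\<omega>\<in>{\<omega>\<in>space P. \<bar>L \<omega>\<bar> \<le> c - 2 * e}. \<exists>Tn. \<bar>Tn - L \<omega>\<bar> \<le> e \<and> (\<bar>Tn\<bar> \<le> c - e \<longrightarrow> \<omega>' \<in> S m) \<and> (\<bar>Tn\<bar> \<ge> c + e \<longrightarrow> \<omega>' \<notin> S m)"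
        using elim(1) by blast
      obtain E' where E': "E' \<in> sets (M m)" "measure (M m) E' \<ge> bm.prob {\<omega>\<in>space P. \<bar>L \<omega>\<bar> \<ge> c + 2 * e} - 4 * p"
        "\<And>\<omega>'. \<omega>' \<in> E' \<Longrightarrow> \<exists>\<omega>\<in>{\<omega>\<in>space P. \<bar>L \<omega>\<bar> \<ge> c + 2 * e}. \<exists>Tn. \<bar>Tn - L \<omega>\<bar> \<le> e \<and> (\<bar>Tn\<bar> \<le> c - e \<longrightarrow> \<omega>' \<in> S m) \<and> (\<bar>Tn\<bar> \<ge> c + e \<longrightarrow> \<omega>' \<notin> S m)"
        using elim(2) by blast
      have "E \<subseteq> S m"
      proof
        fix \<omega>' assume "\<omega>' \<in> E"
        then obtain \<omega> Tn where "\<bar>L \<omega>\<bar> \<le> c - 2 * e" "\<bar>Tn - L \<omega>\<bar> \<le> e" "\<bar>Tn\<bar> \<le> c - e \<longrightarrow> \<omega>' \<in> S m" using E(3) by blast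
        then show "\<omega>' \<in> S m" by linarith
      qed
      then have 1: "measure (M m) E \<le> measure (M m) (S m)" using Smeas by (rule Mm.finite_measure_mono)
      have "E' \<subseteq> space (M m) - S m"
      proof
        fix \<omega>' assume w': "\<omega>' \<in> E'"
        then obtain \<omega> Tn where "\<bar>L \<omega>\<bar> \<ge> c + 2 * e" "\<bar>Tn - L \<omega>\<bar> \<le> e" "\<bar>Tn\<bar> \<ge> c + e \<longrightarrow> \<omega>' \<notin> S m" using E'(3) by blast
        then have "\<omega>' \<notin> S m" by linarith
        then show "\<omega>' \<in> space (M m) - S m" using w' E'(1) sets.sets_into_space by blast
      qed
      then have "measure (M m) E' \<le> measure (M m) (space (M m) - S m)" using Smeas by (intro Mm.finite_measure_mono) auto
      also have "\<dots> = 1 - measure (M m) (S m)" by (rule Mm.prob_compl[OF Smeas])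
      finally show ?case using 1 E(2) E'(2) by linarith
    qed
  qed
  define H where "H = cdf (distr P borel (\<lambda>\<omega>. \<bar>L \<omega>\<bar>))"
  have Hp: "H x = bm.prob {\<omega>\<in>space P. \<bar>L \<omega>\<bar> \<le> x}" for x
  proof -
    have "H x = bm.prob ((\<lambda>\<omega>. \<bar>L \<omega>\<bar>) -` {..x} \<inter> space P)" unfolding H_def cdf_def by (subst measure_distr) auto
    also have "(\<lambda>\<omega>. \<bar>L \<omega>\<bar>) -` {..x} \<inter> space P = {\<omega>\<in>space P. \<bar>L \<omega>\<bar> \<le> x}" by auto
    finally show ?thesis .
  qed
  have compl: "bm.prob {\<omega>\<in>space P. \<bar>L \<omega>\<bar> > x} = 1 - H x" for x
  proof -
    have "{\<omega>\<in>space P. \<bar>L \<omega>\<bar> > x} = space P - {\<omega>\<in>space P. \<bar>L \<omega>\<bar> \<le> x}" by auto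
    then show ?thesis unfolding Hp by (simp add: bm.prob_compl)
  qed
  have Hc: "H c = 1 - \<delta>" using compl[of c] critical_value(2) by simp
  have "(\<lambda>m. measure (M m) (S m)) \<longlonglongrightarrow> 1 - \<delta>"
  proof (rule LIMSEQ_I)
    fix r :: real assume r: "r > 0"
    have "isCont H c" using critical_value(1) by (simp add: H_def)
    then obtain d where d: "d > 0" "\<And>x. \<bar>x - c\<bar> < d \<Longrightarrow> \<bar>H x - H c\<bar> < r / 2"
      unfolding continuous_at_eps_delta dist_real_def using r by (metis half_gt_zero)
    define e where "e = d / 4"
    have e: "e > 0" using d by (simp add: e_def)
    have lo: "H (c - 2 * e) > H c - r / 2" and hi: "H (c + 2 * e) < H c + r / 2"
      using d(2)[of "c - 2 * e"] d(2)[of "c + 2 * e"] d(1) by (auto simp: e_def abs_if split: if_splits)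
    have "bm.prob {\<omega>\<in>space P. \<bar>L \<omega>\<bar> > c + 2 * e} \<le> bm.prob {\<omega>\<in>space P. \<bar>L \<omega>\<bar> \<ge> c + 2 * e}"
      by (rule bm.finite_measure_mono) auto
    then have hi': "bm.prob {\<omega>\<in>space P. \<bar>L \<omega>\<bar> \<ge> c + 2 * e} > 1 - (H c + r / 2)" using compl[of "c + 2 * e"] hi by linarith
    have "r / 8 > 0" using r by simp
    from approx[OF e this]
    have "\<forall>\<^sub>F m in sequentially. norm (measure (M m) (S m) - (1 - \<delta>)) < r"
    proof eventually_elim
      case (elim m)
      then show ?case using lo hi' Hc unfolding Hp[of "c - 2 * e", symmetric] real_norm_def by linarith
    qed
    then show "\<exists>no. \<forall>m\<ge>no. norm (measure (M m) (S m) - (1 - \<delta>)) < r" by (simp add: eventually_sequentially)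
  qed
  then show ?thesis unfolding S_def f0_def Fh_def .
qed

end
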